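(* Let $N>1$ be an integer and let $n_1,n_2$ be positive integers. Put $$\alpha=\frac32-\frac1{2N},\qquad \beta=N-\frac32+\frac1{2N}.$$ Consider the system on $\mathbb{R}^2$ $$\Delta u_1=\alpha\left(e^{2u_1}-1\right)+\beta\left(e^{2u_2}-1\right)+4\pi n_1\delta(x),$$ $$\Delta u_2=\left(\alpha-\tfrac12\right)\left(e^{2u_1}-1\right)+\left(\beta+\tfrac12\right)\left(e^{2u_2}-1\right)+4\pi n_2\delta(x),$$ where $\delta$ is the Dirac distribution concentrated at the origin, subject to the boundary condition $$u_1(x)\to 0,\quad u_2(x)\to 0\quad\text{as } |x|\to\infty .$$ Then this problem has a unique solution $(u_1,u_2)$. Moreover, with the constants $m,p,q,\lambda_0,\lambda$ defined in the context, this solution has the following properties. (i) (Exponential decay.) For every $\varepsilon\in(0,1)$ there is a constant $C(\varepsilon)>0$, depending only on $\varepsilon$ (for the given problem, i.e. for fixed $N,n_1,n_2$), such that for all sufficiently large $|x|$, $$|p\,u_1(x)|^2+|2u_2(x)|^2\le C(\varepsilon)\,e^{-(1-\varepsilon)\sqrt{\lambda_0}\,|x|},$$ $$\left|\nabla\left(m u_1(x)+2u_2(x)\right)\right|^2+\left|\nabla\left(p u_1(x)+q u_2(x)\right)\right|^2\le C(\varepsilon)\,e^{-(1-\varepsilon)\sqrt{\lambda}\,|x|}.$$ (ii) (Quantized integrals.) $$\int_{\mathbb{R}^2}\left\{\left[(m+2)\alpha-1\right]\left(e^{2u_1(x)}-1\right)+\left[(m+2)\beta+1\right]\left(e^{2u_2(x)}-1\right)\right\}dx=-4\pi\left(mn_1+2n_2\right),$$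 $$\int_{\mathbb{R}^2}\left\{\left[(p+q)\alpha-\frac q2\right]\left(e^{2u_1(x)}-1\right)+\left[(p+q)\beta+\frac q2\right]\left(e^{2u_2(x)}-1\right)\right\}dx=-4\pi\left(pn_1+qn_2\right).$$
   Context: The integer $N>1$ and the positive integers $n_1,n_2$ (the multiplicities of the vortices corresponding to $u_1$ and $u_2$, located at the origin) are fixed. With $\alpha=\frac32-\frac1{2N}$ and $\beta=N-\frac32+\frac1{2N}$, define $$\lambda_3=\frac{2N+1+2\sqrt{N^2-N+\frac14}}{4},\qquad \lambda_4=\frac{2N+1-2\sqrt{N^2-N+\frac14}}{4},\qquad \lambda=\min\{\lambda_3,\lambda_4\}>0,$$ $$m=\frac{(2\alpha-1)^2}{2\beta(\lambda_3-\alpha)},\qquad p=\frac{2\alpha-1}{\beta},\qquad q=\frac{4(\lambda_4-\alpha)}{2\alpha-1}.$$ Let $M$ be the positive definite symmetric matrix $$M=\begin{pmatrix}\dfrac{2\alpha^2-\alpha}{\beta} & 2\alpha-1\\ 2\alpha-1 & 2\beta+1\end{pmatrix},$$ let $\lambda_1,\lambda_2>0$ be its eigenvalues, and set $\lambda_0=\min\{\lambda_1,\lambda_2\}>0$. A solution is a pair of real-valued functions $u_1,u_2$, smooth on $\mathbb{R}^2\setminus\{0\}$, with $u_i$ and $e^{2u_i}$ locally integrable on $\mathbb{R}^2$, that satisfies the two equations in the sense of distributions on $\mathbb{R}^2$. *)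

theory Defs
  imports "HOL-Analysis.Analysis" "Jordan_Normal_Form.Char_Poly"
begin

definition alpha :: "nat \<Rightarrow> real"
  where "alpha N = 3 / 2 - 1 / (2 * real N)"

definition beta :: "nat \<Rightarrow> real"
  where "beta N = real N - 3 / 2 + 1 / (2 * real N)"

definition lambda3 :: "nat \<Rightarrow> real"
  where "lambda3 N = (2 * real N + 1 + 2 * sqrt ((real N)\<^sup>2 - real N + 1 / 4)) / 4"

definition lambda4 :: "nat \<Rightarrow> real"
  where "lambda4 N = (2 * real N + 1 - 2 * sqrt ((real N)\<^sup>2 - real N + 1 / 4)) / 4"

definition lambda_min :: "nat \<Rightarrow> real"
  where "lambda_min N = min (lambda3 N) (lambda4 N)"

definition m_const :: "nat \<Rightarrow> real"
  where "m_const N = (2 * alpha N - 1)\<^sup>2 / (2 * beta N * (lambda3 N - alpha N))"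

definition p_const :: "nat \<Rightarrow> real"
  where "p_const N = (2 * alpha N - 1) / beta N"

definition q_const :: "nat \<Rightarrow> real"
  where "q_const N = 4 * (lambda4 N - alpha N) / (2 * alpha N - 1)"

definition M_mat :: "nat \<Rightarrow> real mat"
  where "M_mat N = mat_of_rows_list 2
    [[(2 * (alpha N)\<^sup>2 - alpha N) / beta N, 2 * alpha N - 1],
     [2 * alpha N - 1,                        2 * beta N + 1]]"

definition lambda0 :: "nat \<Rightarrow> real"
  where "lambda0 N = Min {l. eigenvalue (M_mat N) l}"

(* For open S only: the derivatives are taken at interior points, not within S. *)

fun Ck_on :: "nat \<Rightarrow> ('a::euclidean_space \<Rightarrow> real) \<Rightarrow> 'a set \<Rightarrow> bool"
  where
    "Ck_on 0 f S \<longleftrightarrow> continuous_on S f"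
  | "Ck_on (Suc k) f S \<longleftrightarrow>
       (\<forall>x\<in>S. f differentiable (at x)) \<and>
       (\<forall>b\<in>Basis. Ck_on k (\<lambda>x. frechet_derivative f (at x) b) S)"

definition smooth_on :: "('a::euclidean_space \<Rightarrow> real) \<Rightarrow> 'a set \<Rightarrow> bool"
  where "smooth_on f S \<longleftrightarrow> (\<forall>k. Ck_on k f S)"

definition grad :: "('a::euclidean_space \<Rightarrow> real) \<Rightarrow> 'a \<Rightarrow> 'a"
  where "grad f x = (THE D. GDERIV f x :> D)"

definition laplacian :: "('a::euclidean_space \<Rightarrow> real) \<Rightarrow> 'a \<Rightarrow> real"
  where "laplacian f x =
    (\<Sum>b\<in>Basis. frechet_derivative (\<lambda>y. frechet_derivative f (at y) b) (at x) b)"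

definition locally_integrable :: "('a::euclidean_space \<Rightarrow> real) \<Rightarrow> bool"
  where "locally_integrable f \<longleftrightarrow> (\<forall>K. compact K \<longrightarrow> set_integrable lborel K f)"

definition test_function :: "('a::euclidean_space \<Rightarrow> real) \<Rightarrow> bool"
  where "test_function \<phi> \<longleftrightarrow> smooth_on \<phi> UNIV \<and> compact (closure {x. \<phi> x \<noteq> 0})"

(* Laplacian u = f + c * delta_0 in the sense of distributions, for locally integrable u and f. *)

definition laplace_eq_dirac ::
    "('a::euclidean_space \<Rightarrow> real) \<Rightarrow> ('a \<Rightarrow> real) \<Rightarrow> real \<Rightarrow> bool"
  where "laplace_eq_dirac u f c \<longleftrightarrow>
    (\<forall>\<phi>. test_function \<phi> \<longrightarrow>
      (LINT x|lborel. u x * laplacian \<phi> x) = (LINT x|lborel. f x * \<phi> x) + c * \<phi> 0)"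

(* Solutions live on the punctured plane: the value of u1, u2 at 0 is irrelevant
   in every clause below. *)

definition vortex_solution ::
    "nat \<Rightarrow> nat \<Rightarrow> nat \<Rightarrow> (real^2 \<Rightarrow> real) \<Rightarrow> (real^2 \<Rightarrow> real) \<Rightarrow> bool"
  where "vortex_solution N n1 n2 u1 u2 \<longleftrightarrow>
    smooth_on u1 (- {0}) \<and> smooth_on u2 (- {0}) \<and>
    locally_integrable u1 \<and> locally_integrable u2 \<and>
    locally_integrable (\<lambda>x. exp (2 * u1 x)) \<and> locally_integrable (\<lambda>x. exp (2 * u2 x)) \<and>
    laplace_eq_dirac u1
      (\<lambda>x. alpha N * (exp (2 * u1 x) - 1) + beta N * (exp (2 * u2 x) - 1))
      (4 * pi * real n1) \<and>
    laplace_eq_dirac u2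
      (\<lambda>x. (alpha N - 1 / 2) * (exp (2 * u1 x) - 1) + (beta N + 1 / 2) * (exp (2 * u2 x) - 1))
      (4 * pi * real n2) \<and>
    (u1 \<longlongrightarrow> 0) at_infinity \<and> (u2 \<longlongrightarrow> 0) at_infinity"

end

theory Submission
  imports Defs "HOL-Real_Asymp.Real_Asymp"
begin

text \<open>Why the theorem holds. The matrix of the system has the eigenvalues \<open>N\<close> and \<open>1 / 2\<close>, and it is
  symmetric up to a diagonal factor: there is a positive definite form \<open>B\<close> (here \<open>bil\<close>, with quadratic
  form \<open>qf\<close>) such that \<open>B w (A g) = N / 2 * (w1 * g1 + (N - 1) * w2 * g2)\<close> (lemma \<open>bil_rhs\<close>). Since the
  nonlinearity \<open>exp (2 u) - 1\<close> is increasing in each component, pairing the equation for the difference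
  \<open>w\<close> of two solutions with \<open>w\<close> itself through \<open>B\<close> yields a nonnegative quantity. Everything rests on this
  monotonicity.

  Uniqueness. The function \<open>J w = sqrt (1 + qf w)\<close> is convex, Lipschitz and smooth. By mollification it
  follows that \<open>J w\<close> is subharmonic in the sense of distributions, with the pairing above as a lower bound
  for its Laplacian (\<open>J_weakly_subharmonic\<close>). The origin causes no trouble, because the Dirac masses cancel
  in \<open>w\<close> and \<open>w\<close> is integrable there. Testing with a bump function stretched by a factor \<open>R\<close> and letting
  \<open>R\<close> tend to infinity, where \<open>J w - 1\<close> tends to zero, forces the pairing to vanish and hence \<open>w = 0\<close>
  (\<open>weak_solution_unique\<close>).

  Existence. By uniqueness the solution has to be radial, so it is obtained from ordinary differential
  equations. With \<open>v = u - 2 n ln r\<close> and the nonlinearity truncated at a height \<open>E\<close>, the initial value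
  problem starting at \<open>r = 0\<close> is solved by Banach's fixed point theorem (\<open>radial_ivp\<close>). The same monotonicity
  shows that the map from \<open>v 0\<close> to \<open>v R\<close> expands distances in the metric of \<open>qf\<close>; by invariance of domain it
  is onto (\<open>expansive_imp_surj\<close>), so that \<open>u R = 0\<close> can be achieved for every \<open>R\<close>. A bound that depends
  neither on \<open>R\<close> nor on \<open>E\<close> (\<open>a_priori_bound\<close>) removes the truncation and allows \<open>R\<close> to tend to infinity
  (\<open>global_trunc_sol\<close>). For the limit, \<open>\<psi> = qf u\<close> satisfies \<open>\<psi>'' + \<psi>' / r \<ge> \<psi>\<close> far out, and being bounded it
  decays like \<open>exp (- r)\<close> (\<open>far_decay\<close>); an integration gives the decay of the derivatives
  (\<open>radial_solution\<close>).

  Back to the plane. Replacing \<open>norm x\<close> by \<open>sqrt ((norm x)\<^sup>2 + \<epsilon>\<^sup>2)\<close> makes the radial profile twice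
  continuously differentiable across the origin, and as \<open>\<epsilon>\<close> tends to zero the logarithm contributes exactly
  the required Dirac mass (\<open>radial_laplace\<close>). Since \<open>lambda0 N\<close> and \<open>lambda_min N\<close> are at most \<open>1\<close>, decay of
  the squares like \<open>exp (- r)\<close> implies both estimates (\<open>lambda0_le\<close>, \<open>lambda_min_le\<close>). The integrals are
  obtained by testing each equation with a stretched bump function, which shows that the right-hand side
  including its Dirac mass has total mass zero (\<open>quantized_integral\<close>); the two identities are linear
  combinations of these.\<close>

section \<open>Directional derivatives and Green's formula\<close>

text \<open>Differentiation along a single line: differentiating under an integral sign yields derivatives of this
  kind, and Green's formula integrates by parts along one coordinate direction at a time.\<close>

definition has_dderiv :: "('a::euclidean_space \<Rightarrow> real) \<Rightarrow> 'a \<Rightarrow> ('a \<Rightarrow> real) \<Rightarrow> bool"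
  where "has_dderiv f b f' \<longleftrightarrow> (\<forall>x. ((\<lambda>t. f (x + t *\<^sub>R b)) has_real_derivative f' x) (at 0))"

lemma has_dderiv_line:
  assumes "has_dderiv f b f'"
  shows "((\<lambda>t. f (x + t *\<^sub>R b)) has_real_derivative f' (x + t *\<^sub>R b)) (at t)"
proof -
  have "((\<lambda>h. f ((x + t *\<^sub>R b) + h *\<^sub>R b)) has_real_derivative f' (x + t *\<^sub>R b)) (at 0)"
    using assms unfolding has_dderiv_def by blast
  then have "((\<lambda>h. f (x + (h + t) *\<^sub>R b)) has_real_derivative f' (x + t *\<^sub>R b)) (at 0)"
    by (simp add: algebra_simps scaleR_add_left)
  then show ?thesis
    using DERIV_shift[of "\<lambda>s. f (x + s *\<^sub>R b)" "f' (x + t *\<^sub>R b)" 0 t] by simp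
qed

lemma has_dderiv_mult:
  assumes "has_dderiv f b f'" "has_dderiv g b g'"
  shows "has_dderiv (\<lambda>x. f x * g x) b (\<lambda>x. f' x * g x + f x * g' x)"
  using assms unfolding has_dderiv_def
  by (auto intro!: derivative_eq_intros)

lemma has_dderiv_diff:
  assumes "has_dderiv f b f'" "has_dderiv g b g'"
  shows "has_dderiv (\<lambda>x. f x - g x) b (\<lambda>x. f' x - g' x)"
  using assms unfolding has_dderiv_def
  by (auto intro!: derivative_eq_intros)

lemma has_dderiv_frechet:
  assumes "\<And>x. f differentiable (at x)"
  shows "has_dderiv f b (\<lambda>x. frechet_derivative f (at x) b)"
  unfolding has_dderiv_def
proof
  fix x
  let ?D = "frechet_derivative f (at x)"
  have D: "(f has_derivative ?D) (at x)"
    using assms frechet_derivative_works by blast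
  have l: "((\<lambda>t::real. x + t *\<^sub>R b) has_derivative (\<lambda>t. t *\<^sub>R b)) (at 0)"
    by (auto intro!: derivative_eq_intros)
  have "((\<lambda>t. f (x + t *\<^sub>R b)) has_derivative (\<lambda>t. ?D (t *\<^sub>R b))) (at 0)"
    using has_derivative_compose[OF l, of f ?D] D by simp
  moreover have "?D (t *\<^sub>R b) = ?D b * t" for t
    using linear_frechet_derivative[OF assms] by (simp add: linear_cmul)
  ultimately show "((\<lambda>t. f (x + t *\<^sub>R b)) has_real_derivative ?D b) (at 0)"
    by (simp add: has_field_derivative_def)
qed

text \<open>Dominated convergence applied to difference quotients, the mean value theorem providing
  the bound.\<close>

lemma DERIV_integral:
  fixes f f' :: "real \<Rightarrow> 'b \<Rightarrow> real"
  assumes int: "\<And>t. \<bar>t\<bar> < 1 \<Longrightarrow> integrable M (f t)"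
    and d: "\<And>t y. y \<in> space M \<Longrightarrow> \<bar>t\<bar> < 1 \<Longrightarrow> ((\<lambda>t. f t y) has_real_derivative f' t y) (at t)"
    and bd: "\<And>t y. y \<in> space M \<Longrightarrow> \<bar>t\<bar> < 1 \<Longrightarrow> \<bar>f' t y\<bar> \<le> G y"
    and G: "integrable M G"
  shows "((\<lambda>t. integral\<^sup>L M (f t)) has_real_derivative integral\<^sup>L M (f' 0)) (at 0)"
proof -
  have q: "\<bar>(f h y - f 0 y) / h\<bar> \<le> G y" if y: "y \<in> space M" and h: "\<bar>h\<bar> < 1" "h \<noteq> 0" for h y
  proof -
    have "norm (f h y - f 0 y) \<le> G y * norm (h - 0)"
    proof (rule field_differentiable_bound[where S = "{-1<..<1}" and f' = "\<lambda>t. f' t y"])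
      show "((\<lambda>t. f t y) has_field_derivative f' z y) (at z within {-1<..<1})" if "z \<in> {-1<..<1}" for z
        using d[OF y, of z] that by (auto intro: has_field_derivative_at_within)
      show "norm (f' z y) \<le> G y" if "z \<in> {-1<..<1}" for z
        using bd[OF y, of z] that by auto
    qed (use h in auto)
    then show ?thesis using h by (simp add: abs_divide field_simps)
  qed
  show ?thesis
    unfolding has_field_derivative_iff
  proof (rule tendsto_at_iff_sequentially[THEN iffD2], intro allI impI)
    fix X :: "nat \<Rightarrow> real"
    assume X: "\<forall>i. X i \<in> UNIV - {0}" "X \<longlonglongrightarrow> 0"
    obtain n0 where n0: "\<And>n. n \<ge> n0 \<Longrightarrow> \<bar>X n\<bar> < 1"
      using X(2) LIMSEQ_D[of X 0 1] by auto
    define Y where "Y n = X (n + n0)" for n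
    have Y: "Y \<longlonglongrightarrow> 0" "\<And>n. Y n \<noteq> 0" "\<And>n. \<bar>Y n\<bar> < 1"
      using X n0 unfolding Y_def by (auto intro: LIMSEQ_ignore_initial_segment)
    have lim: "(\<lambda>n. (f (Y n) y - f 0 y) / Y n) \<longlonglongrightarrow> f' 0 y" if y: "y \<in> space M" for y
    proof -
      have "((\<lambda>h. (f h y - f 0 y) / h) \<longlongrightarrow> f' 0 y) (at 0)"
        using d[OF y, of 0] by (simp add: has_field_derivative_iff)
      moreover have "filterlim Y (at 0) sequentially"
        using Y by (auto simp: filterlim_at)
      ultimately show ?thesis
        by (rule filterlim_compose)
    qed
    have meas: "(\<lambda>y. (f (Y n) y - f 0 y) / Y n) \<in> borel_measurable M" for n
      using int[of "Y n"] int[of 0] Y(3)[of n] by (intro borel_measurable_divide borel_measurable_diff) auto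
    have meas': "f' 0 \<in> borel_measurable M"
      using borel_measurable_LIMSEQ_metric[OF meas lim] by simp
    have "(\<lambda>n. \<integral>y. (f (Y n) y - f 0 y) / Y n \<partial>M) \<longlonglongrightarrow> integral\<^sup>L M (f' 0)"
      by (rule integral_dominated_convergence[OF meas' meas G])
         (use lim q Y in auto)
    moreover have "(\<integral>y. (f (Y n) y - f 0 y) / Y n \<partial>M) = (integral\<^sup>L M (f (Y n)) - integral\<^sup>L M (f 0)) / Y n" for n
      using int[of "Y n"] int[of 0] Y(3)[of n]
      by (subst Bochner_Integration.integral_divide_zero) (simp add: Bochner_Integration.integral_diff)
    ultimately have "(\<lambda>n. (integral\<^sup>L M (f (Y n)) - integral\<^sup>L M (f 0)) / Y n) \<longlonglongrightarrow> integral\<^sup>L M (f' 0)"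
      by (simp only:)
    then have "(\<lambda>n. (\<lambda>h. (integral\<^sup>L M (f h) - integral\<^sup>L M (f 0)) / h) (X (n + n0))) \<longlonglongrightarrow> integral\<^sup>L M (f' 0)"
      unfolding Y_def .
    then show "((\<lambda>y. (integral\<^sup>L M (f y) - integral\<^sup>L M (f 0)) / (y - 0)) \<circ> X) \<longlonglongrightarrow> integral\<^sup>L M (f' 0)"
      by (simp add: o_def) (rule LIMSEQ_offset)
  qed
qed

lemma integrable_compact_support:
  fixes f :: "'a::euclidean_space \<Rightarrow> real"
  assumes "continuous_on UNIV f" "compact K" "\<And>x. x \<notin> K \<Longrightarrow> f x = 0"
  shows "integrable lborel f"
proof -
  have "set_integrable lborel K f"
    unfolding set_integrable_def
    by (rule borel_integrable_compact) (use assms in \<open>auto intro: continuous_on_subset[OF assms(1)]\<close>)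
  moreover have "(\<lambda>x. indicator K x *\<^sub>R f x) = f"
  proof
    show "indicator K x *\<^sub>R f x = f x" for x
      using assms(3) by (cases "x \<in> K") auto
  qed
  ultimately show ?thesis by (simp only: set_integrable_def)
qed

lemma integral_lborel_shift:
  fixes f :: "'a::euclidean_space \<Rightarrow> real"
  shows "integrable lborel (\<lambda>x. f (x + a)) \<longleftrightarrow> integrable lborel f"
    and "integral\<^sup>L lborel (\<lambda>x. f (x + a)) = integral\<^sup>L lborel f"
proof -
  have *: "(lborel :: 'a measure) = distr lborel borel (\<lambda>x. x + a)"
    using lborel_affine[of 1 a] by (simp add: density_1 add.commute)
  have m: "(\<lambda>x. x + a) \<in> measurable lborel (lborel :: 'a measure)" by simp
  show eq: "integrable lborel (\<lambda>x. f (x + a)) \<longleftrightarrow> integrable lborel f"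
  proof
    assume "integrable lborel f"
    then show "integrable lborel (\<lambda>x. f (x + a))"
      using * integrable_distr[of "\<lambda>x. x + a" lborel borel f] by simp
  next
    assume h: "integrable lborel (\<lambda>x. f (x + a))"
    have **: "(lborel :: 'a measure) = distr lborel borel (\<lambda>x. x + (- a))"
      using lborel_affine[of 1 "-a"] by (simp add: density_1 add.commute)
    have "integrable lborel (\<lambda>x. f (x + (-a) + a))"
    proof (rule integrable_distr[where f = "\<lambda>x. f (x + a)" and T = "\<lambda>x. x + - a"])
      show "integrable (distr lborel borel (\<lambda>x. x + - a)) (\<lambda>x. f (x + a))"
        unfolding **[symmetric] by (rule h)
    qed simp
    then show "integrable lborel f" by simp
  qed
  show "integral\<^sup>L lborel (\<lambda>x. f (x + a)) = integral\<^sup>L lborel f"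
  proof (cases "integrable lborel f")
    case True
    have "integral\<^sup>L lborel f = integral\<^sup>L (distr lborel borel (\<lambda>x. x + a)) f"
      using * by simp
    also have "\<dots> = integral\<^sup>L lborel (\<lambda>x. f (x + a))"
      using True by (intro integral_distr) auto
    finally show ?thesis by simp
  next
    case False
    then show ?thesis using eq by (simp add: not_integrable_integral_eq)
  qed
qed

text \<open>The integral of a compactly supported function is invariant under translations in
  the direction \<open>b\<close>; differentiating this identity shows that the integral of a directional
  derivative vanishes.\<close>

lemma integral_dderiv_zero:
  fixes F F' :: "'a::euclidean_space \<Rightarrow> real"
  assumes d: "has_dderiv F b F'" and c: "continuous_on UNIV F" and c': "continuous_on UNIV F'"
    and K: "compact K" "\<And>x. x \<notin> K \<Longrightarrow> F x = 0"  "\<And>x. x \<notin> K \<Longrightarrow> F' x = 0"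
  shows "integral\<^sup>L lborel F' = 0"
proof -
  define K2 where "K2 = (\<lambda>(x,t). x - t *\<^sub>R b) ` (K \<times> {-1..1::real})"
  have K2: "compact K2" unfolding K2_def case_prod_unfold
    by (intro compact_continuous_image compact_Times K continuous_intros) auto
  have zero: "F' (x + t *\<^sub>R b) = 0" if "x \<notin> K2" "\<bar>t\<bar> < 1" for x t
  proof (rule K(3), rule ccontr)
    assume "\<not> x + t *\<^sub>R b \<notin> K"
    then have "(\<lambda>(x,t). x - t *\<^sub>R b) (x + t *\<^sub>R b, t) \<in> K2"
      unfolding K2_def using that by (intro imageI) auto
    then show False using that by simp
  qed
  have "bounded (F' ` K)"
    using K c' by (intro compact_imp_bounded compact_continuous_image) (auto intro: continuous_on_subset)
  then obtain C where C: "\<And>x. x \<in> K \<Longrightarrow> \<bar>F' x\<bar> \<le> C" "C > 0"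
    unfolding bounded_pos by auto
  then have C': "\<bar>F' x\<bar> \<le> C" for x using K(3)[of x] by (cases "x \<in> K") auto
  have "((\<lambda>t. integral\<^sup>L lborel (\<lambda>x. F (x + t *\<^sub>R b))) has_real_derivative
          integral\<^sup>L lborel (\<lambda>x. F' (x + 0 *\<^sub>R b))) (at 0)"
  proof (rule DERIV_integral[where G = "\<lambda>x. C * indicator K2 x"])
    show "integrable lborel (\<lambda>x. F (x + t *\<^sub>R b))" for t
      using integrable_compact_support[OF c K(1,2)] by (simp add: integral_lborel_shift)
    show "((\<lambda>t. F (y + t *\<^sub>R b)) has_real_derivative F' (y + t *\<^sub>R b)) (at t)" for y t
      by (rule has_dderiv_line[OF d])
    show "\<bar>F' (y + t *\<^sub>R b)\<bar> \<le> C * indicator K2 y" if "\<bar>t\<bar> < 1" for y t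
      using zero[of y t] C'[of "y + t *\<^sub>R b"] that by (cases "y \<in> K2") auto
    show "integrable lborel (\<lambda>x. C * indicator K2 x)"
      using K2 by (intro integrable_mult_right integrable_real_indicator)
        (use emeasure_lborel_cbox_finite emeasure_compact_finite[of K2] in \<open>auto simp: borel_compact less_top\<close>)
  qed
  then have "((\<lambda>t::real. integral\<^sup>L lborel F) has_real_derivative integral\<^sup>L lborel F') (at 0)"
    by (simp add: integral_lborel_shift)
  then show ?thesis
    using DERIV_const DERIV_unique by blast
qed

lemma smooth_on_frechet:
  assumes "smooth_on f S" "b \<in> Basis"
  shows "smooth_on (\<lambda>x. frechet_derivative f (at x) b) S"
  unfolding smooth_on_def
proof
  fix k
  have "Ck_on (Suc k) f S" using assms(1) unfolding smooth_on_def by (rule spec)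
  then show "Ck_on k (\<lambda>x. frechet_derivative f (at x) b) S"
    using assms(2) by (simp only: Ck_on.simps)
qed

lemma smooth_on_imp:
  assumes "smooth_on f S"
  shows "continuous_on S f" "x \<in> S \<Longrightarrow> f differentiable (at x)"
proof -
  have "Ck_on 0 f S" using assms unfolding smooth_on_def by (rule spec)
  then show "continuous_on S f" by (simp only: Ck_on.simps)
  have "Ck_on (Suc 0) f S" using assms unfolding smooth_on_def by (rule spec)
  then show "x \<in> S \<Longrightarrow> f differentiable (at x)" by (simp only: Ck_on.simps)
qed

lemma test_function_support:
  assumes "test_function \<phi>"
  obtains K where "compact K" "\<And>x. x \<notin> K \<Longrightarrow> \<phi> x = 0"
proof -
  have "\<phi> x = 0" if "x \<notin> closure {x. \<phi> x \<noteq> 0}" for x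
    using that closure_subset[of "{x. \<phi> x \<noteq> 0}"] by blast
  then show ?thesis
    using that assms unfolding test_function_def by blast
qed

lemma test_function_frechet:
  assumes t: "test_function \<phi>" and b: "b \<in> Basis"
  shows "test_function (\<lambda>x. frechet_derivative \<phi> (at x) b)"
proof -
  let ?S = "closure {x. \<phi> x \<noteq> 0}"
  have "frechet_derivative \<phi> (at x) b = 0" if "x \<notin> ?S" for x
  proof -
    have "(\<phi> has_derivative (\<lambda>_. 0)) (at x)"
    proof (rule has_derivative_transform_within_open[where s = "- ?S" and f = "\<lambda>_. 0"])
      show "0 = \<phi> y" if "y \<in> - ?S" for y
        using that closure_subset by force
    qed (use that in auto)
    then show ?thesis by (metis frechet_derivative_at)
  qed
  then have "{x. frechet_derivative \<phi> (at x) b \<noteq> 0} \<subseteq> ?S" by auto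
  then have "closure {x. frechet_derivative \<phi> (at x) b \<noteq> 0} \<subseteq> ?S"
    by (simp add: closure_minimal)
  then have "compact (closure {x. frechet_derivative \<phi> (at x) b \<noteq> 0})"
    using t unfolding test_function_def
    using compact_Int_closed[of ?S "closure {x. frechet_derivative \<phi> (at x) b \<noteq> 0}"]
    by (simp add: inf.absorb2)
  then show ?thesis
    using t b smooth_on_frechet unfolding test_function_def by blast
qed

lemma test_function_cont: "test_function \<phi> \<Longrightarrow> continuous_on UNIV \<phi>"
  by (rule smooth_on_imp(1)) (simp add: test_function_def)

lemma test_function_dderiv:
  "test_function \<phi> \<Longrightarrow> has_dderiv \<phi> b (\<lambda>x. frechet_derivative \<phi> (at x) b)"
  by (intro has_dderiv_frechet smooth_on_imp(2)[where S = UNIV]) (auto simp: test_function_def)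

lemma test_function_integrable: "test_function \<phi> \<Longrightarrow> integrable lborel \<phi>"
  by (rule test_function_support) (auto intro: integrable_compact_support test_function_cont)

lemma test_function_bounded:
  assumes "test_function \<phi>"
  obtains C where "C > 0" "\<And>x. \<bar>\<phi> x\<bar> \<le> C"
proof -
  obtain K where K: "compact K" "\<And>x. x \<notin> K \<Longrightarrow> \<phi> x = 0" using test_function_support[OF assms] by blast
  have "bounded (\<phi> ` K)"
    using K test_function_cont[OF assms]
    by (intro compact_imp_bounded compact_continuous_image) (auto intro: continuous_on_subset)
  then obtain C where C: "\<And>x. x \<in> K \<Longrightarrow> \<bar>\<phi> x\<bar> \<le> C" "C > 0"
    unfolding bounded_pos by auto
  have "\<bar>\<phi> x\<bar> \<le> C" for x
    using C K(2)[of x] by (cases "x \<in> K") auto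
  then show ?thesis using that[OF C(2)] by blast
qed

text \<open>Coordinatewise it is enough that the directional derivative of \<open>g * p1 - \<phi> * g1\<close>, a compactly supported
  function, has integral zero.\<close>

lemma green_formula:
  fixes g :: "'a::euclidean_space \<Rightarrow> real" and g1 g2 :: "'a \<Rightarrow> 'a \<Rightarrow> real"
  assumes t: "test_function \<phi>"
    and d1: "\<And>b. b \<in> Basis \<Longrightarrow> has_dderiv g b (g1 b)"
    and d2: "\<And>b. b \<in> Basis \<Longrightarrow> has_dderiv (g1 b) b (g2 b)"
    and c0: "continuous_on UNIV g" and c1: "\<And>b. b \<in> Basis \<Longrightarrow> continuous_on UNIV (g1 b)"
    and c2: "\<And>b. b \<in> Basis \<Longrightarrow> continuous_on UNIV (g2 b)"
  shows "(LINT x|lborel. g x * laplacian \<phi> x) = (LINT x|lborel. (\<Sum>b\<in>Basis. g2 b x) * \<phi> x)"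
proof -
  define p1 where "p1 b x = frechet_derivative \<phi> (at x) b" for b x
  define p2 where "p2 b x = frechet_derivative (p1 b) (at x) b" for b x
  have t1: "test_function (p1 b)" if "b \<in> Basis" for b
    unfolding p1_def using test_function_frechet[OF t that] .
  have t2: "test_function (p2 b)" if "b \<in> Basis" for b
    using test_function_frechet[OF t1[OF that] that] unfolding p2_def .
  have lap: "laplacian \<phi> x = (\<Sum>b\<in>Basis. p2 b x)" for x
    unfolding laplacian_def p2_def p1_def[abs_def] ..
  have int: "integrable lborel (\<lambda>x. h x * \<psi> x)" if h: "continuous_on UNIV h" and \<psi>: "test_function \<psi>"
    for h \<psi> :: "'a \<Rightarrow> real"
  proof -
    obtain K where K: "compact K" "\<And>x. x \<notin> K \<Longrightarrow> \<psi> x = 0" using test_function_support[OF \<psi>] by blast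
    show ?thesis
    proof (rule integrable_compact_support[OF _ K(1)])
      show "continuous_on UNIV (\<lambda>x. h x * \<psi> x)"
        by (intro continuous_on_mult h test_function_cont[OF \<psi>])
    qed (simp add: K(2))
  qed
  have *: "(LINT x|lborel. g x * p2 b x) = (LINT x|lborel. g2 b x * \<phi> x)" if b: "b \<in> Basis" for b
  proof -
    obtain K where K: "compact K" "\<And>x. x \<notin> K \<Longrightarrow> \<phi> x = 0" using test_function_support[OF t] by blast
    obtain K1 where K1: "compact K1" "\<And>x. x \<notin> K1 \<Longrightarrow> p1 b x = 0" using test_function_support[OF t1[OF b]] by blast
    obtain K2 where K2: "compact K2" "\<And>x. x \<notin> K2 \<Longrightarrow> p2 b x = 0" using test_function_support[OF t2[OF b]] by blast
    have "integral\<^sup>L lborel (\<lambda>x. (g1 b x * p1 b x + g x * p2 b x) - (p1 b x * g1 b x + \<phi> x * g2 b x)) = 0"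
    proof (rule integral_dderiv_zero)
      show "has_dderiv (\<lambda>x. g x * p1 b x - \<phi> x * g1 b x) b
         (\<lambda>x. (g1 b x * p1 b x + g x * p2 b x) - (p1 b x * g1 b x + \<phi> x * g2 b x))"
        using test_function_dderiv[OF t, of b] test_function_dderiv[OF t1[OF b], of b] d1[OF b] d2[OF b]
        unfolding p1_def[symmetric] p2_def[symmetric]
        by (intro has_dderiv_diff has_dderiv_mult) (simp_all add: p1_def[abs_def] p2_def[abs_def])
      show "compact (K \<union> (K1 \<union> K2))" using K K1 K2 by auto
      show "continuous_on UNIV (\<lambda>x. g x * p1 b x - \<phi> x * g1 b x)"
        by (intro continuous_on_diff continuous_on_mult c0 c1[OF b] test_function_cont[OF t]
            test_function_cont[OF t1[OF b]])
      show "continuous_on UNIV (\<lambda>x. g1 b x * p1 b x + g x * p2 b x - (p1 b x * g1 b x + \<phi> x * g2 b x))"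
        by (intro continuous_on_diff continuous_on_add continuous_on_mult c0 c1[OF b] c2[OF b]
            test_function_cont[OF t] test_function_cont[OF t1[OF b]] test_function_cont[OF t2[OF b]])
    qed (use K K1 K2 in auto)
    moreover have "(\<lambda>x. (g1 b x * p1 b x + g x * p2 b x) - (p1 b x * g1 b x + \<phi> x * g2 b x))
        = (\<lambda>x. g x * p2 b x - g2 b x * \<phi> x)"
      by (rule ext) (simp add: algebra_simps)
    ultimately have "integral\<^sup>L lborel (\<lambda>x. g x * p2 b x - g2 b x * \<phi> x) = 0"
      by simp
    then show ?thesis
      using Bochner_Integration.integral_diff[OF int[OF c0 t2[OF b]] int[OF c2[OF b] t]] by linarith
  qed
  have "(LINT x|lborel. g x * laplacian \<phi> x) = (\<Sum>b\<in>Basis. LINT x|lborel. g x * p2 b x)"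
    unfolding lap sum_distrib_left by (rule Bochner_Integration.integral_sum) (rule int[OF c0 t2])
  also have "\<dots> = (\<Sum>b\<in>Basis. LINT x|lborel. g2 b x * \<phi> x)"
    by (rule sum.cong[OF refl *])
  also have "\<dots> = (LINT x|lborel. (\<Sum>b\<in>Basis. g2 b x) * \<phi> x)"
    unfolding sum_distrib_right
    by (rule Bochner_Integration.integral_sum[symmetric]) (rule int[OF c2 t])
  finally show ?thesis .
qed

section \<open>Classes of functions closed under differentiation\<close>

lemma Ck_on_cong:
  assumes S: "open S" and eq: "\<And>x. x \<in> S \<Longrightarrow> f x = g x" and f: "Ck_on k f S"
  shows "Ck_on k g S"
  using eq f
proof (induction k arbitrary: f g)
  case 0
  from 0(2) have "continuous_on S f" by (simp only: Ck_on.simps)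
  then have "continuous_on S g" by (rule continuous_on_eq[OF _ 0(1)])
  then show ?case by (simp only: Ck_on.simps)
next
  case (Suc k)
  have f: "\<And>x. x \<in> S \<Longrightarrow> f differentiable (at x)"
    "\<And>b. b \<in> Basis \<Longrightarrow> Ck_on k (\<lambda>x. frechet_derivative f (at x) b) S"
    using Suc(3) unfolding Ck_on.simps by blast+
  have d: "(g has_derivative frechet_derivative f (at x)) (at x)" if x: "x \<in> S" for x
  proof (rule has_derivative_transform_within_open[OF _ S x])
    show "(f has_derivative frechet_derivative f (at x)) (at x)"
      using f(1)[OF x] frechet_derivative_works by blast
  qed (use Suc(2) in auto)
  have "Ck_on k (\<lambda>x. frechet_derivative g (at x) b) S" if b: "b \<in> Basis" for b
  proof (rule Suc.IH[OF _ f(2)[OF b]])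
    show "frechet_derivative f (at x) b = frechet_derivative g (at x) b" if "x \<in> S" for x
      using frechet_derivative_at[OF d[OF that]] by simp
  qed
  moreover have "g differentiable (at x)" if "x \<in> S" for x
    using d[OF that] differentiableI by blast
  ultimately show ?case unfolding Ck_on.simps by blast
qed

text \<open>The algebra of functions generated by \<open>G\<close>. It serves to prove smoothness of concrete functions without
  computing their higher derivatives.\<close>

inductive_set alg :: "('a \<Rightarrow> real) set \<Rightarrow> ('a \<Rightarrow> real) set" for G
  where
    gen: "f \<in> G \<Longrightarrow> f \<in> alg G"
  | const: "(\<lambda>x. c) \<in> alg G"
  | add: "f \<in> alg G \<Longrightarrow> g \<in> alg G \<Longrightarrow> (\<lambda>x. f x + g x) \<in> alg G"
  | mult: "f \<in> alg G \<Longrightarrow> g \<in> alg G \<Longrightarrow> (\<lambda>x. f x * g x) \<in> alg G"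

text \<open>If the partial derivatives of the generators lie in the algebra that they generate, then by
  the product rule the whole algebra is closed under partial derivatives, hence smooth.\<close>

lemma alg_smooth:
  fixes G :: "('a::euclidean_space \<Rightarrow> real) set"
  assumes S: "open S"
    and G: "\<And>f. f \<in> G \<Longrightarrow> \<exists>D. (\<forall>x\<in>S. (f has_derivative D x) (at x)) \<and>
      (\<forall>b\<in>Basis. \<exists>g\<in>alg G. \<forall>x\<in>S. D x b = g x)"
    and f: "f \<in> alg G"
  shows "smooth_on f S"
proof -
  let ?P = "\<lambda>f. \<exists>D. (\<forall>x\<in>S. (f has_derivative D x) (at x)) \<and>
      (\<forall>b\<in>Basis. \<exists>g\<in>alg G. \<forall>x\<in>S. D x b = g x)"
  have P: "?P f" if "f \<in> alg G" for f
    using that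
  proof (induction rule: alg.induct)
    case (gen f)
    then show ?case by (rule G)
  next
    case (const c)
    show ?case
      by (intro exI[of _ "\<lambda>x b. 0"] conjI ballI bexI[of _ "\<lambda>x. 0"]) (auto intro: alg.const)
  next
    case (add f g)
    obtain Df where Df: "\<And>x. x \<in> S \<Longrightarrow> (f has_derivative Df x) (at x)"
      "\<And>b. b \<in> Basis \<Longrightarrow> \<exists>g\<in>alg G. \<forall>x\<in>S. Df x b = g x"
      using add.IH(1) by blast
    obtain Dg where Dg: "\<And>x. x \<in> S \<Longrightarrow> (g has_derivative Dg x) (at x)"
      "\<And>b. b \<in> Basis \<Longrightarrow> \<exists>h\<in>alg G. \<forall>x\<in>S. Dg x b = h x"
      using add.IH(2) by blast
    show ?case
    proof (intro exI[of _ "\<lambda>x b. Df x b + Dg x b"] conjI ballI)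
      show "((\<lambda>x. f x + g x) has_derivative (\<lambda>b. Df x b + Dg x b)) (at x)" if "x \<in> S" for x
        by (rule has_derivative_add[OF Df(1)[OF that] Dg(1)[OF that]])
      fix b :: 'a assume b: "b \<in> Basis"
      obtain h1 where h1: "h1 \<in> alg G" "\<And>x. x \<in> S \<Longrightarrow> Df x b = h1 x" using Df(2)[OF b] by blast
      obtain h2 where h2: "h2 \<in> alg G" "\<And>x. x \<in> S \<Longrightarrow> Dg x b = h2 x" using Dg(2)[OF b] by blast
      show "\<exists>h\<in>alg G. \<forall>x\<in>S. Df x b + Dg x b = h x"
        by (rule bexI[OF _ alg.add[OF h1(1) h2(1)]]) (simp add: h1(2) h2(2))
    qed
  next
    case (mult f g)
    obtain Df where Df: "\<And>x. x \<in> S \<Longrightarrow> (f has_derivative Df x) (at x)"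
      "\<And>b. b \<in> Basis \<Longrightarrow> \<exists>g\<in>alg G. \<forall>x\<in>S. Df x b = g x"
      using mult.IH(1) by blast
    obtain Dg where Dg: "\<And>x. x \<in> S \<Longrightarrow> (g has_derivative Dg x) (at x)"
      "\<And>b. b \<in> Basis \<Longrightarrow> \<exists>h\<in>alg G. \<forall>x\<in>S. Dg x b = h x"
      using mult.IH(2) by blast
    show ?case
    proof (intro exI[of _ "\<lambda>x b. f x * Dg x b + Df x b * g x"] conjI ballI)
      show "((\<lambda>x. f x * g x) has_derivative (\<lambda>b. f x * Dg x b + Df x b * g x)) (at x)" if "x \<in> S" for x
        by (rule has_derivative_mult[OF Df(1)[OF that] Dg(1)[OF that]])
      fix b :: 'a assume b: "b \<in> Basis"
      obtain h1 where h1: "h1 \<in> alg G" "\<And>x. x \<in> S \<Longrightarrow> Df x b = h1 x" using Df(2)[OF b] by blast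
      obtain h2 where h2: "h2 \<in> alg G" "\<And>x. x \<in> S \<Longrightarrow> Dg x b = h2 x" using Dg(2)[OF b] by blast
      show "\<exists>h\<in>alg G. \<forall>x\<in>S. f x * Dg x b + Df x b * g x = h x"
        by (rule bexI[OF _ alg.add[OF alg.mult[OF mult.hyps(1) h2(1)] alg.mult[OF h1(1) mult.hyps(2)]]])
          (simp add: h1(2) h2(2))
    qed
  qed
  have "Ck_on k f S" if "f \<in> alg G" for k f
    using that
  proof (induction k arbitrary: f)
    case 0
    obtain D where D: "\<And>x. x \<in> S \<Longrightarrow> (f has_derivative D x) (at x)" using P[OF 0] by blast
    have "continuous_on S f"
      using D has_derivative_continuous by (intro continuous_at_imp_continuous_on) blast
    then show ?case by (simp only: Ck_on.simps)
  next
    case (Suc k)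
    obtain D where D: "\<And>x. x \<in> S \<Longrightarrow> (f has_derivative D x) (at x)"
      "\<And>b. b \<in> Basis \<Longrightarrow> \<exists>g\<in>alg G. \<forall>x\<in>S. D x b = g x" using P[OF Suc.prems] by blast
    have "Ck_on k (\<lambda>x. frechet_derivative f (at x) b) S" if b: "b \<in> Basis" for b
    proof -
      obtain g where g: "g \<in> alg G" "\<And>x. x \<in> S \<Longrightarrow> D x b = g x" using D(2)[OF b] by blast
      show ?thesis
      proof (rule Ck_on_cong[OF S _ Suc.IH[OF g(1)]])
        show "g x = frechet_derivative f (at x) b" if "x \<in> S" for x
          using g(2)[OF that] frechet_derivative_at[OF D(1)[OF that]] by simp
      qed
    qed
    moreover have "f differentiable (at x)" if "x \<in> S" for x
      using D(1)[OF that] differentiableI by blast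
    ultimately show ?case unfolding Ck_on.simps by blast
  qed
  then show ?thesis using f unfolding smooth_on_def by blast
qed

lemma smooth_on_smult:
  assumes "smooth_on f UNIV"
  shows "smooth_on (\<lambda>y. m * f (c *\<^sub>R (y - a))) UNIV"
proof -
  have "Ck_on k (\<lambda>y. m * f (c *\<^sub>R (y - a))) UNIV" if "Ck_on k f UNIV" for k m f
    using that
  proof (induction k arbitrary: f m)
    case 0
    then have c: "continuous_on UNIV f" by (simp only: Ck_on.simps)
    have "continuous_on UNIV (\<lambda>y. f (c *\<^sub>R (y - a)))"
      by (rule continuous_on_compose2[OF c]) (auto intro!: continuous_intros)
    then have "continuous_on UNIV (\<lambda>y. m * f (c *\<^sub>R (y - a)))" by (rule continuous_on_mult_left)
    then show ?case by (simp only: Ck_on.simps)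
  next
    case (Suc k)
    have f: "\<And>x. f differentiable (at x)"
      "\<And>b. b \<in> Basis \<Longrightarrow> Ck_on k (\<lambda>x. frechet_derivative f (at x) b) UNIV"
      using Suc.prems unfolding Ck_on.simps by blast+
    have D: "((\<lambda>y. m * f (c *\<^sub>R (y - a))) has_derivative
        (\<lambda>h. m * frechet_derivative f (at (c *\<^sub>R (y - a))) (c *\<^sub>R h))) (at y)" for y
    proof -
      have "(f has_derivative frechet_derivative f (at (c *\<^sub>R (y - a)))) (at (c *\<^sub>R (y - a)))"
        using f(1) frechet_derivative_works by blast
      moreover have "((\<lambda>y. c *\<^sub>R (y - a)) has_derivative (\<lambda>h. c *\<^sub>R h)) (at y)"
        by (auto intro!: derivative_eq_intros)
      ultimately have "((\<lambda>y. f (c *\<^sub>R (y - a))) has_derivative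
          (\<lambda>h. frechet_derivative f (at (c *\<^sub>R (y - a))) (c *\<^sub>R h))) (at y)"
        by (rule has_derivative_compose[rotated])
      then show ?thesis by (rule has_derivative_mult_right)
    qed
    have fr: "frechet_derivative (\<lambda>y. m * f (c *\<^sub>R (y - a))) (at y) b
        = (m * c) * frechet_derivative f (at (c *\<^sub>R (y - a))) b" for y b
    proof -
      have "linear (frechet_derivative f (at (c *\<^sub>R (y - a))))"
        by (rule linear_frechet_derivative[OF f(1)])
      then show ?thesis using frechet_derivative_at[OF D[of y], symmetric] by (simp add: linear_cmul)
    qed
    have "Ck_on k (\<lambda>y. frechet_derivative (\<lambda>y. m * f (c *\<^sub>R (y - a))) (at y) b) UNIV" if b: "b \<in> Basis" for b
      unfolding fr by (rule Suc.IH[OF f(2)[OF b]])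
    moreover have "(\<lambda>y. m * f (c *\<^sub>R (y - a))) differentiable (at y)" for y
      using D differentiableI by blast
    ultimately show ?case unfolding Ck_on.simps by blast
  qed
  then show ?thesis using assms unfolding smooth_on_def by blast
qed

lemma frechet_scale:
  assumes f: "test_function f"
  shows "frechet_derivative (\<lambda>y. m * f (c *\<^sub>R (y - a))) (at y) b
        = (m * c) * frechet_derivative f (at (c *\<^sub>R (y - a))) b"
proof -
  have d: "f differentiable (at x)" for x
    by (rule smooth_on_imp(2)[where S = UNIV]) (use f in \<open>auto simp: test_function_def\<close>)
  have "(f has_derivative frechet_derivative f (at (c *\<^sub>R (y - a)))) (at (c *\<^sub>R (y - a)))"
    using d frechet_derivative_works by blast
  moreover have "((\<lambda>y. c *\<^sub>R (y - a)) has_derivative (\<lambda>h. c *\<^sub>R h)) (at y)"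
    by (auto intro!: derivative_eq_intros)
  ultimately have "((\<lambda>y. f (c *\<^sub>R (y - a))) has_derivative
      (\<lambda>h. frechet_derivative f (at (c *\<^sub>R (y - a))) (c *\<^sub>R h))) (at y)"
    by (rule has_derivative_compose[rotated])
  then have "((\<lambda>y. m * f (c *\<^sub>R (y - a))) has_derivative
      (\<lambda>h. m * frechet_derivative f (at (c *\<^sub>R (y - a))) (c *\<^sub>R h))) (at y)"
    by (rule has_derivative_mult_right)
  then show ?thesis
    using linear_frechet_derivative[OF d, of "c *\<^sub>R (y - a)"]
    by (simp add: frechet_derivative_at[symmetric] linear_cmul)
qed

lemma test_function_scale:
  assumes f: "test_function f" and c: "c \<noteq> 0"
  shows "test_function (\<lambda>y. m * f (c *\<^sub>R (y - a)))"
proof -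
  obtain K where K: "compact K" "\<And>x. x \<notin> K \<Longrightarrow> f x = 0" using test_function_support[OF f] by blast
  let ?K = "(\<lambda>z. a + (1 / c) *\<^sub>R z) ` K"
  have cK: "compact ?K" by (intro compact_continuous_image continuous_intros K)
  have "{y. m * f (c *\<^sub>R (y - a)) \<noteq> 0} \<subseteq> ?K"
  proof
    fix y assume "y \<in> {y. m * f (c *\<^sub>R (y - a)) \<noteq> 0}"
    then have "c *\<^sub>R (y - a) \<in> K" using K(2) by fastforce
    then have "a + (1 / c) *\<^sub>R (c *\<^sub>R (y - a)) \<in> ?K" by (rule imageI)
    then show "y \<in> ?K" using c by simp
  qed
  then have "closure {y. m * f (c *\<^sub>R (y - a)) \<noteq> 0} \<subseteq> ?K"
    using cK by (intro closure_minimal compact_imp_closed)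
  then have "compact (closure {y. m * f (c *\<^sub>R (y - a)) \<noteq> 0})"
    using cK compact_Int_closed[of ?K "closure {y. m * f (c *\<^sub>R (y - a)) \<noteq> 0}"] by (simp add: inf.absorb2)
  moreover have "smooth_on (\<lambda>y. m * f (c *\<^sub>R (y - a))) UNIV"
    using f by (intro smooth_on_smult) (simp add: test_function_def)
  ultimately show ?thesis by (simp only: test_function_def)
qed

lemma laplacian_scale:
  assumes f: "test_function f"
  shows "laplacian (\<lambda>y. m * f (c *\<^sub>R (y - a))) y = (m * c\<^sup>2) * laplacian f (c *\<^sub>R (y - a))"
proof -
  have "frechet_derivative (\<lambda>z. frechet_derivative (\<lambda>y. m * f (c *\<^sub>R (y - a))) (at z) b) (at y) b
      = (m * c\<^sup>2) * frechet_derivative (\<lambda>z. frechet_derivative f (at z) b) (at (c *\<^sub>R (y - a))) b"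
    if b: "b \<in> Basis" for b
    unfolding frechet_scale[OF f] frechet_scale[OF test_function_frechet[OF f b]]
    by (simp add: power2_eq_square)
  then show ?thesis unfolding laplacian_def by (simp add: sum_distrib_left)
qed

section \<open>A bump function\<close>

text \<open>The classical flat function \<open>exp (- 1 / s)\<close> together with its multiples by powers of \<open>1 / s\<close>, which arise
  when it is differentiated.\<close>

definition flat :: "nat \<Rightarrow> real \<Rightarrow> real"
  where "flat k s = (if s \<le> 0 then 0 else (1 / s) ^ k * exp (- (1 / s)))"

lemma flat_le: "\<bar>flat k s\<bar> \<le> real (Suc k) ^ Suc k * \<bar>s\<bar>"
proof (cases "s \<le> 0")
  case False
  define y where "y = 1 / s"
  have y: "y > 0" using False by (simp add: y_def)
  have "y / real (Suc k) \<le> exp (y / real (Suc k))"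
    using exp_ge_add_one_self[of "y / real (Suc k)"] by linarith
  then have "(y / real (Suc k)) ^ Suc k \<le> exp (y / real (Suc k)) ^ Suc k"
    using y by (intro power_mono) auto
  also have "\<dots> = exp y" by (subst exp_of_nat_mult[symmetric]) simp
  finally have "y ^ Suc k \<le> real (Suc k) ^ Suc k * exp y"
    unfolding power_divide by (simp add: pos_divide_le_eq mult.commute del: of_nat_Suc power_Suc)
  then have "y * (y ^ k * exp (- y)) \<le> real (Suc k) ^ Suc k"
    by (simp add: exp_minus field_simps del: of_nat_Suc)
  then have "flat k s \<le> real (Suc k) ^ Suc k * s"
    using False y by (simp add: flat_def y_def field_simps del: of_nat_Suc power_Suc)
  moreover have "flat k s \<ge> 0" by (simp add: flat_def)
  ultimately show ?thesis using False by simp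
next
  case True
  have "0 \<le> real (Suc k) ^ Suc k * \<bar>s\<bar>" by (intro mult_nonneg_nonneg) simp_all
  then show ?thesis using True unfolding flat_def by (simp only: if_True abs_zero)
qed

lemma flat_DERIV: "(flat k has_real_derivative (flat (k + 2) s - real k * flat (k + 1) s)) (at s)"
proof -
  consider "s < 0" | "s = 0" | "s > 0" by linarith
  then show ?thesis
  proof cases
    case 1
    have "(flat k has_real_derivative 0) (at s)"
      by (rule has_field_derivative_transform_within_open[where S = "{..<0}" and f = "\<lambda>_. 0"])
        (use 1 in \<open>auto simp: flat_def\<close>)
    then show ?thesis using 1 by (simp add: flat_def)
  next
    case 3
    have "((\<lambda>s. (1 / s) ^ k * exp (- (1 / s))) has_real_derivative (flat (k + 2) s - real k * flat (k + 1) s)) (at s)"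
    proof -
      define y where "y = 1 / s"
      have dy: "((\<lambda>s. 1 / s) has_real_derivative - y\<^sup>2) (at s)"
        using 3 by (auto intro!: derivative_eq_intros simp: y_def power2_eq_square)
      have "((\<lambda>s. (1 / s) ^ k * exp (- (1 / s))) has_real_derivative
          real k * (- y\<^sup>2 * y ^ (k - Suc 0)) * exp (- y) + exp (- y) * (- (- y\<^sup>2)) * y ^ k) (at s)"
        unfolding y_def
        by (intro DERIV_mult DERIV_power DERIV_fun_exp DERIV_minus dy[unfolded y_def])
      moreover have e1: "real k * (- y\<^sup>2 * y ^ (k - Suc 0)) = - real k * y ^ (k + 1)"
        by (cases k) (simp_all add: power2_eq_square algebra_simps)
      moreover have e2: "flat (k + 2) s = exp (- y) * (- (- y\<^sup>2)) * y ^ k" "flat (k + 1) s = y ^ (k + 1) * exp (- y)"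
        using 3 unfolding flat_def y_def[symmetric] by (simp_all add: power2_eq_square)
      have "real k * (- y\<^sup>2 * y ^ (k - Suc 0)) * exp (- y) + exp (- y) * (- (- y\<^sup>2)) * y ^ k
          = flat (k + 2) s - real k * flat (k + 1) s"
        unfolding e1 e2 by simp
      ultimately show ?thesis by (simp only:)
    qed
    then show ?thesis
      by (rule has_field_derivative_transform_within_open[where S = "{0<..}"])
        (use 3 in \<open>auto simp: flat_def\<close>)
  next
    case 2
    have "((\<lambda>t. (flat k t - flat k 0) / (t - 0)) \<longlongrightarrow> 0) (at 0)"
    proof (rule tendsto_0_le[where K = "real (Suc (k + 1)) ^ Suc (k + 1)"])
      show "((\<lambda>t::real. t) \<longlongrightarrow> 0) (at 0)" by (rule tendsto_ident_at)
      have "(flat k t - flat k 0) / (t - 0) = flat (k + 1) t" for t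
        by (simp add: flat_def)
      then show "\<forall>\<^sub>F t in at 0. norm ((flat k t - flat k 0) / (t - 0)) \<le> norm t * real (Suc (k + 1)) ^ Suc (k + 1)"
        using flat_le[of "k + 1"] by (intro always_eventually allI) (simp only: real_norm_def mult.commute)
    qed
    then have "(flat k has_real_derivative 0) (at 0)" by (simp only: has_field_derivative_iff)
    then show ?thesis using 2 by (simp add: flat_def)
  qed
qed

definition bump :: "'a::euclidean_space \<Rightarrow> real"
  where "bump x = flat 0 (1 - inner x x)"

lemma bump_props: "bump x \<ge> 0" "bump (- x) = bump x" "norm x \<ge> 1 \<Longrightarrow> bump x = 0" "norm x < 1 \<Longrightarrow> bump x > 0"
proof -
  show "bump x \<ge> 0" "bump (- x) = bump x" by (simp_all add: bump_def flat_def)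
  have *: "inner x x = (norm x)\<^sup>2" by (simp add: power2_norm_eq_inner)
  show "bump x = 0" if "norm x \<ge> 1"
  proof -
    have "(norm x)\<^sup>2 \<ge> 1\<^sup>2" using that by (intro power_mono) auto
    then show ?thesis by (simp add: bump_def flat_def *)
  qed
  show "bump x > 0" if "norm x < 1"
  proof -
    have "(norm x)\<^sup>2 < 1" using that by (simp add: power_less_one_iff)
    then show ?thesis by (simp add: bump_def flat_def *)
  qed
qed

lemma test_function_bump: "test_function (bump :: 'a::euclidean_space \<Rightarrow> real)"
proof -
  define G :: "('a \<Rightarrow> real) set" where
    "G = range (\<lambda>k x. flat k (1 - inner x x)) \<union> range (\<lambda>b x. inner x b)"
  have fl: "(\<lambda>x. flat k (1 - inner x x)) \<in> alg G" and co: "(\<lambda>x. inner x b) \<in> alg G" for k b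
    by (auto simp: G_def intro!: alg.gen)
  have "smooth_on (bump :: 'a \<Rightarrow> real) UNIV"
  proof (rule alg_smooth[where G = G])
    show "bump \<in> alg G" unfolding bump_def[abs_def] by (rule fl)
    fix f assume "f \<in> G"
    then consider k where "f = (\<lambda>x. flat k (1 - inner x x))" | b where "f = (\<lambda>x. inner x b)"
      unfolding G_def by blast
    then show "\<exists>D. (\<forall>x\<in>UNIV. (f has_derivative D x) (at x)) \<and> (\<forall>b\<in>Basis. \<exists>g\<in>alg G. \<forall>x\<in>UNIV. D x b = g x)"
    proof cases
      case 1
      let ?d = "\<lambda>x. flat (k + 2) (1 - inner x x) + (- real k) * flat (k + 1) (1 - inner x x)"
      have in_alg: "(\<lambda>x. ?d x * ((-2) * (inner x b))) \<in> alg G" for b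
        by (intro alg.add alg.mult alg.const fl co)
      have D: "(f has_derivative (\<lambda>h. ?d x * ((-2) * (inner x h)))) (at x)" for x
      proof -
        have "((\<lambda>x. 1 - inner x x) has_derivative (\<lambda>h. (-2) * (inner x h))) (at x)"
          by (auto intro!: derivative_eq_intros simp: inner_commute)
        from has_derivative_compose[OF this flat_DERIV[of k "1 - inner x x", unfolded has_field_derivative_def]]
        show ?thesis unfolding 1 by (simp add: algebra_simps)
      qed
      show ?thesis
      proof (intro exI[of _ "\<lambda>x h. ?d x * ((-2) * (inner x h))"] conjI ballI D)
        fix b :: 'a
        show "\<exists>g\<in>alg G. \<forall>x\<in>UNIV. ?d x * ((-2) * (inner x b)) = g x"
          by (rule bexI[OF _ in_alg[of b]]) (rule ballI, rule refl)
      qed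
    next
      case 2
      have D: "(f has_derivative (\<lambda>h. inner h b)) (at x)" for x
        unfolding 2 by (auto intro!: derivative_eq_intros)
      have in_alg: "(\<lambda>x. inner h b) \<in> alg G" for h by (rule alg.const)
      show ?thesis
      proof (intro exI[of _ "\<lambda>x h. inner h b"] conjI ballI D)
        fix a :: 'a
        show "\<exists>g\<in>alg G. \<forall>x\<in>UNIV. inner a b = g x"
          by (rule bexI[OF _ in_alg[of a]]) (rule ballI, rule refl)
      qed
    qed
  qed simp
  moreover have "compact (closure {x::'a. bump x \<noteq> 0})"
  proof -
    have "{x::'a. bump x \<noteq> 0} \<subseteq> cball 0 1" using bump_props(3) by force
    then have "bounded {x::'a. bump x \<noteq> 0}" using bounded_subset bounded_cball by blast
    then show ?thesis by (simp add: compact_closure)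
  qed
  ultimately show ?thesis by (simp only: test_function_def)
qed

section \<open>Mollification\<close>

lemma locally_integrable_indicator:
  assumes "locally_integrable w" "compact K"
  shows "integrable lborel (\<lambda>y. indicator K y * w y)"
proof -
  have "set_integrable lborel K w" using assms unfolding locally_integrable_def by blast
  then show ?thesis unfolding set_integrable_def by simp
qed

lemma integrable_locally_mult:
  assumes w: "locally_integrable w" and K: "compact K" "\<And>y. y \<notin> K \<Longrightarrow> f y = 0"
    and f: "f \<in> borel_measurable borel" and C: "\<And>y. \<bar>f y\<bar> \<le> C"
  shows "integrable lborel (\<lambda>y. w y * f y)"
proof -
  have i: "integrable lborel (\<lambda>y. indicator K y * w y)" by (rule locally_integrable_indicator[OF w K(1)])
  have eq: "w y * f y = (indicator K y * w y) * f y" for y using K(2)[of y] by (cases "y \<in> K") auto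
  have m: "(\<lambda>y. (indicator K y * w y) * f y) \<in> borel_measurable lborel"
    by (rule borel_measurable_times[OF borel_measurable_integrable[OF i]]) (use f in simp)
  have "integrable lborel (\<lambda>y. (indicator K y * w y) * f y)"
  proof (rule Bochner_Integration.integrable_bound[OF _ m])
    show "integrable lborel (\<lambda>y. C * (indicator K y * w y))" by (rule integrable_mult_right[OF i])
    have "\<bar>(indicator K y * w y) * f y\<bar> \<le> \<bar>C * (indicator K y * w y)\<bar>" for y
    proof -
      have "0 \<le> C" using order_trans[OF abs_ge_zero C] by blast
      then show ?thesis using C[of y] by (simp add: abs_mult mult.commute mult_right_mono)
    qed
    then show "AE y in lborel. norm ((indicator K y * w y) * f y) \<le> norm (C * (indicator K y * w y))" by simp
  qed
  then show ?thesis unfolding eq .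
qed

text \<open>While \<open>x\<close> stays in a ball, the supports of the translates of \<open>\<phi>\<close> stay in one compact set. This provides
  the dominating functions for convolutions with a merely locally integrable function.\<close>

lemma compact_translates:
  fixes K :: "'a::euclidean_space set"
  assumes K: "compact K" "\<forall>z. z \<notin> K \<longrightarrow> \<phi> z = 0" and c: "c \<noteq> 0"
  shows "\<exists>K'. compact K' \<and> (\<forall>x y. norm (x - a) \<le> R \<longrightarrow> y \<notin> K' \<longrightarrow> \<phi> (c *\<^sub>R (y - x)) = 0)"
proof -
  let ?K = "(\<lambda>p. snd p + (1 / c) *\<^sub>R fst p) ` (K \<times> cball a R)"
  have "compact ?K" by (intro compact_continuous_image continuous_intros compact_Times K) auto
  moreover have "\<phi> (c *\<^sub>R (y - x)) = 0" if "norm (x - a) \<le> R" "y \<notin> ?K" for x y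
  proof (rule K(2)[rule_format], rule notI)
    assume "c *\<^sub>R (y - x) \<in> K"
    then have "(c *\<^sub>R (y - x), x) \<in> K \<times> cball a R"
      using that(1) by (auto simp: dist_norm norm_minus_commute)
    then have "(\<lambda>p. snd p + (1 / c) *\<^sub>R fst p) (c *\<^sub>R (y - x), x) \<in> ?K" by (rule imageI)
    then show False using that(2) c by simp
  qed
  ultimately show ?thesis by (intro exI[of _ ?K] conjI allI impI)
qed

lemma conv_integrable:
  assumes w: "locally_integrable w" and \<phi>: "test_function \<phi>" and c: "c \<noteq> 0"
  shows "integrable lborel (\<lambda>y. w y * \<phi> (c *\<^sub>R (y - x)))"
proof -
  obtain K where K0: "compact K" "\<And>z. z \<notin> K \<Longrightarrow> \<phi> z = 0" using test_function_support[OF \<phi>] by blast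
  have K: "compact K" "\<forall>z. z \<notin> K \<longrightarrow> \<phi> z = 0" using K0 by simp_all
  obtain K' where K': "compact K'" "\<forall>x' y. norm (x' - x) \<le> 0 \<longrightarrow> y \<notin> K' \<longrightarrow> \<phi> (c *\<^sub>R (y - x')) = 0"
    using compact_translates[where \<phi> = \<phi> and a = x and R = 0, OF K c] by (elim exE conjE)
  obtain C where C: "\<And>z. \<bar>\<phi> z\<bar> \<le> C" using test_function_bounded[OF \<phi>] by blast
  have "continuous_on UNIV (\<lambda>y. \<phi> (c *\<^sub>R (y - x)))"
    by (rule continuous_on_compose2[OF test_function_cont[OF \<phi>]]) (auto intro!: continuous_intros)
  then have m: "(\<lambda>y. \<phi> (c *\<^sub>R (y - x))) \<in> borel_measurable borel"
    by (rule borel_measurable_continuous_onI)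
  show ?thesis
    by (rule integrable_locally_mult[OF w K'(1) _ m C]) (use K'(2) in simp)
qed

lemma conv_continuous:
  fixes w :: "'a::euclidean_space \<Rightarrow> real"
  assumes w: "locally_integrable w" and \<phi>: "test_function \<phi>" and c: "c \<noteq> 0"
  shows "continuous_on UNIV (\<lambda>x. LINT y|lborel. w y * \<phi> (c *\<^sub>R (y - x)))"
proof (rule continuous_on_sequentiallyI)
  fix u :: "nat \<Rightarrow> 'a" and a assume u: "u \<longlonglongrightarrow> a"
  obtain K where K0: "compact K" "\<And>z. z \<notin> K \<Longrightarrow> \<phi> z = 0" using test_function_support[OF \<phi>] by blast
  have K: "compact K" "\<forall>z. z \<notin> K \<longrightarrow> \<phi> z = 0" using K0 by simp_all
  obtain C where C: "\<And>z. \<bar>\<phi> z\<bar> \<le> C" using test_function_bounded[OF \<phi>] by blast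
  have "(\<lambda>n. u n - a) \<longlonglongrightarrow> 0" using u by (simp add: LIM_zero_iff)
  then have "Bseq (\<lambda>n. u n - a)" by (intro convergent_imp_Bseq convergentI)
  then obtain R where R: "\<And>n. norm (u n - a) \<le> R" unfolding Bseq_def by blast
  obtain K' where K': "compact K'" "\<forall>x y. norm (x - a) \<le> R \<longrightarrow> y \<notin> K' \<longrightarrow> \<phi> (c *\<^sub>R (y - x)) = 0"
    using compact_translates[where \<phi> = \<phi> and a = a and R = R, OF K c] by (elim exE conjE)
  have i: "integrable lborel (\<lambda>y. C * \<bar>indicator K' y * w y\<bar>)"
    by (intro integrable_mult_right integrable_abs locally_integrable_indicator[OF w K'(1)])
  show "(\<lambda>n. LINT y|lborel. w y * \<phi> (c *\<^sub>R (y - u n))) \<longlonglongrightarrow> (LINT y|lborel. w y * \<phi> (c *\<^sub>R (y - a)))"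
  proof (rule integral_dominated_convergence[OF _ _ i])
    show "(\<lambda>y. w y * \<phi> (c *\<^sub>R (y - a))) \<in> borel_measurable lborel"
      "(\<lambda>y. w y * \<phi> (c *\<^sub>R (y - u n))) \<in> borel_measurable lborel" for n
      by (intro borel_measurable_integrable conv_integrable[OF w \<phi> c])+
    have "(\<lambda>n. w y * \<phi> (c *\<^sub>R (y - u n))) \<longlonglongrightarrow> w y * \<phi> (c *\<^sub>R (y - a))" for y
    proof -
      have "isCont \<phi> (c *\<^sub>R (y - a))"
        using test_function_cont[OF \<phi>] unfolding continuous_on_eq_continuous_at[OF open_UNIV] by blast
      moreover have "(\<lambda>n. c *\<^sub>R (y - u n)) \<longlonglongrightarrow> c *\<^sub>R (y - a)" by (intro tendsto_intros u)
      ultimately have "(\<lambda>n. \<phi> (c *\<^sub>R (y - u n))) \<longlonglongrightarrow> \<phi> (c *\<^sub>R (y - a))" by (rule isCont_tendsto_compose)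
      then show ?thesis by (rule tendsto_mult_left)
    qed
    then show "AE y in lborel. (\<lambda>n. w y * \<phi> (c *\<^sub>R (y - u n))) \<longlonglongrightarrow> w y * \<phi> (c *\<^sub>R (y - a))" by simp
    fix n
    have "\<bar>w y * \<phi> (c *\<^sub>R (y - u n))\<bar> \<le> C * \<bar>indicator K' y * w y\<bar>" for y
      using K'(2)[rule_format, OF R[of n], of y] C[of "c *\<^sub>R (y - u n)"]
      by (cases "y \<in> K'") (simp_all add: abs_mult mult.commute[of C] mult_left_mono)
    then show "AE y in lborel. norm (w y * \<phi> (c *\<^sub>R (y - u n))) \<le> C * \<bar>indicator K' y * w y\<bar>" by simp
  qed
qed

text \<open>Under the integral sign the derivative falls on the test function; its sign changes because \<open>x\<close> enters
  through \<open>y - x\<close>.\<close>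

lemma conv_dderiv:
  fixes w :: "'a::euclidean_space \<Rightarrow> real"
  assumes w: "locally_integrable w" and \<phi>: "test_function \<phi>" and c: "c \<noteq> 0" and b: "b \<in> Basis"
  shows "has_dderiv (\<lambda>x. LINT y|lborel. w y * \<phi> (c *\<^sub>R (y - x))) b
    (\<lambda>x. LINT y|lborel. w y * (- c * frechet_derivative \<phi> (at (c *\<^sub>R (y - x))) b))"
  unfolding has_dderiv_def
proof
  fix x :: 'a
  let ?p = "\<lambda>z. frechet_derivative \<phi> (at z) b"
  have p: "test_function ?p" by (rule test_function_frechet[OF \<phi> b])
  obtain K where K0: "compact K" "\<And>z. z \<notin> K \<Longrightarrow> ?p z = 0" using test_function_support[OF p] by blast
  have K: "compact K" "\<forall>z. z \<notin> K \<longrightarrow> ?p z = 0" using K0 by simp_all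
  obtain C where C: "\<And>z. \<bar>?p z\<bar> \<le> C" using test_function_bounded[OF p] by blast
  obtain K' where K': "compact K'" "\<forall>x' y. norm (x' - x) \<le> 1 \<longrightarrow> y \<notin> K' \<longrightarrow> ?p (c *\<^sub>R (y - x')) = 0"
    using compact_translates[where \<phi> = ?p and a = x and R = 1, OF K c] by (elim exE conjE)
  have i: "integrable lborel (\<lambda>y. (\<bar>c\<bar> * C) * \<bar>indicator K' y * w y\<bar>)"
    by (intro integrable_mult_right integrable_abs locally_integrable_indicator[OF w K'(1)])
  have "((\<lambda>t. LINT y|lborel. w y * \<phi> (c *\<^sub>R (y - (x + t *\<^sub>R b)))) has_real_derivative
      (LINT y|lborel. w y * (- c * ?p (c *\<^sub>R (y - (x + 0 *\<^sub>R b)))))) (at 0)"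
  proof (rule DERIV_integral[OF _ _ _ i])
    show "integrable lborel (\<lambda>y. w y * \<phi> (c *\<^sub>R (y - (x + t *\<^sub>R b))))" for t
      by (rule conv_integrable[OF w \<phi> c])
    fix t :: real and y :: 'a assume t: "\<bar>t\<bar> < 1"
    have "((\<lambda>s. \<phi> (c *\<^sub>R (y - x) + s *\<^sub>R b)) has_real_derivative ?p (c *\<^sub>R (y - x) + (- c * t) *\<^sub>R b)) (at (- c * t))"
      by (rule has_dderiv_line[OF test_function_dderiv[OF \<phi>]])
    moreover have "((\<lambda>t. - c * t) has_real_derivative - c) (at t)" by (auto intro!: derivative_eq_intros)
    ultimately have "((\<lambda>t. \<phi> (c *\<^sub>R (y - x) + (- c * t) *\<^sub>R b)) has_real_derivative
        ?p (c *\<^sub>R (y - x) + (- c * t) *\<^sub>R b) * (- c)) (at t)"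
      by (rule DERIV_chain2)
    moreover have "c *\<^sub>R (y - x) + (- c * s) *\<^sub>R b = c *\<^sub>R (y - (x + s *\<^sub>R b))" for s
      by (simp add: algebra_simps)
    ultimately have "((\<lambda>t. \<phi> (c *\<^sub>R (y - (x + t *\<^sub>R b)))) has_real_derivative
        - c * ?p (c *\<^sub>R (y - (x + t *\<^sub>R b)))) (at t)" by (simp only: mult.commute)
    then show "((\<lambda>t. w y * \<phi> (c *\<^sub>R (y - (x + t *\<^sub>R b)))) has_real_derivative
        w y * (- c * ?p (c *\<^sub>R (y - (x + t *\<^sub>R b))))) (at t)"
      by (rule DERIV_cmult)
    have n: "norm ((x + t *\<^sub>R b) - x) \<le> 1" using t b by simp
    have "\<bar>w y\<bar> * (\<bar>c\<bar> * \<bar>?p (c *\<^sub>R (y - (x + t *\<^sub>R b)))\<bar>) \<le> \<bar>w y\<bar> * (\<bar>c\<bar> * C)"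
      by (intro mult_left_mono C) auto
    then show "\<bar>w y * (- c * ?p (c *\<^sub>R (y - (x + t *\<^sub>R b))))\<bar> \<le> (\<bar>c\<bar> * C) * \<bar>indicator K' y * w y\<bar>"
      using K'(2)[rule_format, OF n, of y] by (cases "y \<in> K'") (simp_all add: abs_mult mult.commute)
  qed
  then show "((\<lambda>t. LINT y|lborel. w y * \<phi> (c *\<^sub>R (y - (x + t *\<^sub>R b)))) has_real_derivative
      (LINT y|lborel. w y * (- c * ?p (c *\<^sub>R (y - x))))) (at 0)" by simp
qed

lemma lborel_integral_scale:
  fixes f :: "'a::euclidean_space \<Rightarrow> real"
  assumes f: "f \<in> borel_measurable borel" and c: "c \<noteq> 0"
  shows "(LINT y|lborel. \<bar>c\<bar> ^ DIM('a) * f (c *\<^sub>R (y - a))) = (LINT y|lborel. f y)"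
proof -
  let ?T = "\<lambda>y::'a. (- (c *\<^sub>R a)) + c *\<^sub>R y"
  have T: "?T y = c *\<^sub>R (y - a)" for y by (simp add: algebra_simps)
  have "(LINT y|lborel. f y) = integral\<^sup>L (density (distr lborel borel ?T) (\<lambda>_. ennreal (\<bar>c\<bar> ^ DIM('a)))) f"
    using lborel_affine[OF c, of "- (c *\<^sub>R a)"] by simp
  also have "\<dots> = integral\<^sup>L (distr lborel borel ?T) (\<lambda>y. \<bar>c\<bar> ^ DIM('a) *\<^sub>R f y)"
    using f by (intro integral_density) auto
  also have "\<dots> = (LINT y|lborel. \<bar>c\<bar> ^ DIM('a) *\<^sub>R f (?T y))"
    using f by (intro integral_distr) auto
  finally have "(LINT y|lborel. f y) = (LINT y|lborel. \<bar>c\<bar> ^ DIM('a) *\<^sub>R f (?T y))" .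
  then show ?thesis unfolding T real_scaleR_def by (rule sym)
qed

text \<open>The rescaled bump function, normalised to have integral one and supported in the ball of radius
  \<open>1 / (n + 1)\<close>.\<close>

definition kernel :: "nat \<Rightarrow> 'a::euclidean_space \<Rightarrow> real"
  where "kernel n z = real (Suc n) ^ DIM('a) / (LINT x|lborel. bump (x::'a)) * bump (real (Suc n) *\<^sub>R z)"

text \<open>A vanishing integral would make the unit ball negligible.\<close>

lemma bump_integral_pos: "(LINT x|lborel. bump (x::'a::euclidean_space)) > 0"
proof -
  have i: "integrable lborel (bump :: 'a \<Rightarrow> real)" by (rule test_function_integrable[OF test_function_bump])
  have "(LINT x|lborel. bump (x::'a)) \<noteq> 0"
  proof
    assume "(LINT x|lborel. bump (x::'a)) = 0"
    then have "AE x in lborel. bump (x::'a) = 0"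
      by (rule iffD1[OF integral_nonneg_eq_0_iff_AE[OF i AE_I2[OF bump_props(1)]]])
    then have "AE x in lborel. x \<notin> ball (0::'a) 1"
      by eventually_elim (use bump_props(4) in force)
    then have "emeasure lborel (ball (0::'a) 1) = 0"
      by (subst (asm) AE_iff_measurable[OF _ refl]) (auto simp: ball_def)
    then show False using open_not_negligible[of "ball (0::'a) 1"] by (auto simp: negligible_iff_emeasure0)
  qed
  moreover have "(LINT x|lborel. bump (x::'a)) \<ge> 0" by (intro integral_nonneg_AE) (simp add: bump_props(1))
  ultimately show ?thesis by simp
qed

lemma test_function_kernel: "test_function (kernel n)"
proof -
  have "test_function (\<lambda>y::'a. real (Suc n) ^ DIM('a) / (LINT x|lborel. bump (x::'a)) * bump (real (Suc n) *\<^sub>R (y - 0)))"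
    by (rule test_function_scale[OF test_function_bump]) simp
  then show ?thesis unfolding kernel_def[abs_def] by simp
qed

lemma kernel_props:
  fixes x z :: "'a::euclidean_space"
  shows "kernel n z \<ge> 0" "kernel n (- z) = kernel n z" "norm z \<ge> 1 / real (Suc n) \<Longrightarrow> kernel n z = 0"
    "kernel n \<in> borel_measurable borel"
    "integrable lborel (\<lambda>y. kernel n (y - x))" "(LINT y|lborel. kernel n (y - x)) = 1"
proof -
  note p = bump_integral_pos[where 'a = 'a]
  show "kernel n z \<ge> 0" unfolding kernel_def using p by (simp add: bump_props(1))
  show "kernel n (- z) = kernel n z" unfolding kernel_def by (simp add: bump_props(2) del: of_nat_Suc)
  show "kernel n z = 0" if "norm z \<ge> 1 / real (Suc n)"
  proof -
    have "norm (real (Suc n) *\<^sub>R z) \<ge> 1" using that by (simp add: pos_divide_le_eq mult.commute del: of_nat_Suc)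
    then show ?thesis unfolding kernel_def using bump_props(3) by fastforce
  qed
  have mb: "(bump :: 'a \<Rightarrow> real) \<in> borel_measurable borel"
    by (rule borel_measurable_continuous_onI[OF test_function_cont[OF test_function_bump]])
  show "kernel n \<in> borel_measurable borel"
    by (rule borel_measurable_continuous_onI[OF test_function_cont[OF test_function_kernel]])
  have "test_function (\<lambda>y. real (Suc n) ^ DIM('a) / (LINT x|lborel. bump (x::'a)) * bump (real (Suc n) *\<^sub>R (y - x)))"
    by (rule test_function_scale[OF test_function_bump]) simp
  then show "integrable lborel (\<lambda>y. kernel n (y - x))"
    unfolding kernel_def by (rule test_function_integrable)
  have "(LINT y|lborel. kernel n (y - x)) = (LINT y|lborel. (\<bar>real (Suc n)\<bar> ^ DIM('a) * bump (real (Suc n) *\<^sub>R (y - x))) / (LINT x|lborel. bump (x::'a)))"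
    unfolding kernel_def by (simp del: of_nat_Suc)
  also have "\<dots> = 1"
    using lborel_integral_scale[OF mb, of "real (Suc n)" x] p by (simp del: of_nat_Suc)
  finally show "(LINT y|lborel. kernel n (y - x)) = 1" .
qed

definition moll :: "nat \<Rightarrow> ('a::euclidean_space \<Rightarrow> real) \<Rightarrow> 'a \<Rightarrow> real"
  where "moll n w x = (LINT y|lborel. w y * kernel n (y - x))"

lemma moll_integrable: "locally_integrable w \<Longrightarrow> integrable lborel (\<lambda>y. w y * kernel n (y - x))"
  using conv_integrable[OF _ test_function_kernel, of w 1 n x] by simp

lemma moll_continuous: "locally_integrable w \<Longrightarrow> continuous_on UNIV (moll n w)"
  using conv_continuous[OF _ test_function_kernel, of w 1 n] by (simp add: moll_def[abs_def])

lemma moll_add: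
  assumes "locally_integrable v" "locally_integrable w"
  shows "moll n (\<lambda>x. v x + w x) x = moll n v x + moll n w x"
  unfolding moll_def distrib_right
  by (rule Bochner_Integration.integral_add) (intro moll_integrable assms)+

text \<open>A mollified value is an average over a small ball, hence as close to a constant as the values on that ball.\<close>

lemma moll_diff_le:
  assumes w: "locally_integrable w" and le: "\<And>y. norm (y - x) < 1 / real (Suc n) \<Longrightarrow> \<bar>w y - c\<bar> \<le> \<eta>"
  shows "\<bar>moll n w x - c\<bar> \<le> \<eta>"
proof -
  have ic: "integrable lborel (\<lambda>y. c * kernel n (y - x))" "integrable lborel (\<lambda>y. \<eta> * kernel n (y - x))"
    by (intro integrable_mult_right kernel_props)+
  have id: "integrable lborel (\<lambda>y. w y * kernel n (y - x) - c * kernel n (y - x))"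
    by (intro Bochner_Integration.integrable_diff moll_integrable w ic)
  have "moll n w x - c = (LINT y|lborel. w y * kernel n (y - x) - c * kernel n (y - x))"
    unfolding moll_def using Bochner_Integration.integral_diff[OF moll_integrable[OF w] ic(1)]
    by (simp add: kernel_props(6))
  also have "\<bar>\<dots>\<bar> \<le> (LINT y|lborel. \<bar>w y * kernel n (y - x) - c * kernel n (y - x)\<bar>)"
    by (rule integral_abs_bound)
  also have "\<dots> \<le> (LINT y|lborel. \<eta> * kernel n (y - x))"
  proof (rule integral_mono[OF integrable_abs[OF id] ic(2)])
    fix y
    show "\<bar>w y * kernel n (y - x) - c * kernel n (y - x)\<bar> \<le> \<eta> * kernel n (y - x)"
    proof (cases "norm (y - x) < 1 / real (Suc n)")
      case True
      have "\<bar>w y - c\<bar> * kernel n (y - x) \<le> \<eta> * kernel n (y - x)"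
        using le[OF True] kernel_props(1) by (intro mult_right_mono) auto
      then show ?thesis using kernel_props(1)[of n "y - x"]
        by (simp add: left_diff_distrib[symmetric] abs_mult)
    qed (simp add: kernel_props(3))
  qed
  also have "\<dots> = \<eta>" by (simp add: kernel_props(6))
  finally show ?thesis .
qed

lemma moll_tendsto:
  assumes w: "locally_integrable w" and c: "isCont w x"
  shows "(\<lambda>n. moll n w x) \<longlonglongrightarrow> w x"
proof (rule LIMSEQ_I)
  fix e :: real assume e: "e > 0"
  then have e2: "e / 2 > 0" by simp
  then obtain \<delta> where \<delta>: "\<delta> > 0" "\<And>y. norm (y - x) < \<delta> \<Longrightarrow> \<bar>w y - w x\<bar> < e / 2"
    using c unfolding continuous_at_eps_delta dist_norm real_norm_def by blast
  obtain N where N: "1 / real (Suc N) < \<delta>" using nat_approx_posE[OF \<delta>(1)] .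
  have "norm (moll n w x - w x) < e" if n: "n \<ge> N" for n
  proof -
    have "1 / real (Suc n) \<le> 1 / real (Suc N)" using n by (intro divide_left_mono) auto
    then have "\<bar>w y - w x\<bar> \<le> e / 2" if "norm (y - x) < 1 / real (Suc n)" for y
      using \<delta>(2)[of y] N that by (simp del: of_nat_Suc)
    then have "\<bar>moll n w x - w x\<bar> \<le> e / 2" by (rule moll_diff_le[OF w])
    then show ?thesis using e by simp
  qed
  then show "\<exists>N. \<forall>n\<ge>N. norm (moll n w x - w x) < e" by blast
qed

text \<open>By Tonelli, mollification does not increase the \<open>L\<^sup>1\<close> norm.\<close>

lemma moll_L1:
  assumes h: "integrable lborel h"
  shows "(\<integral>\<^sup>+x. ennreal \<bar>moll n h x\<bar> \<partial>lborel) \<le> ennreal (LINT x|lborel. \<bar>h x\<bar>)"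
proof -
  have mh[measurable]: "h \<in> borel_measurable borel" using borel_measurable_integrable[OF h] by simp
  have mk[measurable]: "kernel n \<in> borel_measurable borel" by (rule kernel_props)
  have "(\<integral>\<^sup>+x. ennreal \<bar>moll n h x\<bar> \<partial>lborel) \<le> (\<integral>\<^sup>+x. (\<integral>\<^sup>+y. ennreal \<bar>h y\<bar> * ennreal (kernel n (y - x)) \<partial>lborel) \<partial>lborel)"
  proof (rule nn_integral_mono)
    fix x :: 'a
    have "ennreal \<bar>moll n h x\<bar> \<le> (\<integral>\<^sup>+y. ennreal (norm (h y * kernel n (y - x))) \<partial>lborel)"
      unfolding moll_def using integral_norm_bound_ennreal[of lborel "\<lambda>y. h y * kernel n (y - x)"]
      by (cases "integrable lborel (\<lambda>y. h y * kernel n (y - x))") (auto simp: not_integrable_integral_eq)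
    also have "\<dots> = (\<integral>\<^sup>+y. ennreal \<bar>h y\<bar> * ennreal (kernel n (y - x)) \<partial>lborel)"
      by (intro nn_integral_cong) (simp add: abs_mult ennreal_mult kernel_props(1))
    finally show "ennreal \<bar>moll n h x\<bar> \<le> (\<integral>\<^sup>+y. ennreal \<bar>h y\<bar> * ennreal (kernel n (y - x)) \<partial>lborel)" .
  qed
  also have "\<dots> = (\<integral>\<^sup>+y. (\<integral>\<^sup>+x. ennreal \<bar>h y\<bar> * ennreal (kernel n (y - x)) \<partial>lborel) \<partial>lborel)"
    by (rule lborel_pair.Fubini') measurable
  also have "\<dots> = (\<integral>\<^sup>+y. ennreal \<bar>h y\<bar> \<partial>lborel)"
  proof (rule nn_integral_cong)
    fix y :: 'a
    have e: "kernel n (y - x) = kernel n (x - y)" for x using kernel_props(2)[of n "x - y"] by simp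
    have "(\<integral>\<^sup>+x. ennreal \<bar>h y\<bar> * ennreal (kernel n (y - x)) \<partial>lborel) = ennreal \<bar>h y\<bar> * (\<integral>\<^sup>+x. ennreal (kernel n (x - y)) \<partial>lborel)"
      unfolding e by (rule nn_integral_cmult) measurable
    also have "(\<integral>\<^sup>+x. ennreal (kernel n (x - y)) \<partial>lborel) = ennreal (LINT x|lborel. kernel n (x - y))"
      by (rule nn_integral_eq_integral) (auto simp: kernel_props)
    finally show "(\<integral>\<^sup>+x. ennreal \<bar>h y\<bar> * ennreal (kernel n (y - x)) \<partial>lborel) = ennreal \<bar>h y\<bar>"
      by (simp add: kernel_props(6))
  qed
  also have "\<dots> = ennreal (LINT x|lborel. \<bar>h x\<bar>)"
    by (rule nn_integral_eq_integral) (use h in auto)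
  finally show ?thesis .
qed

lemma locally_integrable_continuous:
  "continuous_on UNIV f \<Longrightarrow> locally_integrable f"
  unfolding locally_integrable_def set_integrable_def
  by (intro allI impI borel_integrable_compact) (auto intro: continuous_on_subset)

lemma locally_integrable_add:
  "locally_integrable f \<Longrightarrow> locally_integrable g \<Longrightarrow> locally_integrable (\<lambda>x. f x + g x)"
  unfolding locally_integrable_def by (auto intro: set_integral_add)

lemma locally_integrable_diff:
  "locally_integrable f \<Longrightarrow> locally_integrable g \<Longrightarrow> locally_integrable (\<lambda>x. f x - g x)"
  unfolding locally_integrable_def by (auto intro: set_integral_diff)

lemma locally_integrable_cmult:
  "locally_integrable f \<Longrightarrow> locally_integrable (\<lambda>x. c * f x)"
  unfolding locally_integrable_def by auto

lemma locally_integrable_bound: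
  assumes g: "locally_integrable g" and f: "f \<in> borel_measurable borel" and le: "\<And>x. \<bar>f x\<bar> \<le> g x"
  shows "locally_integrable f"
  unfolding locally_integrable_def set_integrable_def
proof (intro allI impI)
  fix K :: "'a set" assume K: "compact K"
  have [measurable]: "K \<in> sets borel" using K by (rule borel_compact)
  show "integrable lborel (\<lambda>x. indicator K x *\<^sub>R f x)"
  proof (rule Bochner_Integration.integrable_bound[OF locally_integrable_indicator[OF g K]])
    show "(\<lambda>x. indicator K x *\<^sub>R f x) \<in> borel_measurable lborel" using f by measurable
    have "norm (indicator K x *\<^sub>R f x) \<le> norm (indicator K x * g x)" for x
      using le[of x] by (cases "x \<in> K") auto
    then show "AE x in lborel. norm (indicator K x *\<^sub>R f x) \<le> norm (indicator K x * g x)" by simp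
  qed
qed

lemma locally_integrable_measurable:
  fixes f :: "'a::euclidean_space \<Rightarrow> real"
  assumes "locally_integrable f"
  shows "f \<in> borel_measurable borel"
proof (rule borel_measurable_LIMSEQ_metric)
  show "(\<lambda>x. indicator (cball 0 (real n)) x * f x) \<in> borel_measurable borel" for n
    using borel_measurable_integrable[OF locally_integrable_indicator[OF assms compact_cball]] by simp
  fix x :: 'a
  obtain N where N: "norm x \<le> real N" using real_arch_simple by blast
  have "indicator (cball 0 (real n)) x * f x = f x" if "n \<ge> N" for n
    using N that by (simp add: indicator_def)
  then show "(\<lambda>n. indicator (cball 0 (real n)) x * f x) \<longlonglongrightarrow> f x"
    by (intro tendsto_eventually) (auto simp: eventually_sequentially)
qed

lemma locally_integrable_mult:
  assumes w: "locally_integrable w" and \<theta>: "continuous_on UNIV \<theta>" and C: "\<And>x. \<bar>\<theta> x\<bar> \<le> C"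
  shows "locally_integrable (\<lambda>x. \<theta> x * w x)"
proof (rule locally_integrable_bound[where g = "\<lambda>x. C * \<bar>w x\<bar>"])
  show "locally_integrable (\<lambda>x. C * \<bar>w x\<bar>)"
    unfolding locally_integrable_def
  proof (intro allI impI)
    fix K :: "'a set" assume K: "compact K"
    have "set_integrable lborel K w" using w K unfolding locally_integrable_def by blast
    then have "set_integrable lborel K (\<lambda>x. \<bar>w x\<bar>)" by (rule set_integrable_abs)
    then show "set_integrable lborel K (\<lambda>x. C * \<bar>w x\<bar>)" by simp
  qed
  show "(\<lambda>x. \<theta> x * w x) \<in> borel_measurable borel"
    by (intro borel_measurable_times borel_measurable_continuous_onI[OF \<theta>] locally_integrable_measurable[OF w])
  show "\<bar>\<theta> x * w x\<bar> \<le> C * \<bar>w x\<bar>" for x unfolding abs_mult using C by (intro mult_right_mono) auto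
qed

lemma integrable_test_mult:
  assumes w: "locally_integrable w" and \<psi>: "test_function \<psi>"
  shows "integrable lborel (\<lambda>x. w x * \<psi> x)"
  using conv_integrable[OF w \<psi>, of 1 0] by simp

lemma integrable_test_mult_abs:
  assumes w: "locally_integrable w" and \<psi>: "test_function \<psi>"
  shows "integrable lborel (\<lambda>x. \<bar>w x\<bar> * \<bar>\<psi> x\<bar>)"
  using integrable_abs[OF integrable_test_mult[OF w \<psi>]] by (simp add: abs_mult)

text \<open>Absolute continuity of the integral, at the origin.\<close>

lemma small_balls:
  fixes w :: "'a::euclidean_space \<Rightarrow> real"
  assumes w: "locally_integrable w"
  shows "(\<lambda>n. LINT x|lborel. indicator (cball 0 (1 / real (Suc n))) x * \<bar>w x\<bar>) \<longlonglongrightarrow> 0"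
proof -
  have i: "integrable lborel (\<lambda>x. \<bar>indicator (cball 0 1) x * w x\<bar>)"
    by (intro integrable_abs locally_integrable_indicator[OF w]) simp
  have mw: "w \<in> borel_measurable borel" by (rule locally_integrable_measurable[OF w])
  have "(\<lambda>n. LINT x|lborel. indicator (cball 0 (1 / real (Suc n))) x * \<bar>w x\<bar>) \<longlonglongrightarrow> (LINT x|(lborel :: 'a measure). 0)"
  proof (rule integral_dominated_convergence[OF _ _ i])
    have lim: "(\<lambda>n. indicator (cball 0 (1 / real (Suc n))) x * \<bar>w x\<bar>) \<longlonglongrightarrow> 0" if "x \<noteq> 0" for x :: 'a
    proof -
      have "norm x > 0" using that by simp
      then obtain N where N: "1 / real (Suc N) < norm x" by (rule nat_approx_posE)
      have "indicator (cball 0 (1 / real (Suc n))) x * \<bar>w x\<bar> = 0" if "n \<ge> N" for n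
      proof -
        have "1 / real (Suc n) \<le> 1 / real (Suc N)" using that by (intro divide_left_mono) auto
        then show ?thesis using N by (simp add: indicator_def del: of_nat_Suc)
      qed
      then show ?thesis by (intro tendsto_eventually) (auto simp: eventually_sequentially)
    qed
    have "AE x in lborel. x \<noteq> (0::'a)" by (rule AE_lborel_singleton)
    then show "AE x in lborel. (\<lambda>n. indicator (cball 0 (1 / real (Suc n))) x * \<bar>w x\<bar>) \<longlonglongrightarrow> (0::real)"
      by eventually_elim (rule lim)
    fix n
    have one: "1 / real (Suc n) \<le> 1" by simp
    have "norm (indicator (cball 0 (1 / real (Suc n))) x * \<bar>w x\<bar>) \<le> \<bar>indicator (cball 0 1) x * w x\<bar>" for x :: 'a
    proof (cases "norm x \<le> 1 / real (Suc n)")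
      case True
      then have "norm x \<le> 1" using one by linarith
      then show ?thesis using True by (simp add: indicator_def)
    next
      case False
      then show ?thesis by (simp add: indicator_def del: of_nat_Suc)
    qed
    then show "AE x in lborel. norm (indicator (cball 0 (1 / real (Suc n))) x * \<bar>w x\<bar>) \<le> \<bar>indicator (cball 0 1) x * w x\<bar>" by simp
    show "(\<lambda>x. indicator (cball 0 (1 / real (Suc n))) x * \<bar>w x\<bar>) \<in> borel_measurable lborel"
      using mw by (intro borel_measurable_times borel_measurable_indicator borel_measurable_abs) auto
  qed simp
  then show ?thesis by simp
qed

lemma moll_locally_integrable: "locally_integrable w \<Longrightarrow> locally_integrable (moll n w)"
  by (rule locally_integrable_continuous[OF moll_continuous])

text \<open>Convergence in \<open>L\<^sup>1\<close> for a continuous function: the mollified values near the support of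
  \<open>\<psi>\<close> are bounded by a maximum over a slightly larger compact set.\<close>

lemma moll_converge_continuous:
  fixes w :: "'a::euclidean_space \<Rightarrow> real"
  assumes w: "continuous_on UNIV w" and \<psi>: "test_function \<psi>"
  shows "(\<lambda>n. LINT x|lborel. \<bar>moll n w x - w x\<bar> * \<bar>\<psi> x\<bar>) \<longlonglongrightarrow> 0"
proof -
  have li: "locally_integrable w" by (rule locally_integrable_continuous[OF w])
  obtain K where K: "compact K" "\<And>x. x \<notin> K \<Longrightarrow> \<psi> x = 0" using test_function_support[OF \<psi>] by blast
  define K1 where "K1 = (\<lambda>p. fst p + snd p) ` (K \<times> cball 0 1)"
  have K1: "compact K1" unfolding K1_def by (intro compact_continuous_image compact_Times K continuous_intros) auto
  have "bounded (w ` K1)"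
    using K1 w by (intro compact_imp_bounded compact_continuous_image) (auto intro: continuous_on_subset)
  then obtain C where C: "\<And>x. x \<in> K1 \<Longrightarrow> \<bar>w x\<bar> \<le> C" unfolding bounded_iff by auto
  have inK1: "y \<in> K1" if "x \<in> K" "norm (y - x) \<le> 1" for x y
  proof -
    have "(\<lambda>p. fst p + snd p) (x, y - x) \<in> K1" unfolding K1_def using that by (intro imageI) auto
    then show ?thesis by simp
  qed
  have "(\<lambda>n. LINT x|lborel. \<bar>moll n w x - w x\<bar> * \<bar>\<psi> x\<bar>) \<longlonglongrightarrow> (LINT x|(lborel :: 'a measure). 0)"
  proof (rule integral_dominated_convergence[where w = "\<lambda>x. (C + C) * \<bar>\<psi> x\<bar>"])
    show "integrable lborel (\<lambda>x. (C + C) * \<bar>\<psi> x\<bar>)"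
      by (intro integrable_mult_right integrable_abs test_function_integrable[OF \<psi>])
    show "(\<lambda>x. \<bar>moll n w x - w x\<bar> * \<bar>\<psi> x\<bar>) \<in> borel_measurable lborel" for n
      by (intro borel_measurable_integrable integrable_test_mult_abs \<psi> locally_integrable_diff moll_locally_integrable li)
    have "(\<lambda>n. \<bar>moll n w x - w x\<bar> * \<bar>\<psi> x\<bar>) \<longlonglongrightarrow> \<bar>w x - w x\<bar> * \<bar>\<psi> x\<bar>" for x
      using w by (intro tendsto_intros moll_tendsto li) (simp add: continuous_on_eq_continuous_at)
    then show "AE x in lborel. (\<lambda>n. \<bar>moll n w x - w x\<bar> * \<bar>\<psi> x\<bar>) \<longlonglongrightarrow> 0" by simp
    fix n
    have "norm (\<bar>moll n w x - w x\<bar> * \<bar>\<psi> x\<bar>) \<le> (C + C) * \<bar>\<psi> x\<bar>" for x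
    proof (cases "x \<in> K")
      case True
      have one: "1 / real (Suc n) \<le> 1" by simp
      have "\<bar>moll n w x - 0\<bar> \<le> C"
      proof (rule moll_diff_le[OF li])
        fix y :: 'a assume "norm (y - x) < 1 / real (Suc n)"
        then have "norm (y - x) \<le> 1" using one by linarith
        then show "\<bar>w y - 0\<bar> \<le> C" using C[OF inK1[OF True]] by simp
      qed
      moreover have "\<bar>w x\<bar> \<le> C" using C[OF inK1[OF True, of x]] by simp
      ultimately have "\<bar>moll n w x - w x\<bar> \<le> C + C" by linarith
      then show ?thesis by (simp add: mult_right_mono)
    qed (simp add: K(2))
    then show "AE x in lborel. norm (\<bar>moll n w x - w x\<bar> * \<bar>\<psi> x\<bar>) \<le> (C + C) * \<bar>\<psi> x\<bar>" by simp
  qed simp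
  then show ?thesis by simp
qed

lemma moll_L1_lebesgue:
  fixes h :: "'a::euclidean_space \<Rightarrow> real"
  assumes h: "integrable lborel h" and li: "locally_integrable h"
  shows "integrable lborel (\<lambda>x. \<bar>moll n h x\<bar>)" "(LINT x|lborel. \<bar>moll n h x\<bar>) \<le> (LINT x|lborel. \<bar>h x\<bar>)"
proof -
  have m: "moll n h \<in> borel_measurable borel"
    by (rule borel_measurable_continuous_onI[OF moll_continuous[OF li]])
  have fin: "(\<integral>\<^sup>+x. ennreal \<bar>moll n h x\<bar> \<partial>lborel) \<le> ennreal (LINT x|lborel. \<bar>h x\<bar>)"
    by (rule moll_L1[OF h])
  have i: "integrable lborel (moll n h)"
    using m fin by (intro integrableI_bounded) (auto simp: le_less_trans)
  then show "integrable lborel (\<lambda>x. \<bar>moll n h x\<bar>)" by (rule integrable_abs)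
  have "ennreal (LINT x|lborel. \<bar>moll n h x\<bar>) = (\<integral>\<^sup>+x. ennreal \<bar>moll n h x\<bar> \<partial>lborel)"
    by (rule nn_integral_eq_integral[symmetric]) (use i in auto)
  then have "ennreal (LINT x|lborel. \<bar>moll n h x\<bar>) \<le> ennreal (LINT x|lborel. \<bar>h x\<bar>)" using fin by simp
  then show "(LINT x|lborel. \<bar>moll n h x\<bar>) \<le> (LINT x|lborel. \<bar>h x\<bar>)"
    by (simp add: ennreal_le_iff integral_nonneg_AE)
qed

text \<open>At the origin \<open>w\<close> may be unbounded. A cutoff splits it into a part that is continuous on the whole space
  and a part with small \<open>L\<^sup>1\<close> norm near the origin; mollification keeps the latter small.\<close>

lemma moll_converge:
  fixes w :: "'a::euclidean_space \<Rightarrow> real"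
  assumes w: "locally_integrable w" and c: "continuous_on (- {0}) w" and \<psi>: "test_function \<psi>"
  shows "(\<lambda>n. LINT x|lborel. \<bar>moll n w x - w x\<bar> * \<bar>\<psi> x\<bar>) \<longlonglongrightarrow> 0"
proof (rule LIMSEQ_I)
  fix e :: real assume e: "e > 0"
  obtain C where C: "C > 0" "\<And>x. \<bar>\<psi> x\<bar> \<le> C" using test_function_bounded[OF \<psi>] by blast
  have e': "e / (4 * C) > 0" using e C by simp
  obtain m where m: "\<bar>LINT x|lborel. indicator (cball 0 (1 / real (Suc m))) x * \<bar>w x\<bar>\<bar> < e / (4 * C)"
    using LIMSEQ_D[OF small_balls[OF w] e'] by auto
  define r where "r = 1 / real (Suc m)"
  have r: "r > 0" by (simp add: r_def)
  \<comment> \<open>A continuous cutoff that vanishes on the ball of radius \<open>r / 2\<close> and equals \<open>1\<close> outside the ball of radius \<open>r\<close>.\<close>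
  define \<theta> where "\<theta> x = min 1 (max 0 (2 * norm x / r - 1))" for x :: 'a
  have \<theta>c: "continuous_on UNIV \<theta>" unfolding \<theta>_def[abs_def] using r by (intro continuous_intros) auto
  have \<theta>01: "0 \<le> \<theta> x" "\<theta> x \<le> 1" for x by (simp_all add: \<theta>_def)
  have \<theta>0: "\<theta> x = 0" if "norm x < r / 2" for x using that r by (simp add: \<theta>_def field_simps)
  have \<theta>1: "\<theta> x = 1" if "norm x \<ge> r" for x using that r by (simp add: \<theta>_def field_simps)
  define w1 where "w1 x = \<theta> x * w x" for x
  define w2 where "w2 x = (1 - \<theta> x) * w x" for x
  have li1: "locally_integrable w1" unfolding w1_def[abs_def]
    by (rule locally_integrable_mult[OF w \<theta>c, of 1]) (use \<theta>01 in auto)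
  have li2: "locally_integrable w2" unfolding w2_def[abs_def]
  proof (rule locally_integrable_mult[OF w, of _ 1])
    show "continuous_on UNIV (\<lambda>x. 1 - \<theta> x)" by (intro continuous_intros \<theta>c)
  qed (use \<theta>01 in auto)
  have "isCont w1 x" for x
  proof (cases "x = 0")
    case True
    have "((\<lambda>_. 0) \<longlongrightarrow> 0) (at (0::'a))" by simp
    then have "(w1 \<longlongrightarrow> 0) (at 0)"
    proof (rule Lim_transform_within[where d = "r / 2"])
      show "0 = w1 y" if "0 < dist y 0" "dist y 0 < r / 2" for y
        using \<theta>0[of y] that by (simp add: w1_def)
    qed (use r in simp)
    moreover have "w1 0 = 0" using \<theta>0[of 0] r by (simp add: w1_def)
    ultimately show ?thesis using True by (simp add: isCont_def)
  next
    case False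
    have "isCont w x" using c False by (simp add: continuous_on_eq_continuous_at open_Compl)
    moreover have "isCont \<theta> x" using \<theta>c by (simp add: continuous_on_eq_continuous_at)
    ultimately show ?thesis unfolding w1_def[abs_def] by (intro continuous_intros)
  qed
  then have c1: "continuous_on UNIV w1" by (simp add: continuous_at_imp_continuous_on)
  have w2le: "\<bar>w2 x\<bar> \<le> indicator (cball 0 r) x * \<bar>w x\<bar>" for x
  proof (cases "norm x \<le> r")
    case True
    have "\<bar>1 - \<theta> x\<bar> * \<bar>w x\<bar> \<le> 1 * \<bar>w x\<bar>" using \<theta>01[of x] by (intro mult_right_mono) auto
    then show ?thesis using True by (simp add: w2_def abs_mult)
  next
    case False
    then show ?thesis using \<theta>1[of x] by (simp add: w2_def)
  qed
  have iw: "integrable lborel (\<lambda>x. indicator (cball 0 r) x * \<bar>w x\<bar>)"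
    using integrable_abs[OF locally_integrable_indicator[OF w compact_cball, of 0 r]] by (simp add: abs_mult)
  have i2: "integrable lborel w2"
    by (rule Bochner_Integration.integrable_bound[OF iw])
      (use w2le order_trans in \<open>auto intro!: locally_integrable_measurable[OF li2] simp: abs_mult\<close>)
  have small: "(LINT x|lborel. \<bar>w2 x\<bar>) < e / (4 * C)"
  proof -
    have "(LINT x|lborel. \<bar>w2 x\<bar>) \<le> (LINT x|lborel. indicator (cball 0 r) x * \<bar>w x\<bar>)"
      by (rule integral_mono[OF integrable_abs[OF i2] iw w2le])
    then show ?thesis using m unfolding r_def by linarith
  qed
  obtain N where N: "\<And>n. n \<ge> N \<Longrightarrow> \<bar>LINT x|lborel. \<bar>moll n w1 x - w1 x\<bar> * \<bar>\<psi> x\<bar>\<bar> < e / 2"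
    using LIMSEQ_D[OF moll_converge_continuous[OF c1 \<psi>], of "e / 2"] e by auto
  have "norm ((LINT x|lborel. \<bar>moll n w x - w x\<bar> * \<bar>\<psi> x\<bar>) - 0) < e" if n: "n \<ge> N" for n
  proof -
    have mi: "integrable lborel (\<lambda>x. \<bar>moll n v x - v x\<bar> * \<bar>\<psi> x\<bar>)" if "locally_integrable v" for v
      by (intro integrable_test_mult_abs \<psi> locally_integrable_diff moll_locally_integrable that)
    note L1 = moll_L1_lebesgue[OF i2 li2, of n]
    have i3: "integrable lborel (\<lambda>x. C * (\<bar>moll n w2 x\<bar> + \<bar>w2 x\<bar>))"
      by (intro integrable_mult_right Bochner_Integration.integrable_add L1 integrable_abs i2)
    have split: "moll n w x = moll n w1 x + moll n w2 x" for x
    proof -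
      have "w = (\<lambda>x. w1 x + w2 x)" by (auto simp: w1_def w2_def algebra_simps)
      then show ?thesis using moll_add[OF li1 li2, of n x] by simp
    qed
    have "(LINT x|lborel. \<bar>moll n w x - w x\<bar> * \<bar>\<psi> x\<bar>)
        \<le> (LINT x|lborel. \<bar>moll n w1 x - w1 x\<bar> * \<bar>\<psi> x\<bar> + C * (\<bar>moll n w2 x\<bar> + \<bar>w2 x\<bar>))"
    proof (rule integral_mono[OF mi[OF w] Bochner_Integration.integrable_add[OF mi[OF li1] i3]])
      fix x
      have "w x = w1 x + w2 x" by (simp add: w1_def w2_def algebra_simps)
      then have "\<bar>moll n w x - w x\<bar> \<le> \<bar>moll n w1 x - w1 x\<bar> + (\<bar>moll n w2 x\<bar> + \<bar>w2 x\<bar>)"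
        unfolding split by linarith
      then have "\<bar>moll n w x - w x\<bar> * \<bar>\<psi> x\<bar> \<le> (\<bar>moll n w1 x - w1 x\<bar> + (\<bar>moll n w2 x\<bar> + \<bar>w2 x\<bar>)) * \<bar>\<psi> x\<bar>"
        by (intro mult_right_mono) auto
      also have "\<dots> \<le> \<bar>moll n w1 x - w1 x\<bar> * \<bar>\<psi> x\<bar> + C * (\<bar>moll n w2 x\<bar> + \<bar>w2 x\<bar>)"
      proof -
        have "(\<bar>moll n w2 x\<bar> + \<bar>w2 x\<bar>) * \<bar>\<psi> x\<bar> \<le> (\<bar>moll n w2 x\<bar> + \<bar>w2 x\<bar>) * C"
          using C(2)[of x] by (intro mult_left_mono) auto
        then show ?thesis by (simp add: algebra_simps)
      qed
      finally show "\<bar>moll n w x - w x\<bar> * \<bar>\<psi> x\<bar> \<le> \<bar>moll n w1 x - w1 x\<bar> * \<bar>\<psi> x\<bar> + C * (\<bar>moll n w2 x\<bar> + \<bar>w2 x\<bar>)" .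
    qed
    also have "\<dots> = (LINT x|lborel. \<bar>moll n w1 x - w1 x\<bar> * \<bar>\<psi> x\<bar>) + C * ((LINT x|lborel. \<bar>moll n w2 x\<bar>) + (LINT x|lborel. \<bar>w2 x\<bar>))"
      using Bochner_Integration.integral_add[OF mi[OF li1] i3]
        Bochner_Integration.integral_add[OF L1(1) integrable_abs[OF i2]] by simp
    also have "\<dots> < e / 2 + C * (e / (4 * C) + e / (4 * C))"
    proof (rule add_strict_mono)
      show "(LINT x|lborel. \<bar>moll n w1 x - w1 x\<bar> * \<bar>\<psi> x\<bar>) < e / 2" using N[OF n] by linarith
      show "C * ((LINT x|lborel. \<bar>moll n w2 x\<bar>) + (LINT x|lborel. \<bar>w2 x\<bar>)) < C * (e / (4 * C) + e / (4 * C))"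
        using small L1(2) C(1) by (intro mult_strict_left_mono) linarith+
    qed
    also have "\<dots> = e" using C by (simp add: field_simps)
    finally have "(LINT x|lborel. \<bar>moll n w x - w x\<bar> * \<bar>\<psi> x\<bar>) < e" .
    moreover have "(LINT x|lborel. \<bar>moll n w x - w x\<bar> * \<bar>\<psi> x\<bar>) \<ge> 0" by (intro integral_nonneg_AE) simp
    ultimately show ?thesis by simp
  qed
  then show "\<exists>N. \<forall>n\<ge>N. norm ((LINT x|lborel. \<bar>moll n w x - w x\<bar> * \<bar>\<psi> x\<bar>) - 0) < e" by blast
qed

text \<open>Both derivatives are moved to the kernel, which as a function of the integration variable is a test
  function; testing the equation with it gives the mollified right-hand side.\<close>

lemma moll_weak_laplacian:
  fixes w :: "'a::euclidean_space \<Rightarrow> real"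
  assumes w: "locally_integrable w" and eq: "laplace_eq_dirac w g 0"
  obtains w1 w2 where
    "\<And>b. b \<in> Basis \<Longrightarrow> has_dderiv (moll n w) b (w1 b)"
    "\<And>b. b \<in> Basis \<Longrightarrow> has_dderiv (w1 b) b (w2 b)"
    "\<And>b. b \<in> Basis \<Longrightarrow> continuous_on UNIV (w1 b)"
    "\<And>b. b \<in> Basis \<Longrightarrow> continuous_on UNIV (w2 b)"
    "\<And>x. (\<Sum>b\<in>Basis. w2 b x) = moll n g x"
proof -
  let ?k = "kernel n :: 'a \<Rightarrow> real"
  have k: "test_function ?k" by (rule test_function_kernel)
  define p where "p b z = frechet_derivative ?k (at z) b" for b z
  define q where "q b z = frechet_derivative (p b) (at z) b" for b z
  have p: "test_function (p b)" if "b \<in> Basis" for b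
    unfolding p_def using test_function_frechet[OF k that] .
  have q: "test_function (q b)" if "b \<in> Basis" for b
    unfolding q_def using test_function_frechet[OF p[OF that] that] .
  define w1 where "w1 b x = (LINT y|lborel. w y * (- 1 * p b (1 *\<^sub>R (y - x))))" for b x
  define w2 where "w2 b x = (LINT y|lborel. w y * q b (1 *\<^sub>R (y - x)))" for b x
  have w1: "w1 b x = - 1 * (LINT y|lborel. w y * p b (1 *\<^sub>R (y - x)))" for b x
    unfolding w1_def by simp
  show ?thesis
  proof (rule that)
    fix b :: 'a assume b: "b \<in> Basis"
    show "has_dderiv (moll n w) b (w1 b)"
      using conv_dderiv[OF w k _ b, of 1] unfolding moll_def[abs_def] w1_def[abs_def] p_def by simp
    have d: "has_dderiv (\<lambda>x. LINT y|lborel. w y * p b (1 *\<^sub>R (y - x))) b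
        (\<lambda>x. LINT y|lborel. w y * (- 1 * q b (1 *\<^sub>R (y - x))))"
      using conv_dderiv[OF w p[OF b] _ b, of 1] unfolding q_def by simp
    show "has_dderiv (w1 b) b (w2 b)"
      unfolding has_dderiv_def
    proof
      fix x
      have "((\<lambda>t. - 1 * (LINT y|lborel. w y * p b (1 *\<^sub>R (y - (x + t *\<^sub>R b))))) has_real_derivative
          - 1 * (LINT y|lborel. w y * (- 1 * q b (1 *\<^sub>R (y - x))))) (at 0)"
        using d unfolding has_dderiv_def by (intro DERIV_cmult) blast
      then show "((\<lambda>t. w1 b (x + t *\<^sub>R b)) has_real_derivative w2 b x) (at 0)"
        unfolding w1 w2_def by simp
    qed
    show "continuous_on UNIV (w1 b)"
      unfolding w1 by (intro continuous_on_mult_left conv_continuous[OF w p[OF b]]) simp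
    show "continuous_on UNIV (w2 b)"
      unfolding w2_def by (intro conv_continuous[OF w q[OF b]]) simp
  next
    fix x :: 'a
    have t: "test_function (\<lambda>y. 1 * ?k (1 *\<^sub>R (y - x)))" by (rule test_function_scale[OF k]) simp
    have "(\<Sum>b\<in>Basis. w2 b x) = (LINT y|lborel. (\<Sum>b\<in>Basis. w y * q b (1 *\<^sub>R (y - x))))"
      unfolding w2_def by (rule Bochner_Integration.integral_sum[symmetric]) (intro conv_integrable[OF w q], auto)
    also have "\<dots> = (LINT y|lborel. w y * laplacian (\<lambda>y. 1 * ?k (1 *\<^sub>R (y - x))) y)"
      unfolding laplacian_scale[OF k] unfolding laplacian_def q_def p_def[abs_def] by (simp add: sum_distrib_left)
    also have "\<dots> = (LINT y|lborel. g y * (1 * ?k (1 *\<^sub>R (y - x))))"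
      using eq t unfolding laplace_eq_dirac_def by simp
    finally show "(\<Sum>b\<in>Basis. w2 b x) = moll n g x" by (simp add: moll_def)
  qed
qed

section \<open>Radial initial value problems with a singular origin\<close>

lemma integral_deriv_half_line:
  fixes G :: "real \<Rightarrow> 'a::banach"
  assumes c: "continuous_on {0..} G"
  shows "r > 0 \<Longrightarrow> ((\<lambda>u. integral {0..u} G) has_vector_derivative G r) (at r)"
    and "continuous_on {0..} (\<lambda>u. integral {0..u} G)"
proof -
  have c': "continuous_on {0..a} G" for a
    using c by (rule continuous_on_subset) auto
  show "((\<lambda>u. integral {0..u} G) has_vector_derivative G r) (at r)" if "r > 0"
  proof -
    have "((\<lambda>u. integral {0..u} G) has_vector_derivative G r) (at r within {0..r+1})"
      using that by (intro integral_has_vector_derivative c') auto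
    moreover have "at r within {0..r+1} = at r"
      using that by (intro at_within_interior) auto
    ultimately show ?thesis by simp
  qed
  show "continuous_on {0..} (\<lambda>u. integral {0..u} G)"
    unfolding continuous_on_eq_continuous_within
  proof
    fix x :: real assume x: "x \<in> {0..}"
    have "continuous_on {0..x+1} (\<lambda>u. integral {0..u} G)"
      by (intro indefinite_integral_continuous_1 integrable_continuous_real c')
    then have "continuous (at x within {0..x+1}) (\<lambda>u. integral {0..u} G)"
      using x by (auto simp: continuous_on_eq_continuous_within)
    moreover have "at x within {0..} = at x within {0..x+1}"
      by (rule at_within_nhd[of _ "{..<x+1}"]) auto
    ultimately show "continuous (at x within {0..}) (\<lambda>u. integral {0..u} G)"
      by simp
  qed
qed

lemma norm_integral_le_diff:
  fixes G :: "real \<Rightarrow> 'a::banach"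
  assumes c: "continuous_on {0..} G" and t: "0 \<le> t"
    and d: "\<And>s. s \<in> {0..t} \<Longrightarrow> (g has_real_derivative g' s) (at s)"
    and le: "\<And>s. s \<in> {0..t} \<Longrightarrow> norm (G s) \<le> g' s"
  shows "norm (integral {0..t} G) \<le> g t - g 0"
proof -
  have I: "(g' has_integral (g t - g 0)) {0..t}"
    using t d
    by (intro fundamental_theorem_of_calculus)
      (auto simp: has_real_derivative_iff_has_vector_derivative intro: has_vector_derivative_at_within)
  have "norm (integral {0..t} G) \<le> integral {0..t} g'"
  proof (rule Henstock_Kurzweil_Integration.integral_norm_bound_integral)
    show "G integrable_on {0..t}"
      by (intro integrable_continuous_real continuous_on_subset[OF c]) auto
  qed (use I le in auto)
  then show ?thesis using I by (simp add: integral_unique)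
qed

text \<open>The system \<open>v' = y / r\<close>, \<open>y' = r * F r v\<close>, that is \<open>v'' + v' / r = F r v\<close>, for a bounded right-hand side
  that is Lipschitz in \<open>v\<close>.\<close>

locale radial_rhs =
  fixes F :: "real \<Rightarrow> 'a::banach \<Rightarrow> 'a" and L B :: real
  assumes cont: "continuous_on UNIV (\<lambda>p. F (fst p) (snd p))"
    and lip: "norm (F r v - F r w) \<le> L * norm (v - w)"
    and bd: "norm (F r v) \<le> B"
    and L0: "L \<ge> 0"
begin

text \<open>The quantity \<open>r * v'\<close>, up to the factor \<open>2 \<pi>\<close> the flux of the gradient through the circle of radius \<open>r\<close>.
  It vanishes quadratically at the origin (lemma \<open>norm_flux\<close>), so that the integrand \<open>flux v t / t\<close> below is
  continuous there.\<close>

definition flux :: "(real \<Rightarrow> 'a) \<Rightarrow> real \<Rightarrow> 'a"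
  where "flux v t = integral {0..t} (\<lambda>s. s *\<^sub>R F s (v s))"

definition sol_map :: "'a \<Rightarrow> (real \<Rightarrow> 'a) \<Rightarrow> real \<Rightarrow> 'a"
  where "sol_map s v r = s + integral {0..r} (\<lambda>t. (1 / t) *\<^sub>R flux v t)"

lemma B0: "B \<ge> 0"
  using bd[of 0 0] norm_ge_zero order_trans by blast

lemma cont_rhs:
  assumes "continuous_on {0..} v"
  shows "continuous_on {0..} (\<lambda>s. s *\<^sub>R F s (v s))"
proof -
  have "continuous_on {0..} (\<lambda>s. F (fst (s, v s)) (snd (s, v s)))"
    by (rule continuous_on_compose2[OF cont]) (auto intro!: continuous_intros assms)
  then show ?thesis by (auto intro!: continuous_intros)
qed

lemma norm_flux: "norm (flux v t) \<le> B * t\<^sup>2 / 2" if v: "continuous_on {0..} v" and t: "t \<ge> 0" for v t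
proof -
  have "norm (integral {0..t} (\<lambda>s. s *\<^sub>R F s (v s))) \<le> B * t\<^sup>2 / 2 - B * 0\<^sup>2 / 2"
  proof (rule norm_integral_le_diff[OF cont_rhs[OF v] t])
    show "((\<lambda>s. B * s\<^sup>2 / 2) has_real_derivative B * s) (at s)" for s
      by (auto intro!: derivative_eq_intros)
    show "norm (s *\<^sub>R F s (v s)) \<le> B * s" if "s \<in> {0..t}" for s
      using that bd[of s "v s"] by (simp add: mult.commute[of B] mult_left_mono)
  qed
  then show ?thesis by (simp add: flux_def)
qed

lemma flux_deriv:
  assumes v: "continuous_on {0..} v"
  shows "r > 0 \<Longrightarrow> (flux v has_vector_derivative r *\<^sub>R F r (v r)) (at r)"
    and "continuous_on {0..} (flux v)"
  unfolding flux_def[abs_def] using integral_deriv_half_line[OF cont_rhs[OF v]] by auto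

lemma norm_slope: "norm ((1 / t) *\<^sub>R flux v t) \<le> B * t / 2" if v: "continuous_on {0..} v" and t: "t \<ge> 0" for v t
proof (cases "t = 0")
  case False
  have "norm (flux v t) / t \<le> (B * t\<^sup>2 / 2) / t"
    using norm_flux[OF v, of t] t by (intro divide_right_mono) auto
  also have "\<dots> = B * t / 2" using False by (simp add: power2_eq_square)
  finally show ?thesis using t False by simp
qed auto

lemma cont_slope:
  assumes v: "continuous_on {0..} v"
  shows "continuous_on {0..} (\<lambda>t. (1 / t) *\<^sub>R flux v t)"
  unfolding continuous_on_eq_continuous_within
proof
  fix x :: real assume x: "x \<in> {0..}"
  show "continuous (at x within {0..}) (\<lambda>t. (1 / t) *\<^sub>R flux v t)"
  proof (cases "x = 0")
    case False
    have "continuous (at x within {0..}) (flux v)"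
      using flux_deriv(2)[OF v] x by (auto simp: continuous_on_eq_continuous_within)
    then show ?thesis using False
      by (intro continuous_intros) auto
  next
    case True
    have "((\<lambda>t. (1 / t) *\<^sub>R flux v t) \<longlongrightarrow> 0) (at 0 within {0..})"
    proof (rule tendsto_0_le[where K = 1])
      show "((\<lambda>t. B * t / 2) \<longlongrightarrow> 0) (at 0 within {0..})"
        by (auto intro!: tendsto_eq_intros)
      have "norm ((1 / t) *\<^sub>R flux v t) \<le> norm (B * t / 2) * 1" if "t \<in> {0..}" for t
        using norm_slope[OF v, of t] that B0 by simp
      then show "\<forall>\<^sub>F t in at 0 within {0..}. norm ((1 / t) *\<^sub>R flux v t) \<le> norm (B * t / 2) * 1"
        by (auto simp: eventually_at_filter)
    qed
    then show ?thesis using True by (simp add: continuous_within)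
  qed
qed

lemma sol_map_deriv:
  assumes v: "continuous_on {0..} v"
  shows "r > 0 \<Longrightarrow> (sol_map s v has_vector_derivative (1 / r) *\<^sub>R flux v r) (at r)"
    and "continuous_on {0..} (sol_map s v)" and "sol_map s v 0 = s"
proof -
  show "(sol_map s v has_vector_derivative (1 / r) *\<^sub>R flux v r) (at r)" if "r > 0"
    unfolding sol_map_def[abs_def]
    using has_vector_derivative_add[OF has_vector_derivative_const integral_deriv_half_line(1)[OF cont_slope[OF v] that]]
    by simp
  show "continuous_on {0..} (sol_map s v)"
    unfolding sol_map_def[abs_def]
    by (intro continuous_intros integral_deriv_half_line(2)[OF cont_slope[OF v]])
  show "sol_map s v 0 = s" by (simp add: sol_map_def)
qed

lemma norm_sol_map: "norm (sol_map s v r) \<le> norm s + B * r\<^sup>2 / 4"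
  if v: "continuous_on {0..} v" and r: "r \<ge> 0" for s v r
proof -
  have "norm (integral {0..r} (\<lambda>t. (1 / t) *\<^sub>R flux v t)) \<le> B * r\<^sup>2 / 4 - B * 0\<^sup>2 / 4"
  proof (rule norm_integral_le_diff[OF cont_slope[OF v] r])
    show "((\<lambda>s. B * s\<^sup>2 / 4) has_real_derivative B * s / 2) (at s)" for s
      by (auto intro!: derivative_eq_intros)
  qed (use norm_slope[OF v] in auto)
  then show ?thesis unfolding sol_map_def
    by (intro norm_triangle_le) simp
qed

definition rate :: real where "rate = 1 + L"

text \<open>In the supremum norm weighted by \<open>exp (- rate * r)\<close> the solution map halves distances: it integrates
  twice, each integration gains a factor \<open>1 / rate\<close>, and \<open>2 * L \<le> rate\<^sup>2\<close>.\<close>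

lemma sol_map_contract:
  assumes v: "continuous_on {0..} v" and w: "continuous_on {0..} w"
    and le: "\<And>s. s \<ge> 0 \<Longrightarrow> norm (v s - w s) \<le> \<delta> * exp (rate * s)" and r: "r \<ge> 0"
  shows "norm (sol_map a v r - sol_map a w r) \<le> \<delta> / 2 * exp (rate * r)"
proof -
  have k: "rate > 0" "rate \<ge> 1" "2 * L \<le> rate\<^sup>2"
    using L0 by (auto simp: rate_def power2_eq_square algebra_simps)
  have \<delta>: "\<delta> \<ge> 0" using order_trans[OF norm_ge_zero le[of 0]] by simp
  have fl: "norm (flux v t - flux w t) \<le> L * \<delta> * t * exp (rate * t) / rate" if t: "t \<ge> 0" for t
  proof -
    have c: "continuous_on {0..} (\<lambda>s. s *\<^sub>R F s (v s) - s *\<^sub>R F s (w s))"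
      by (intro continuous_intros cont_rhs v w)
    have "norm (integral {0..t} (\<lambda>s. s *\<^sub>R F s (v s) - s *\<^sub>R F s (w s)))
        \<le> L * \<delta> * t * exp (rate * t) / rate - L * \<delta> * t * exp (rate * 0) / rate"
    proof (rule norm_integral_le_diff[OF c t])
      show "((\<lambda>s. L * \<delta> * t * exp (rate * s) / rate) has_real_derivative L * \<delta> * t * exp (rate * s)) (at s)" for s
        using k by (auto intro!: derivative_eq_intros)
      show "norm (s *\<^sub>R F s (v s) - s *\<^sub>R F s (w s)) \<le> L * \<delta> * t * exp (rate * s)" if s: "s \<in> {0..t}" for s
      proof -
        have "norm (s *\<^sub>R F s (v s) - s *\<^sub>R F s (w s)) = s * norm (F s (v s) - F s (w s))"
          using s by (simp add: scaleR_diff_right[symmetric])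
        also have "\<dots> \<le> t * (L * (\<delta> * exp (rate * s)))"
          using s L0 \<delta> le[of s] lip[of s "v s" "w s"]
          by (intro mult_mono order_trans[OF lip] mult_left_mono) auto
        finally show ?thesis by (simp add: mult_ac)
      qed
    qed
    also have "\<dots> \<le> L * \<delta> * t * exp (rate * t) / rate"
      using k L0 \<delta> t by simp
    finally have le': "norm (integral {0..t} (\<lambda>s. s *\<^sub>R F s (v s) - s *\<^sub>R F s (w s)))
        \<le> L * \<delta> * t * exp (rate * t) / rate" .
    have "flux v t - flux w t = integral {0..t} (\<lambda>s. s *\<^sub>R F s (v s) - s *\<^sub>R F s (w s))"
      unfolding flux_def
      by (rule Henstock_Kurzweil_Integration.integral_diff[symmetric])
         (auto intro!: integrable_continuous_real continuous_on_subset[OF cont_rhs[OF v]]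
           continuous_on_subset[OF cont_rhs[OF w]])
    then show ?thesis using le' by simp
  qed
  have c: "continuous_on {0..} (\<lambda>t. (1 / t) *\<^sub>R flux v t - (1 / t) *\<^sub>R flux w t)"
    by (intro continuous_on_diff cont_slope v w)
  have "norm (integral {0..r} (\<lambda>t. (1 / t) *\<^sub>R flux v t - (1 / t) *\<^sub>R flux w t))
      \<le> L * \<delta> * exp (rate * r) / rate\<^sup>2 - L * \<delta> * exp (rate * 0) / rate\<^sup>2"
  proof (rule norm_integral_le_diff[OF c r])
    show "((\<lambda>s. L * \<delta> * exp (rate * s) / rate\<^sup>2) has_real_derivative L * \<delta> * exp (rate * s) / rate) (at s)" for s
      using k by (auto intro!: derivative_eq_intros simp: power2_eq_square)
    show "norm ((1 / t) *\<^sub>R flux v t - (1 / t) *\<^sub>R flux w t) \<le> L * \<delta> * exp (rate * t) / rate" if t: "t \<in> {0..r}" for t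
    proof (cases "t = 0")
      case True
      then show ?thesis using L0 \<delta> k by simp
    next
      case False
      have "norm ((1 / t) *\<^sub>R flux v t - (1 / t) *\<^sub>R flux w t) = norm (flux v t - flux w t) / t"
        using t by (simp add: scaleR_diff_right[symmetric])
      also have "\<dots> \<le> (L * \<delta> * t * exp (rate * t) / rate) / t"
        using fl[of t] t by (intro divide_right_mono) auto
      also have "\<dots> = L * \<delta> * exp (rate * t) / rate" using False by simp
      finally show ?thesis .
    qed
  qed
  also have "\<dots> \<le> L * \<delta> * exp (rate * r) / rate\<^sup>2"
    using L0 \<delta> by simp
  also have "\<dots> = (2 * L / rate\<^sup>2) * (\<delta> / 2 * exp (rate * r))" by simp
  also have "\<dots> \<le> 1 * (\<delta> / 2 * exp (rate * r))"
    using k \<delta> by (intro mult_right_mono) auto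
  finally have le': "norm (integral {0..r} (\<lambda>t. (1 / t) *\<^sub>R flux v t - (1 / t) *\<^sub>R flux w t)) \<le> \<delta> / 2 * exp (rate * r)"
    by simp
  have "sol_map a v r - sol_map a w r = integral {0..r} (\<lambda>t. (1 / t) *\<^sub>R flux v t - (1 / t) *\<^sub>R flux w t)"
    unfolding sol_map_def
    by (subst Henstock_Kurzweil_Integration.integral_diff)
       (auto intro!: integrable_continuous_real continuous_on_subset[OF cont_slope[OF v]]
         continuous_on_subset[OF cont_slope[OF w]])
  then show ?thesis using le' by simp
qed

text \<open>Bounded continuous functions on the real line stand for the functions \<open>exp (- rate * r) * v r\<close>; freezing
  the argument at \<open>0\<close> for negative \<open>r\<close> makes the solution map total on that Banach space.\<close>

definition unweight :: "(real \<Rightarrow>\<^sub>C 'a) \<Rightarrow> real \<Rightarrow> 'a"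
  where "unweight g r = exp (rate * r) *\<^sub>R apply_bcontfun g r"

definition weighted_map :: "'a \<Rightarrow> (real \<Rightarrow>\<^sub>C 'a) \<Rightarrow> (real \<Rightarrow>\<^sub>C 'a)"
  where "weighted_map s g =
    Bcontfun (\<lambda>r. exp (- rate * max 0 r) *\<^sub>R sol_map s (unweight g) (max 0 r))"

lemma cont_unweight: "continuous_on S (unweight g)"
  unfolding unweight_def[abs_def] by (intro continuous_intros) auto

lemma apply_weighted_map:
  "apply_bcontfun (weighted_map s g) r = exp (- rate * max 0 r) *\<^sub>R sol_map s (unweight g) (max 0 r)"
proof -
  let ?h = "\<lambda>r. exp (- rate * max 0 r) *\<^sub>R sol_map s (unweight g) (max 0 r)"
  have "continuous_on UNIV (\<lambda>r::real. sol_map s (unweight g) (max 0 r))"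
    by (rule continuous_on_compose2[OF sol_map_deriv(2)[OF cont_unweight]])
       (auto intro!: continuous_intros)
  then have c: "continuous_on UNIV ?h"
    by (intro continuous_intros)
  have b: "norm (?h r) \<le> norm s + B" for r
  proof -
    define t where "t = max 0 r"
    have t: "t \<ge> 0" by (simp add: t_def)
    have k: "rate \<ge> 1" using L0 by (simp add: rate_def)
    have e: "exp (rate * t) \<ge> 1 + t\<^sup>2 / 2"
    proof -
      have "1 + t\<^sup>2 / 2 \<le> 1 + t + t\<^sup>2 / 2" using t by simp
      also have "\<dots> \<le> exp t" using exp_lower_Taylor_quadratic[OF t] .
      also have "\<dots> \<le> exp (rate * t)" using k t by (simp add: mult_le_cancel_right1)
      finally show ?thesis .
    qed
    have "norm (?h r) = norm (sol_map s (unweight g) t) / exp (rate * t)"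
      by (simp add: t_def exp_minus divide_inverse mult.commute)
    also have "\<dots> \<le> (norm s + B * t\<^sup>2 / 4) / exp (rate * t)"
      using norm_sol_map[OF cont_unweight t] by (intro divide_right_mono) auto
    also have "\<dots> \<le> norm s + B"
    proof -
      have "norm s + B * t\<^sup>2 / 4 \<le> (norm s + B) * (1 + t\<^sup>2 / 2)"
        using B0 mult_nonneg_nonneg[of B "t\<^sup>2"] mult_nonneg_nonneg[of "norm s" "t\<^sup>2"]
        by (simp add: field_simps)
      also have "\<dots> \<le> (norm s + B) * exp (rate * t)"
        using e B0 by (intro mult_left_mono) auto
      finally show ?thesis by (simp add: field_simps)
    qed
    finally show ?thesis .
  qed
  have "?h \<in> bcontfun" using c b by (rule bcontfun_normI)
  then show ?thesis
    unfolding weighted_map_def by (simp only: Bcontfun_inverse)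
qed

lemma dist_weighted_map:
  "dist (weighted_map s g) (weighted_map s h) \<le> 1 / 2 * dist g h"
  "dist (weighted_map s g) (weighted_map t g) \<le> norm (s - t)"
proof -
  have k: "rate > 0" using L0 by (simp add: rate_def)
  show "dist (weighted_map s g) (weighted_map s h) \<le> 1 / 2 * dist g h"
  proof (rule dist_bound)
    fix r :: real
    define x where "x = max 0 r"
    have "norm (unweight g y - unweight h y) \<le> dist g h * exp (rate * y)" for y
      using dist_bounded[of g y h]
      by (simp add: unweight_def scaleR_diff_right[symmetric] dist_norm mult.commute)
    then have "norm (sol_map s (unweight g) x - sol_map s (unweight h) x) \<le> dist g h / 2 * exp (rate * x)"
      by (intro sol_map_contract cont_unweight) (auto simp: x_def)
    then have "exp (- rate * x) * norm (sol_map s (unweight g) x - sol_map s (unweight h) x)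
        \<le> exp (- rate * x) * (dist g h / 2 * exp (rate * x))"
      by (intro mult_left_mono) auto
    also have "\<dots> = dist g h / 2" by (simp add: exp_minus)
    finally show "dist (apply_bcontfun (weighted_map s g) r) (apply_bcontfun (weighted_map s h) r) \<le> 1 / 2 * dist g h"
      unfolding apply_weighted_map x_def[symmetric] by (simp add: dist_norm scaleR_diff_right[symmetric])
  qed
  show "dist (weighted_map s g) (weighted_map t g) \<le> norm (s - t)"
  proof (rule dist_bound)
    fix r :: real
    have "dist (apply_bcontfun (weighted_map s g) r) (apply_bcontfun (weighted_map t g) r)
        = exp (- rate * max 0 r) * norm (s - t)"
      unfolding apply_weighted_map sol_map_def by (simp add: dist_norm scaleR_diff_right[symmetric])
    also have "\<dots> \<le> 1 * norm (s - t)"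
      using k by (intro mult_right_mono) auto
    finally show "dist (apply_bcontfun (weighted_map s g) r) (apply_bcontfun (weighted_map t g) r) \<le> norm (s - t)"
      by simp
  qed
qed

text \<open>The fixed points of the weighted solution map. A fixed point depends on the initial value with at most
  twice the Lipschitz constant of the map in that value, because the contraction factor is \<open>1 / 2\<close>.\<close>

theorem radial_ivp:
  obtains V Y :: "'a \<Rightarrow> real \<Rightarrow> 'a" where
    "\<And>s. V s 0 = s" "\<And>s. continuous_on {0..} (V s)"
    "\<And>s. Y s 0 = 0" "\<And>s. continuous_on {0..} (Y s)"
    "\<And>s r. r > 0 \<Longrightarrow> (V s has_vector_derivative (1 / r) *\<^sub>R Y s r) (at r)"
    "\<And>s r. r > 0 \<Longrightarrow> (Y s has_vector_derivative r *\<^sub>R F r (V s r)) (at r)"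
    "\<And>s r. r \<ge> 0 \<Longrightarrow> norm (Y s r) \<le> B * r\<^sup>2 / 2"
    "\<And>s t r. r \<ge> 0 \<Longrightarrow> norm (V s r - V t r) \<le> 2 * exp (rate * r) * norm (s - t)"
proof -
  have "\<exists>g. weighted_map s g = g" for s
    using banach_fix_type[of "1/2" "weighted_map s"] dist_weighted_map(1)[of s] by auto
  then obtain g where g: "\<And>s. weighted_map s (g s) = g s" by metis
  define V where "V s = unweight (g s)" for s
  define Y where "Y s = flux (V s)" for s
  have cV: "continuous_on S (V s)" for S s unfolding V_def by (rule cont_unweight)
  have fix_eq: "V s r = sol_map s (V s) r" if "r \<ge> 0" for s r
  proof -
    have "V s r = exp (rate * r) *\<^sub>R apply_bcontfun (weighted_map s (g s)) r"
      by (simp add: V_def unweight_def g)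
    also have "\<dots> = sol_map s (V s) r"
      using that by (simp only: apply_weighted_map V_def) (simp add: exp_minus)
    finally show ?thesis .
  qed
  show ?thesis
  proof (rule that[of V Y])
    show "V s 0 = s" for s using fix_eq[of 0 s] sol_map_deriv(3)[OF cV] by simp
    show "continuous_on {0..} (V s)" for s by (rule cV)
    show "Y s 0 = 0" for s by (simp add: Y_def flux_def)
    show "continuous_on {0..} (Y s)" for s unfolding Y_def by (rule flux_deriv(2)[OF cV])
    show "(V s has_vector_derivative (1 / r) *\<^sub>R Y s r) (at r)" if r: "r > 0" for s r
    proof (rule has_vector_derivative_transform_within_open)
      show "(sol_map s (V s) has_vector_derivative (1 / r) *\<^sub>R Y s r) (at r)"
        unfolding Y_def by (rule sol_map_deriv(1)[OF cV r])
      show "sol_map s (V s) x = V s x" if "x \<in> {0<..}" for x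
        using that fix_eq[of x s] by simp
    qed (use r in auto)
    show "(Y s has_vector_derivative r *\<^sub>R F r (V s r)) (at r)" if "r > 0" for s r
      unfolding Y_def by (rule flux_deriv(1)[OF cV that])
    show "norm (Y s r) \<le> B * r\<^sup>2 / 2" if "r \<ge> 0" for s r
      unfolding Y_def by (rule norm_flux[OF cV that])
    show "norm (V s r - V t r) \<le> 2 * exp (rate * r) * norm (s - t)" if "r \<ge> 0" for s t r
    proof -
      have "dist (g s) (g t) \<le> dist (weighted_map s (g s)) (weighted_map s (g t))
          + dist (weighted_map s (g t)) (weighted_map t (g t))"
        using dist_triangle[of "weighted_map s (g s)" "weighted_map t (g t)" "weighted_map s (g t)"]
        by (simp add: g)
      also have "\<dots> \<le> 1 / 2 * dist (g s) (g t) + norm (s - t)"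
        by (intro add_mono dist_weighted_map)
      finally have d: "dist (g s) (g t) \<le> 2 * norm (s - t)" by simp
      have "norm (V s r - V t r) = exp (rate * r) * dist (apply_bcontfun (g s) r) (apply_bcontfun (g t) r)"
        by (simp add: V_def unweight_def scaleR_diff_right[symmetric] dist_norm)
      also have "\<dots> \<le> exp (rate * r) * (2 * norm (s - t))"
        using dist_bounded[of "g s" r "g t"] d by (intro mult_left_mono) auto
      finally show ?thesis by simp
    qed
  qed
qed

end

section \<open>The symmetrised system\<close>

text \<open>The matrix with rows \<open>(\<alpha>, \<beta>)\<close> and \<open>(\<alpha> - 1 / 2, \<beta> + 1 / 2)\<close> has the eigenvalues \<open>\<alpha> + \<beta>\<close> and \<open>1 / 2\<close>.
  The number \<open>d\<close> is the weight of the second component that symmetrises it; for the vortex equations it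
  equals \<open>N - 1\<close>.\<close>

locale vortex_system =
  fixes \<alpha> \<beta> d :: real and n1 n2 :: nat
  assumes a0: "\<alpha> > 0" and b0: "\<beta> > 0" and d1: "d \<ge> 1"
    and sym: "d * \<alpha> = \<beta> + d / 2"
    and n1: "n1 > 0" and n2: "n2 > 0"
begin

definition rhs1 :: "real \<Rightarrow> real \<Rightarrow> real" where "rhs1 a b = \<alpha> * a + \<beta> * b"
definition rhs2 :: "real \<Rightarrow> real \<Rightarrow> real" where "rhs2 a b = (\<alpha> - 1 / 2) * a + (\<beta> + 1 / 2) * b"

text \<open>The form that turns the matrix into a multiple of the diagonal matrix with entries \<open>1\<close> and \<open>d\<close>, see
  \<open>bil_rhs\<close>.\<close>

definition bil :: "real \<Rightarrow> real \<Rightarrow> real \<Rightarrow> real \<Rightarrow> real"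
  where "bil x1 x2 y1 y2 = \<beta> * (x1 - x2) * (y1 - y2) + x1 * y1 / 2 + d * x2 * y2 / 2"

definition qf :: "real \<Rightarrow> real \<Rightarrow> real" where "qf x1 x2 = bil x1 x2 x1 x2"

lemma qf_eq: "qf x1 x2 = \<beta> * (x1 - x2)\<^sup>2 + x1\<^sup>2 / 2 + d * x2\<^sup>2 / 2"
  by (simp add: qf_def bil_def power2_eq_square)

lemma bil_sym: "bil x1 x2 y1 y2 = bil y1 y2 x1 x2"
  by (simp add: bil_def mult.commute mult.left_commute)

lemma bil_divide: "bil x1 x2 (y1 / r) (y2 / r) = bil x1 x2 y1 y2 / r"
  by (simp add: bil_def diff_divide_distrib add_divide_distrib right_diff_distrib)

text \<open>The key algebraic identity: the coupling disappears, and what remains is a sum over the two components, in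
  which the monotonicity of the exponential can be used.\<close>

lemma bil_rhs: "bil w1 w2 (rhs1 a b) (rhs2 a b) = (\<alpha> + \<beta>) / 2 * (w1 * a + d * (w2 * b))"
proof -
  have "bil w1 w2 (rhs1 a b) (rhs2 a b) = \<beta> * (w1 - w2) * (a - b) / 2
      + w1 * (\<alpha> * a + \<beta> * b) / 2 + w2 * ((d * \<alpha> - d / 2) * a + (d * \<beta> + d / 2) * b) / 2"
    unfolding bil_def rhs1_def rhs2_def by (simp add: field_simps)
  also have "d * \<alpha> - d / 2 = \<beta>" using sym by simp
  also have "d * \<beta> + d / 2 = d * (\<alpha> + \<beta>) - \<beta>" using sym by (simp add: algebra_simps)
  also have "\<beta> * (w1 - w2) * (a - b) / 2 + w1 * (\<alpha> * a + \<beta> * b) / 2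
      + w2 * (\<beta> * a + (d * (\<alpha> + \<beta>) - \<beta>) * b) / 2 = (\<alpha> + \<beta>) / 2 * (w1 * a + d * (w2 * b))"
    by (simp add: field_simps)
  finally show ?thesis .
qed

lemma qf_nonneg: "qf x1 x2 \<ge> 0"
  unfolding qf_eq using b0 d1 by simp

lemma abs_le_qf:
  assumes "qf x1 x2 \<le> S\<^sup>2" "S \<ge> 0"
  shows "\<bar>x1\<bar> \<le> 2 * S" "\<bar>x2\<bar> \<le> 2 * S"
proof -
  have "d * x2\<^sup>2 \<ge> x2\<^sup>2" using d1 by (simp add: mult_le_cancel_right1)
  moreover have "\<beta> * (x1 - x2)\<^sup>2 \<ge> 0" using b0 by simp
  ultimately have "x1\<^sup>2 + x2\<^sup>2 \<le> 2 * S\<^sup>2" using assms(1) unfolding qf_eq by linarith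
  moreover have "2 * S\<^sup>2 \<le> (2 * S)\<^sup>2" by (simp add: power_mult_distrib)
  moreover have "x1\<^sup>2 \<ge> 0" "x2\<^sup>2 \<ge> 0" by simp_all
  ultimately have "\<bar>x1\<bar>\<^sup>2 \<le> (2 * S)\<^sup>2" "\<bar>x2\<bar>\<^sup>2 \<le> (2 * S)\<^sup>2"
    unfolding power2_abs by linarith+
  then show "\<bar>x1\<bar> \<le> 2 * S" "\<bar>x2\<bar> \<le> 2 * S"
    using power2_le_imp_le[of "\<bar>x1\<bar>" "2 * S"] power2_le_imp_le[of "\<bar>x2\<bar>" "2 * S"] assms(2) by auto
qed

definition qbound :: real where "qbound = \<beta> + (1 + d) / 2"

lemma qf_le: "qf x1 x2 \<le> qbound * (\<bar>x1\<bar> + \<bar>x2\<bar>)\<^sup>2"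
proof -
  let ?k = "(\<bar>x1\<bar> + \<bar>x2\<bar>)\<^sup>2"
  have "\<bar>x1 - x2\<bar>\<^sup>2 \<le> ?k" "\<bar>x1\<bar>\<^sup>2 \<le> ?k" "\<bar>x2\<bar>\<^sup>2 \<le> ?k" by (intro power_mono; simp)+
  then have "\<beta> * (x1 - x2)\<^sup>2 \<le> \<beta> * ?k" "x1\<^sup>2 \<le> ?k" "d * x2\<^sup>2 \<le> d * ?k"
    using b0 d1 by (auto intro!: mult_left_mono)
  moreover have "qbound * ?k = \<beta> * ?k + ?k / 2 + d * ?k / 2"
    unfolding qbound_def by (simp add: field_simps)
  ultimately show ?thesis unfolding qf_eq by linarith
qed

text \<open>The constant \<open>\<alpha> + \<beta>\<close> is the one that appears in \<open>bil_DERIV\<close>; the comparison turns the energy identity into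
  the differential inequality \<open>\<psi>'' + \<psi>' / r \<ge> \<psi>\<close> for small solutions. It holds because
  \<open>d * (x1 - x2)\<^sup>2\<close> and \<open>(x1 + d * x2)\<^sup>2\<close> add up to \<open>(1 + d) * (x1\<^sup>2 + d * x2\<^sup>2)\<close>.\<close>

lemma qf_le_weighted: "qf x1 x2 \<le> (\<alpha> + \<beta>) * (x1\<^sup>2 + d * x2\<^sup>2)"
proof -
  have "d * (x1 - x2)\<^sup>2 + (x1 + d * x2)\<^sup>2 = (1 + d) * (x1\<^sup>2 + d * x2\<^sup>2)"
    by (simp add: power2_eq_square algebra_simps)
  then have "d * (x1 - x2)\<^sup>2 \<le> (1 + d) * (x1\<^sup>2 + d * x2\<^sup>2)"
    using zero_le_power2[of "x1 + d * x2"] by linarith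
  then have "\<beta> * (d * (x1 - x2)\<^sup>2) \<le> \<beta> * ((1 + d) * (x1\<^sup>2 + d * x2\<^sup>2))"
    using b0 by (intro mult_left_mono) auto
  also have "\<dots> = (d * (\<alpha> + \<beta>) - d / 2) * (x1\<^sup>2 + d * x2\<^sup>2)"
    using sym by (simp add: algebra_simps)
  finally have "d * (\<beta> * (x1 - x2)\<^sup>2) \<le> (d * (\<alpha> + \<beta>) - d / 2) * (x1\<^sup>2 + d * x2\<^sup>2)"
    by (simp only: mult.left_commute)
  moreover have "(d * (\<alpha> + \<beta>) - d / 2) * (x1\<^sup>2 + d * x2\<^sup>2)
      = d * ((\<alpha> + \<beta>) * (x1\<^sup>2 + d * x2\<^sup>2)) - d * ((x1\<^sup>2 + d * x2\<^sup>2) / 2)"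
    by (simp add: left_diff_distrib mult.assoc)
  ultimately have "d * (\<beta> * (x1 - x2)\<^sup>2 + (x1\<^sup>2 + d * x2\<^sup>2) / 2) \<le> d * ((\<alpha> + \<beta>) * (x1\<^sup>2 + d * x2\<^sup>2))"
    unfolding distrib_left[of d] by linarith
  then have "\<beta> * (x1 - x2)\<^sup>2 + (x1\<^sup>2 + d * x2\<^sup>2) / 2 \<le> (\<alpha> + \<beta>) * (x1\<^sup>2 + d * x2\<^sup>2)"
    using d1 by simp
  then show ?thesis unfolding qf_eq by (simp add: field_simps)
qed

lemma bil_cauchy: "(bil x1 x2 y1 y2)\<^sup>2 \<le> qf x1 x2 * qf y1 y2"
proof -
  have "qf x1 x2 * qf y1 y2 - (bil x1 x2 y1 y2)\<^sup>2
      = (\<beta> / 2 + d / 4 + \<beta> * d / 2) * (x1 * y2 - x2 * y1)\<^sup>2"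
    unfolding qf_def bil_def by (simp add: power2_eq_square field_simps)
  moreover have "\<dots> \<ge> 0" using b0 d1 by simp
  ultimately show ?thesis by linarith
qed

text \<open>The energy identity behind all estimates: along a solution of the linear relations below,
  \<open>r\<close> times the derivative of the quadratic form is \<open>2 bil w y\<close>, whose own derivative is the
  sum of a square and of a term of definite sign for a monotone nonlinearity.\<close>

lemma qf_DERIV:
  assumes "(w1 has_real_derivative y1 r / r) (at r)" "(w2 has_real_derivative y2 r / r) (at r)"
  shows "((\<lambda>r. qf (w1 r) (w2 r)) has_real_derivative 2 * bil (w1 r) (w2 r) (y1 r) (y2 r) / r) (at r)"
proof -
  have "((\<lambda>r. qf (w1 r) (w2 r)) has_real_derivative 2 * bil (w1 r) (w2 r) p1 p2) (at r)"
    if "(w1 has_real_derivative p1) (at r)" "(w2 has_real_derivative p2) (at r)" for p1 p2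
    unfolding qf_eq bil_def
    by (auto intro!: derivative_eq_intros that simp: algebra_simps)
  from this[OF assms] show ?thesis by (simp add: bil_divide)
qed

lemma bil_DERIV:
  assumes "(w1 has_real_derivative y1 r / r) (at r)" "(w2 has_real_derivative y2 r / r) (at r)"
    and "(y1 has_real_derivative r * rhs1 a b) (at r)" "(y2 has_real_derivative r * rhs2 a b) (at r)"
  shows "((\<lambda>r. 2 * bil (w1 r) (w2 r) (y1 r) (y2 r)) has_real_derivative
      2 * qf (y1 r) (y2 r) / r + r * ((\<alpha> + \<beta>) * (w1 r * a + d * (w2 r * b)))) (at r)"
proof -
  have "((\<lambda>r. 2 * bil (w1 r) (w2 r) (y1 r) (y2 r)) has_real_derivative
      2 * (bil p1 p2 (y1 r) (y2 r) + bil (w1 r) (w2 r) g1 g2)) (at r)"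
    if "(w1 has_real_derivative p1) (at r)" "(w2 has_real_derivative p2) (at r)"
      "(y1 has_real_derivative g1) (at r)" "(y2 has_real_derivative g2) (at r)" for p1 p2 g1 g2
    unfolding bil_def
    by (auto intro!: derivative_eq_intros that simp: algebra_simps)
  from this[OF assms]
  have "((\<lambda>r. 2 * bil (w1 r) (w2 r) (y1 r) (y2 r)) has_real_derivative
      2 * (bil (y1 r / r) (y2 r / r) (y1 r) (y2 r) + bil (w1 r) (w2 r) (r * rhs1 a b) (r * rhs2 a b))) (at r)" .
  moreover have "bil (w1 r) (w2 r) (r * rhs1 a b) (r * rhs2 a b) = r * bil (w1 r) (w2 r) (rhs1 a b) (rhs2 a b)"
    by (simp add: bil_def algebra_simps)
  moreover have "bil (y1 r / r) (y2 r / r) (y1 r) (y2 r) = qf (y1 r) (y2 r) / r"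
    by (simp only: bil_sym[of "y1 r / r"] bil_divide qf_def)
  moreover have "2 * (qf (y1 r) (y2 r) / r + r * ((\<alpha> + \<beta>) / 2 * (w1 r * a + d * (w2 r * b))))
      = 2 * qf (y1 r) (y2 r) / r + r * ((\<alpha> + \<beta>) * (w1 r * a + d * (w2 r * b)))"
    by (simp add: field_simps)
  ultimately show ?thesis
    by (simp only: bil_rhs)
qed

lemma bil_DERIV_ge:
  assumes "(w1 has_real_derivative y1 r / r) (at r)" "(w2 has_real_derivative y2 r / r) (at r)"
    and "(y1 has_real_derivative r * rhs1 a b) (at r)" "(y2 has_real_derivative r * rhs2 a b) (at r)"
    and r: "r > 0" and c: "c \<le> w1 r * a + d * (w2 r * b)"
  obtains D where "((\<lambda>r. 2 * bil (w1 r) (w2 r) (y1 r) (y2 r)) has_real_derivative D) (at r)"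
    "r * ((\<alpha> + \<beta>) * c) \<le> D"
proof (rule that[OF bil_DERIV[OF assms(1-4)]])
  have "r * ((\<alpha> + \<beta>) * c) \<le> r * ((\<alpha> + \<beta>) * (w1 r * a + d * (w2 r * b)))"
    using r c a0 b0 by (intro mult_left_mono) auto
  moreover have "2 * qf (y1 r) (y2 r) / r \<ge> 0" using qf_nonneg r by simp
  ultimately show "r * ((\<alpha> + \<beta>) * c) \<le> 2 * qf (y1 r) (y2 r) / r + r * ((\<alpha> + \<beta>) * (w1 r * a + d * (w2 r * b)))"
    by linarith
qed

section \<open>The truncated radial problem\<close>

text \<open>Truncating the exponential at height \<open>E\<close> makes the nonlinearity Lipschitz; the factor \<open>c\<close>
  is the weight \<open>r ^ (4 n)\<close> left over when the logarithm is split off from the unknown.\<close>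

definition trunc :: "real \<Rightarrow> real \<Rightarrow> real \<Rightarrow> real"
  where "trunc E c x = min (c * exp (2 * x)) E"

lemma trunc_mono: "c \<ge> 0 \<Longrightarrow> x \<le> y \<Longrightarrow> trunc E c x \<le> trunc E c y"
  unfolding trunc_def by (intro min.mono mult_left_mono) auto

lemma trunc_monotone: "c \<ge> 0 \<Longrightarrow> (x - y) * (trunc E c x - trunc E c y) \<ge> 0"
  using trunc_mono[of c x y E] trunc_mono[of c y x E]
  by (cases "x \<le> y") (auto intro: mult_nonneg_nonneg mult_nonpos_nonpos)

text \<open>For \<open>x \<le> y\<close> the value at \<open>x\<close> is at least \<open>exp (- 2 (y - x))\<close> times the value at \<open>y\<close>, and values are
  bounded by \<open>E\<close>.\<close>

lemma trunc_lipschitz: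
  assumes c: "c \<ge> 0" and E: "E \<ge> 0"
  shows "\<bar>trunc E c x - trunc E c y\<bar> \<le> 2 * E * \<bar>x - y\<bar>"
proof -
  have *: "trunc E c y - trunc E c x \<le> 2 * E * (y - x)" if xy: "x \<le> y" for x y
  proof -
    let ?e = "exp (- (2 * (y - x)))" and ?m = "trunc E c y"
    have m: "0 \<le> ?m" "?m \<le> E" "?m \<le> c * exp (2 * y)" using c E by (auto simp: trunc_def)
    have e: "1 - 2 * (y - x) \<le> ?e" using exp_ge_add_one_self[of "- (2 * (y - x))"] by linarith
    have e1: "?e \<le> 1" using xy by simp
    have "?e * ?m \<le> ?e * (c * exp (2 * y))" using m by (intro mult_left_mono) auto
    also have "\<dots> = c * exp (2 * x)" by (simp add: exp_diff exp_minus algebra_simps)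
    finally have "?e * ?m \<le> c * exp (2 * x)" .
    moreover have "?e * ?m \<le> E" using m e1 mult_mono[of ?e 1 ?m E] by simp
    ultimately have "?e * ?m \<le> trunc E c x" by (simp add: trunc_def)
    then have "?m - trunc E c x \<le> (1 - ?e) * ?m" by (simp add: algebra_simps)
    also have "\<dots> \<le> (2 * (y - x)) * E" using m e e1 xy by (intro mult_mono) auto
    finally show ?thesis by (simp add: mult_ac)
  qed
  show ?thesis
    using *[of x y] *[of y x] trunc_mono[OF c, of x y E] trunc_mono[OF c, of y x E]
    by (cases "x \<le> y") auto
qed

lemma trunc_bounds: "c \<ge> 0 \<Longrightarrow> E \<ge> 0 \<Longrightarrow> 0 \<le> trunc E c x \<and> trunc E c x \<le> E"
  by (simp add: trunc_def)

lemma exp_gap: "1 - exp (- (2 * x)) \<ge> min x (1 / 2)" if x: "x \<ge> 0" for x :: real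
proof -
  have e: "exp (- (2 * y)) \<le> 1 - y" if y: "0 \<le> y" "y \<le> 1 / 2" for y :: real
  proof -
    have "1 \<le> (1 - y) * (1 + 2 * y)" using y mult_nonneg_nonneg[of y "1 - 2 * y"] by (simp add: algebra_simps)
    also have "\<dots> \<le> (1 - y) * exp (2 * y)"
      using y exp_ge_add_one_self[of "2 * y"] by (intro mult_left_mono) auto
    finally show ?thesis by (simp add: exp_minus field_simps)
  qed
  show ?thesis
  proof (cases "x \<le> 1 / 2")
    case True then show ?thesis using e[of x] x by simp
  next
    case False
    then have "exp (- (2 * x)) \<le> exp (- (2 * (1 / 2)))" by simp
    also have "\<dots> \<le> 1 / 2" using e[of "1 / 2"] by simp
    finally show ?thesis using False by simp
  qed
qed

text \<open>The lower bound is uniform in the truncation height \<open>E\<close>, which is what makes the a priori bound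
  independent of it. It is quadratic near zero, as needed for the decay, and linear at infinity.\<close>

lemma trunc_coercive:
  assumes E: "E \<ge> 2"
  shows "x * (trunc E 1 x - 1) \<ge> \<bar>x\<bar> * min \<bar>x\<bar> (1 / 2)"
proof (cases "x \<ge> 0")
  case True
  have "exp (2 * x) \<ge> 1 + 2 * x" by (rule exp_ge_add_one_self)
  then have "trunc E 1 x - 1 \<ge> min x (1 / 2)"
    using E True unfolding trunc_def by linarith
  then show ?thesis using True by (simp add: mult_left_mono)
next
  case False
  have "exp (2 * x) \<le> 1" using False by simp
  then have "trunc E 1 x = exp (2 * x)" using E unfolding trunc_def by linarith
  then have "1 - trunc E 1 x \<ge> min (- x) (1 / 2)" using exp_gap[of "- x"] False by simp
  then have "(- x) * (1 - trunc E 1 x) \<ge> (- x) * min (- x) (1 / 2)"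
    using False by (intro mult_left_mono) auto
  then show ?thesis using False by (simp add: algebra_simps)
qed

lemma abs_min_nonneg: "\<bar>x\<bar> * min \<bar>x\<bar> (1 / 2) \<ge> (0::real)" by simp

lemma abs_min_linear: "\<bar>x\<bar> * min \<bar>x\<bar> (1 / 2) \<ge> \<bar>x\<bar> / 2 - (1::real)"
proof (cases "\<bar>x\<bar> \<le> 1 / 2")
  case True
  then show ?thesis using abs_min_nonneg[of x] by linarith
qed auto

text \<open>The absolute value of \<open>r\<close> only serves to have a bounded continuous right-hand side for all real \<open>r\<close>.\<close>

definition trunc_rhs :: "real \<Rightarrow> real \<Rightarrow> real \<times> real \<Rightarrow> real \<times> real"
  where "trunc_rhs E r v =
    (let a = trunc E (\<bar>r\<bar> ^ (4 * n1)) (fst v) - 1; b = trunc E (\<bar>r\<bar> ^ (4 * n2)) (snd v) - 1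
     in (rhs1 a b, rhs2 a b))"

definition rhs_size :: real where "rhs_size = 2 * (\<alpha> + \<beta> + 1)"

lemma norm_rhs: "norm (rhs1 a b, rhs2 a b) \<le> rhs_size * (\<bar>a\<bar> + \<bar>b\<bar>)"
proof -
  have *: "\<bar>x * a + y * b\<bar> \<le> (\<alpha> + \<beta> + 1) * (\<bar>a\<bar> + \<bar>b\<bar>)"
    if "\<bar>x\<bar> \<le> \<alpha> + \<beta> + 1" "\<bar>y\<bar> \<le> \<alpha> + \<beta> + 1" for x y
  proof -
    have "\<bar>x * a + y * b\<bar> \<le> \<bar>x\<bar> * \<bar>a\<bar> + \<bar>y\<bar> * \<bar>b\<bar>"
      by (metis abs_mult abs_triangle_ineq)
    also have "\<dots> \<le> (\<alpha> + \<beta> + 1) * \<bar>a\<bar> + (\<alpha> + \<beta> + 1) * \<bar>b\<bar>"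
      using that by (intro add_mono mult_right_mono) auto
    finally show ?thesis by (simp add: algebra_simps)
  qed
  have "norm (rhs1 a b, rhs2 a b) \<le> \<bar>rhs1 a b\<bar> + \<bar>rhs2 a b\<bar>"
    using norm_Pair_le[of "rhs1 a b" "rhs2 a b"] by simp
  also have "\<dots> \<le> (\<alpha> + \<beta> + 1) * (\<bar>a\<bar> + \<bar>b\<bar>) + (\<alpha> + \<beta> + 1) * (\<bar>a\<bar> + \<bar>b\<bar>)"
    unfolding rhs1_def rhs2_def using a0 b0 by (intro add_mono *) auto
  finally show ?thesis by (simp add: rhs_size_def algebra_simps)
qed

lemma radial_rhs_trunc:
  assumes E: "E \<ge> 1"
  shows "radial_rhs (trunc_rhs E) (rhs_size * (4 * E)) (rhs_size * (2 * E))"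
proof
  have s0: "rhs_size \<ge> 0" using a0 b0 by (simp add: rhs_size_def)
  show "continuous_on UNIV (\<lambda>p. trunc_rhs E (fst p) (snd p))"
    unfolding trunc_rhs_def Let_def rhs1_def rhs2_def trunc_def
    by (intro continuous_intros)
  show "norm (trunc_rhs E r v - trunc_rhs E r w) \<le> rhs_size * (4 * E) * norm (v - w)" for r v w
  proof -
    let ?a = "trunc E (\<bar>r\<bar> ^ (4 * n1)) (fst v) - trunc E (\<bar>r\<bar> ^ (4 * n1)) (fst w)"
    let ?b = "trunc E (\<bar>r\<bar> ^ (4 * n2)) (snd v) - trunc E (\<bar>r\<bar> ^ (4 * n2)) (snd w)"
    have "trunc_rhs E r v - trunc_rhs E r w = (rhs1 ?a ?b, rhs2 ?a ?b)"
      by (simp add: trunc_rhs_def Let_def rhs1_def rhs2_def algebra_simps diff_divide_distrib)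
    then have le: "norm (trunc_rhs E r v - trunc_rhs E r w) \<le> rhs_size * (\<bar>?a\<bar> + \<bar>?b\<bar>)"
      using norm_rhs by metis
    have "\<bar>?a\<bar> + \<bar>?b\<bar> \<le> 2 * E * norm (v - w) + 2 * E * norm (v - w)"
    proof (intro add_mono)
      have "\<bar>fst v - fst w\<bar> \<le> norm (v - w)" "\<bar>snd v - snd w\<bar> \<le> norm (v - w)"
        using norm_fst_le[of "fst (v - w)" "snd (v - w)"] norm_snd_le[of "snd (v - w)" "fst (v - w)"]
        unfolding prod.collapse by simp_all
      then show "\<bar>?a\<bar> \<le> 2 * E * norm (v - w)" "\<bar>?b\<bar> \<le> 2 * E * norm (v - w)"
        using E by (auto intro!: order_trans[OF trunc_lipschitz] mult_left_mono)
    qed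
    from order_trans[OF le mult_left_mono[OF this s0]] show ?thesis
      by (simp add: algebra_simps)
  qed
  show "norm (trunc_rhs E r v) \<le> rhs_size * (2 * E)" for r v
  proof -
    have "\<bar>trunc E (\<bar>r\<bar> ^ (4 * n1)) (fst v) - 1\<bar> \<le> E" "\<bar>trunc E (\<bar>r\<bar> ^ (4 * n2)) (snd v) - 1\<bar> \<le> E"
      using trunc_bounds[of "\<bar>r\<bar> ^ (4 * n1)" E "fst v"] trunc_bounds[of "\<bar>r\<bar> ^ (4 * n2)" E "snd v"] E
      by auto
    then show ?thesis unfolding trunc_rhs_def Let_def
      using s0 by (intro order_trans[OF norm_rhs] mult_left_mono) auto
  qed
  show "0 \<le> rhs_size * (4 * E)" using s0 E by simp
qed

text \<open>The regular part \<open>v\<close> and its flux \<open>y = r * v'\<close>; the associated vortex profile is \<open>v r + 2 * n * ln r\<close>.\<close>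

definition trunc_sol :: "real \<Rightarrow> (real \<Rightarrow> real) \<Rightarrow> (real \<Rightarrow> real) \<Rightarrow> (real \<Rightarrow> real) \<Rightarrow> (real \<Rightarrow> real) \<Rightarrow> bool"
  where "trunc_sol E v1 v2 y1 y2 \<longleftrightarrow>
    continuous_on {0..} v1 \<and> continuous_on {0..} v2 \<and> continuous_on {0..} y1 \<and> continuous_on {0..} y2 \<and>
    y1 0 = 0 \<and> y2 0 = 0 \<and>
    (\<forall>r>0. (v1 has_real_derivative y1 r / r) (at r) \<and> (v2 has_real_derivative y2 r / r) (at r) \<and>
      (y1 has_real_derivative r * rhs1 (trunc E (r ^ (4 * n1)) (v1 r) - 1) (trunc E (r ^ (4 * n2)) (v2 r) - 1)) (at r) \<and>
      (y2 has_real_derivative r * rhs2 (trunc E (r ^ (4 * n1)) (v1 r) - 1) (trunc E (r ^ (4 * n2)) (v2 r) - 1)) (at r))"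

lemma trunc_sol_family:
  assumes E: "E \<ge> 1"
  obtains v1 v2 y1 y2 :: "real \<times> real \<Rightarrow> real \<Rightarrow> real" and K k :: real where
    "\<And>s. v1 s 0 = fst s" "\<And>s. v2 s 0 = snd s"
    "\<And>s. trunc_sol E (v1 s) (v2 s) (y1 s) (y2 s)"
    "\<And>s r. r \<ge> 0 \<Longrightarrow> \<bar>y1 s r\<bar> \<le> K * r\<^sup>2" "\<And>s r. r \<ge> 0 \<Longrightarrow> \<bar>y2 s r\<bar> \<le> K * r\<^sup>2"
    "\<And>s t r. r \<ge> 0 \<Longrightarrow> norm ((v1 s r, v2 s r) - (v1 t r, v2 t r)) \<le> 2 * exp (k * r) * norm (s - t)"
proof -
  interpret radial_rhs "trunc_rhs E" "rhs_size * (4 * E)" "rhs_size * (2 * E)"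
    using E by (rule radial_rhs_trunc)
  show ?thesis
  proof (rule radial_ivp)
    fix V Y :: "real \<times> real \<Rightarrow> real \<Rightarrow> real \<times> real"
    assume h: "\<And>s. V s 0 = s" "\<And>s. continuous_on {0..} (V s)"
      "\<And>s. Y s 0 = 0" "\<And>s. continuous_on {0..} (Y s)"
      "\<And>s r. r > 0 \<Longrightarrow> (V s has_vector_derivative (1 / r) *\<^sub>R Y s r) (at r)"
      "\<And>s r. r > 0 \<Longrightarrow> (Y s has_vector_derivative r *\<^sub>R trunc_rhs E r (V s r)) (at r)"
      "\<And>s r. r \<ge> 0 \<Longrightarrow> norm (Y s r) \<le> rhs_size * (2 * E) * r\<^sup>2 / 2"
      "\<And>s t r. r \<ge> 0 \<Longrightarrow> norm (V s r - V t r) \<le> 2 * exp (rate * r) * norm (s - t)"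
    show thesis
    proof (rule that[of "\<lambda>s r. fst (V s r)" "\<lambda>s r. snd (V s r)" "\<lambda>s r. fst (Y s r)" "\<lambda>s r. snd (Y s r)"
          "rhs_size * E" rate])
      show "trunc_sol E (\<lambda>r. fst (V s r)) (\<lambda>r. snd (V s r)) (\<lambda>r. fst (Y s r)) (\<lambda>r. snd (Y s r))" for s
        unfolding trunc_sol_def
      proof (intro conjI allI impI)
        show "continuous_on {0..} (\<lambda>r. fst (V s r))" "continuous_on {0..} (\<lambda>r. snd (V s r))"
          "continuous_on {0..} (\<lambda>r. fst (Y s r))" "continuous_on {0..} (\<lambda>r. snd (Y s r))"
          by (intro continuous_intros h)+
        fix r :: real assume r: "r > 0"
        show "((\<lambda>r. fst (V s r)) has_real_derivative fst (Y s r) / r) (at r)"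
          "((\<lambda>r. snd (V s r)) has_real_derivative snd (Y s r) / r) (at r)"
          using bounded_linear.has_vector_derivative[OF bounded_linear_fst h(5)[OF r]]
            bounded_linear.has_vector_derivative[OF bounded_linear_snd h(5)[OF r]]
          by (simp_all add: has_real_derivative_iff_has_vector_derivative)
        show "((\<lambda>r. fst (Y s r)) has_real_derivative r * rhs1 (trunc E (r ^ (4 * n1)) (fst (V s r)) - 1) (trunc E (r ^ (4 * n2)) (snd (V s r)) - 1)) (at r)"
          "((\<lambda>r. snd (Y s r)) has_real_derivative r * rhs2 (trunc E (r ^ (4 * n1)) (fst (V s r)) - 1) (trunc E (r ^ (4 * n2)) (snd (V s r)) - 1)) (at r)"
          using bounded_linear.has_vector_derivative[OF bounded_linear_fst h(6)[OF r]]
            bounded_linear.has_vector_derivative[OF bounded_linear_snd h(6)[OF r]] r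
          by (simp_all add: has_real_derivative_iff_has_vector_derivative trunc_rhs_def Let_def)
      qed (simp_all add: h)
      show "\<bar>fst (Y s r)\<bar> \<le> rhs_size * E * r\<^sup>2" "\<bar>snd (Y s r)\<bar> \<le> rhs_size * E * r\<^sup>2" if "r \<ge> 0" for s r
        using h(7)[OF that, of s] norm_fst_le[of "fst (Y s r)" "snd (Y s r)"]
          norm_snd_le[of "snd (Y s r)" "fst (Y s r)"] by simp_all
      show "norm ((fst (V s r), snd (V s r)) - (fst (V t r), snd (V t r))) \<le> 2 * exp (rate * r) * norm (s - t)"
        if "r \<ge> 0" for s t r
        using h(8)[OF that, of s t] by (simp only: prod.collapse)
    qed (simp_all add: h)
  qed
qed

section \<open>Shooting\<close>

text \<open>The energy identity integrated. For \<open>c = 0\<close> it says that \<open>r\<close> times the derivative of the quadratic form is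
  nondecreasing; for \<open>c > 0\<close> it grows at least quadratically.\<close>

lemma bil_growth:
  assumes pq: "0 \<le> p" "p \<le> q"
    and cont: "continuous_on {p..q} w1" "continuous_on {p..q} w2" "continuous_on {p..q} y1" "continuous_on {p..q} y2"
    and w: "\<And>r. p < r \<Longrightarrow> r < q \<Longrightarrow> (w1 has_real_derivative y1 r / r) (at r)"
      "\<And>r. p < r \<Longrightarrow> r < q \<Longrightarrow> (w2 has_real_derivative y2 r / r) (at r)"
    and y: "\<And>r. p < r \<Longrightarrow> r < q \<Longrightarrow> (y1 has_real_derivative r * rhs1 (a r) (b r)) (at r)"
      "\<And>r. p < r \<Longrightarrow> r < q \<Longrightarrow> (y2 has_real_derivative r * rhs2 (a r) (b r)) (at r)"
    and c: "\<And>r. p < r \<Longrightarrow> r < q \<Longrightarrow> c \<le> w1 r * a r + d * (w2 r * b r)"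
  shows "2 * bil (w1 p) (w2 p) (y1 p) (y2 p) + (\<alpha> + \<beta>) * c * (q\<^sup>2 - p\<^sup>2) / 2
    \<le> 2 * bil (w1 q) (w2 q) (y1 q) (y2 q)"
proof -
  let ?z = "\<lambda>r. 2 * bil (w1 r) (w2 r) (y1 r) (y2 r) - (\<alpha> + \<beta>) * c * r\<^sup>2 / 2"
  have "?z p \<le> ?z q"
  proof (rule DERIV_nonneg_imp_increasing_open[OF pq(2)])
    show "continuous_on {p..q} ?z"
      unfolding bil_def by (intro continuous_intros cont) auto
    fix r :: real assume r: "p < r" "r < q"
    have r0: "r > 0" using r pq by simp
    obtain D where D: "((\<lambda>r. 2 * bil (w1 r) (w2 r) (y1 r) (y2 r)) has_real_derivative D) (at r)"
      "r * ((\<alpha> + \<beta>) * c) \<le> D"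
      by (rule bil_DERIV_ge[OF w(1)[OF r] w(2)[OF r] y(1)[OF r] y(2)[OF r] r0 c[OF r]])
    have "((\<lambda>r. (\<alpha> + \<beta>) * c * r\<^sup>2 / 2) has_real_derivative (\<alpha> + \<beta>) * c * r) (at r)"
      by (auto intro!: derivative_eq_intros)
    from DERIV_diff[OF D(1) this]
    have "(?z has_real_derivative D - (\<alpha> + \<beta>) * c * r) (at r)" .
    then show "\<exists>y. (?z has_real_derivative y) (at r) \<and> 0 \<le> y"
      using D(2) by (auto simp: mult_ac)
  qed
  then show ?thesis by (simp add: algebra_simps diff_divide_distrib)
qed

lemma qf_growth:
  assumes pq: "0 \<le> p" "p \<le> q"
    and cont: "continuous_on {p..q} w1" "continuous_on {p..q} w2"
    and w: "\<And>r. p < r \<Longrightarrow> r < q \<Longrightarrow> (w1 has_real_derivative y1 r / r) (at r)"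
      "\<And>r. p < r \<Longrightarrow> r < q \<Longrightarrow> (w2 has_real_derivative y2 r / r) (at r)"
    and k: "\<And>r. p < r \<Longrightarrow> r < q \<Longrightarrow> k \<le> 2 * bil (w1 r) (w2 r) (y1 r) (y2 r) / r"
  shows "qf (w1 p) (w2 p) + k * (q - p) \<le> qf (w1 q) (w2 q)"
proof -
  let ?z = "\<lambda>r. qf (w1 r) (w2 r) - k * r"
  have "?z p \<le> ?z q"
  proof (rule DERIV_nonneg_imp_increasing_open[OF pq(2)])
    show "continuous_on {p..q} ?z"
      unfolding qf_def bil_def by (intro continuous_intros cont) auto
    fix r :: real assume r: "p < r" "r < q"
    have "(?z has_real_derivative 2 * bil (w1 r) (w2 r) (y1 r) (y2 r) / r - k) (at r)"
      by (auto intro!: derivative_eq_intros qf_DERIV w r)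
    then show "\<exists>y. (?z has_real_derivative y) (at r) \<and> 0 \<le> y"
      using k[OF r] by (meson diff_ge_0_iff_ge)
  qed
  then show ?thesis by (simp add: algebra_simps)
qed

lemma trunc_sol_props:
  assumes "trunc_sol E v1 v2 y1 y2"
  shows "continuous_on {0..} v1" "continuous_on {0..} v2" "continuous_on {0..} y1" "continuous_on {0..} y2"
    "y1 0 = 0" "y2 0 = 0"
    "\<And>r. r > 0 \<Longrightarrow> (v1 has_real_derivative y1 r / r) (at r)"
    "\<And>r. r > 0 \<Longrightarrow> (v2 has_real_derivative y2 r / r) (at r)"
    "\<And>r. r > 0 \<Longrightarrow> (y1 has_real_derivative r * rhs1 (trunc E (r ^ (4 * n1)) (v1 r) - 1) (trunc E (r ^ (4 * n2)) (v2 r) - 1)) (at r)"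
    "\<And>r. r > 0 \<Longrightarrow> (y2 has_real_derivative r * rhs2 (trunc E (r ^ (4 * n1)) (v1 r) - 1) (trunc E (r ^ (4 * n2)) (v2 r) - 1)) (at r)"
  using assms unfolding trunc_sol_def by blast+

text \<open>For the difference of two solutions the pairing is nonnegative by monotonicity of \<open>trunc\<close>, and the fluxes
  vanish at the origin. Hence \<open>r\<close> times the derivative of the quadratic form of the difference starts at zero
  and never decreases.\<close>

lemma trunc_sol_expansive:
  assumes v: "trunc_sol E v1 v2 y1 y2" and w: "trunc_sol E w1 w2 x1 x2" and r: "r \<ge> 0"
  shows "qf (v1 0 - w1 0) (v2 0 - w2 0) \<le> qf (v1 r - w1 r) (v2 r - w2 r)"
proof -
  note V = trunc_sol_props[OF v] and W = trunc_sol_props[OF w]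
  have c: "continuous_on {0..t} h" if "continuous_on {0..} h" for t and h :: "real \<Rightarrow> real"
    using that by (rule continuous_on_subset) auto
  have z: "0 \<le> 2 * bil (v1 t - w1 t) (v2 t - w2 t) (y1 t - x1 t) (y2 t - x2 t)" if t: "t \<ge> 0" for t
  proof -
    let ?a = "\<lambda>r. trunc E (r ^ (4 * n1)) (v1 r) - trunc E (r ^ (4 * n1)) (w1 r)"
    let ?b = "\<lambda>r. trunc E (r ^ (4 * n2)) (v2 r) - trunc E (r ^ (4 * n2)) (w2 r)"
    have "2 * bil (v1 0 - w1 0) (v2 0 - w2 0) (y1 0 - x1 0) (y2 0 - x2 0) + (\<alpha> + \<beta>) * 0 * (t\<^sup>2 - 0\<^sup>2) / 2
      \<le> 2 * bil (v1 t - w1 t) (v2 t - w2 t) (y1 t - x1 t) (y2 t - x2 t)"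
    proof (rule bil_growth[where ?w1.0 = "\<lambda>r. v1 r - w1 r" and ?w2.0 = "\<lambda>r. v2 r - w2 r"
          and ?y1.0 = "\<lambda>r. y1 r - x1 r" and ?y2.0 = "\<lambda>r. y2 r - x2 r" and a = ?a and b = ?b])
      fix r :: real assume r: "0 < r"
      show "((\<lambda>r. v1 r - w1 r) has_real_derivative (y1 r - x1 r) / r) (at r)"
        "((\<lambda>r. v2 r - w2 r) has_real_derivative (y2 r - x2 r) / r) (at r)"
        using DERIV_diff[OF V(7)[OF r] W(7)[OF r]] DERIV_diff[OF V(8)[OF r] W(8)[OF r]]
        by (simp_all add: diff_divide_distrib)
      show "((\<lambda>r. y1 r - x1 r) has_real_derivative r * rhs1 (?a r) (?b r)) (at r)"
        using DERIV_diff[OF V(9)[OF r] W(9)[OF r]] by (simp add: rhs1_def algebra_simps)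
      show "((\<lambda>r. y2 r - x2 r) has_real_derivative r * rhs2 (?a r) (?b r)) (at r)"
        using DERIV_diff[OF V(10)[OF r] W(10)[OF r]] by (simp add: rhs2_def algebra_simps diff_divide_distrib)
      show "0 \<le> (v1 r - w1 r) * ?a r + d * ((v2 r - w2 r) * ?b r)"
        using r d1 by (intro add_nonneg_nonneg mult_nonneg_nonneg[of d] trunc_monotone) auto
    qed (use t in \<open>auto intro!: continuous_intros c V W\<close>)
    then show ?thesis by (simp add: V W bil_def)
  qed
  have "qf (v1 0 - w1 0) (v2 0 - w2 0) + 0 * (r - 0) \<le> qf (v1 r - w1 r) (v2 r - w2 r)"
  proof (rule qf_growth[where ?w1.0 = "\<lambda>r. v1 r - w1 r" and ?w2.0 = "\<lambda>r. v2 r - w2 r"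
          and ?y1.0 = "\<lambda>r. y1 r - x1 r" and ?y2.0 = "\<lambda>r. y2 r - x2 r"])
    fix r :: real assume r: "0 < r"
    show "((\<lambda>r. v1 r - w1 r) has_real_derivative (y1 r - x1 r) / r) (at r)"
      "((\<lambda>r. v2 r - w2 r) has_real_derivative (y2 r - x2 r) / r) (at r)"
      using DERIV_diff[OF V(7)[OF r] W(7)[OF r]] DERIV_diff[OF V(8)[OF r] W(8)[OF r]]
      by (simp_all add: diff_divide_distrib)
    show "0 \<le> 2 * bil (v1 r - w1 r) (v2 r - w2 r) (y1 r - x1 r) (y2 r - x2 r) / r"
      using z[of r] r by simp
  qed (use r in \<open>auto intro!: continuous_intros c V W\<close>)
  then show ?thesis by simp
qed

end

text \<open>A continuous expansive map has an open image by invariance of domain and a closed image by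
  completeness.\<close>

lemma expansive_imp_surj:
  fixes f :: "'a::euclidean_space \<Rightarrow> 'a"
  assumes c: "continuous_on UNIV f" and k: "k > 0" and e: "\<And>x y. k * dist x y \<le> dist (f x) (f y)"
  shows "surj f"
proof -
  have inj: "inj f"
  proof (rule injI)
    fix x y assume "f x = f y"
    then have "k * dist x y \<le> 0" using e[of x y] by simp
    then show "x = y" using k by (simp add: mult_le_0_iff)
  qed
  have "open (range f)" by (rule invariance_of_domain[OF c open_UNIV inj])
  moreover have "closed (range f)"
    unfolding closed_sequential_limits
  proof (intro allI impI)
    fix y l assume h: "(\<forall>n. y n \<in> range f) \<and> y \<longlonglongrightarrow> l"
    then have "\<forall>n. \<exists>x. y n = f x" by blast
    then obtain x where x: "\<And>n. y n = f (x n)" unfolding choice_iff by blast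
    have "Cauchy x"
    proof (rule metric_CauchyI)
      fix \<epsilon> :: real assume "\<epsilon> > 0"
      then have "k * \<epsilon> > 0" using k by simp
      moreover have "Cauchy y" using h LIMSEQ_imp_Cauchy by blast
      ultimately obtain M where M: "\<And>m n. m \<ge> M \<Longrightarrow> n \<ge> M \<Longrightarrow> dist (y m) (y n) < k * \<epsilon>"
        using metric_CauchyD[of y "k * \<epsilon>"] by blast
      have "dist (x m) (x n) < \<epsilon>" if "m \<ge> M" "n \<ge> M" for m n
      proof -
        have "k * dist (x m) (x n) < k * \<epsilon>" using e[of "x m" "x n"] M[OF that] x by simp
        then show ?thesis using k by simp
      qed
      then show "\<exists>M. \<forall>m\<ge>M. \<forall>n\<ge>M. dist (x m) (x n) < \<epsilon>" by blast
    qed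
    then obtain z where z: "x \<longlonglongrightarrow> z" using Cauchy_convergent_iff convergent_def by blast
    have "isCont f z" using c by (simp add: continuous_on_eq_continuous_at)
    then have "(\<lambda>n. f (x n)) \<longlonglongrightarrow> f z" using z by (rule isCont_tendsto_compose)
    moreover have "(\<lambda>n. f (x n)) = y" using x by (intro ext) simp
    ultimately have "y \<longlonglongrightarrow> f z" by simp
    then have "l = f z" using h LIMSEQ_unique by blast
    then show "l \<in> range f" by simp
  qed
  ultimately show ?thesis
    using clopen[of "range f"] by auto
qed

context vortex_system
begin

lemma trunc_log:
  assumes "r > 0"
  shows "trunc E (r ^ (4 * n)) x = trunc E 1 (x + 2 * real n * ln r)"
proof -
  have "exp (4 * real n * ln r) = r ^ (4 * n)"
    using assms exp_of_nat_mult[of "4 * n" "ln r"] by simp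
  moreover have "2 * (x + 2 * real n * ln r) = 4 * real n * ln r + 2 * x" by simp
  ultimately have "exp (2 * (x + 2 * real n * ln r)) = r ^ (4 * n) * exp (2 * x)"
    by (simp only: exp_add)
  then show ?thesis unfolding trunc_def by simp
qed

text \<open>Adding the logarithm shifts the flux by a constant and removes the weight \<open>r ^ (4 * n)\<close> from the equation.\<close>

lemma trunc_sol_log:
  assumes v: "trunc_sol E v1 v2 y1 y2" and r: "r > 0"
  defines "u1 \<equiv> \<lambda>r. v1 r + 2 * real n1 * ln r" and "u2 \<equiv> \<lambda>r. v2 r + 2 * real n2 * ln r"
  shows "(u1 has_real_derivative (y1 r + 2 * real n1) / r) (at r)"
    "(u2 has_real_derivative (y2 r + 2 * real n2) / r) (at r)"
    "((\<lambda>r. y1 r + 2 * real n1) has_real_derivative r * rhs1 (trunc E 1 (u1 r) - 1) (trunc E 1 (u2 r) - 1)) (at r)"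
    "((\<lambda>r. y2 r + 2 * real n2) has_real_derivative r * rhs2 (trunc E 1 (u1 r) - 1) (trunc E 1 (u2 r) - 1)) (at r)"
proof -
  note V = trunc_sol_props[OF v]
  show "(u1 has_real_derivative (y1 r + 2 * real n1) / r) (at r)"
    "(u2 has_real_derivative (y2 r + 2 * real n2) / r) (at r)"
    unfolding u1_def u2_def using r
    by (auto intro!: derivative_eq_intros V(7,8) simp: field_simps)
  show "((\<lambda>r. y1 r + 2 * real n1) has_real_derivative r * rhs1 (trunc E 1 (u1 r) - 1) (trunc E 1 (u2 r) - 1)) (at r)"
    "((\<lambda>r. y2 r + 2 * real n2) has_real_derivative r * rhs2 (trunc E 1 (u1 r) - 1) (trunc E 1 (u2 r) - 1)) (at r)"
    unfolding u1_def u2_def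
    using DERIV_add[OF V(9)[OF r] DERIV_const] DERIV_add[OF V(10)[OF r] DERIV_const]
    by (simp_all add: trunc_log[OF r])
qed

section \<open>The a priori bound\<close>

text \<open>With \<open>S\<^sup>2\<close> the maximum of the quadratic form, \<open>inner_const * S\<close> bounds the loss of \<open>r * \<psi>'\<close> in the unit disc
  and \<open>jump_const * S\<close> its jump at \<open>r = 1\<close>, where the unknown changes from \<open>v\<close> to \<open>u\<close>. Up to the radius
  \<open>far_radius\<close> the form \<open>\<psi>\<close> itself drops by at most \<open>drop_const * S\<close>; as long as it is at least \<open>S\<^sup>2 / 2\<close>, the absolute
  values of the two components add up to at least \<open>coerc_const * S\<close>. The radius is so large that the growth
  forced by such components outweighs the loss and the jump.\<close>

definition inner_const :: real where "inner_const = (\<alpha> + \<beta>) * (1 + d) * 2"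
definition jump_const :: real where "jump_const = 4 * (4 * \<beta> * (real n1 + real n2) + real n1 + d * real n2)"
definition coerc_const :: real where "coerc_const = 1 / (2 * qbound)"
definition far_radius :: real
  where "far_radius = 2 + 8 * (inner_const + jump_const) / ((\<alpha> + \<beta>) * coerc_const)"
definition drop_const :: real where "drop_const = inner_const + (inner_const + jump_const) * far_radius"
definition size_bound :: real where "size_bound = 2 * drop_const + 4 * (1 + d) / coerc_const"

lemma const_pos: "inner_const > 0" "jump_const > 0" "qbound \<ge> 1" "coerc_const > 0" "far_radius \<ge> 2"
  "drop_const > 0" "size_bound > 0"
proof -
  show i: "inner_const > 0" unfolding inner_const_def using a0 b0 d1 by simp
  show j: "jump_const > 0" unfolding jump_const_def using b0 d1 n1 n2 by (simp add: add_pos_nonneg)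
  have "(1 + d) / 2 \<ge> 1" using d1 by simp
  then show q: "qbound \<ge> 1" unfolding qbound_def using b0 by linarith
  show c: "coerc_const > 0" unfolding coerc_const_def using q by simp
  show f: "far_radius \<ge> 2" unfolding far_radius_def using i j c a0 b0 by simp
  show dr: "drop_const > 0" unfolding drop_const_def using i j f by (simp add: add_pos_nonneg)
  show "size_bound > 0" unfolding size_bound_def using dr c d1 by (simp add: add_pos_nonneg)
qed

text \<open>The quantity \<open>z = r * \<psi>'\<close> is nondecreasing for \<open>r \<ge> 1\<close>, and it is nonpositive up to \<open>R\<close> because \<open>\<psi>\<close> vanishes
  at \<open>R\<close>. At \<open>r = 1\<close> it is at least a negative multiple of \<open>S\<close>, so \<open>\<psi>\<close> stays of the order \<open>S\<^sup>2\<close> on a long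
  interval if \<open>S\<close> is large. There the nonlinearity, which grows at least linearly, drives \<open>z\<close> up by more than
  that multiple of \<open>S\<close> and makes it positive, a contradiction.\<close>

lemma a_priori_bound:
  assumes E: "E \<ge> 2" and v: "trunc_sol E v1 v2 y1 y2" and R: "R > far_radius"
    and zero: "v1 R + 2 * real n1 * ln R = 0" "v2 R + 2 * real n2 * ln R = 0"
  shows "r \<in> {0..R} \<Longrightarrow> qf (v1 r + 2 * real n1 * ln (max 1 r)) (v2 r + 2 * real n2 * ln (max 1 r)) \<le> size_bound\<^sup>2"
proof -
  note V = trunc_sol_props[OF v] and C = const_pos
  have R2: "R > 2" using R C by linarith
  have c: "continuous_on {p..q} h" if "continuous_on {0..} h" "p \<ge> 0" for p q and h :: "real \<Rightarrow> real"
    using that by (auto intro: continuous_on_subset)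
  define u1 where "u1 r = v1 r + 2 * real n1 * ln r" for r
  define u2 where "u2 r = v2 r + 2 * real n2 * ln r" for r
  have U: "(u1 has_real_derivative (y1 r + 2 * real n1) / r) (at r)"
    "(u2 has_real_derivative (y2 r + 2 * real n2) / r) (at r)"
    "((\<lambda>r. y1 r + 2 * real n1) has_real_derivative r * rhs1 (trunc E 1 (u1 r) - 1) (trunc E 1 (u2 r) - 1)) (at r)"
    "((\<lambda>r. y2 r + 2 * real n2) has_real_derivative r * rhs2 (trunc E 1 (u1 r) - 1) (trunc E 1 (u2 r) - 1)) (at r)"
    if "r > 0" for r
    using trunc_sol_log[OF v that] unfolding u1_def[abs_def] u2_def[abs_def] .
  have cu: "continuous_on {p..q} u1" "continuous_on {p..q} u2" if "p > 0" for p q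
    unfolding u1_def[abs_def] u2_def[abs_def] using that by (intro continuous_intros c V(1,2); force)+
  define z where "z r = 2 * bil (u1 r) (u2 r) (y1 r + 2 * real n1) (y2 r + 2 * real n2)" for r
  define \<psi> where "\<psi> r = qf (u1 r) (u2 r)" for r
  have zg: "z p + (\<alpha> + \<beta>) * k * (q\<^sup>2 - p\<^sup>2) / 2 \<le> z q"
    if "0 < p" "p \<le> q" "\<And>r. p < r \<Longrightarrow> r < q \<Longrightarrow> k \<le> u1 r * (trunc E 1 (u1 r) - 1) + d * (u2 r * (trunc E 1 (u2 r) - 1))" for p q k
    unfolding z_def
    by (rule bil_growth[where ?y1.0 = "\<lambda>r. y1 r + 2 * real n1" and ?y2.0 = "\<lambda>r. y2 r + 2 * real n2"
          and a = "\<lambda>r. trunc E 1 (u1 r) - 1" and b = "\<lambda>r. trunc E 1 (u2 r) - 1"])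
       (use that in \<open>auto intro!: continuous_intros cu c V(1-4) U\<close>)
  have coer: "\<bar>x\<bar> * min \<bar>x\<bar> (1 / 2) \<le> x * (trunc E 1 x - 1)" for x
    using trunc_coercive[OF E] .
  have "0 \<le> u1 r * (trunc E 1 (u1 r) - 1) + d * (u2 r * (trunc E 1 (u2 r) - 1))" for r
    using coer[of "u1 r"] coer[of "u2 r"] abs_min_nonneg[of "u1 r"] abs_min_nonneg[of "u2 r"] d1
    by (intro add_nonneg_nonneg mult_nonneg_nonneg[of d]) linarith+
  then have zmono: "z p \<le> z q" if "0 < p" "p \<le> q" for p q
    using zg[of p q 0] that by simp
  have \<psi>g: "\<psi> p + k * (q - p) \<le> \<psi> q" if "0 < p" "p \<le> q" "\<And>r. p < r \<Longrightarrow> r < q \<Longrightarrow> k \<le> z r / r" for p q k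
    unfolding \<psi>_def
    by (rule qf_growth[where ?y1.0 = "\<lambda>r. y1 r + 2 * real n1" and ?y2.0 = "\<lambda>r. y2 r + 2 * real n2"])
       (use that in \<open>auto intro!: cu U simp: z_def\<close>)
  have \<psi>R: "\<psi> R = 0" unfolding \<psi>_def u1_def u2_def zero by (simp add: qf_eq)
  have \<psi>0: "\<psi> r \<ge> 0" for r unfolding \<psi>_def by (rule qf_nonneg)
  \<comment> \<open>A positive slope would persist up to \<open>R\<close>, where the form vanishes.\<close>
  have zneg: "z r \<le> 0" if r: "0 < r" "r < R" for r
  proof (rule ccontr)
    assume "\<not> z r \<le> 0"
    then have zr: "z r > 0" by simp
    have "\<psi> r + z r / R * (R - r) \<le> \<psi> R"
    proof (rule \<psi>g)
      fix t :: real assume t: "r < t" "t < R"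
      have "z r / R \<le> z r / t" using zr t r by (intro divide_left_mono) auto
      also have "\<dots> \<le> z t / t" using zmono[of r t] t r by (intro divide_right_mono) auto
      finally show "z r / R \<le> z t / t" .
    qed (use r in auto)
    moreover have "z r / R * (R - r) > 0" using zr r by simp
    ultimately show False using \<psi>0[of r] \<psi>R by linarith
  qed
  have \<psi>anti: "\<psi> q \<le> \<psi> p" if "0 < p" "p \<le> q" "q \<le> R" for p q
  proof -
    have "- \<psi> p \<le> - \<psi> q"
    proof (rule DERIV_nonneg_imp_increasing_open[OF that(2)])
      show "continuous_on {p..q} (\<lambda>r. - \<psi> r)"
        unfolding \<psi>_def qf_def bil_def using that by (intro continuous_intros cu) auto
      fix r :: real assume r: "p < r" "r < q"
      have "(\<psi> has_real_derivative z r / r) (at r)"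
        unfolding \<psi>_def[abs_def] z_def using r that
        by (intro qf_DERIV[where ?y1.0 = "\<lambda>r. y1 r + 2 * real n1" and ?y2.0 = "\<lambda>r. y2 r + 2 * real n2"] U) auto
      then have "((\<lambda>r. - \<psi> r) has_real_derivative - (z r / r)) (at r)" by (rule DERIV_minus)
      moreover have "z r / r \<le> 0" using zneg[of r] r that by (simp add: divide_nonpos_pos)
      ultimately show "\<exists>y. ((\<lambda>r. - \<psi> r) has_real_derivative y) (at r) \<and> 0 \<le> y"
        by (meson neg_0_le_iff_le)
    qed
    then show ?thesis by simp
  qed
  \<comment> \<open>The unknown to be bounded is \<open>v\<close> in the unit disc, where \<open>u\<close> is singular, and \<open>u\<close> outside.\<close>
  define w1 where "w1 r = v1 r + 2 * real n1 * ln (max 1 r)" for r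
  define w2 where "w2 r = v2 r + 2 * real n2 * ln (max 1 r)" for r
  have w_in: "w1 r = v1 r" "w2 r = v2 r" if "r \<le> 1" for r
    using that by (simp_all add: w1_def w2_def max_def)
  have w_out: "w1 r = u1 r" "w2 r = u2 r" if "r \<ge> 1" for r
    using that by (simp_all add: w1_def w2_def u1_def u2_def max_def)
  have "continuous_on {0..R} (\<lambda>r. qf (w1 r) (w2 r))"
    unfolding qf_def bil_def w1_def w2_def by (intro continuous_intros c V(1-4)) auto
  then obtain x where x: "x \<in> {0..R}" and max: "\<And>r. r \<in> {0..R} \<Longrightarrow> qf (w1 r) (w2 r) \<le> qf (w1 x) (w2 x)"
    using continuous_attains_sup[of "{0..R}" "\<lambda>r. qf (w1 r) (w2 r)"] R2 by auto
  define S where "S = sqrt (qf (w1 x) (w2 x))"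
  have S: "S \<ge> 0" "S\<^sup>2 = qf (w1 x) (w2 x)" by (simp_all add: S_def qf_nonneg)
  have w_le: "\<bar>w1 r\<bar> \<le> 2 * S" "\<bar>w2 r\<bar> \<le> 2 * S" if "r \<in> {0..R}" for r
    using abs_le_qf[of "w1 r" "w2 r" S] max[OF that] S by auto
  \<comment> \<open>Inside the unit disc the form decreases at most linearly in \<open>S\<close>.\<close>
  have z0: "- (inner_const * S * r) \<le> 2 * bil (v1 r) (v2 r) (y1 r) (y2 r) \<and> - (inner_const * S) \<le> 2 * bil (v1 r) (v2 r) (y1 r) (y2 r) / r"
    if r: "0 < r" "r \<le> 1" for r
  proof -
    have g: "2 * bil (v1 0) (v2 0) (y1 0) (y2 0) + (\<alpha> + \<beta>) * (- ((1 + d) * (2 * S))) * (r\<^sup>2 - 0\<^sup>2) / 2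
      \<le> 2 * bil (v1 r) (v2 r) (y1 r) (y2 r)"
    proof (rule bil_growth[where a = "\<lambda>r. trunc E (r ^ (4 * n1)) (v1 r) - 1" and b = "\<lambda>r. trunc E (r ^ (4 * n2)) (v2 r) - 1"])
      fix t :: real assume t: "0 < t" "t < r"
      \<comment> \<open>For \<open>y < 0\<close> the weight \<open>t ^ (4 * n) \<le> 1\<close> keeps the nonlinearity nonpositive.\<close>
      have key: "- (2 * S) \<le> y * (trunc E (t ^ (4 * n)) y - 1)" if y: "\<bar>y\<bar> \<le> 2 * S" for y and n :: nat
      proof (cases "y \<ge> 0")
        case True
        have "y * (trunc E (t ^ (4 * n)) y - 1) \<ge> y * (- 1)"
          using True trunc_bounds[of "t ^ (4 * n)" E y] t E by (intro mult_left_mono) auto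
        then show ?thesis using y by simp
      next
        case False
        have "t ^ (4 * n) * exp (2 * y) \<le> 1 * 1"
          using t r False by (intro mult_mono power_le_one) auto
        then have "trunc E (t ^ (4 * n)) y \<le> 1" by (simp add: trunc_def)
        then have "y * (trunc E (t ^ (4 * n)) y - 1) \<ge> 0" using False by (simp add: mult_nonpos_nonpos)
        then show ?thesis using S by linarith
      qed
      have "\<bar>v1 t\<bar> \<le> 2 * S" "\<bar>v2 t\<bar> \<le> 2 * S" using w_le[of t] w_in[of t] t r R2 by auto
      then have "d * (- (2 * S)) \<le> d * (v2 t * (trunc E (t ^ (4 * n2)) (v2 t) - 1))"
        "- (2 * S) \<le> v1 t * (trunc E (t ^ (4 * n1)) (v1 t) - 1)"
        using d1 key[of "v1 t" n1] key[of "v2 t" n2] by (auto simp only: intro!: mult_left_mono)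
      then show "- ((1 + d) * (2 * S)) \<le> v1 t * (trunc E (t ^ (4 * n1)) (v1 t) - 1) + d * (v2 t * (trunc E (t ^ (4 * n2)) (v2 t) - 1))"
        by (simp add: algebra_simps)
    qed (use r in \<open>auto intro!: c V(1-4) V(7-10)\<close>)
    have "bil (v1 0) (v2 0) (y1 0) (y2 0) = 0" by (simp add: V bil_def)
    then have g: "- (inner_const * S * (r\<^sup>2 / 2)) \<le> 2 * bil (v1 r) (v2 r) (y1 r) (y2 r)"
    proof -
      have "inner_const * S * (r\<^sup>2 / 2) = - ((\<alpha> + \<beta>) * (- ((1 + d) * (2 * S))) * (r\<^sup>2 - 0\<^sup>2) / 2)"
        by (simp add: inner_const_def field_simps)
      then show ?thesis using g \<open>bil (v1 0) (v2 0) (y1 0) (y2 0) = 0\<close> by linarith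
    qed
    have "r\<^sup>2 / 2 \<le> r" using r by (simp add: power2_eq_square)
    then have "inner_const * S * (r\<^sup>2 / 2) \<le> inner_const * S * r" using S C by (intro mult_left_mono) auto
    then have "- (inner_const * S * r) \<le> 2 * bil (v1 r) (v2 r) (y1 r) (y2 r)" using g by linarith
    then show ?thesis using r by (simp add: field_simps)
  qed
  have in1: "qf (v1 r) (v2 r) - inner_const * S \<le> \<psi> 1" if r: "r \<in> {0..1}" for r
  proof -
    have "qf (v1 r) (v2 r) + (- (inner_const * S)) * (1 - r) \<le> qf (v1 1) (v2 1)"
      using r z0 by (intro qf_growth[of _ _ _ _ y1 y2]) (auto intro!: c V(1-4) V(7,8))
    moreover have "inner_const * S * (1 - r) \<le> inner_const * S * 1" using r S C by (intro mult_left_mono) auto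
    ultimately show ?thesis by (simp add: \<psi>_def u1_def u2_def)
  qed
  have M1: "S\<^sup>2 - inner_const * S \<le> \<psi> 1"
  proof (cases "x \<le> 1")
    case True
    then show ?thesis using in1[of x] x S w_in[of x] by simp
  next
    case False
    then have "S\<^sup>2 \<le> \<psi> 1" using \<psi>anti[of 1 x] x S w_out[of x] by (simp add: \<psi>_def)
    moreover have "inner_const * S \<ge> 0" using C S by simp
    ultimately show ?thesis by linarith
  qed
  have v1: "\<bar>v1 1\<bar> \<le> 2 * S" "\<bar>v2 1\<bar> \<le> 2 * S" using w_le[of 1] w_in[of 1] R2 by auto
  have z1: "- ((inner_const + jump_const) * S) \<le> z 1"
  proof -
    have "z 1 = 2 * bil (v1 1) (v2 1) (y1 1) (y2 1) + 2 * bil (v1 1) (v2 1) (2 * real n1) (2 * real n2)"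
      by (simp add: z_def u1_def u2_def bil_def add_divide_distrib algebra_simps)
    moreover have "\<bar>2 * bil (v1 1) (v2 1) (2 * real n1) (2 * real n2)\<bar> \<le> jump_const * S"
    proof -
      have 1: "\<bar>(v1 1 - v2 1) * (real n1 - real n2)\<bar> \<le> (4 * S) * (real n1 + real n2)"
        unfolding abs_mult using v1 S by (intro mult_mono) auto
      have 2: "\<bar>v1 1 * real n1\<bar> \<le> 2 * S * real n1" "\<bar>v2 1 * real n2\<bar> \<le> 2 * S * real n2"
        unfolding abs_mult using v1 by (auto intro!: mult_right_mono)
      have "2 * bil (v1 1) (v2 1) (2 * real n1) (2 * real n2)
          = 4 * (\<beta> * ((v1 1 - v2 1) * (real n1 - real n2))) + 2 * (v1 1 * real n1) + 2 * (d * (v2 1 * real n2))"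
        by (simp add: bil_def field_simps)
      moreover have "\<bar>\<beta> * ((v1 1 - v2 1) * (real n1 - real n2))\<bar> \<le> \<beta> * ((4 * S) * (real n1 + real n2))"
        unfolding abs_mult[of \<beta>] using 1 b0 by (simp add: mult_left_mono)
      moreover have "\<bar>d * (v2 1 * real n2)\<bar> \<le> d * (2 * S * real n2)"
        unfolding abs_mult[of d] using 2 d1 by (simp add: mult_left_mono)
      moreover have "jump_const * S = 4 * (\<beta> * ((4 * S) * (real n1 + real n2))) + 2 * (2 * S * real n1) + 2 * (d * (2 * S * real n2))"
        by (simp add: jump_const_def algebra_simps)
      ultimately show ?thesis using 2 by linarith
    qed
    moreover have "- (inner_const * S) \<le> 2 * bil (v1 1) (v2 1) (y1 1) (y2 1)" using z0[of 1] by simp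
    ultimately show ?thesis by (simp add: algebra_simps abs_le_iff)
  qed
  have far: "S\<^sup>2 - drop_const * S \<le> \<psi> r" if r: "1 \<le> r" "r \<le> far_radius" for r
  proof -
    have "\<psi> 1 + (- ((inner_const + jump_const) * S)) * (r - 1) \<le> \<psi> r"
    proof (rule \<psi>g)
      fix t :: real assume t: "1 < t"
      have "(inner_const + jump_const) * S * 1 \<le> (inner_const + jump_const) * S * t"
        using t C S by (intro mult_left_mono) auto
      moreover have "z 1 \<le> z t" using zmono[of 1 t] t by simp
      ultimately have "- ((inner_const + jump_const) * S * t) \<le> z t"
        using z1 unfolding mult_1_right by linarith
      then show "- ((inner_const + jump_const) * S) \<le> z t / t" using t by (simp add: pos_le_divide_eq)
    qed (use r in auto)
    moreover have "(inner_const + jump_const) * S * (r - 1) \<le> (inner_const + jump_const) * S * far_radius"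
      using r C S by (intro mult_left_mono) auto
    ultimately show ?thesis using M1 by (simp add: drop_const_def algebra_simps)
  qed
  have "S \<le> size_bound"
  proof (rule ccontr)
    assume "\<not> S \<le> size_bound"
    then have Sb: "S > 2 * drop_const + 4 * (1 + d) / coerc_const" by (simp add: size_bound_def)
    moreover have "4 * (1 + d) / coerc_const > 0" using d1 C by simp
    ultimately have Sd: "2 * drop_const \<le> S" and Sc: "4 * (1 + d) / coerc_const \<le> S" and S1: "S > 0"
      using C by linarith+
    have Sc: "4 * (1 + d) \<le> coerc_const * S" using Sc C by (simp add: field_simps)
    have lower: "coerc_const * S \<le> \<bar>u1 r\<bar> + \<bar>u2 r\<bar>" if r: "1 \<le> r" "r \<le> far_radius" for r
    proof -
      have "2 * drop_const * S \<le> S * S" using Sd S1 by (intro mult_right_mono) auto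
      then have "S\<^sup>2 / 2 \<le> \<psi> r" using far[OF r] by (simp add: power2_eq_square)
      also have "\<dots> \<le> qbound * (\<bar>u1 r\<bar> + \<bar>u2 r\<bar>)\<^sup>2" unfolding \<psi>_def by (rule qf_le)
      finally have "S\<^sup>2 / (2 * qbound) \<le> (\<bar>u1 r\<bar> + \<bar>u2 r\<bar>)\<^sup>2" using C by (simp add: field_simps)
      moreover have "(coerc_const * S)\<^sup>2 \<le> S\<^sup>2 / (2 * qbound)"
      proof -
        have "coerc_const\<^sup>2 \<le> 1 / (2 * qbound)"
          unfolding coerc_const_def power2_eq_square using C by (simp add: field_simps)
        then have "coerc_const\<^sup>2 * S\<^sup>2 \<le> 1 / (2 * qbound) * S\<^sup>2" by (rule mult_right_mono) simp
        then show ?thesis by (simp add: power_mult_distrib)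
      qed
      ultimately have "(coerc_const * S)\<^sup>2 \<le> (\<bar>u1 r\<bar> + \<bar>u2 r\<bar>)\<^sup>2" by linarith
      then show ?thesis by (rule power2_le_imp_le) simp
    qed
    have "z 1 + (\<alpha> + \<beta>) * (coerc_const * S / 4) * (far_radius\<^sup>2 - 1\<^sup>2) / 2 \<le> z far_radius"
    proof (rule zg)
      fix r :: real assume r: "1 < r" "r < far_radius"
      have "d * (u2 r * (trunc E 1 (u2 r) - 1)) \<ge> d * (\<bar>u2 r\<bar> / 2 - 1)"
        using d1 coer[of "u2 r"] abs_min_linear[of "u2 r"] by (intro mult_left_mono) auto
      moreover have "u1 r * (trunc E 1 (u1 r) - 1) \<ge> \<bar>u1 r\<bar> / 2 - 1"
        using coer[of "u1 r"] abs_min_linear[of "u1 r"] by linarith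
      moreover have "d * \<bar>u2 r\<bar> \<ge> \<bar>u2 r\<bar>" using d1 by (simp add: mult_le_cancel_right1)
      moreover have "d * (\<bar>u2 r\<bar> / 2 - 1) = d * \<bar>u2 r\<bar> / 2 - d" by (simp add: algebra_simps)
      moreover have "coerc_const * S \<le> \<bar>u1 r\<bar> + \<bar>u2 r\<bar>" using lower[of r] r by simp
      ultimately show "coerc_const * S / 4 \<le> u1 r * (trunc E 1 (u1 r) - 1) + d * (u2 r * (trunc E 1 (u2 r) - 1))"
        using Sc by argo
    qed (use C in auto)
    moreover have "(\<alpha> + \<beta>) * (coerc_const * S / 4) * (far_radius\<^sup>2 - 1\<^sup>2) / 2 > (inner_const + jump_const) * S"
    proof -
      have "far_radius\<^sup>2 - 1 \<ge> far_radius"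
      proof -
        have "2 * far_radius \<le> far_radius\<^sup>2"
          using C(5) by (simp add: power2_eq_square mult_right_mono)
        then show ?thesis using C(5) by linarith
      qed
      moreover have "far_radius > 8 * (inner_const + jump_const) / ((\<alpha> + \<beta>) * coerc_const)"
        by (simp add: far_radius_def)
      ultimately have "far_radius\<^sup>2 - 1 > 8 * (inner_const + jump_const) / ((\<alpha> + \<beta>) * coerc_const)" by linarith
      then have "(\<alpha> + \<beta>) * coerc_const * (far_radius\<^sup>2 - 1) > 8 * (inner_const + jump_const)"
        using a0 b0 C by (simp add: pos_divide_less_eq mult.commute)
      then have "(\<alpha> + \<beta>) * coerc_const * (far_radius\<^sup>2 - 1) * S > 8 * (inner_const + jump_const) * S"
        using S1 by (rule mult_strict_right_mono)
      then show ?thesis by (simp add: field_simps)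
    qed
    ultimately have "z far_radius > 0" using z1 by linarith
    moreover have "z far_radius \<le> 0" using zneg[of far_radius] R C by simp
    ultimately show False by simp
  qed
  then have "S\<^sup>2 \<le> size_bound\<^sup>2" using S by (intro power_mono) auto
  then show "r \<in> {0..R} \<Longrightarrow> qf (v1 r + 2 * real n1 * ln (max 1 r)) (v2 r + 2 * real n2 * ln (max 1 r)) \<le> size_bound\<^sup>2"
    using max[of r] S unfolding w1_def w2_def by linarith
qed

end

section \<open>Passage to the limit and exponential decay\<close>

text \<open>If \<open>y p\<close> were smaller, integrating the bound on \<open>y'\<close> would keep \<open>y\<close> below a negative constant \<open>- \<eta>\<close>, and
  \<open>u\<close> would tend to minus infinity like \<open>- \<eta> * ln r\<close>. The function \<open>g\<close> in the proof is the antiderivative of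
  the bound that vanishes at infinity.\<close>

lemma flux_lower:
  fixes u y :: "real \<Rightarrow> real"
  assumes p: "p > 0" and C: "C \<ge> 0"
    and du: "\<And>r. r \<ge> p \<Longrightarrow> (u has_real_derivative y r / r) (at r)"
    and dy: "\<And>r. r \<ge> p \<Longrightarrow> (y has_real_derivative f r) (at r)"
    and f: "\<And>r. r \<ge> p \<Longrightarrow> f r \<le> C * (r * exp (- r / 2))"
    and u: "\<And>r. r \<ge> p \<Longrightarrow> \<bar>u r\<bar> \<le> 1 / 2"
  shows "- (C * ((2 * p + 4) * exp (- p / 2))) \<le> y p"
proof (rule ccontr)
  define g where "g r = C * ((2 * r + 4) * exp (- r / 2))" for r :: real
  have dg: "(g has_real_derivative - (C * (r * exp (- r / 2)))) (at r)" for r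
    unfolding g_def[abs_def] by (auto intro!: derivative_eq_intros simp: algebra_simps)
  assume "\<not> - (C * ((2 * p + 4) * exp (- p / 2))) \<le> y p"
  then have neg: "y p + g p < 0" unfolding g_def by linarith
  define \<eta> where "\<eta> = - (y p + g p)"
  have \<eta>: "\<eta> > 0" "y p + g p = - \<eta>" using neg by (simp_all add: \<eta>_def)
  have yq: "y q \<le> - \<eta>" if q: "q \<ge> p" for q
  proof -
    have "y q + g q \<le> y p + g p"
    proof (rule DERIV_nonpos_imp_nonincreasing[OF q])
      fix x assume x: "p \<le> x" "x \<le> q"
      show "\<exists>D. ((\<lambda>r. y r + g r) has_real_derivative D) (at x) \<and> D \<le> 0"
        using DERIV_add[OF dy[OF x(1)] dg[of x]] f[OF x(1)] by (intro exI conjI) auto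
    qed
    moreover have "g q \<ge> 0" using C p q by (simp add: g_def)
    ultimately show ?thesis using \<eta> by linarith
  qed
  define q where "q = p * exp (2 / \<eta>)"
  have q: "q \<ge> p" using p \<eta> by (simp add: q_def)
  have "u q + \<eta> * ln q \<le> u p + \<eta> * ln p"
  proof (rule DERIV_nonpos_imp_nonincreasing[OF q])
    fix x assume x: "p \<le> x" "x \<le> q"
    have "((\<lambda>r. u r + \<eta> * ln r) has_real_derivative y x / x + \<eta> * (1 / x)) (at x)"
      using x p by (intro DERIV_add du DERIV_cmult DERIV_ln_divide) auto
    moreover have "y x / x + \<eta> * (1 / x) = (y x + \<eta>) / x" by (simp add: add_divide_distrib)
    moreover have "\<dots> \<le> 0" using yq[OF x(1)] x p by (simp add: divide_nonpos_pos)
    ultimately show "\<exists>D. ((\<lambda>r. u r + \<eta> * ln r) has_real_derivative D) (at x) \<and> D \<le> 0" by metis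
  qed
  moreover have "\<eta> * ln q = \<eta> * ln p + 2" using p \<eta> by (simp add: q_def ln_mult algebra_simps)
  ultimately show False using u[of p] u[OF q] by (simp add: abs_le_iff)
qed

context vortex_system
begin

lemma norm_sq_le_qf: "(norm (x1, x2))\<^sup>2 \<le> 2 * qf x1 x2"
proof -
  have "d * x2\<^sup>2 \<ge> x2\<^sup>2" using d1 by (simp add: mult_le_cancel_right1)
  moreover have "\<beta> * (x1 - x2)\<^sup>2 \<ge> 0" using b0 by simp
  ultimately show ?thesis unfolding qf_eq norm_Pair by simp
qed

lemma qf_le_norm_sq: "qf x1 x2 \<le> 2 * qbound * (norm (x1, x2))\<^sup>2"
proof -
  have "(\<bar>x1\<bar> + \<bar>x2\<bar>)\<^sup>2 \<le> 2 * (norm (x1, x2))\<^sup>2"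
    using zero_le_power2[of "\<bar>x1\<bar> - \<bar>x2\<bar>"] by (simp add: norm_Pair power2_eq_square algebra_simps)
  then have "qbound * (\<bar>x1\<bar> + \<bar>x2\<bar>)\<^sup>2 \<le> qbound * (2 * (norm (x1, x2))\<^sup>2)"
    using const_pos(3) by (intro mult_left_mono) auto
  then show ?thesis using qf_le[of x1 x2] by simp
qed

text \<open>The shooting map at radius \<open>R\<close> is onto, so for a sequence of radii there are solutions with \<open>u R = 0\<close>. By
  the a priori bound their initial values lie in a fixed ball, and any limit point of them is the initial
  value of a bounded global solution. The truncation height is chosen so large that the solution never
  reaches it.\<close>

lemma global_trunc_sol:
  obtains E v1 v2 y1 y2 K where
    "E \<ge> 2" "exp (4 * size_bound) \<le> E" "trunc_sol E v1 v2 y1 y2"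
    "\<And>r. r \<ge> 0 \<Longrightarrow> qf (v1 r + 2 * real n1 * ln (max 1 r)) (v2 r + 2 * real n2 * ln (max 1 r)) \<le> size_bound\<^sup>2"
    "\<And>r. r \<ge> 0 \<Longrightarrow> \<bar>y1 r\<bar> \<le> K * r\<^sup>2" "\<And>r. r \<ge> 0 \<Longrightarrow> \<bar>y2 r\<bar> \<le> K * r\<^sup>2"
proof -
  define E where "E = exp (4 * size_bound) + 2"
  have E: "E \<ge> 2" "E \<ge> 1" "exp (4 * size_bound) \<le> E" by (simp_all add: E_def add_increasing)
  obtain v1 v2 y1 y2 :: "real \<times> real \<Rightarrow> real \<Rightarrow> real" and K k where
    init: "\<And>s. v1 s 0 = fst s" "\<And>s. v2 s 0 = snd s"
    and sol: "\<And>s. trunc_sol E (v1 s) (v2 s) (y1 s) (y2 s)"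
    and yb: "\<And>s r. r \<ge> 0 \<Longrightarrow> \<bar>y1 s r\<bar> \<le> K * r\<^sup>2" "\<And>s r. r \<ge> 0 \<Longrightarrow> \<bar>y2 s r\<bar> \<le> K * r\<^sup>2"
    and dep: "\<And>s t r. r \<ge> 0 \<Longrightarrow> norm ((v1 s r, v2 s r) - (v1 t r, v2 t r)) \<le> 2 * exp (k * r) * norm (s - t)"
    using trunc_sol_family[OF E(2)] by metis
  have cont: "continuous_on UNIV (\<lambda>s. (v1 s r, v2 s r))" if r: "r \<ge> 0" for r
  proof (rule lipschitz_on_continuous_on)
    show "(2 * exp (k * r))-lipschitz_on UNIV (\<lambda>s. (v1 s r, v2 s r))"
      by (rule lipschitz_onI) (use dep[OF r] in \<open>simp_all only: dist_norm, simp\<close>)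
  qed
  have shoot: "\<exists>s. v1 s R = a \<and> v2 s R = b" if R: "R \<ge> 0" for R a b
  proof -
    have "surj (\<lambda>s. (v1 s R, v2 s R))"
    proof (rule expansive_imp_surj[OF cont[OF R], of "1 / (2 * qbound)"])
      show "1 / (2 * qbound) > 0" using const_pos(3) by simp
      fix s t :: "real \<times> real"
      let ?D = "norm (v1 s R - v1 t R, v2 s R - v2 t R)"
      have "(norm (fst s - fst t, snd s - snd t))\<^sup>2 \<le> 2 * qf (fst s - fst t) (snd s - snd t)"
        by (rule norm_sq_le_qf)
      also have "\<dots> \<le> 2 * qf (v1 s R - v1 t R) (v2 s R - v2 t R)"
        using trunc_sol_expansive[OF sol[of s] sol[of t] R] by (simp add: init)
      also have "\<dots> \<le> 2 * (2 * qbound * ?D\<^sup>2)" using qf_le_norm_sq by (intro mult_left_mono) auto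
      also have "\<dots> = (4 * qbound) * ?D\<^sup>2" by simp
      also have "\<dots> \<le> (2 * qbound)\<^sup>2 * ?D\<^sup>2"
        using const_pos(3) by (intro mult_right_mono) (simp_all add: power2_eq_square)
      finally have "(norm (fst s - fst t, snd s - snd t))\<^sup>2 \<le> (2 * qbound * ?D)\<^sup>2"
        by (simp add: power_mult_distrib)
      then have "norm (fst s - fst t, snd s - snd t) \<le> 2 * qbound * ?D"
        by (rule power2_le_imp_le) (use const_pos(3) in auto)
      moreover have "dist s t = norm (fst s - fst t, snd s - snd t)"
        by (simp add: dist_prod_def norm_Pair dist_norm)
      moreover have "dist (v1 s R, v2 s R) (v1 t R, v2 t R) = ?D"
        by (simp add: dist_norm)
      ultimately show "1 / (2 * qbound) * dist s t \<le> dist (v1 s R, v2 s R) (v1 t R, v2 t R)"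
        using const_pos(3) by (simp add: field_simps)
    qed
    from surjD[OF this, of "(a, b)"] show ?thesis by auto
  qed
  define R where "R j = far_radius + 1 + real j" for j :: nat
  have R: "R j > far_radius" "R j \<ge> 0" for j using const_pos(5) by (simp_all add: R_def)
  have "\<forall>j. \<exists>s. v1 s (R j) = - (2 * real n1 * ln (R j)) \<and> v2 s (R j) = - (2 * real n2 * ln (R j))"
    using shoot R(2) by blast
  then obtain s where s: "\<And>j. v1 (s j) (R j) = - (2 * real n1 * ln (R j))"
    "\<And>j. v2 (s j) (R j) = - (2 * real n2 * ln (R j))"
    unfolding choice_iff by blast
  let ?q = "\<lambda>s r. qf (v1 s r + 2 * real n1 * ln (max 1 r)) (v2 s r + 2 * real n2 * ln (max 1 r))"
  have bd: "?q (s j) r \<le> size_bound\<^sup>2" if "r \<in> {0..R j}" for j r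
    using a_priori_bound[OF E(1) sol R(1)[of j] _ _ that, of "s j"] s[of j] by simp
  have "s j \<in> cball 0 (2 * size_bound)" for j
  proof -
    have "qf (fst (s j)) (snd (s j)) \<le> size_bound\<^sup>2"
      using bd[of 0 j] R(2)[of j] by (simp add: init)
    then have "(norm (s j))\<^sup>2 \<le> 2 * size_bound\<^sup>2"
      using norm_sq_le_qf[of "fst (s j)" "snd (s j)"] by simp
    also have "\<dots> \<le> (2 * size_bound)\<^sup>2" by (simp add: power_mult_distrib)
    finally have "norm (s j) \<le> 2 * size_bound"
      by (rule power2_le_imp_le) (use const_pos(7) in auto)
    then show ?thesis by simp
  qed
  then have s_in: "\<forall>j. s j \<in> cball 0 (2 * size_bound)" by blast
  obtain l and \<sigma> :: "nat \<Rightarrow> nat" where l: "strict_mono \<sigma>" "(s \<circ> \<sigma>) \<longlonglongrightarrow> l"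
    by (rule seq_compactE[OF compact_imp_seq_compact[OF compact_cball] s_in])
  have lim: "?q l r \<le> size_bound\<^sup>2" if r: "r \<ge> 0" for r
  proof (rule LIMSEQ_le_const2)
    have "isCont (\<lambda>s. (v1 s r, v2 s r)) l" using cont[OF r] unfolding continuous_on_eq_continuous_at[OF open_UNIV] by blast
    then have t: "(\<lambda>n. (v1 ((s \<circ> \<sigma>) n) r, v2 ((s \<circ> \<sigma>) n) r)) \<longlonglongrightarrow> (v1 l r, v2 l r)"
      using l(2) by (rule isCont_tendsto_compose)
    have c: "(\<lambda>n. v1 (s (\<sigma> n)) r) \<longlonglongrightarrow> v1 l r" "(\<lambda>n. v2 (s (\<sigma> n)) r) \<longlonglongrightarrow> v2 l r"
      using tendsto_fst[OF t] tendsto_snd[OF t] by (simp_all add: o_def)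
    show "(\<lambda>n. ?q (s (\<sigma> n)) r) \<longlonglongrightarrow> ?q l r"
      unfolding qf_def bil_def by (intro tendsto_intros c) auto
    obtain m where m: "real m \<ge> r" using real_arch_simple by blast
    have "r \<in> {0..R (\<sigma> n)}" if "n \<ge> m" for n
    proof -
      have "real m \<le> real (\<sigma> n)" using that seq_suble[OF l(1), of n] by simp
      then show ?thesis using r m const_pos(5) by (simp add: R_def)
    qed
    then show "\<exists>N. \<forall>n\<ge>N. ?q (s (\<sigma> n)) r \<le> size_bound\<^sup>2" using bd by blast
  qed
  show ?thesis
    by (rule that[OF E(1,3) sol[of l] lim yb(1) yb(2)])
qed

text \<open>Let \<open>\<psi>\<close> be the quadratic form of the solution and \<open>z = r * \<psi>'\<close>, a nondecreasing function. Boundedness of \<open>\<psi>\<close>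
  makes \<open>z\<close> nonpositive, and coercivity then makes \<open>\<psi>\<close> small somewhere and hence from there on. In the region
  where the components are at most \<open>1 / 2\<close>, the inequality \<open>x * (exp (2 * x) - 1) \<ge> x\<^sup>2\<close> gives
  \<open>\<psi>'' + \<psi>' / r \<ge> \<psi>\<close>, and this forces \<open>\<psi>' + \<psi> \<le> 0\<close>.\<close>

lemma far_decay:
  assumes E: "E \<ge> 2" and v: "trunc_sol E v1 v2 y1 y2"
    and bd: "\<And>r. r \<ge> 1 \<Longrightarrow> qf (v1 r + 2 * real n1 * ln r) (v2 r + 2 * real n2 * ln r) \<le> M"
  obtains p C where "p \<ge> 1" "C > 0"
    "\<And>r. r \<ge> p \<Longrightarrow> \<bar>v1 r + 2 * real n1 * ln r\<bar> \<le> min (1 / 2) (C * exp (- r / 2))"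
    "\<And>r. r \<ge> p \<Longrightarrow> \<bar>v2 r + 2 * real n2 * ln r\<bar> \<le> min (1 / 2) (C * exp (- r / 2))"
proof -
  define u1 where "u1 r = v1 r + 2 * real n1 * ln r" for r
  define u2 where "u2 r = v2 r + 2 * real n2 * ln r" for r
  define x1 where "x1 r = y1 r + 2 * real n1" for r
  define x2 where "x2 r = y2 r + 2 * real n2" for r
  define a where "a r = trunc E 1 (u1 r) - 1" for r
  define b where "b r = trunc E 1 (u2 r) - 1" for r
  have U: "(u1 has_real_derivative x1 r / r) (at r)" "(u2 has_real_derivative x2 r / r) (at r)"
    "(x1 has_real_derivative r * rhs1 (a r) (b r)) (at r)" "(x2 has_real_derivative r * rhs2 (a r) (b r)) (at r)"
    if "r > 0" for r
    using trunc_sol_log[OF v that]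
    unfolding u1_def[abs_def] u2_def[abs_def] x1_def[abs_def] x2_def[abs_def] a_def[abs_def] b_def[abs_def] .
  have cU: "continuous_on {p..q} u1" "continuous_on {p..q} u2" "continuous_on {p..q} x1" "continuous_on {p..q} x2"
    if "p > 0" for p q
  proof -
    have cont_of: "continuous_on {p..q} f" if f: "\<And>r. r > 0 \<Longrightarrow> (f has_real_derivative D r) (at r)" for f D
    proof (rule DERIV_continuous_on)
      show "(f has_real_derivative D r) (at r within {p..q})" if "r \<in> {p..q}" for r
        by (rule has_field_derivative_at_within[OF f]) (use \<open>p > 0\<close> that in auto)
    qed
    from cont_of[OF U(1)] cont_of[OF U(2)] cont_of[OF U(3)] cont_of[OF U(4)]
    show "continuous_on {p..q} u1" "continuous_on {p..q} u2" "continuous_on {p..q} x1" "continuous_on {p..q} x2"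
      by simp_all
  qed
  define z where "z r = 2 * bil (u1 r) (u2 r) (x1 r) (x2 r)" for r
  define \<psi> where "\<psi> r = qf (u1 r) (u2 r)" for r
  have M: "\<psi> r \<le> M" if "r \<ge> 1" for r using bd[OF that] by (simp add: \<psi>_def u1_def u2_def)
  have \<psi>0: "\<psi> r \<ge> 0" for r by (simp add: \<psi>_def qf_nonneg)
  have d\<psi>: "(\<psi> has_real_derivative z r / r) (at r)" if "r > 0" for r
    unfolding \<psi>_def[abs_def] z_def by (rule qf_DERIV[of u1 x1 r u2 x2, OF U(1,2)[OF that]])
  have coer: "\<bar>u1 r\<bar> * min \<bar>u1 r\<bar> (1 / 2) + \<bar>u2 r\<bar> * min \<bar>u2 r\<bar> (1 / 2) \<le> u1 r * a r + d * (u2 r * b r)" for r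
  proof -
    have t: "\<bar>u2 r\<bar> * min \<bar>u2 r\<bar> (1 / 2) \<le> u2 r * b r" "\<bar>u1 r\<bar> * min \<bar>u1 r\<bar> (1 / 2) \<le> u1 r * a r"
      unfolding a_def b_def using trunc_coercive[OF E] by blast+
    have "1 * (u2 r * b r) \<le> d * (u2 r * b r)"
      using d1 t(1) abs_min_nonneg[of "u2 r"] by (intro mult_right_mono) linarith+
    then show ?thesis using t by linarith
  qed
  have zg: "z p + (\<alpha> + \<beta>) * k * (q\<^sup>2 - p\<^sup>2) / 2 \<le> z q"
    if "0 < p" "p \<le> q" "\<And>r. p < r \<Longrightarrow> r < q \<Longrightarrow> k \<le> u1 r * a r + d * (u2 r * b r)" for p q k
    unfolding z_def
    by (rule bil_growth[where a = a and b = b]) (use that in \<open>auto intro!: cU U\<close>)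
  have zmono: "z p \<le> z q" if "0 < p" "p \<le> q" for p q
  proof -
    have "0 \<le> u1 r * a r + d * (u2 r * b r)" for r
      using coer[of r] abs_min_nonneg[of "u1 r"] abs_min_nonneg[of "u2 r"] by linarith
    then show ?thesis using zg[of p q 0] that by simp
  qed
  \<comment> \<open>A positive slope would make the bounded form grow logarithmically.\<close>
  have zneg: "z p \<le> 0" if p: "p \<ge> 1" for p
  proof (rule ccontr)
    assume "\<not> z p \<le> 0"
    then have zp: "z p > 0" by simp
    define q where "q = p * exp ((M + 1) / z p)"
    have M0: "M \<ge> 0" using order_trans[OF \<psi>0 M[of 1]] by simp
    have q: "q \<ge> p" using p zp M0 by (simp add: q_def)
    have "\<psi> p - z p * ln p \<le> \<psi> q - z p * ln q"
    proof (rule DERIV_nonneg_imp_nondecreasing[OF q])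
      fix x assume x: "p \<le> x" "x \<le> q"
      have "((\<lambda>r. \<psi> r - z p * ln r) has_real_derivative z x / x - z p * (1 / x)) (at x)"
        using x p by (intro DERIV_diff d\<psi> DERIV_cmult DERIV_ln_divide) auto
      moreover have "z x / x - z p * (1 / x) = (z x - z p) / x" by (simp add: diff_divide_distrib)
      moreover have "\<dots> \<ge> 0" using zmono[of p x] x p by simp
      ultimately show "\<exists>D. ((\<lambda>r. \<psi> r - z p * ln r) has_real_derivative D) (at x) \<and> 0 \<le> D" by metis
    qed
    moreover have "ln q = ln p + (M + 1) / z p" using p zp by (simp add: q_def ln_mult)
    then have "z p * ln q = z p * ln p + (M + 1)" using zp by (simp only: distrib_left[of "z p" "ln p"]) simp
    ultimately show False using \<psi>0[of p] M[of q] q p by linarith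
  qed
  have \<psi>anti: "\<psi> q \<le> \<psi> p" if "1 \<le> p" "p \<le> q" for p q
  proof (rule DERIV_nonpos_imp_nonincreasing[OF that(2)])
    fix x assume x: "p \<le> x" "x \<le> q"
    then show "\<exists>D. (\<psi> has_real_derivative D) (at x) \<and> D \<le> 0"
      using d\<psi>[of x] zneg[of x] that by (intro exI[of _ "z x / x"]) (simp add: divide_nonpos_pos)
  qed
  \<comment> \<open>Components below \<open>\<mu>\<close> have a quadratic form of at most \<open>1 / 16\<close>; hence, while the form is larger, one component is at least \<open>\<mu>\<close> and \<open>z\<close> grows quadratically.\<close>
  define \<mu> where "\<mu> = 1 / (8 * qbound)"
  have \<mu>: "0 < \<mu>" "\<mu> \<le> 1 / 2" "qbound * (2 * \<mu>)\<^sup>2 \<le> 1 / 16"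
    using const_pos(3) by (simp_all add: \<mu>_def power2_eq_square field_simps)
  obtain p where p: "p \<ge> 1" "\<psi> p \<le> 1 / 16"
  proof (rule ccontr)
    assume "\<not> thesis"
    then have big: "\<psi> r > 1 / 16" if "r \<ge> 1" for r using that \<open>\<And>p. 1 \<le> p \<Longrightarrow> \<psi> p \<le> 1 / 16 \<Longrightarrow> thesis\<close> by force
    have low: "\<mu> * \<mu> \<le> u1 r * a r + d * (u2 r * b r)" if r: "r \<ge> 1" for r
    proof -
      have "\<not> (\<bar>u1 r\<bar> < \<mu> \<and> \<bar>u2 r\<bar> < \<mu>)"
      proof
        assume "\<bar>u1 r\<bar> < \<mu> \<and> \<bar>u2 r\<bar> < \<mu>"
        then have "(\<bar>u1 r\<bar> + \<bar>u2 r\<bar>)\<^sup>2 \<le> (2 * \<mu>)\<^sup>2" by (intro power_mono) auto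
        then have "qbound * (\<bar>u1 r\<bar> + \<bar>u2 r\<bar>)\<^sup>2 \<le> qbound * (2 * \<mu>)\<^sup>2"
          using const_pos(3) by (intro mult_left_mono) auto
        then show False using qf_le[of "u1 r" "u2 r"] big[OF r] \<mu>(3) unfolding \<psi>_def by linarith
      qed
      moreover have "\<mu> * \<mu> \<le> \<bar>x\<bar> * min \<bar>x\<bar> (1 / 2)" if "\<not> \<bar>x\<bar> < \<mu>" for x
        using that \<mu> by (intro mult_mono) auto
      ultimately have "\<mu> * \<mu> \<le> \<bar>u1 r\<bar> * min \<bar>u1 r\<bar> (1 / 2) \<or> \<mu> * \<mu> \<le> \<bar>u2 r\<bar> * min \<bar>u2 r\<bar> (1 / 2)"
        by blast
      then show ?thesis
        using coer[of r] abs_min_nonneg[of "u1 r"] abs_min_nonneg[of "u2 r"] by linarith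
    qed
    define k where "k = (\<alpha> + \<beta>) * (\<mu> * \<mu>) / 2"
    have k: "k > 0" using a0 b0 \<mu> by (simp add: k_def)
    define q where "q = 1 + (\<bar>z 1\<bar> + 1) / k"
    have q: "q \<ge> 1" using k by (simp add: q_def)
    have "z 1 + (\<alpha> + \<beta>) * (\<mu> * \<mu>) * (q\<^sup>2 - 1\<^sup>2) / 2 \<le> z q"
      using q low by (intro zg) auto
    then have "z 1 + k * (q\<^sup>2 - 1) \<le> z q" by (simp add: k_def)
    moreover have "q\<^sup>2 - 1 \<ge> q - 1" using q by (simp add: power2_eq_square)
    then have "k * (q\<^sup>2 - 1) \<ge> k * (q - 1)" using k by (intro mult_left_mono) auto
    moreover have "k * (q - 1) = \<bar>z 1\<bar> + 1" using k by (simp add: q_def)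
    ultimately show False using zneg[OF q] by linarith
  qed
  have small: "\<bar>u1 r\<bar> \<le> 1 / 2" "\<bar>u2 r\<bar> \<le> 1 / 2" if "r \<ge> p" for r
  proof -
    have "\<psi> r \<le> (1 / 4)\<^sup>2" using \<psi>anti[OF p(1) that] p(2) by (simp add: power2_eq_square)
    then show "\<bar>u1 r\<bar> \<le> 1 / 2" "\<bar>u2 r\<bar> \<le> 1 / 2"
      using abs_le_qf[of "u1 r" "u2 r" "1 / 4"] unfolding \<psi>_def by auto
  qed
  \<comment> \<open>Since \<open>\<psi>'' + \<psi>' / r \<ge> \<psi>\<close> and \<open>\<psi>' \<le> 0\<close>, the function \<open>\<psi>' + \<psi>\<close> grows at least
    exponentially wherever it is positive.\<close>
  have slope: "z r / r + \<psi> r \<le> 0" if r: "r \<ge> p" for r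
  proof (rule ccontr)
    let ?A = "\<lambda>r. z r / r + \<psi> r"
    assume "\<not> ?A r \<le> 0"
    then have A: "?A r > 0" by simp
    define q where "q = r + 1 / ?A r"
    have q: "q \<ge> r" using A by (simp add: q_def)
    have "?A r * exp (- r) \<le> ?A q * exp (- q)"
    proof (rule DERIV_nonneg_imp_nondecreasing[OF q])
      fix x assume x: "r \<le> x" "x \<le> q"
      have x0: "x > 0" "x \<ge> 1" "x \<ge> p" using x r p by auto
      have "(u1 x)\<^sup>2 + d * (u2 x)\<^sup>2 \<le> u1 x * a x + d * (u2 x * b x)"
      proof -
        have "(u2 x)\<^sup>2 \<le> u2 x * b x" "(u1 x)\<^sup>2 \<le> u1 x * a x"
          using trunc_coercive[OF E, of "u1 x"] trunc_coercive[OF E, of "u2 x"] small[OF x0(3)]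
          unfolding a_def b_def by (simp_all add: min_def power2_eq_square)
        then show ?thesis using d1 by (intro add_mono mult_left_mono) auto
      qed
      from bil_DERIV_ge[of u1 x1 x u2 x2, OF U[OF x0(1)] x0(1) this]
      obtain D where D: "(z has_real_derivative D) (at x)" "x * ((\<alpha> + \<beta>) * ((u1 x)\<^sup>2 + d * (u2 x)\<^sup>2)) \<le> D"
        unfolding z_def[abs_def] by blast
      have "x * \<psi> x \<le> x * ((\<alpha> + \<beta>) * ((u1 x)\<^sup>2 + d * (u2 x)\<^sup>2))"
        unfolding \<psi>_def using x0 by (intro mult_left_mono qf_le_weighted) auto
      then have D2: "\<psi> x \<le> D / x" using D(2) x0 by (simp add: field_simps)
      have z2: "z x / (x * x) \<le> 0" using zneg[of x] x0 by (simp add: divide_nonpos_pos)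
      have "((\<lambda>r. ?A r * exp (- r)) has_real_derivative
          ((D * x - z x * 1) / (x * x) + z x / x) * exp (- x) + exp (- x) * (- 1) * ?A x) (at x)"
        using x0 by (intro DERIV_mult DERIV_add DERIV_divide D(1) DERIV_ident d\<psi>)
          (auto intro!: derivative_eq_intros)
      moreover have "((D * x - z x * 1) / (x * x) + z x / x) * exp (- x) + exp (- x) * (- 1) * ?A x
          = (D / x - z x / (x * x) - \<psi> x) * exp (- x)"
        using x0 by (simp add: algebra_simps diff_divide_distrib)
      moreover have "\<dots> \<ge> 0" using D2 z2 by simp
      ultimately show "\<exists>y. ((\<lambda>r. ?A r * exp (- r)) has_real_derivative y) (at x) \<and> 0 \<le> y" by metis
    qed
    then have "?A r * exp (q - r) \<le> ?A q" by (simp add: exp_diff exp_minus field_simps)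
    moreover have "?A r * (1 + (q - r)) \<le> ?A r * exp (q - r)"
      using A exp_ge_add_one_self[of "q - r"] by (intro mult_left_mono) auto
    moreover have "?A r * (1 + (q - r)) = ?A r + 1" using A by (simp add: q_def algebra_simps)
    moreover have "z q / q \<le> 0" using zneg[of q] p q r by (simp add: divide_nonpos_pos)
    then have "?A q \<le> 1 / 16"
      using \<psi>anti[of p q] p q r by linarith
    ultimately show False using A by linarith
  qed
  have dec: "\<psi> r \<le> exp p * exp (- r)" if r: "r \<ge> p" for r
  proof -
    have "\<psi> r * exp r \<le> \<psi> p * exp p"
    proof (rule DERIV_nonpos_imp_nonincreasing[OF r])
      fix x assume x: "p \<le> x" "x \<le> r"
      have x0: "x > 0" using x p by simp
      have "((\<lambda>r. \<psi> r * exp r) has_real_derivative z x / x * exp x + exp x * \<psi> x) (at x)"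
        by (intro DERIV_mult d\<psi> DERIV_exp x0)
      moreover have "z x / x * exp x + exp x * \<psi> x = (z x / x + \<psi> x) * exp x" by (simp add: algebra_simps)
      moreover have "\<dots> \<le> 0" using slope[OF x(1)] by (simp add: mult_nonpos_nonneg)
      ultimately show "\<exists>D. ((\<lambda>r. \<psi> r * exp r) has_real_derivative D) (at x) \<and> D \<le> 0" by metis
    qed
    also have "\<dots> \<le> 1 * exp p" using p by (intro mult_right_mono) auto
    finally show ?thesis by (simp add: exp_minus field_simps)
  qed
  define C where "C = 2 * exp (p / 2)"
  have fin: "\<bar>u1 r\<bar> \<le> C * exp (- r / 2)" "\<bar>u2 r\<bar> \<le> C * exp (- r / 2)" if r: "r \<ge> p" for r
  proof -
    have "(exp (p / 2) * exp (- r / 2))\<^sup>2 = exp p * exp (- r)"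
      by (simp add: power_mult_distrib exp_double[symmetric])
    then show "\<bar>u1 r\<bar> \<le> C * exp (- r / 2)" "\<bar>u2 r\<bar> \<le> C * exp (- r / 2)"
      using abs_le_qf[of "u1 r" "u2 r" "exp (p / 2) * exp (- r / 2)"] dec[OF r]
      unfolding \<psi>_def C_def by auto
  qed
  show ?thesis
    by (rule that[of p C]) (use p fin small in \<open>auto simp: C_def u1_def u2_def\<close>)
qed

end

section \<open>The radial solution\<close>

lemma abs_exp_minus_one_le: "\<bar>exp x - 1\<bar> \<le> 2 * \<bar>x\<bar>" if "\<bar>x\<bar> \<le> 1" for x :: real
proof (cases "x \<ge> 0")
  case True
  have "x * x \<le> x * 1" using True that by (intro mult_left_mono) auto
  then have "exp x \<le> 1 + 2 * x" using exp_bound[of x] True that by (simp add: power2_eq_square)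
  then show ?thesis using True exp_ge_add_one_self[of x] by linarith
next
  case False
  then have "exp x \<le> 1" by simp
  then show ?thesis using False exp_ge_add_one_self[of x] by linarith
qed

context vortex_system
begin

lemma flux_abs:
  fixes u y :: "real \<Rightarrow> real"
  assumes p: "p > 0" and C: "C \<ge> 0"
    and du: "\<And>r. r \<ge> p \<Longrightarrow> (u has_real_derivative y r / r) (at r)"
    and dy: "\<And>r. r \<ge> p \<Longrightarrow> (y has_real_derivative r * f r) (at r)"
    and f: "\<And>r. r \<ge> p \<Longrightarrow> \<bar>f r\<bar> \<le> C * exp (- r / 2)"
    and u: "\<And>r. r \<ge> p \<Longrightarrow> \<bar>u r\<bar> \<le> 1 / 2"
  shows "\<bar>y p\<bar> \<le> C * ((2 * p + 4) * exp (- p / 2))"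
proof -
  have f': "r * f r \<le> C * (r * exp (- r / 2))" "- (r * f r) \<le> C * (r * exp (- r / 2))" if r: "r \<ge> p" for r
  proof -
    have "\<bar>r * f r\<bar> \<le> r * (C * exp (- r / 2))"
      unfolding abs_mult using f[OF r] r p by (simp add: mult_left_mono)
    then show "r * f r \<le> C * (r * exp (- r / 2))" "- (r * f r) \<le> C * (r * exp (- r / 2))"
      by (simp_all add: mult.left_commute)
  qed
  have "- (C * ((2 * p + 4) * exp (- p / 2))) \<le> y p"
    by (rule flux_lower[where f = "\<lambda>r. r * f r"]) (use p C du dy f' u in auto)
  moreover have "- (C * ((2 * p + 4) * exp (- p / 2))) \<le> - y p"
  proof (rule flux_lower[where f = "\<lambda>r. - (r * f r)" and u = "\<lambda>r. - u r" and y = "\<lambda>r. - y r"])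
    fix r assume r: "p \<le> r"
    show "((\<lambda>r. - u r) has_real_derivative - y r / r) (at r)"
      using DERIV_minus[OF du[OF r]] by simp
    show "((\<lambda>r. - y r) has_real_derivative - (r * f r)) (at r)"
      using DERIV_minus[OF dy[OF r]] by simp
  qed (use p C f' u in auto)
  ultimately show ?thesis by (simp add: abs_le_iff)
qed

text \<open>The a priori bound keeps \<open>exp (2 * u)\<close> below the truncation height, so the truncated equation is the original
  one.\<close>

theorem radial_solution:
  obtains u1 u2 y1 y2 :: "real \<Rightarrow> real" and p C K :: real where
    "p \<ge> 1" "C > 0" "K \<ge> 0"
    "\<And>r. r > 0 \<Longrightarrow> (u1 has_real_derivative y1 r / r) (at r)"
    "\<And>r. r > 0 \<Longrightarrow> (u2 has_real_derivative y2 r / r) (at r)"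
    "\<And>r. r > 0 \<Longrightarrow> (y1 has_real_derivative r * rhs1 (exp (2 * u1 r) - 1) (exp (2 * u2 r) - 1)) (at r)"
    "\<And>r. r > 0 \<Longrightarrow> (y2 has_real_derivative r * rhs2 (exp (2 * u1 r) - 1) (exp (2 * u2 r) - 1)) (at r)"
    "\<And>r. 0 < r \<Longrightarrow> r \<le> 1 \<Longrightarrow> \<bar>u1 r - 2 * real n1 * ln r\<bar> \<le> K"
    "\<And>r. 0 < r \<Longrightarrow> r \<le> 1 \<Longrightarrow> \<bar>u2 r - 2 * real n2 * ln r\<bar> \<le> K"
    "\<And>r. r \<ge> 1 \<Longrightarrow> \<bar>u1 r\<bar> \<le> K" "\<And>r. r \<ge> 1 \<Longrightarrow> \<bar>u2 r\<bar> \<le> K"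
    "\<And>r. r > 0 \<Longrightarrow> \<bar>y1 r - 2 * real n1\<bar> \<le> K * r\<^sup>2"
    "\<And>r. r > 0 \<Longrightarrow> \<bar>y2 r - 2 * real n2\<bar> \<le> K * r\<^sup>2"
    "\<And>r. r \<ge> p \<Longrightarrow> \<bar>u1 r\<bar> \<le> C * exp (- r / 2)"
    "\<And>r. r \<ge> p \<Longrightarrow> \<bar>u2 r\<bar> \<le> C * exp (- r / 2)"
    "\<And>r. r \<ge> p \<Longrightarrow> \<bar>y1 r\<bar> \<le> C * ((2 * r + 4) * exp (- r / 2))"
    "\<And>r. r \<ge> p \<Longrightarrow> \<bar>y2 r\<bar> \<le> C * ((2 * r + 4) * exp (- r / 2))"
proof -
  obtain E v1 v2 x1 x2 K0 where E: "E \<ge> 2" "exp (4 * size_bound) \<le> E"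
    and v: "trunc_sol E v1 v2 x1 x2"
    and bd: "\<And>r. r \<ge> 0 \<Longrightarrow> qf (v1 r + 2 * real n1 * ln (max 1 r)) (v2 r + 2 * real n2 * ln (max 1 r)) \<le> size_bound\<^sup>2"
    and xb: "\<And>r. r \<ge> 0 \<Longrightarrow> \<bar>x1 r\<bar> \<le> K0 * r\<^sup>2" "\<And>r. r \<ge> 0 \<Longrightarrow> \<bar>x2 r\<bar> \<le> K0 * r\<^sup>2"
    using global_trunc_sol by metis
  have sb: "size_bound \<ge> 0" using const_pos(7) by simp
  define u1 where "u1 r = v1 r + 2 * real n1 * ln r" for r
  define u2 where "u2 r = v2 r + 2 * real n2 * ln r" for r
  define y1 where "y1 r = x1 r + 2 * real n1" for r
  define y2 where "y2 r = x2 r + 2 * real n2" for r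
  have w: "\<bar>v1 r + 2 * real n1 * ln (max 1 r)\<bar> \<le> 2 * size_bound" "\<bar>v2 r + 2 * real n2 * ln (max 1 r)\<bar> \<le> 2 * size_bound"
    if "r \<ge> 0" for r
    using abs_le_qf[OF bd[OF that] sb] by auto
  have near: "\<bar>v1 r\<bar> \<le> 2 * size_bound" "\<bar>v2 r\<bar> \<le> 2 * size_bound" if "0 < r" "r \<le> 1" for r
    using w[of r] that by (simp_all add: max_absorb1)
  have far: "\<bar>u1 r\<bar> \<le> 2 * size_bound" "\<bar>u2 r\<bar> \<le> 2 * size_bound" if "1 \<le> r" for r
    using w[of r] that by (simp_all add: max_absorb2 u1_def u2_def)
  have u_le: "u1 r \<le> 2 * size_bound" "u2 r \<le> 2 * size_bound" if r: "r > 0" for r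
  proof -
    have "ln r \<le> 0" if "r \<le> 1" using that r by simp
    then have "2 * real n1 * ln r \<le> 0" "2 * real n2 * ln r \<le> 0" if "r \<le> 1"
      using that by (simp_all add: mult_nonneg_nonpos)
    then show "u1 r \<le> 2 * size_bound" "u2 r \<le> 2 * size_bound"
      using near[of r] far[of r] r by (cases "r \<le> 1"; force simp: u1_def u2_def)+
  qed
  have tr: "trunc E 1 (u1 r) = exp (2 * u1 r)" "trunc E 1 (u2 r) = exp (2 * u2 r)" if r: "r > 0" for r
  proof -
    have "exp (2 * u1 r) \<le> exp (4 * size_bound)" "exp (2 * u2 r) \<le> exp (4 * size_bound)"
      using u_le[OF r] by simp_all
    then show "trunc E 1 (u1 r) = exp (2 * u1 r)" "trunc E 1 (u2 r) = exp (2 * u2 r)"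
      using E unfolding trunc_def by linarith+
  qed
  have U: "(u1 has_real_derivative y1 r / r) (at r)" "(u2 has_real_derivative y2 r / r) (at r)"
    "(y1 has_real_derivative r * rhs1 (exp (2 * u1 r) - 1) (exp (2 * u2 r) - 1)) (at r)"
    "(y2 has_real_derivative r * rhs2 (exp (2 * u1 r) - 1) (exp (2 * u2 r) - 1)) (at r)" if "r > 0" for r
    unfolding tr[OF that, symmetric]
    using trunc_sol_log[OF v that]
    unfolding u1_def[abs_def] u2_def[abs_def] y1_def[abs_def] y2_def[abs_def] .
  have bd1: "qf (v1 r + 2 * real n1 * ln r) (v2 r + 2 * real n2 * ln r) \<le> size_bound\<^sup>2" if "r \<ge> 1" for r
    using bd[of r] that by (simp add: max_absorb2)
  obtain p C0 where p: "p \<ge> 1" and C0: "C0 > 0"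
    and dec: "\<And>r. r \<ge> p \<Longrightarrow> \<bar>v1 r + 2 * real n1 * ln r\<bar> \<le> min (1 / 2) (C0 * exp (- r / 2))"
      "\<And>r. r \<ge> p \<Longrightarrow> \<bar>v2 r + 2 * real n2 * ln r\<bar> \<le> min (1 / 2) (C0 * exp (- r / 2))"
    using far_decay[OF E(1) v bd1] by metis
  have u: "\<bar>u1 r\<bar> \<le> 1 / 2" "\<bar>u2 r\<bar> \<le> 1 / 2" "\<bar>u1 r\<bar> \<le> C0 * exp (- r / 2)" "\<bar>u2 r\<bar> \<le> C0 * exp (- r / 2)"
    if "r \<ge> p" for r
    using dec[OF that] by (simp_all add: u1_def u2_def)
  have s0: "rhs_size > 0" using a0 b0 by (simp add: rhs_size_def)
  define C where "C = C0 + rhs_size * (8 * C0)"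
  have C: "C > 0" "C0 \<le> C" "rhs_size * (8 * C0) \<le> C" using C0 s0 by (simp_all add: C_def add_pos_pos)
  have f: "\<bar>rhs1 (exp (2 * u1 r) - 1) (exp (2 * u2 r) - 1)\<bar> \<le> C * exp (- r / 2) \<and>
      \<bar>rhs2 (exp (2 * u1 r) - 1) (exp (2 * u2 r) - 1)\<bar> \<le> C * exp (- r / 2)" if r: "r \<ge> p" for r
  proof -
    have "\<bar>exp (2 * u1 r) - 1\<bar> + \<bar>exp (2 * u2 r) - 1\<bar> \<le> 8 * C0 * exp (- r / 2)"
    proof -
      have "\<bar>2 * u1 r\<bar> \<le> 1" "\<bar>2 * u2 r\<bar> \<le> 1" using u(1,2)[OF r] by linarith+
      then have "\<bar>exp (2 * u1 r) - 1\<bar> \<le> 2 * \<bar>2 * u1 r\<bar>" "\<bar>exp (2 * u2 r) - 1\<bar> \<le> 2 * \<bar>2 * u2 r\<bar>"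
        by (simp_all only: abs_exp_minus_one_le)
      then show ?thesis using u(3,4)[OF r] by linarith
    qed
    then have "rhs_size * (\<bar>exp (2 * u1 r) - 1\<bar> + \<bar>exp (2 * u2 r) - 1\<bar>) \<le> rhs_size * (8 * C0 * exp (- r / 2))"
      using s0 by (intro mult_left_mono) auto
    also have "\<dots> = rhs_size * (8 * C0) * exp (- r / 2)" by simp
    also have "\<dots> \<le> C * exp (- r / 2)" using C by (intro mult_right_mono) auto
    finally have n: "norm (rhs1 (exp (2 * u1 r) - 1) (exp (2 * u2 r) - 1), rhs2 (exp (2 * u1 r) - 1) (exp (2 * u2 r) - 1)) \<le> C * exp (- r / 2)"
      using norm_rhs order_trans by blast
    then show ?thesis
      using norm_fst_le[of "rhs1 (exp (2 * u1 r) - 1) (exp (2 * u2 r) - 1)" "rhs2 (exp (2 * u1 r) - 1) (exp (2 * u2 r) - 1)"]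
        norm_snd_le[of "rhs2 (exp (2 * u1 r) - 1) (exp (2 * u2 r) - 1)" "rhs1 (exp (2 * u1 r) - 1) (exp (2 * u2 r) - 1)"]
      by simp
  qed
  have yb: "\<bar>y1 r\<bar> \<le> C * ((2 * r + 4) * exp (- r / 2))" if r: "r \<ge> p" for r
    by (rule flux_abs[where u = u1 and f = "\<lambda>r. rhs1 (exp (2 * u1 r) - 1) (exp (2 * u2 r) - 1)"])
      (use r p C U u f in auto)
  have yb2: "\<bar>y2 r\<bar> \<le> C * ((2 * r + 4) * exp (- r / 2))" if r: "r \<ge> p" for r
    by (rule flux_abs[where u = u2 and f = "\<lambda>r. rhs2 (exp (2 * u1 r) - 1) (exp (2 * u2 r) - 1)"])
      (use r p C U u f in auto)
  define K where "K = max K0 (2 * size_bound)"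
  have K: "K0 \<le> K" "2 * size_bound \<le> K" "K \<ge> 0" using sb by (simp_all add: K_def)
  have Kr: "K0 * r\<^sup>2 \<le> K * r\<^sup>2" for r using K by (intro mult_right_mono) auto
  have Cr: "C0 * exp (- r / 2) \<le> C * exp (- r / 2)" for r using C by (intro mult_right_mono) auto
  show ?thesis
  proof (rule that[OF p C(1) K(3) U])
    fix r :: real
    show "\<bar>u1 r - 2 * real n1 * ln r\<bar> \<le> K" "\<bar>u2 r - 2 * real n2 * ln r\<bar> \<le> K" if "0 < r" "r \<le> 1"
      using near[OF that] K by (simp_all add: u1_def u2_def)
    show "\<bar>u1 r\<bar> \<le> K" "\<bar>u2 r\<bar> \<le> K" if "1 \<le> r" using far[OF that] K by auto
    show "\<bar>y1 r - 2 * real n1\<bar> \<le> K * r\<^sup>2" "\<bar>y2 r - 2 * real n2\<bar> \<le> K * r\<^sup>2" if "0 < r"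
    proof -
      have "\<bar>x1 r\<bar> \<le> K0 * r\<^sup>2" "\<bar>x2 r\<bar> \<le> K0 * r\<^sup>2" using xb[of r] that by auto
      then show "\<bar>y1 r - 2 * real n1\<bar> \<le> K * r\<^sup>2" "\<bar>y2 r - 2 * real n2\<bar> \<le> K * r\<^sup>2"
        using Kr[of r] unfolding y1_def y2_def by linarith+
    qed
    show "\<bar>u1 r\<bar> \<le> C * exp (- r / 2)" "\<bar>u2 r\<bar> \<le> C * exp (- r / 2)" if "p \<le> r"
      using u(3,4)[OF that] Cr[of r] by linarith+
    show "\<bar>y1 r\<bar> \<le> C * ((2 * r + 4) * exp (- r / 2))" "\<bar>y2 r\<bar> \<le> C * ((2 * r + 4) * exp (- r / 2))" if "p \<le> r"
      using yb[OF that] yb2[OF that] .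
  qed
qed

end

section \<open>Test functions at large scales\<close>

lemma Ck_on_add:
  assumes "Ck_on k f UNIV" "Ck_on k g UNIV"
  shows "Ck_on k (\<lambda>x. f x + g x) UNIV"
  using assms
proof (induction k arbitrary: f g)
  case 0
  then have "continuous_on UNIV f" "continuous_on UNIV g" by (simp_all only: Ck_on.simps)
  then have "continuous_on UNIV (\<lambda>x. f x + g x)" by (rule continuous_on_add)
  then show ?case by (simp only: Ck_on.simps)
next
  case (Suc k)
  have f: "\<And>x. f differentiable (at x)"
    "\<And>b. b \<in> Basis \<Longrightarrow> Ck_on k (\<lambda>x. frechet_derivative f (at x) b) UNIV"
    using Suc.prems(1) unfolding Ck_on.simps by blast+
  have g: "\<And>x. g differentiable (at x)"
    "\<And>b. b \<in> Basis \<Longrightarrow> Ck_on k (\<lambda>x. frechet_derivative g (at x) b) UNIV"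
    using Suc.prems(2) unfolding Ck_on.simps by blast+
  have D: "((\<lambda>x. f x + g x) has_derivative
      (\<lambda>h. frechet_derivative f (at x) h + frechet_derivative g (at x) h)) (at x)" for x
    using f(1) g(1) frechet_derivative_works by (intro has_derivative_add) blast+
  have fr: "frechet_derivative (\<lambda>x. f x + g x) (at x) b = frechet_derivative f (at x) b + frechet_derivative g (at x) b" for x b
    by (simp add: frechet_derivative_at[OF D, symmetric])
  have "Ck_on k (\<lambda>x. frechet_derivative (\<lambda>x. f x + g x) (at x) b) UNIV" if "b \<in> Basis" for b
    unfolding fr by (rule Suc.IH[OF f(2)[OF that] g(2)[OF that]])
  moreover have "(\<lambda>x. f x + g x) differentiable (at x)" for x using D differentiableI by blast
  ultimately show ?case unfolding Ck_on.simps by blast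
qed

lemma test_function_add:
  assumes f: "test_function f" and g: "test_function g"
  shows "test_function (\<lambda>x. f x + g x)"
proof -
  have "Ck_on k f UNIV" "Ck_on k g UNIV" for k
    using f g unfolding test_function_def smooth_on_def by blast+
  then have s: "smooth_on (\<lambda>x. f x + g x) UNIV"
    unfolding smooth_on_def by (intro allI Ck_on_add)
  have b: "bounded {x. f x \<noteq> 0}" "bounded {x. g x \<noteq> 0}"
    using f g unfolding test_function_def compact_closure by blast+
  have "bounded {x. f x + g x \<noteq> 0}"
    by (rule bounded_subset[OF bounded_Un[THEN iffD2, OF conjI[OF b]]]) auto
  then have "compact (closure {x. f x + g x \<noteq> 0})" unfolding compact_closure .
  then show ?thesis using s unfolding test_function_def by (rule conjI[rotated])
qed

lemma test_function_zero: "test_function (\<lambda>x. 0)"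
proof -
  have "test_function (\<lambda>y::'a. 0 * bump (1 *\<^sub>R (y - 0)))" by (rule test_function_scale[OF test_function_bump]) simp
  then show ?thesis by simp
qed

lemma test_function_sum:
  assumes "finite A" "\<And>i. i \<in> A \<Longrightarrow> test_function (f i)"
  shows "test_function (\<lambda>x. \<Sum>i\<in>A. f i x)"
  using assms
proof (induction A rule: finite_induct)
  case empty
  show ?case using test_function_zero by simp
next
  case (insert i A)
  have "test_function (\<lambda>x. f i x + (\<Sum>j\<in>A. f j x))"
    by (intro test_function_add insert.IH) (use insert.prems in auto)
  then show ?case using insert.hyps by simp
qed

lemma test_function_laplacian:
  assumes "test_function \<phi>" shows "test_function (laplacian \<phi>)"
  unfolding laplacian_def[abs_def]
  by (intro test_function_sum test_function_frechet assms) auto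

text \<open>Green's formula for the constant function \<open>1\<close>.\<close>

lemma laplacian_integral_zero:
  assumes "test_function \<phi>" shows "(LINT x|lborel. laplacian \<phi> x) = 0"
  using green_formula[OF assms, of "\<lambda>_. 1" "\<lambda>_ _. 0" "\<lambda>_ _. 0"]
  by (simp add: has_dderiv_def)

text \<open>In the plane the \<open>L\<^sup>1\<close> norm of the Laplacian of \<open>\<zeta> (x / R)\<close> does not depend on \<open>R\<close>, and its mass
  moves to infinity as \<open>R\<close> grows.\<close>

lemma scaled_laplacian_limit:
  fixes h :: "real^2 \<Rightarrow> real"
  assumes h: "locally_integrable h" and lim: "(h \<longlongrightarrow> 0) at_infinity" and \<zeta>: "test_function \<zeta>"
  shows "(\<lambda>n. LINT x|lborel. h x * laplacian (\<lambda>y. \<zeta> ((1 / real (Suc n)) *\<^sub>R y)) x) \<longlonglongrightarrow> 0"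
proof (rule LIMSEQ_I)
  fix e :: real assume e: "e > 0"
  let ?L = "laplacian \<zeta>"
  have L: "test_function ?L" by (rule test_function_laplacian[OF \<zeta>])
  obtain C where C: "C > 0" "\<And>x. \<bar>?L x\<bar> \<le> C" using test_function_bounded[OF L] by blast
  define I where "I = (LINT x|lborel. \<bar>?L x\<bar>)"
  have I: "I \<ge> 0" unfolding I_def by (intro integral_nonneg_AE) simp
  define \<eta> where "\<eta> = e / (2 * (I + 1))"
  have \<eta>: "\<eta> > 0" "\<eta> * I < e / 2" using e I by (simp_all add: \<eta>_def field_simps)
  obtain r where r: "\<And>x. norm x \<ge> r \<Longrightarrow> \<bar>h x\<bar> < \<eta>"
    using tendstoD[OF lim \<eta>(1)] unfolding eventually_at_infinity by auto
  define H where "H = (LINT x|lborel. \<bar>indicator (cball 0 r) x * h x\<bar>)"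
  have H: "H \<ge> 0" unfolding H_def by (intro integral_nonneg_AE) simp
  have iH: "integrable lborel (\<lambda>x. \<bar>indicator (cball 0 r) x * h x\<bar>)"
    by (intro integrable_abs locally_integrable_indicator[OF h]) simp
  have "(\<lambda>n. C * H * (1 / real (Suc n))\<^sup>2) \<longlonglongrightarrow> C * H * 0\<^sup>2"
    by (intro tendsto_intros LIMSEQ_inverse_real_of_nat[unfolded inverse_eq_divide])
  then have "(\<lambda>n. C * H * (1 / real (Suc n))\<^sup>2) \<longlonglongrightarrow> 0" by simp
  then obtain N where N: "\<And>n. n \<ge> N \<Longrightarrow> \<bar>C * H * (1 / real (Suc n))\<^sup>2\<bar> < e / 2"
    using LIMSEQ_D[of _ 0 "e / 2"] e by fastforce
  have "norm ((LINT x|lborel. h x * laplacian (\<lambda>y. \<zeta> ((1 / real (Suc n)) *\<^sub>R y)) x) - 0) < e" if n: "n \<ge> N" for n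
  proof -
    define c where "c = 1 / real (Suc n)"
    have c: "c > 0" by (simp add: c_def)
    have lap: "laplacian (\<lambda>y. \<zeta> (c *\<^sub>R y)) x = c\<^sup>2 * ?L (c *\<^sub>R x)" for x
      using laplacian_scale[OF \<zeta>, of 1 c 0 x] by simp
    have tL: "test_function (\<lambda>y. c\<^sup>2 * ?L (c *\<^sub>R (y - 0)))" by (rule test_function_scale[OF L]) (use c in simp)
    then have iL: "integrable lborel (\<lambda>y. c\<^sup>2 * \<bar>?L (c *\<^sub>R y)\<bar>)"
      using integrable_abs[OF test_function_integrable[OF tL]] by (simp add: abs_mult)
    have "(\<lambda>x. \<bar>?L x\<bar>) \<in> borel_measurable borel"
      by (intro borel_measurable_abs borel_measurable_continuous_onI test_function_cont[OF L])
    from lborel_integral_scale[OF this, of c 0]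
    have sc: "(LINT y|lborel. c\<^sup>2 * \<bar>?L (c *\<^sub>R y)\<bar>) = I" using c by (simp add: I_def)
    have i: "integrable lborel (\<lambda>x. h x * (c\<^sup>2 * ?L (c *\<^sub>R x)))" using integrable_test_mult[OF h tL] by simp
    have "\<bar>LINT x|lborel. h x * laplacian (\<lambda>y. \<zeta> (c *\<^sub>R y)) x\<bar> \<le> (LINT x|lborel. \<bar>h x * (c\<^sup>2 * ?L (c *\<^sub>R x))\<bar>)"
      unfolding lap by (rule integral_abs_bound)
    also have "\<dots> \<le> (LINT x|lborel. (c\<^sup>2 * C) * \<bar>indicator (cball 0 r) x * h x\<bar> + \<eta> * (c\<^sup>2 * \<bar>?L (c *\<^sub>R x)\<bar>))"
    proof (rule integral_mono[OF integrable_abs[OF i] Bochner_Integration.integrable_add[OF integrable_mult_right[OF iH] integrable_mult_right[OF iL]]])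
      fix x :: "real^2"
      show "\<bar>h x * (c\<^sup>2 * ?L (c *\<^sub>R x))\<bar> \<le> (c\<^sup>2 * C) * \<bar>indicator (cball 0 r) x * h x\<bar> + \<eta> * (c\<^sup>2 * \<bar>?L (c *\<^sub>R x)\<bar>)"
      proof (cases "norm x \<le> r")
        case True
        have "\<bar>h x\<bar> * (c\<^sup>2 * \<bar>?L (c *\<^sub>R x)\<bar>) \<le> \<bar>h x\<bar> * (c\<^sup>2 * C)"
          using C(2) by (intro mult_left_mono) auto
        moreover have "\<eta> * (c\<^sup>2 * \<bar>?L (c *\<^sub>R x)\<bar>) \<ge> 0" using \<eta> by simp
        ultimately show ?thesis using True by (simp add: abs_mult mult.commute)
      next
        case False
        then have "\<bar>h x\<bar> * (c\<^sup>2 * \<bar>?L (c *\<^sub>R x)\<bar>) \<le> \<eta> * (c\<^sup>2 * \<bar>?L (c *\<^sub>R x)\<bar>)"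
          using r[of x] by (intro mult_right_mono) auto
        then show ?thesis using False by (simp add: abs_mult)
      qed
    qed
    also have "\<dots> = (c\<^sup>2 * C) * H + \<eta> * I"
      using Bochner_Integration.integral_add[OF integrable_mult_right[OF iH, of "c\<^sup>2 * C"] integrable_mult_right[OF iL, of \<eta>]]
      by (simp only: Bochner_Integration.integral_mult_right_zero[of lborel "c\<^sup>2 * C"]
          Bochner_Integration.integral_mult_right_zero[of lborel \<eta>] sc H_def)
    also have "\<dots> < e / 2 + e / 2"
      using N[OF n] \<eta>(2) unfolding c_def[symmetric] by (simp add: mult_ac)
    finally show ?thesis by (simp add: c_def)
  qed
  then show "\<exists>N. \<forall>n\<ge>N. norm ((LINT x|lborel. h x * laplacian (\<lambda>y. \<zeta> ((1 / real (Suc n)) *\<^sub>R y)) x) - 0) < e" by blast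
qed

lemma laplace_eq_dirac_diff:
  assumes u: "locally_integrable u" "locally_integrable f" "laplace_eq_dirac u f c"
    and v: "locally_integrable v" "locally_integrable g" "laplace_eq_dirac v g c"
  shows "laplace_eq_dirac (\<lambda>x. v x - u x) (\<lambda>x. g x - f x) 0"
  unfolding laplace_eq_dirac_def
proof (intro allI impI)
  fix \<phi> :: "'a \<Rightarrow> real" assume \<phi>: "test_function \<phi>"
  note L = test_function_laplacian[OF \<phi>]
  have e: "(LINT x|lborel. u x * laplacian \<phi> x) = (LINT x|lborel. f x * \<phi> x) + c * \<phi> 0"
    "(LINT x|lborel. v x * laplacian \<phi> x) = (LINT x|lborel. g x * \<phi> x) + c * \<phi> 0"
    using u(3) v(3) \<phi> unfolding laplace_eq_dirac_def by blast+
  show "(LINT x|lborel. (v x - u x) * laplacian \<phi> x) = (LINT x|lborel. (g x - f x) * \<phi> x) + 0 * \<phi> 0"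
    unfolding left_diff_distrib
    using Bochner_Integration.integral_diff[OF integrable_test_mult[OF v(1) L] integrable_test_mult[OF u(1) L]]
      Bochner_Integration.integral_diff[OF integrable_test_mult[OF v(2) \<phi>] integrable_test_mult[OF u(2) \<phi>]] e
    by simp
qed

section \<open>Uniqueness\<close>

context vortex_system
begin

text \<open>A smooth substitute for \<open>sqrt (qf x y)\<close>. Its linear growth keeps \<open>J w\<close> locally integrable and continuous
  with respect to \<open>L\<^sup>1\<close> convergence of \<open>w\<close>.\<close>

definition J :: "real \<Rightarrow> real \<Rightarrow> real" where "J x y = sqrt (1 + qf x y)"

lemma J_pos: "J x y \<ge> 1" "J x y > 0" "(J x y)\<^sup>2 = 1 + qf x y"
proof -
  have q: "qf x y \<ge> 0" by (rule qf_nonneg)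
  show "(J x y)\<^sup>2 = 1 + qf x y" unfolding J_def using q by simp
  show "J x y \<ge> 1" unfolding J_def using q by simp
  then show "J x y > 0" by linarith
qed

lemma bil_le_J: "\<bar>bil x1 x2 y1 y2\<bar> \<le> J x1 x2 * sqrt (qf y1 y2)"
proof (rule power2_le_imp_le)
  have "(bil x1 x2 y1 y2)\<^sup>2 \<le> qf x1 x2 * qf y1 y2" by (rule bil_cauchy)
  also have "\<dots> \<le> (1 + qf x1 x2) * qf y1 y2" using qf_nonneg by (intro mult_right_mono) auto
  finally show "\<bar>bil x1 x2 y1 y2\<bar>\<^sup>2 \<le> (J x1 x2 * sqrt (qf y1 y2))\<^sup>2"
    by (simp add: power_mult_distrib J_pos(3) qf_nonneg)
  show "0 \<le> J x1 x2 * sqrt (qf y1 y2)" using J_pos(2)[of x1 x2] by (simp add: qf_nonneg)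
qed

lemma sqrt_qf_le: "sqrt (qf y1 y2) \<le> qbound * (\<bar>y1\<bar> + \<bar>y2\<bar>)"
proof -
  have nn: "0 \<le> qbound * (\<bar>y1\<bar> + \<bar>y2\<bar>)" using const_pos(3) by simp
  have "qf y1 y2 \<le> qbound * (\<bar>y1\<bar> + \<bar>y2\<bar>)\<^sup>2" by (rule qf_le)
  also have "\<dots> \<le> qbound\<^sup>2 * (\<bar>y1\<bar> + \<bar>y2\<bar>)\<^sup>2"
    using const_pos(3) by (intro mult_right_mono) (simp_all add: power2_eq_square)
  finally have "qf y1 y2 \<le> (qbound * (\<bar>y1\<bar> + \<bar>y2\<bar>))\<^sup>2" by (simp add: power_mult_distrib)
  then have "sqrt (qf y1 y2) \<le> sqrt ((qbound * (\<bar>y1\<bar> + \<bar>y2\<bar>))\<^sup>2)" by (rule real_sqrt_le_mono)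
  then show ?thesis using nn by (simp only: real_sqrt_abs abs_of_nonneg)
qed

lemma bil_div_J: "\<bar>bil x1 x2 y1 y2 / J x1 x2\<bar> \<le> qbound * (\<bar>y1\<bar> + \<bar>y2\<bar>)"
proof -
  have "\<bar>bil x1 x2 y1 y2\<bar> / J x1 x2 \<le> sqrt (qf y1 y2)"
    using bil_le_J[of x1 x2 y1 y2] J_pos(2)[of x1 x2] by (simp add: divide_le_eq mult.commute)
  then show ?thesis using sqrt_qf_le[of y1 y2] J_pos(2)[of x1 x2] by (simp add: abs_divide)
qed

lemma J_lipschitz: "\<bar>J x1 x2 - J y1 y2\<bar> \<le> qbound * (\<bar>x1 - y1\<bar> + \<bar>x2 - y2\<bar>)"
proof -
  let ?s = "sqrt (qf (x1 - y1) (x2 - y2))"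
  have "(J x1 x2 - J y1 y2) * (J x1 x2 + J y1 y2) = qf x1 x2 - qf y1 y2"
    using J_pos(3)[of x1 x2] J_pos(3)[of y1 y2] by (simp add: power2_eq_square algebra_simps)
  also have "\<dots> = bil x1 x2 (x1 - y1) (x2 - y2) + bil y1 y2 (x1 - y1) (x2 - y2)"
    unfolding qf_def bil_def by (simp add: field_simps)
  finally have "\<bar>(J x1 x2 - J y1 y2) * (J x1 x2 + J y1 y2)\<bar> \<le> J x1 x2 * ?s + J y1 y2 * ?s"
    using bil_le_J[of x1 x2 "x1 - y1" "x2 - y2"] bil_le_J[of y1 y2 "x1 - y1" "x2 - y2"] by linarith
  then have "\<bar>J x1 x2 - J y1 y2\<bar> * (J x1 x2 + J y1 y2) \<le> ?s * (J x1 x2 + J y1 y2)"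
    using J_pos(2)[of x1 x2] J_pos(2)[of y1 y2]
    unfolding abs_mult distrib_left[of ?s] by (simp add: mult.commute)
  then have "\<bar>J x1 x2 - J y1 y2\<bar> \<le> ?s"
    using J_pos(2)[of x1 x2] J_pos(2)[of y1 y2] by simp
  then show ?thesis using sqrt_qf_le[of "x1 - y1" "x2 - y2"] by linarith
qed

text \<open>The last inequality is the convexity of \<open>J\<close>: the second derivative of \<open>J w\<close> is at least the contribution
  of the second derivative of \<open>w\<close>. It follows from the Cauchy-Schwarz inequality for \<open>bil\<close>, which bounds
  \<open>(j1 x)\<^sup>2\<close> by \<open>qf (a1 x) (a2 x)\<close>.\<close>

lemma J_second_derivative:
  assumes w: "has_dderiv w1 b a1" "has_dderiv w2 b a2" "has_dderiv a1 b c1" "has_dderiv a2 b c2"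
  defines "j1 \<equiv> \<lambda>x. bil (w1 x) (w2 x) (a1 x) (a2 x) / J (w1 x) (w2 x)"
  defines "j2 \<equiv> \<lambda>x. (qf (a1 x) (a2 x) + bil (w1 x) (w2 x) (c1 x) (c2 x) - (j1 x)\<^sup>2) / J (w1 x) (w2 x)"
  shows "has_dderiv (\<lambda>x. J (w1 x) (w2 x)) b j1" "has_dderiv j1 b j2"
    "bil (w1 x) (w2 x) (c1 x) (c2 x) / J (w1 x) (w2 x) \<le> j2 x"
proof -
  have dq: "((\<lambda>t. 1 + qf (w1 (x + t *\<^sub>R b)) (w2 (x + t *\<^sub>R b))) has_real_derivative
      2 * bil (w1 x) (w2 x) (a1 x) (a2 x)) (at 0)" for x
  proof -
    have "((\<lambda>t. w1 (x + t *\<^sub>R b)) has_real_derivative a1 x) (at 0)" "((\<lambda>t. w2 (x + t *\<^sub>R b)) has_real_derivative a2 x) (at 0)"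
      using w unfolding has_dderiv_def by blast+
    then show ?thesis unfolding qf_eq bil_def
      by (auto intro!: derivative_eq_intros simp: algebra_simps)
  qed
  have dJ: "((\<lambda>t. J (w1 (x + t *\<^sub>R b)) (w2 (x + t *\<^sub>R b))) has_real_derivative j1 x) (at 0)" for x
  proof -
    have pos: "1 + qf (w1 (x + 0 *\<^sub>R b)) (w2 (x + 0 *\<^sub>R b)) > 0"
      using qf_nonneg[of "w1 (x + 0 *\<^sub>R b)" "w2 (x + 0 *\<^sub>R b)"] by linarith
    have "((\<lambda>t. sqrt (1 + qf (w1 (x + t *\<^sub>R b)) (w2 (x + t *\<^sub>R b)))) has_real_derivative
        (inverse (sqrt (1 + qf (w1 (x + 0 *\<^sub>R b)) (w2 (x + 0 *\<^sub>R b)))) / 2) * (2 * bil (w1 x) (w2 x) (a1 x) (a2 x))) (at 0)"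
      by (rule DERIV_chain2[OF DERIV_real_sqrt[OF pos] dq])
    moreover have "(inverse (sqrt (1 + qf (w1 (x + 0 *\<^sub>R b)) (w2 (x + 0 *\<^sub>R b)))) / 2) * (2 * bil (w1 x) (w2 x) (a1 x) (a2 x)) = j1 x"
      by (simp add: j1_def J_def field_simps)
    ultimately show ?thesis unfolding J_def by (simp only:)
  qed
  then show "has_dderiv (\<lambda>x. J (w1 x) (w2 x)) b j1" unfolding has_dderiv_def by blast
  show "has_dderiv j1 b j2"
    unfolding has_dderiv_def
  proof
    fix x
    have d: "((\<lambda>t. w1 (x + t *\<^sub>R b)) has_real_derivative a1 x) (at 0)" "((\<lambda>t. w2 (x + t *\<^sub>R b)) has_real_derivative a2 x) (at 0)"
      "((\<lambda>t. a1 (x + t *\<^sub>R b)) has_real_derivative c1 x) (at 0)" "((\<lambda>t. a2 (x + t *\<^sub>R b)) has_real_derivative c2 x) (at 0)"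
      using w unfolding has_dderiv_def by blast+
    have db: "((\<lambda>t. bil (w1 (x + t *\<^sub>R b)) (w2 (x + t *\<^sub>R b)) (a1 (x + t *\<^sub>R b)) (a2 (x + t *\<^sub>R b))) has_real_derivative
        (qf (a1 x) (a2 x) + bil (w1 x) (w2 x) (c1 x) (c2 x))) (at 0)"
      unfolding qf_def bil_def using d
      by (auto intro!: derivative_eq_intros simp: algebra_simps add_divide_distrib)
    have nz: "J (w1 (x + 0 *\<^sub>R b)) (w2 (x + 0 *\<^sub>R b)) \<noteq> 0" using J_pos(2)[of "w1 (x + 0 *\<^sub>R b)" "w2 (x + 0 *\<^sub>R b)"] by (simp only: less_imp_neq[symmetric] not_False_eq_True)
    let ?Jx = "J (w1 x) (w2 x)" and ?B = "bil (w1 x) (w2 x) (a1 x) (a2 x)"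
      and ?A = "qf (a1 x) (a2 x) + bil (w1 x) (w2 x) (c1 x) (c2 x)"
    have J0: "?Jx \<noteq> 0" using nz by simp
    from DERIV_divide[OF db dJ nz]
    have "((\<lambda>t. j1 (x + t *\<^sub>R b)) has_real_derivative (?A * ?Jx - ?B * j1 x) / (?Jx * ?Jx)) (at 0)"
      by (simp add: j1_def)
    moreover have "?B = j1 x * ?Jx" using J0 by (simp add: j1_def)
    then have "(?A * ?Jx - ?B * j1 x) / (?Jx * ?Jx) = j2 x"
      using J0 by (simp add: j2_def power2_eq_square field_simps)
    ultimately show "((\<lambda>t. j1 (x + t *\<^sub>R b)) has_real_derivative j2 x) (at 0)" by simp
  qed
  have "(j1 x)\<^sup>2 \<le> qf (a1 x) (a2 x)"
  proof -
    have "(bil (w1 x) (w2 x) (a1 x) (a2 x))\<^sup>2 \<le> qf (w1 x) (w2 x) * qf (a1 x) (a2 x)" by (rule bil_cauchy)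
    also have "\<dots> \<le> (J (w1 x) (w2 x))\<^sup>2 * qf (a1 x) (a2 x)"
      unfolding J_pos(3) using qf_nonneg by (intro mult_right_mono) auto
    finally show ?thesis unfolding j1_def power_divide
      using J_pos(2)[of "w1 x" "w2 x"] by (simp add: divide_le_eq mult.commute)
  qed
  then show "bil (w1 x) (w2 x) (c1 x) (c2 x) / J (w1 x) (w2 x) \<le> j2 x"
    unfolding j2_def using J_pos(2)[of "w1 x" "w2 x"] by (intro divide_right_mono) auto
qed

text \<open>A Kato type inequality. For mollified functions it follows from Green's formula and the convexity of
  \<open>J\<close>, and it survives the limit because \<open>J\<close> is Lipschitz and \<open>bil w g / J w\<close> is bounded by a multiple of
  \<open>g\<close>. Subtracting \<open>1\<close> from \<open>J w\<close> is harmless since a Laplacian has integral zero, and it makes the left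
  factor vanish where \<open>w\<close> does.\<close>

lemma J_weakly_subharmonic:
  fixes w1 w2 g1 g2 :: "'a::euclidean_space \<Rightarrow> real"
  assumes w: "locally_integrable w1" "locally_integrable w2" and g: "locally_integrable g1" "locally_integrable g2"
    and cw: "continuous_on (- {0}) w1" "continuous_on (- {0}) w2"
    and cg: "continuous_on (- {0}) g1" "continuous_on (- {0}) g2"
    and eq: "laplace_eq_dirac w1 g1 0" "laplace_eq_dirac w2 g2 0"
    and \<zeta>: "test_function \<zeta>" and pos: "\<And>x. \<zeta> x \<ge> 0"
  shows "(LINT x|lborel. bil (w1 x) (w2 x) (g1 x) (g2 x) / J (w1 x) (w2 x) * \<zeta> x)
    \<le> (LINT x|lborel. (J (w1 x) (w2 x) - 1) * laplacian \<zeta> x)"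
proof -
  let ?W1 = "\<lambda>n. moll n w1" and ?W2 = "\<lambda>n. moll n w2" and ?G1 = "\<lambda>n. moll n g1" and ?G2 = "\<lambda>n. moll n g2"
  let ?L = "laplacian \<zeta>"
  have L: "test_function ?L" by (rule test_function_laplacian[OF \<zeta>])
  have cont_of: "v \<in> borel_measurable borel" if "locally_integrable v" for v :: "'a \<Rightarrow> real"
    using that by (rule locally_integrable_measurable)
  have [measurable]: "w1 \<in> borel_measurable borel" "w2 \<in> borel_measurable borel"
    "g1 \<in> borel_measurable borel" "g2 \<in> borel_measurable borel"
    using w g cont_of by blast+
  have [measurable]: "?W1 n \<in> borel_measurable borel" "?W2 n \<in> borel_measurable borel"
    "?G1 n \<in> borel_measurable borel" "?G2 n \<in> borel_measurable borel" for n
    by (intro cont_of moll_locally_integrable w g)+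
  have mJ: "(\<lambda>x. J (u x) (v x)) \<in> borel_measurable borel"
    if [measurable]: "u \<in> borel_measurable borel" "v \<in> borel_measurable borel" for u v :: "'a \<Rightarrow> real"
    unfolding J_def qf_def bil_def by measurable
  have mB: "(\<lambda>x. bil (u x) (v x) (s x) (t x) / J (u x) (v x)) \<in> borel_measurable borel"
    if [measurable]: "u \<in> borel_measurable borel" "v \<in> borel_measurable borel"
      "s \<in> borel_measurable borel" "t \<in> borel_measurable borel" for u v s t :: "'a \<Rightarrow> real"
    unfolding J_def qf_def bil_def by measurable
  have li_abs: "locally_integrable (\<lambda>x. qbound * (\<bar>u x\<bar> + \<bar>v x\<bar>))"
    if "locally_integrable u" "locally_integrable v" for u v :: "'a \<Rightarrow> real"
  proof -
    have a: "locally_integrable (\<lambda>x. \<bar>s x\<bar>)" if "locally_integrable s" for s :: "'a \<Rightarrow> real"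
      using that unfolding locally_integrable_def by (auto intro: set_integrable_abs)
    show ?thesis by (intro locally_integrable_cmult locally_integrable_add a that)
  qed
  have liJ: "locally_integrable (\<lambda>x. J (u x) (v x))"
    if u: "locally_integrable u" "locally_integrable v" for u v :: "'a \<Rightarrow> real"
  proof (rule locally_integrable_bound)
    show "locally_integrable (\<lambda>x. 1 + qbound * (\<bar>u x\<bar> + \<bar>v x\<bar>))"
      by (intro locally_integrable_add li_abs u locally_integrable_continuous continuous_on_const)
    show "(\<lambda>x. J (u x) (v x)) \<in> borel_measurable borel" by (intro mJ cont_of u)
    fix x
    have "J 0 0 = 1" by (simp add: J_def qf_eq)
    then show "\<bar>J (u x) (v x)\<bar> \<le> 1 + qbound * (\<bar>u x\<bar> + \<bar>v x\<bar>)"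
      using J_lipschitz[of "u x" "v x" 0 0] by simp
  qed
  have liB: "locally_integrable (\<lambda>x. bil (u x) (v x) (s x) (t x) / J (u x) (v x))"
    if "locally_integrable u" "locally_integrable v" "locally_integrable s" "locally_integrable t" for u v s t :: "'a \<Rightarrow> real"
    by (rule locally_integrable_bound[OF li_abs[OF that(3,4)]]) (intro mB cont_of that, rule bil_div_J)
  have Wi: "locally_integrable (?W1 n)" "locally_integrable (?W2 n)" "locally_integrable (?G1 n)" "locally_integrable (?G2 n)" for n
    by (intro moll_locally_integrable w g)+
  have classical: "(LINT x|lborel. bil (?W1 n x) (?W2 n x) (?G1 n x) (?G2 n x) / J (?W1 n x) (?W2 n x) * \<zeta> x)
      \<le> (LINT x|lborel. J (?W1 n x) (?W2 n x) * ?L x)" for n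
  proof -
    obtain a1 c1 where 1: "\<And>b. b \<in> Basis \<Longrightarrow> has_dderiv (?W1 n) b (a1 b)"
      "\<And>b. b \<in> Basis \<Longrightarrow> has_dderiv (a1 b) b (c1 b)"
      "\<And>b. b \<in> Basis \<Longrightarrow> continuous_on UNIV (a1 b)" "\<And>b. b \<in> Basis \<Longrightarrow> continuous_on UNIV (c1 b)"
      "\<And>x. (\<Sum>b\<in>Basis. c1 b x) = ?G1 n x" using moll_weak_laplacian[OF w(1) eq(1)] by metis
    obtain a2 c2 where 2: "\<And>b. b \<in> Basis \<Longrightarrow> has_dderiv (?W2 n) b (a2 b)"
      "\<And>b. b \<in> Basis \<Longrightarrow> has_dderiv (a2 b) b (c2 b)"
      "\<And>b. b \<in> Basis \<Longrightarrow> continuous_on UNIV (a2 b)" "\<And>b. b \<in> Basis \<Longrightarrow> continuous_on UNIV (c2 b)"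
      "\<And>x. (\<Sum>b\<in>Basis. c2 b x) = ?G2 n x" using moll_weak_laplacian[OF w(2) eq(2)] by metis
    note cW = moll_continuous[OF w(1), of n] moll_continuous[OF w(2), of n]
    have Jnz: "J (?W1 n x) (?W2 n x) \<noteq> 0" for x using J_pos(2)[of "?W1 n x" "?W2 n x"] by simp
    define j1 where "j1 b x = bil (?W1 n x) (?W2 n x) (a1 b x) (a2 b x) / J (?W1 n x) (?W2 n x)" for b x
    define j2 where "j2 b x = (qf (a1 b x) (a2 b x) + bil (?W1 n x) (?W2 n x) (c1 b x) (c2 b x) - (j1 b x)\<^sup>2) / J (?W1 n x) (?W2 n x)" for b x
    have cJ: "continuous_on UNIV (\<lambda>x. J (?W1 n x) (?W2 n x))"
      unfolding J_def qf_def bil_def by (intro continuous_intros cW) auto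
    have cj1: "continuous_on UNIV (j1 b)" if b: "b \<in> Basis" for b
      unfolding j1_def[abs_def]
      by (intro continuous_on_divide cJ) (use Jnz in \<open>auto simp: bil_def intro!: continuous_intros cW 1(3)[OF b] 2(3)[OF b]\<close>)
    have cj2: "continuous_on UNIV (j2 b)" if b: "b \<in> Basis" for b
      unfolding j2_def[abs_def]
      by (intro continuous_on_divide cJ continuous_on_diff continuous_on_add continuous_on_power cj1[OF b])
        (use Jnz in \<open>auto simp: bil_def qf_def intro!: continuous_intros cW 1(3,4)[OF b] 2(3,4)[OF b]\<close>)
    have J: "has_dderiv (\<lambda>x. J (?W1 n x) (?W2 n x)) b (j1 b)" "has_dderiv (j1 b) b (j2 b)"
      "bil (?W1 n x) (?W2 n x) (c1 b x) (c2 b x) / J (?W1 n x) (?W2 n x) \<le> j2 b x" if b: "b \<in> Basis" for b x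
      using J_second_derivative[OF 1(1)[OF b] 2(1)[OF b] 1(2)[OF b] 2(2)[OF b]]
      unfolding j1_def[abs_def] j2_def[abs_def] by blast+
    have "(LINT x|lborel. J (?W1 n x) (?W2 n x) * ?L x) = (LINT x|lborel. (\<Sum>b\<in>Basis. j2 b x) * \<zeta> x)"
      by (rule green_formula[OF \<zeta> J(1,2) cJ cj1 cj2])
    also have "\<dots> \<ge> (LINT x|lborel. bil (?W1 n x) (?W2 n x) (?G1 n x) (?G2 n x) / J (?W1 n x) (?W2 n x) * \<zeta> x)"
    proof (rule integral_mono)
      show "integrable lborel (\<lambda>x. bil (?W1 n x) (?W2 n x) (?G1 n x) (?G2 n x) / J (?W1 n x) (?W2 n x) * \<zeta> x)"
        by (intro integrable_test_mult liB Wi \<zeta>)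
      show "integrable lborel (\<lambda>x. (\<Sum>b\<in>Basis. j2 b x) * \<zeta> x)"
        by (intro integrable_test_mult \<zeta> locally_integrable_continuous continuous_on_sum cj2)
      fix x
      have "bil (?W1 n x) (?W2 n x) (?G1 n x) (?G2 n x) = (\<Sum>b\<in>Basis. bil (?W1 n x) (?W2 n x) (c1 b x) (c2 b x))"
        unfolding 1(5)[symmetric] 2(5)[symmetric] bil_def
        by (simp add: sum.distrib sum_distrib_left sum_subtractf sum_divide_distrib right_diff_distrib)
      then have "bil (?W1 n x) (?W2 n x) (?G1 n x) (?G2 n x) / J (?W1 n x) (?W2 n x)
          = (\<Sum>b\<in>Basis. bil (?W1 n x) (?W2 n x) (c1 b x) (c2 b x) / J (?W1 n x) (?W2 n x))"
        by (simp add: sum_divide_distrib)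
      also have "\<dots> \<le> (\<Sum>b\<in>Basis. j2 b x)" by (intro sum_mono J(3))
      finally show "bil (?W1 n x) (?W2 n x) (?G1 n x) (?G2 n x) / J (?W1 n x) (?W2 n x) * \<zeta> x \<le> (\<Sum>b\<in>Basis. j2 b x) * \<zeta> x"
        using pos by (rule mult_right_mono)
    qed
    finally show ?thesis .
  qed
  note conv = moll_converge[OF w(1) cw(1) L] moll_converge[OF w(2) cw(2) L]
    moll_converge[OF g(1) cg(1) \<zeta>] moll_converge[OF g(2) cg(2) \<zeta>]
  have limJ: "(\<lambda>n. LINT x|lborel. J (?W1 n x) (?W2 n x) * ?L x) \<longlonglongrightarrow> (LINT x|lborel. J (w1 x) (w2 x) * ?L x)"
  proof (rule LIM_zero_cancel, rule Lim_null_comparison[OF always_eventually, OF allI])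
    fix n
    let ?a = "\<lambda>x. \<bar>?W1 n x - w1 x\<bar> * \<bar>?L x\<bar>" and ?b = "\<lambda>x. \<bar>?W2 n x - w2 x\<bar> * \<bar>?L x\<bar>"
    have iab: "integrable lborel ?a" "integrable lborel ?b"
      by (intro integrable_test_mult_abs locally_integrable_diff Wi w L)+
    have i1: "integrable lborel (\<lambda>x. J (?W1 n x) (?W2 n x) * ?L x)" and i2: "integrable lborel (\<lambda>x. J (w1 x) (w2 x) * ?L x)"
      by (intro integrable_test_mult liJ Wi w L)+
    have "norm ((LINT x|lborel. J (?W1 n x) (?W2 n x) * ?L x) - (LINT x|lborel. J (w1 x) (w2 x) * ?L x))
        = \<bar>LINT x|lborel. J (?W1 n x) (?W2 n x) * ?L x - J (w1 x) (w2 x) * ?L x\<bar>"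
      using Bochner_Integration.integral_diff[OF i1 i2] by simp
    also have "\<dots> \<le> (LINT x|lborel. \<bar>J (?W1 n x) (?W2 n x) * ?L x - J (w1 x) (w2 x) * ?L x\<bar>)"
      by (rule integral_abs_bound)
    also have "\<dots> \<le> (LINT x|lborel. qbound * (?a x + ?b x))"
    proof (rule integral_mono)
      show "integrable lborel (\<lambda>x. \<bar>J (?W1 n x) (?W2 n x) * ?L x - J (w1 x) (w2 x) * ?L x\<bar>)"
        by (intro integrable_abs Bochner_Integration.integrable_diff i1 i2)
      show "integrable lborel (\<lambda>x. qbound * (?a x + ?b x))"
        by (intro integrable_mult_right Bochner_Integration.integrable_add iab)
      fix x
      have "\<bar>J (?W1 n x) (?W2 n x) - J (w1 x) (w2 x)\<bar> * \<bar>?L x\<bar> \<le> (qbound * (\<bar>?W1 n x - w1 x\<bar> + \<bar>?W2 n x - w2 x\<bar>)) * \<bar>?L x\<bar>"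
        by (intro mult_right_mono J_lipschitz) auto
      moreover have "J (?W1 n x) (?W2 n x) * ?L x - J (w1 x) (w2 x) * ?L x = (J (?W1 n x) (?W2 n x) - J (w1 x) (w2 x)) * ?L x"
        by (simp add: left_diff_distrib)
      ultimately show "\<bar>J (?W1 n x) (?W2 n x) * ?L x - J (w1 x) (w2 x) * ?L x\<bar> \<le> qbound * (?a x + ?b x)"
        by (simp add: abs_mult distrib_right mult.assoc)
    qed
    also have "\<dots> = qbound * ((LINT x|lborel. ?a x) + (LINT x|lborel. ?b x))"
      by (simp only: Bochner_Integration.integral_mult_right_zero Bochner_Integration.integral_add[OF iab])
    finally show "norm ((LINT x|lborel. J (?W1 n x) (?W2 n x) * ?L x) - (LINT x|lborel. J (w1 x) (w2 x) * ?L x))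
        \<le> qbound * ((LINT x|lborel. ?a x) + (LINT x|lborel. ?b x))" .
  next
    have "(\<lambda>n. qbound * ((LINT x|lborel. \<bar>?W1 n x - w1 x\<bar> * \<bar>?L x\<bar>) + (LINT x|lborel. \<bar>?W2 n x - w2 x\<bar> * \<bar>?L x\<bar>)))
        \<longlonglongrightarrow> qbound * (0 + 0)" by (intro tendsto_intros conv)
    then show "(\<lambda>n. qbound * ((LINT x|lborel. \<bar>?W1 n x - w1 x\<bar> * \<bar>?L x\<bar>) + (LINT x|lborel. \<bar>?W2 n x - w2 x\<bar> * \<bar>?L x\<bar>)))
        \<longlonglongrightarrow> 0" by simp
  qed
  \<comment> \<open>Replacing the mollified \<open>g\<close> by \<open>g\<close> costs an \<open>L\<^sup>1\<close> error; afterwards \<open>g\<close> itself provides a dominating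
    function for the pointwise convergence in \<open>w\<close>.\<close>
  have lim1: "(\<lambda>n. LINT x|lborel. bil (?W1 n x) (?W2 n x) (?G1 n x - g1 x) (?G2 n x - g2 x) / J (?W1 n x) (?W2 n x) * \<zeta> x) \<longlonglongrightarrow> 0"
  proof (rule Lim_null_comparison[OF always_eventually, OF allI])
    fix n
    let ?a = "\<lambda>x. \<bar>?G1 n x - g1 x\<bar> * \<bar>\<zeta> x\<bar>" and ?b = "\<lambda>x. \<bar>?G2 n x - g2 x\<bar> * \<bar>\<zeta> x\<bar>"
    let ?B = "\<lambda>x. bil (?W1 n x) (?W2 n x) (?G1 n x - g1 x) (?G2 n x - g2 x) / J (?W1 n x) (?W2 n x)"
    have iab: "integrable lborel ?a" "integrable lborel ?b"
      by (intro integrable_test_mult_abs locally_integrable_diff Wi g \<zeta>)+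
    have iB: "integrable lborel (\<lambda>x. ?B x * \<zeta> x)"
      by (intro integrable_test_mult liB locally_integrable_diff Wi g \<zeta>)
    have "norm (LINT x|lborel. ?B x * \<zeta> x) \<le> (LINT x|lborel. \<bar>?B x * \<zeta> x\<bar>)"
      unfolding real_norm_def by (rule integral_abs_bound)
    also have "\<dots> \<le> (LINT x|lborel. qbound * (?a x + ?b x))"
    proof (rule integral_mono[OF integrable_abs[OF iB]])
      show "integrable lborel (\<lambda>x. qbound * (?a x + ?b x))"
        by (intro integrable_mult_right Bochner_Integration.integrable_add iab)
      fix x
      have "\<bar>?B x\<bar> * \<bar>\<zeta> x\<bar> \<le> (qbound * (\<bar>?G1 n x - g1 x\<bar> + \<bar>?G2 n x - g2 x\<bar>)) * \<bar>\<zeta> x\<bar>"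
        by (intro mult_right_mono bil_div_J) auto
      then show "\<bar>?B x * \<zeta> x\<bar> \<le> qbound * (?a x + ?b x)"
        by (simp only: abs_mult distrib_right mult.assoc)
    qed
    also have "\<dots> = qbound * ((LINT x|lborel. ?a x) + (LINT x|lborel. ?b x))"
      by (simp only: Bochner_Integration.integral_mult_right_zero Bochner_Integration.integral_add[OF iab])
    finally show "norm (LINT x|lborel. ?B x * \<zeta> x) \<le> qbound * ((LINT x|lborel. ?a x) + (LINT x|lborel. ?b x))" .
  next
    have "(\<lambda>n. qbound * ((LINT x|lborel. \<bar>?G1 n x - g1 x\<bar> * \<bar>\<zeta> x\<bar>) + (LINT x|lborel. \<bar>?G2 n x - g2 x\<bar> * \<bar>\<zeta> x\<bar>)))
        \<longlonglongrightarrow> qbound * (0 + 0)" by (intro tendsto_intros conv)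
    then show "(\<lambda>n. qbound * ((LINT x|lborel. \<bar>?G1 n x - g1 x\<bar> * \<bar>\<zeta> x\<bar>) + (LINT x|lborel. \<bar>?G2 n x - g2 x\<bar> * \<bar>\<zeta> x\<bar>)))
        \<longlonglongrightarrow> 0" by simp
  qed
  have lim2: "(\<lambda>n. LINT x|lborel. bil (?W1 n x) (?W2 n x) (g1 x) (g2 x) / J (?W1 n x) (?W2 n x) * \<zeta> x)
      \<longlonglongrightarrow> (LINT x|lborel. bil (w1 x) (w2 x) (g1 x) (g2 x) / J (w1 x) (w2 x) * \<zeta> x)"
  proof (rule integral_dominated_convergence[where w = "\<lambda>x. \<bar>(qbound * (\<bar>g1 x\<bar> + \<bar>g2 x\<bar>)) * \<zeta> x\<bar>"])
    show "integrable lborel (\<lambda>x. \<bar>(qbound * (\<bar>g1 x\<bar> + \<bar>g2 x\<bar>)) * \<zeta> x\<bar>)"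
      by (intro integrable_abs integrable_test_mult li_abs g \<zeta>)
    show "(\<lambda>x. bil (w1 x) (w2 x) (g1 x) (g2 x) / J (w1 x) (w2 x) * \<zeta> x) \<in> borel_measurable lborel"
      by (intro borel_measurable_integrable integrable_test_mult liB w g \<zeta>)
    show "(\<lambda>x. bil (?W1 n x) (?W2 n x) (g1 x) (g2 x) / J (?W1 n x) (?W2 n x) * \<zeta> x) \<in> borel_measurable lborel" for n
      by (intro borel_measurable_integrable integrable_test_mult liB Wi g \<zeta>)
    have pt: "(\<lambda>n. bil (?W1 n x) (?W2 n x) (g1 x) (g2 x) / J (?W1 n x) (?W2 n x) * \<zeta> x)
        \<longlonglongrightarrow> bil (w1 x) (w2 x) (g1 x) (g2 x) / J (w1 x) (w2 x) * \<zeta> x" if "x \<noteq> 0" for x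
    proof -
      have "isCont w1 x" "isCont w2 x"
        using cw that by (simp_all add: continuous_on_eq_continuous_at open_Compl)
      then have t: "(\<lambda>n. ?W1 n x) \<longlonglongrightarrow> w1 x" "(\<lambda>n. ?W2 n x) \<longlonglongrightarrow> w2 x"
        using moll_tendsto w by blast+
      have "sqrt (1 + qf (w1 x) (w2 x)) \<noteq> 0" using J_pos(2)[of "w1 x" "w2 x"] by (simp add: J_def)
      then show ?thesis unfolding J_def qf_def bil_def by (intro tendsto_intros t) (auto simp: qf_def bil_def)
    qed
    have "AE x in lborel. x \<noteq> (0::'a)" by (rule AE_lborel_singleton)
    then show "AE x in lborel. (\<lambda>n. bil (?W1 n x) (?W2 n x) (g1 x) (g2 x) / J (?W1 n x) (?W2 n x) * \<zeta> x)
        \<longlonglongrightarrow> bil (w1 x) (w2 x) (g1 x) (g2 x) / J (w1 x) (w2 x) * \<zeta> x"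
      by eventually_elim (rule pt)
    have "norm (bil (?W1 n x) (?W2 n x) (g1 x) (g2 x) / J (?W1 n x) (?W2 n x) * \<zeta> x)
        \<le> \<bar>(qbound * (\<bar>g1 x\<bar> + \<bar>g2 x\<bar>)) * \<zeta> x\<bar>" for n x
    proof -
      have "\<bar>bil (?W1 n x) (?W2 n x) (g1 x) (g2 x) / J (?W1 n x) (?W2 n x)\<bar> \<le> \<bar>qbound * (\<bar>g1 x\<bar> + \<bar>g2 x\<bar>)\<bar>"
        by (rule order_trans[OF bil_div_J abs_ge_self])
      then show ?thesis unfolding real_norm_def abs_mult[of _ "\<zeta> x"] by (rule mult_right_mono) simp
    qed
    then show "AE x in lborel. norm (bil (?W1 n x) (?W2 n x) (g1 x) (g2 x) / J (?W1 n x) (?W2 n x) * \<zeta> x)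
        \<le> \<bar>(qbound * (\<bar>g1 x\<bar> + \<bar>g2 x\<bar>)) * \<zeta> x\<bar>" for n by simp
  qed
  have split: "(LINT x|lborel. bil (?W1 n x) (?W2 n x) (?G1 n x) (?G2 n x) / J (?W1 n x) (?W2 n x) * \<zeta> x)
      = (LINT x|lborel. bil (?W1 n x) (?W2 n x) (?G1 n x - g1 x) (?G2 n x - g2 x) / J (?W1 n x) (?W2 n x) * \<zeta> x)
      + (LINT x|lborel. bil (?W1 n x) (?W2 n x) (g1 x) (g2 x) / J (?W1 n x) (?W2 n x) * \<zeta> x)" for n
  proof -
    have "bil (?W1 n x) (?W2 n x) (?G1 n x) (?G2 n x) / J (?W1 n x) (?W2 n x) * \<zeta> x
      = bil (?W1 n x) (?W2 n x) (?G1 n x - g1 x) (?G2 n x - g2 x) / J (?W1 n x) (?W2 n x) * \<zeta> x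
      + bil (?W1 n x) (?W2 n x) (g1 x) (g2 x) / J (?W1 n x) (?W2 n x) * \<zeta> x" for x
    proof -
      have "bil (?W1 n x) (?W2 n x) (?G1 n x) (?G2 n x)
        = bil (?W1 n x) (?W2 n x) (?G1 n x - g1 x) (?G2 n x - g2 x) + bil (?W1 n x) (?W2 n x) (g1 x) (g2 x)"
        unfolding bil_def by (simp add: algebra_simps diff_divide_distrib add_divide_distrib)
      then show ?thesis by (simp only: add_divide_distrib distrib_right)
    qed
    then show ?thesis
      by (simp only:) (intro Bochner_Integration.integral_add integrable_test_mult liB locally_integrable_diff Wi g \<zeta>)
  qed
  have limB: "(\<lambda>n. LINT x|lborel. bil (?W1 n x) (?W2 n x) (?G1 n x) (?G2 n x) / J (?W1 n x) (?W2 n x) * \<zeta> x)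
      \<longlonglongrightarrow> (LINT x|lborel. bil (w1 x) (w2 x) (g1 x) (g2 x) / J (w1 x) (w2 x) * \<zeta> x)"
    unfolding split using tendsto_add[OF lim1 lim2] by simp
  have "(LINT x|lborel. bil (w1 x) (w2 x) (g1 x) (g2 x) / J (w1 x) (w2 x) * \<zeta> x)
      \<le> (LINT x|lborel. J (w1 x) (w2 x) * ?L x)"
    by (rule LIMSEQ_le[OF limB limJ]) (use classical in auto)
  also have "\<dots> = (LINT x|lborel. (J (w1 x) (w2 x) - 1) * ?L x)"
    unfolding left_diff_distrib
    using Bochner_Integration.integral_diff[OF integrable_test_mult[OF liJ[OF w] L] test_function_integrable[OF L]]
      laplacian_integral_zero[OF \<zeta>] by simp
  finally show ?thesis .
qed

text \<open>The strengths \<open>c1\<close> and \<open>c2\<close> of the Dirac masses are arbitrary: they cancel in the difference of two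
  solutions.\<close>

definition weak_solution :: "real \<Rightarrow> real \<Rightarrow> (real^2 \<Rightarrow> real) \<Rightarrow> (real^2 \<Rightarrow> real) \<Rightarrow> bool"
  where "weak_solution c1 c2 u1 u2 \<longleftrightarrow>
    continuous_on (- {0}) u1 \<and> continuous_on (- {0}) u2 \<and>
    locally_integrable u1 \<and> locally_integrable u2 \<and>
    locally_integrable (\<lambda>x. exp (2 * u1 x)) \<and> locally_integrable (\<lambda>x. exp (2 * u2 x)) \<and>
    laplace_eq_dirac u1 (\<lambda>x. rhs1 (exp (2 * u1 x) - 1) (exp (2 * u2 x) - 1)) c1 \<and>
    laplace_eq_dirac u2 (\<lambda>x. rhs2 (exp (2 * u1 x) - 1) (exp (2 * u2 x) - 1)) c2 \<and>
    (u1 \<longlongrightarrow> 0) at_infinity \<and> (u2 \<longlongrightarrow> 0) at_infinity"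

lemma locally_integrable_rhs:
  fixes a b :: "'a::euclidean_space \<Rightarrow> real"
  assumes "locally_integrable a" "locally_integrable b"
  shows "locally_integrable (\<lambda>x. rhs1 (a x) (b x))" "locally_integrable (\<lambda>x. rhs2 (a x) (b x))"
  unfolding rhs1_def rhs2_def by (intro locally_integrable_add locally_integrable_cmult assms)+

lemma exp_diff_mult_pos: "0 < (x - y) * (exp (2 * x) - exp (2 * y))" if "x \<noteq> y" for x y :: real
proof (cases "x < y")
  case True
  then show ?thesis by (intro mult_neg_neg) auto
next
  case False
  then show ?thesis using that by (intro mult_pos_pos) auto
qed

text \<open>The pairing \<open>G\<close> of the difference with the difference of the right-hand sides is nonnegative, and positive
  wherever the two solutions differ. By the Kato type inequality its integral against a stretched bump
  function is bounded by a quantity that tends to zero, so \<open>G\<close> vanishes almost everywhere; being continuous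
  away from the origin, it vanishes there identically.\<close>

theorem weak_solution_unique:
  assumes u: "weak_solution k1 k2 u1 u2" and v: "weak_solution k1 k2 v1 v2" and x: "x \<noteq> 0"
  shows "v1 x = u1 x \<and> v2 x = u2 x"
proof -
  note U = u[unfolded weak_solution_def] and V = v[unfolded weak_solution_def]
  define w1 where "w1 x = v1 x - u1 x" for x
  define w2 where "w2 x = v2 x - u2 x" for x
  define a where "a x = exp (2 * v1 x) - exp (2 * u1 x)" for x
  define b where "b x = exp (2 * v2 x) - exp (2 * u2 x)" for x
  define g1 where "g1 x = rhs1 (a x) (b x)" for x
  define g2 where "g2 x = rhs2 (a x) (b x)" for x
  have li1: "locally_integrable (\<lambda>x::real^2. 1 :: real)" by (intro locally_integrable_continuous continuous_on_const)
  have w: "locally_integrable w1" "locally_integrable w2"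
    unfolding w1_def[abs_def] w2_def[abs_def] using U V by (auto intro: locally_integrable_diff)
  have ab: "locally_integrable a" "locally_integrable b"
    unfolding a_def[abs_def] b_def[abs_def] using U V by (auto intro: locally_integrable_diff)
  have g: "locally_integrable g1" "locally_integrable g2"
    unfolding g1_def[abs_def] g2_def[abs_def] by (intro locally_integrable_rhs ab)+
  have cw: "continuous_on (- {0}) w1" "continuous_on (- {0}) w2"
    unfolding w1_def[abs_def] w2_def[abs_def] using U V by (auto intro: continuous_on_diff)
  have cab: "continuous_on (- {0}) a" "continuous_on (- {0}) b"
    unfolding a_def[abs_def] b_def[abs_def] using U V by (auto intro!: continuous_intros)
  have cg: "continuous_on (- {0}) g1" "continuous_on (- {0}) g2"
    unfolding g1_def[abs_def] g2_def[abs_def] rhs1_def rhs2_def by (intro continuous_intros cab)+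
  have lf: "locally_integrable (\<lambda>x. rhs1 (exp (2 * s x) - 1) (exp (2 * t x) - 1))"
    "locally_integrable (\<lambda>x. rhs2 (exp (2 * s x) - 1) (exp (2 * t x) - 1))"
    if "locally_integrable (\<lambda>x. exp (2 * s x))" "locally_integrable (\<lambda>x. exp (2 * t x))" for s t :: "real^2 \<Rightarrow> real"
    by (intro locally_integrable_rhs locally_integrable_diff that li1)+
  have "laplace_eq_dirac (\<lambda>x. v1 x - u1 x) (\<lambda>x. rhs1 (exp (2 * v1 x) - 1) (exp (2 * v2 x) - 1) - rhs1 (exp (2 * u1 x) - 1) (exp (2 * u2 x) - 1)) 0"
    "laplace_eq_dirac (\<lambda>x. v2 x - u2 x) (\<lambda>x. rhs2 (exp (2 * v1 x) - 1) (exp (2 * v2 x) - 1) - rhs2 (exp (2 * u1 x) - 1) (exp (2 * u2 x) - 1)) 0"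
    using U V by (auto intro!: laplace_eq_dirac_diff lf)
  moreover have "rhs1 (exp (2 * v1 x) - 1) (exp (2 * v2 x) - 1) - rhs1 (exp (2 * u1 x) - 1) (exp (2 * u2 x) - 1) = g1 x"
    "rhs2 (exp (2 * v1 x) - 1) (exp (2 * v2 x) - 1) - rhs2 (exp (2 * u1 x) - 1) (exp (2 * u2 x) - 1) = g2 x" for x
    by (simp_all add: g1_def g2_def a_def b_def rhs1_def rhs2_def algebra_simps diff_divide_distrib)
  ultimately have eq: "laplace_eq_dirac w1 g1 0" "laplace_eq_dirac w2 g2 0"
    unfolding w1_def[abs_def] w2_def[abs_def] by (simp_all only:)
  define G where "G x = bil (w1 x) (w2 x) (g1 x) (g2 x) / J (w1 x) (w2 x)" for x
  have bil_eq: "bil (w1 x) (w2 x) (g1 x) (g2 x) = (\<alpha> + \<beta>) / 2 * (w1 x * a x + d * (w2 x * b x))" for x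
    unfolding g1_def g2_def by (rule bil_rhs)
  have mono: "w1 x * a x \<ge> 0" "w2 x * b x \<ge> 0" "w1 x \<noteq> 0 \<Longrightarrow> w1 x * a x > 0" "w2 x \<noteq> 0 \<Longrightarrow> w2 x * b x > 0" for x
    using exp_diff_mult_pos[of "v1 x" "u1 x"] exp_diff_mult_pos[of "v2 x" "u2 x"]
    by (cases "v1 x = u1 x"; cases "v2 x = u2 x"; simp add: w1_def w2_def a_def b_def)+
  have G0: "G x \<ge> 0" for x
  proof -
    have "d \<ge> 0" using d1 by simp
    then have "d * (w2 x * b x) \<ge> 0" using mono(2)[of x] by (rule mult_nonneg_nonneg)
    then have "w1 x * a x + d * (w2 x * b x) \<ge> 0" using mono(1)[of x] by linarith
    then show ?thesis unfolding G_def bil_eq using a0 b0 J_pos(2)[of "w1 x" "w2 x"] by simp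
  qed
  have Gpos: "G x > 0" if "w1 x \<noteq> 0 \<or> w2 x \<noteq> 0" for x
  proof -
    have "w2 x * b x \<le> d * (w2 x * b x)" using mono(2)[of x] d1 by (simp add: mult_le_cancel_right1)
    then have "w1 x * a x + d * (w2 x * b x) > 0" using mono[of x] that by (auto intro: add_pos_nonneg add_nonneg_pos)
    then show ?thesis unfolding G_def bil_eq using a0 b0 J_pos(2)[of "w1 x" "w2 x"] by simp
  qed
  have Jnz: "J (w1 x) (w2 x) \<noteq> 0" for x using J_pos(2)[of "w1 x" "w2 x"] by simp
  have cG: "continuous_on (- {0}) G"
    unfolding G_def[abs_def]
  proof (rule continuous_on_divide)
    show "continuous_on (- {0}) (\<lambda>x. bil (w1 x) (w2 x) (g1 x) (g2 x))"
      unfolding bil_def by (intro continuous_intros cw cg) auto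
    show "continuous_on (- {0}) (\<lambda>x. J (w1 x) (w2 x))"
      unfolding J_def qf_def bil_def by (intro continuous_intros cw) auto
  qed (use Jnz in simp)
  have mG: "G \<in> borel_measurable borel"
  proof -
    have [measurable]: "w1 \<in> borel_measurable borel" "w2 \<in> borel_measurable borel"
      "g1 \<in> borel_measurable borel" "g2 \<in> borel_measurable borel"
      by (intro locally_integrable_measurable w g)+
    show ?thesis unfolding G_def[abs_def] J_def qf_def bil_def by measurable
  qed
  have li_abs: "locally_integrable (\<lambda>x. \<bar>s x\<bar>)" if "locally_integrable s" for s :: "real^2 \<Rightarrow> real"
    using that unfolding locally_integrable_def by (auto intro: set_integrable_abs)
  have liG: "locally_integrable G"
  proof (rule locally_integrable_bound[OF _ mG])
    show "locally_integrable (\<lambda>x. qbound * (\<bar>g1 x\<bar> + \<bar>g2 x\<bar>))"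
      by (intro locally_integrable_cmult locally_integrable_add li_abs g)
    show "\<bar>G x\<bar> \<le> qbound * (\<bar>g1 x\<bar> + \<bar>g2 x\<bar>)" for x unfolding G_def by (rule bil_div_J)
  qed
  define h where "h x = J (w1 x) (w2 x) - 1" for x
  have lih: "locally_integrable h"
  proof (rule locally_integrable_bound)
    show "locally_integrable (\<lambda>x. qbound * (\<bar>w1 x\<bar> + \<bar>w2 x\<bar>))"
      by (intro locally_integrable_cmult locally_integrable_add li_abs w)
    have [measurable]: "w1 \<in> borel_measurable borel" "w2 \<in> borel_measurable borel"
      by (intro locally_integrable_measurable w)+
    show "h \<in> borel_measurable borel" unfolding h_def[abs_def] J_def qf_def bil_def by measurable
    have "J 0 0 = 1" by (simp add: J_def qf_eq)
    then show "\<bar>h x\<bar> \<le> qbound * (\<bar>w1 x\<bar> + \<bar>w2 x\<bar>)" for x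
      using J_lipschitz[of "w1 x" "w2 x" 0 0] by (simp add: h_def)
  qed
  have limw: "(w1 \<longlongrightarrow> 0) at_infinity" "(w2 \<longlongrightarrow> 0) at_infinity"
    unfolding w1_def[abs_def] w2_def[abs_def] using U V by (auto intro: tendsto_eq_intros)
  have "((\<lambda>x. J (w1 x) (w2 x) - 1) \<longlongrightarrow> J 0 0 - 1) at_infinity"
    unfolding J_def qf_def bil_def by (intro tendsto_intros limw) auto
  then have limh: "(h \<longlongrightarrow> 0) at_infinity" unfolding h_def[abs_def] by (simp add: J_def qf_eq)
  define \<zeta> where "\<zeta> n y = bump ((1 / real (Suc n)) *\<^sub>R y)" for n :: nat and y :: "real^2"
  have t\<zeta>: "test_function (\<zeta> n)" for n
    using test_function_scale[OF test_function_bump, of "1 / real (Suc n)" 1 0] unfolding \<zeta>_def[abs_def] by simp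
  have ineq: "(LINT x|lborel. G x * \<zeta> n x) \<le> (LINT x|lborel. h x * laplacian (\<zeta> n) x)" for n
    unfolding G_def h_def by (rule J_weakly_subharmonic[OF w g cw cg eq t\<zeta>]) (simp add: \<zeta>_def bump_props)
  have lim0: "(\<lambda>n. LINT x|lborel. h x * laplacian (\<zeta> n) x) \<longlonglongrightarrow> 0"
    unfolding \<zeta>_def[abs_def] by (rule scaled_laplacian_limit[OF lih limh test_function_bump])
  obtain C where C: "\<And>z::real^2. \<bar>bump z\<bar> \<le> C" using test_function_bounded[OF test_function_bump] by blast
  \<comment> \<open>The integrability of \<open>G\<close> over the plane is not known in advance, hence the restriction to balls.\<close>
  have ae: "AE x in lborel. indicator (cball 0 m) x * G x = (0::real)" for m :: real
  proof -
    have iG: "integrable lborel (\<lambda>x. indicator (cball 0 m) x * G x)"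
      by (rule locally_integrable_indicator[OF liG compact_cball])
    have le: "(LINT x|lborel. (indicator (cball 0 m) x * G x) * \<zeta> n x) \<le> (LINT x|lborel. h x * laplacian (\<zeta> n) x)" for n
    proof -
      have "(LINT x|lborel. (indicator (cball 0 m) x * G x) * \<zeta> n x) \<le> (LINT x|lborel. G x * \<zeta> n x)"
      proof (rule integral_mono)
        have "locally_integrable (\<lambda>x. indicator (cball 0 m) x * G x)"
          unfolding locally_integrable_def set_integrable_def
        proof (intro allI impI)
          fix K :: "(real^2) set" assume "compact K"
          then have "K \<in> sets lborel" by (simp add: borel_compact)
          then show "integrable lborel (\<lambda>x. indicator K x *\<^sub>R (indicator (cball 0 m) x * G x))"
            by (rule integrable_mult_indicator[OF _ iG])
        qed
        then show "integrable lborel (\<lambda>x. (indicator (cball 0 m) x * G x) * \<zeta> n x)"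
          by (rule integrable_test_mult[OF _ t\<zeta>])
        show "integrable lborel (\<lambda>x. G x * \<zeta> n x)" by (rule integrable_test_mult[OF liG t\<zeta>])
        show "(indicator (cball 0 m) x * G x) * \<zeta> n x \<le> G x * \<zeta> n x" for x
          using G0[of x] by (auto simp: indicator_def \<zeta>_def bump_props)
      qed
      then show ?thesis using ineq[of n] by linarith
    qed
    have "(\<lambda>n. LINT x|lborel. (indicator (cball 0 m) x * G x) * \<zeta> n x) \<longlonglongrightarrow> (LINT x|lborel. (indicator (cball 0 m) x * G x) * bump (0::real^2))"
    proof (rule integral_dominated_convergence[where w = "\<lambda>x. C * \<bar>indicator (cball 0 m) x * G x\<bar>"])
      show "integrable lborel (\<lambda>x. C * \<bar>indicator (cball 0 m) x * G x\<bar>)"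
        by (intro integrable_mult_right integrable_abs iG)
      show "(\<lambda>x. (indicator (cball 0 m) x * G x) * bump (0::real^2)) \<in> borel_measurable lborel"
        by (rule borel_measurable_times[OF borel_measurable_integrable[OF iG] borel_measurable_const])
      show "(\<lambda>x. (indicator (cball 0 m) x * G x) * \<zeta> n x) \<in> borel_measurable lborel" for n
        by (rule borel_measurable_times[OF borel_measurable_integrable[OF iG] borel_measurable_integrable[OF test_function_integrable[OF t\<zeta>]]])
      have "(\<lambda>n. (indicator (cball 0 m) x * G x) * \<zeta> n x) \<longlonglongrightarrow> (indicator (cball 0 m) x * G x) * bump (0::real^2)" for x
      proof -
        have "isCont (bump :: real^2 \<Rightarrow> real) 0"
          using test_function_cont[OF test_function_bump[where 'a = "real^2"]] by (simp add: continuous_on_eq_continuous_at)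
        moreover have "(\<lambda>n. (1 / real (Suc n)) *\<^sub>R x) \<longlonglongrightarrow> 0 *\<^sub>R x"
          by (intro tendsto_intros LIMSEQ_inverse_real_of_nat[unfolded inverse_eq_divide])
        then have "(\<lambda>n. (1 / real (Suc n)) *\<^sub>R x) \<longlonglongrightarrow> 0" by simp
        ultimately have "(\<lambda>n. bump ((1 / real (Suc n)) *\<^sub>R x)) \<longlonglongrightarrow> bump (0::real^2)"
          by (rule isCont_tendsto_compose)
        then show ?thesis unfolding \<zeta>_def by (rule tendsto_mult_left)
      qed
      then show "AE x in lborel. (\<lambda>n. (indicator (cball 0 m) x * G x) * \<zeta> n x) \<longlonglongrightarrow> (indicator (cball 0 m) x * G x) * bump (0::real^2)"
        by simp
      have "norm ((indicator (cball 0 m) x * G x) * \<zeta> n x) \<le> C * \<bar>indicator (cball 0 m) x * G x\<bar>" for n x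
      proof -
        have "\<bar>\<zeta> n x\<bar> \<le> C" unfolding \<zeta>_def by (rule C)
        then have "\<bar>indicator (cball 0 m) x * G x\<bar> * \<bar>\<zeta> n x\<bar> \<le> \<bar>indicator (cball 0 m) x * G x\<bar> * C"
          by (rule mult_left_mono) simp
        then show ?thesis by (simp only: real_norm_def abs_mult mult.commute[of C])
      qed
      then show "AE x in lborel. norm ((indicator (cball 0 m) x * G x) * \<zeta> n x) \<le> C * \<bar>indicator (cball 0 m) x * G x\<bar>" for n by simp
    qed
    from LIMSEQ_le[OF this lim0] le
    have "(LINT x|lborel. (indicator (cball 0 m) x * G x) * bump (0::real^2)) \<le> 0" by auto
    then have "(LINT x|lborel. indicator (cball 0 m) x * G x) * bump (0::real^2) \<le> 0" by simp
    moreover have "bump (0::real^2) > 0" by (simp add: bump_props)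
    ultimately have "(LINT x|lborel. indicator (cball 0 m) x * G x) \<le> 0" by (simp add: mult_le_0_iff)
    moreover have nn: "AE x in lborel. 0 \<le> indicator (cball 0 m) x * G x" using G0 by simp
    then have "(LINT x|lborel. indicator (cball 0 m) x * G x) \<ge> 0" by (rule integral_nonneg_AE)
    ultimately have "(LINT x|lborel. indicator (cball 0 m) x * G x) = 0" by linarith
    then show ?thesis by (rule iffD1[OF integral_nonneg_eq_0_iff_AE[OF iG nn]])
  qed
  have "\<not> (w1 x \<noteq> 0 \<or> w2 x \<noteq> 0)"
  proof
    assume "w1 x \<noteq> 0 \<or> w2 x \<noteq> 0"
    then have Gx: "G x > 0" by (rule Gpos)
    define m where "m = norm x + 1"
    define S where "S = (- {0} \<inter> G -` {0<..}) \<inter> ball 0 m"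
    have oS: "open S" unfolding S_def
      using cG by (intro open_Int continuous_open_preimage) (auto intro: open_Compl)
    have "x \<in> S" using Gx x by (simp add: S_def m_def)
    have "AE y in lborel. y \<notin> S"
      using ae[of m] by eventually_elim (auto simp: S_def indicator_def split: if_splits)
    then have "emeasure lborel S = 0"
      by (subst (asm) AE_iff_measurable[OF _ refl]) (use oS in auto)
    then have "negligible S" using oS by (simp add: negligible_iff_emeasure0)
    then show False using open_not_negligible[OF oS] \<open>x \<in> S\<close> by blast
  qed
  then show ?thesis by (simp add: w1_def w2_def)
qed

end

section \<open>Radial integrals in the plane\<close>

text \<open>Layer-cake formula: the disc of radius \<open>sqrt s\<close> has area \<open>\<pi> * s\<close>. It replaces polar coordinates, for radial
  functions written as integrals over their level sets.\<close>

lemma radial_layer: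
  fixes w :: "real \<Rightarrow> ennreal"
  assumes [measurable]: "w \<in> borel_measurable borel"
  shows "(\<integral>\<^sup>+x. (\<integral>\<^sup>+s. w s * indicator {(norm (x::real^2))\<^sup>2..} s \<partial>lborel) \<partial>lborel)
    = (\<integral>\<^sup>+s. w s * ennreal (pi * s) * indicator {0..} s \<partial>lborel)"
proof -
  have ind: "indicator {(norm x)\<^sup>2..} s = (if (norm x)\<^sup>2 \<le> s then 1 else 0 :: ennreal)" for s and x :: "real^2"
    by (simp add: indicator_def)
  have "(\<integral>\<^sup>+x. (\<integral>\<^sup>+s. w s * indicator {(norm (x::real^2))\<^sup>2..} s \<partial>lborel) \<partial>lborel)
      = (\<integral>\<^sup>+s. (\<integral>\<^sup>+x. w s * indicator {(norm (x::real^2))\<^sup>2..} s \<partial>lborel) \<partial>lborel)"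
    unfolding ind by (rule lborel_pair.Fubini') measurable
  also have "\<dots> = (\<integral>\<^sup>+s. w s * ennreal (pi * s) * indicator {0..} s \<partial>lborel)"
  proof (rule nn_integral_cong)
    fix s :: real
    show "(\<integral>\<^sup>+x. w s * indicator {(norm (x::real^2))\<^sup>2..} s \<partial>lborel) = w s * ennreal (pi * s) * indicator {0..} s"
    proof (cases "s \<ge> 0")
      case True
      have eq: "indicator {(norm x)\<^sup>2..} s = (indicator (cball 0 (sqrt s)) x :: ennreal)" for x :: "real^2"
        using True by (simp add: indicator_def real_le_rsqrt sqrt_ge_absD) (metis norm_ge_zero real_le_rsqrt real_sqrt_le_iff real_sqrt_unique)
      have "(\<integral>\<^sup>+x. w s * indicator {(norm (x::real^2))\<^sup>2..} s \<partial>lborel) = w s * emeasure lborel (cball (0::real^2) (sqrt s))"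
        unfolding eq by (rule nn_integral_cmult_indicator) simp
      also have "emeasure lborel (cball (0::real^2) (sqrt s)) = ennreal (pi * s)"
        using True by (simp add: emeasure_cball unit_ball_vol_2)
      finally show ?thesis using True by simp
    next
      case False
      then have "indicator {(norm x)\<^sup>2..} s = (0 :: ennreal)" for x :: "real^2"
        by (simp add: indicator_def) (meson dual_order.trans zero_le_power2)
      then show ?thesis using False by simp
    qed
  qed
  finally show ?thesis .
qed

text \<open>A function of total mass \<open>\<pi>\<close>. Its rescalings \<open>\<epsilon>\<^sup>2 / ((norm x)\<^sup>2 + \<epsilon>\<^sup>2)\<^sup>2\<close> are a quarter of the Laplacian of
  \<open>ln ((norm x)\<^sup>2 + \<epsilon>\<^sup>2)\<close>.\<close>

definition bubble :: "real^2 \<Rightarrow> real" where "bubble x = 1 / (1 + (norm x)\<^sup>2)\<^sup>2"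

lemma bubble_integral: "integrable lborel bubble" "(LINT x|lborel. bubble x) = pi"
proof -
  have inner: "ennreal (bubble x) = (\<integral>\<^sup>+s. ennreal (2 / (1 + s) ^ 3) * indicator {(norm x)\<^sup>2..} s \<partial>lborel)" for x
  proof -
    have "(\<integral>\<^sup>+s. ennreal (2 / (1 + s) ^ 3) * indicator {(norm x)\<^sup>2..} s \<partial>lborel) = ennreal (0 - (- 1 / (1 + (norm x)\<^sup>2)\<^sup>2))"
    proof (rule nn_integral_FTC_atLeast)
      show "(\<lambda>s::real. 2 / (1 + s) ^ 3) \<in> borel_measurable borel" by measurable
      fix s :: real assume "(norm x)\<^sup>2 \<le> s"
      then have s: "s \<ge> 0" using zero_le_power2[of "norm x"] by linarith
      show "((\<lambda>s. - 1 / (1 + s)\<^sup>2) has_real_derivative 2 / (1 + s) ^ 3) (at s)"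
        using s by (auto intro!: derivative_eq_intros simp: power2_eq_square power3_eq_cube divide_simps) 
      show "0 \<le> 2 / (1 + s) ^ 3" using s by simp
    next
      show "((\<lambda>s::real. - 1 / (1 + s)\<^sup>2) \<longlongrightarrow> 0) at_top" by real_asymp
    qed
    then show ?thesis by (simp add: bubble_def)
  qed
  have m: "bubble \<in> borel_measurable borel" unfolding bubble_def[abs_def] by measurable
  have "(\<integral>\<^sup>+x. ennreal (bubble x) \<partial>lborel) = (\<integral>\<^sup>+s. ennreal (2 / (1 + s) ^ 3) * ennreal (pi * s) * indicator {0..} s \<partial>lborel)"
    unfolding inner by (rule radial_layer) measurable
  also have "\<dots> = (\<integral>\<^sup>+s. ennreal (pi * (2 * s / (1 + s) ^ 3)) * indicator {0..} s \<partial>lborel)"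
    by (intro nn_integral_cong) (auto simp: indicator_def ennreal_mult[symmetric] mult_ac)
  also have "\<dots> = ennreal (pi - pi * (0\<^sup>2 / (1 + 0)\<^sup>2))"
  proof (rule nn_integral_FTC_atLeast)
    show "(\<lambda>s::real. pi * (2 * s / (1 + s) ^ 3)) \<in> borel_measurable borel" by measurable
    fix s :: real assume s: "0 \<le> s"
    then have nz: "1 + s \<noteq> 0" by simp
    have "((\<lambda>s. s\<^sup>2 / (1 + s)\<^sup>2) has_real_derivative ((2 * s) * (1 + s)\<^sup>2 - s\<^sup>2 * (2 * (1 + s))) / ((1 + s)\<^sup>2 * (1 + s)\<^sup>2)) (at s)"
      using nz by (auto intro!: derivative_eq_intros)
    moreover have "((2 * s) * (1 + s)\<^sup>2 - s\<^sup>2 * (2 * (1 + s))) / ((1 + s)\<^sup>2 * (1 + s)\<^sup>2) = 2 * s / (1 + s) ^ 3"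
    proof -
      have "(2 * s) * (1 + s)\<^sup>2 - s\<^sup>2 * (2 * (1 + s)) = (2 * s) * (1 + s)" by (simp add: power2_eq_square algebra_simps)
      moreover have "(1 + s)\<^sup>2 * (1 + s)\<^sup>2 = (1 + s) ^ 3 * (1 + s)" by (simp add: power2_eq_square power3_eq_cube)
      ultimately show ?thesis using nz by (metis nonzero_mult_divide_mult_cancel_right)
    qed
    ultimately show "((\<lambda>s. pi * (s\<^sup>2 / (1 + s)\<^sup>2)) has_real_derivative pi * (2 * s / (1 + s) ^ 3)) (at s)"
      by (simp only: DERIV_cmult)
    show "0 \<le> pi * (2 * s / (1 + s) ^ 3)" using s by simp
  next
    show "((\<lambda>s::real. pi * (s\<^sup>2 / (1 + s)\<^sup>2)) \<longlongrightarrow> pi) at_top" by real_asymp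
  qed
  finally have I: "(\<integral>\<^sup>+x. ennreal (bubble x) \<partial>lborel) = ennreal pi" by simp
  have nn: "AE x in lborel. 0 \<le> bubble x" by (simp add: bubble_def)
  show i: "integrable lborel bubble"
    by (rule integrableI_nonneg[OF _ nn]) (use m I in auto)
  show "(LINT x|lborel. bubble x) = pi"
    using nn_integral_eq_integral[OF i nn] I integral_nonneg_AE[OF nn] by simp
qed

text \<open>The logarithm is the superposition of the indicators of discs of area \<open>\<pi> * s\<close> with density \<open>1 / s\<close>, up to a
  factor \<open>2\<close>.\<close>

lemma log_integrable: "integrable lborel (\<lambda>x::real^2. max 0 (- ln (norm x)))"
proof -
  have m: "(\<lambda>x::real^2. max 0 (- ln (norm x))) \<in> borel_measurable borel" by measurable
  let ?w = "\<lambda>s::real. ennreal (1 / s) * indicator {0<..1} s"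
  have le: "ennreal (max 0 (- ln (norm x))) \<le> (\<integral>\<^sup>+s. ?w s * indicator {(norm x)\<^sup>2..} s \<partial>lborel)" for x :: "real^2"
  proof (cases "0 < norm x \<and> norm x \<le> 1")
    case True
    then have x: "0 < (norm x)\<^sup>2" "(norm x)\<^sup>2 \<le> 1" by (auto simp: power_le_one)
    have "(\<integral>\<^sup>+s. ?w s * indicator {(norm x)\<^sup>2..} s \<partial>lborel) = (\<integral>\<^sup>+s. ennreal (1 / s) * indicator {(norm x)\<^sup>2..1} s \<partial>lborel)"
      using x(1) by (intro nn_integral_cong) (auto simp: indicator_def ennreal_eq_0_iff not_less)
    also have "\<dots> = ennreal (ln 1 - ln ((norm x)\<^sup>2))"
    proof (rule nn_integral_FTC_Icc[OF _ _ _ x(2)])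
      show "(\<lambda>s::real. 1 / s) \<in> borel_measurable borel" by measurable
      fix s assume "s \<in> {(norm x)\<^sup>2..1}"
      then have "(norm x)\<^sup>2 \<le> s" by simp
      with x(1) have s: "s > 0" by (rule less_le_trans)
      show "(ln has_real_derivative 1 / s) (at s)" by (rule DERIV_ln_divide[OF s])
      show "0 \<le> 1 / s" using s by simp
    qed
    also have "\<dots> = ennreal (2 * (- ln (norm x)))" using True by (simp add: ln_realpow)
    also have "\<dots> \<ge> ennreal (max 0 (- ln (norm x)))" using True by (intro ennreal_leI) (simp add: ln_le_zero_iff)
    finally show ?thesis .
  next
    case False
    then have "norm x = 0 \<or> norm x > 1" by auto
    then have "max 0 (- ln (norm x)) = 0" by auto
    then show ?thesis by simp
  qed
  have "(\<integral>\<^sup>+x. ennreal (max 0 (- ln (norm (x::real^2)))) \<partial>lborel) \<le> (\<integral>\<^sup>+x. (\<integral>\<^sup>+s. ?w s * indicator {(norm (x::real^2))\<^sup>2..} s \<partial>lborel) \<partial>lborel)"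
    by (intro nn_integral_mono le)
  also have "\<dots> = (\<integral>\<^sup>+s. ?w s * ennreal (pi * s) * indicator {0..} s \<partial>lborel)"
    by (rule radial_layer) measurable
  also have "\<dots> \<le> (\<integral>\<^sup>+s. ennreal pi * indicator {0..1::real} s \<partial>lborel)"
  proof (rule nn_integral_mono)
    fix s :: real
    have "ennreal (1 / s) * ennreal (pi * s) = ennreal pi" if "s > 0"
      using that by (simp add: ennreal_mult[symmetric])
    then show "?w s * ennreal (pi * s) * indicator {0..} s \<le> ennreal pi * indicator {0..1} s"
      by (cases "0 < s \<and> s \<le> 1") (auto simp: indicator_def)
  qed
  also have "\<dots> = ennreal pi" by (simp add: nn_integral_cmult_indicator)
  finally have "(\<integral>\<^sup>+x. ennreal (max 0 (- ln (norm (x::real^2)))) \<partial>lborel) < \<infinity>" by (simp add: le_less_trans)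
  then show ?thesis using m by (intro integrableI_nonneg) auto
qed

section \<open>From radial profiles to distributions in the plane\<close>

text \<open>One radial function \<open>u\<close> with \<open>u'' + u' / r = f\<close> and the singularity \<open>2 * n * ln r\<close> at the origin, where
  \<open>y = r * u'\<close>. The bounds suffice for dominated convergence on compact sets.\<close>

locale single_profile =
  fixes u y f :: "real \<Rightarrow> real" and n K :: real
  assumes du: "\<And>r. r > 0 \<Longrightarrow> (u has_real_derivative y r / r) (at r)"
    and dy: "\<And>r. r > 0 \<Longrightarrow> (y has_real_derivative r * f r) (at r)"
    and cf: "continuous_on {0<..} f"
    and f_le: "\<And>r. r > 0 \<Longrightarrow> \<bar>f r\<bar> \<le> K"
    and u_le: "\<And>r. r > 0 \<Longrightarrow> \<bar>u r\<bar> \<le> K + 2 * n * max 0 (- ln r)"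
    and y_le: "\<And>r. r > 0 \<Longrightarrow> \<bar>y r - 2 * n\<bar> \<le> K * r\<^sup>2"
    and n0: "n \<ge> 0"
begin

lemma cu: "continuous_on {0<..} u" and cy: "continuous_on {0<..} y"
  using du dy by (auto intro!: continuous_at_imp_continuous_on DERIV_isCont)

lemma radial_continuous:
  fixes g :: "real \<Rightarrow> real"
  assumes "continuous_on {0<..} g"
  shows "continuous_on (- {0}) (\<lambda>x::'a::real_normed_vector. g (norm x))"
  by (rule continuous_on_compose2[OF assms]) (auto intro!: continuous_intros)

lemma radial_measurable:
  fixes g :: "real \<Rightarrow> real"
  assumes "continuous_on {0<..} g"
  shows "(\<lambda>x::real^2. g (norm x)) \<in> borel_measurable borel"
  by (rule borel_measurable_continuous_countable_exceptions[of "{0}"]) (use radial_continuous[OF assms] in auto)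

definition bound :: "real^2 \<Rightarrow> real" where "bound x = \<bar>K\<bar> + 2 * n * max 0 (- ln (norm x))"

lemma bound_locally_integrable: "locally_integrable bound"
proof -
  have "locally_integrable (\<lambda>x::real^2. max 0 (- ln (norm x)))"
    unfolding locally_integrable_def set_integrable_def
    by (intro allI impI integrable_mult_indicator log_integrable) (simp add: borel_compact)
  then show ?thesis unfolding bound_def[abs_def]
    by (intro locally_integrable_add locally_integrable_cmult locally_integrable_continuous[OF continuous_on_const])
qed

lemma u_locally_integrable: "locally_integrable (\<lambda>x::real^2. u (norm x))"
proof (rule locally_integrable_bound)
  show "locally_integrable (\<lambda>x. bound x + (\<bar>u 0\<bar>))"
    by (intro locally_integrable_add bound_locally_integrable locally_integrable_continuous[OF continuous_on_const])
  show "(\<lambda>x::real^2. u (norm x)) \<in> borel_measurable borel" by (rule radial_measurable[OF cu])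
  fix x :: "real^2"
  show "\<bar>u (norm x)\<bar> \<le> bound x + \<bar>u 0\<bar>"
  proof (cases "x = 0")
    case False
    then show ?thesis using u_le[of "norm x"] by (simp add: bound_def)
  qed (use n0 in \<open>simp add: bound_def\<close>)
qed

lemma f_locally_integrable: "locally_integrable (\<lambda>x::real^2. f (norm x))"
proof (rule locally_integrable_bound)
  show "locally_integrable (\<lambda>x::real^2. \<bar>K\<bar> + \<bar>f 0\<bar>)"
    by (rule locally_integrable_continuous[OF continuous_on_const])
  show "(\<lambda>x::real^2. f (norm x)) \<in> borel_measurable borel" by (rule radial_measurable[OF cf])
  fix x :: "real^2"
  show "\<bar>f (norm x)\<bar> \<le> \<bar>K\<bar> + \<bar>f 0\<bar>"
    using f_le[of "norm x"] by (cases "x = 0") auto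
qed

text \<open>Replacing \<open>norm x\<close> by \<open>sqrt (norm x ^ 2 + \<epsilon> ^ 2)\<close> gives a function of class \<open>C\<^sup>2\<close> on the whole plane.
  Its Laplacian is that of the profile up to an error and to a multiple of the rescaled kernel
  \<open>\<epsilon> ^ 2 / (norm x ^ 2 + \<epsilon> ^ 2) ^ 2\<close>, which tends to \<open>\<pi>\<close> times the Dirac mass.\<close>

definition sq :: "real \<Rightarrow> real^2 \<Rightarrow> real" where "sq \<epsilon> x = inner x x + \<epsilon>\<^sup>2"

lemma sq_pos: "\<epsilon> > 0 \<Longrightarrow> sq \<epsilon> x > 0" "sq \<epsilon> x \<ge> \<epsilon>\<^sup>2" "sqrt (sq \<epsilon> x) \<ge> norm x"
proof -
  show "\<epsilon> > 0 \<Longrightarrow> sq \<epsilon> x > 0" by (simp add: sq_def add_nonneg_pos)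
  show "sq \<epsilon> x \<ge> \<epsilon>\<^sup>2" by (simp add: sq_def)
  show "sqrt (sq \<epsilon> x) \<ge> norm x" unfolding norm_eq_sqrt_inner sq_def by simp
qed

lemma regularised_green:
  assumes e: "\<epsilon> > 0" and \<phi>: "test_function \<phi>"
  shows "(LINT x|lborel. u (sqrt (sq \<epsilon> x)) * laplacian \<phi> x) =
    (LINT x|lborel. (f (sqrt (sq \<epsilon> x)) * (1 - \<epsilon>\<^sup>2 / sq \<epsilon> x) + 2 * y (sqrt (sq \<epsilon> x)) * \<epsilon>\<^sup>2 / (sq \<epsilon> x)\<^sup>2) * \<phi> x)"
proof -
  let ?s = "sq \<epsilon>" and ?r = "\<lambda>x. sqrt (sq \<epsilon> x)"
  have s: "?s x > 0" "?s x \<noteq> 0" for x using sq_pos(1)[OF e, of x] by simp_all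
  have r: "?r x > 0" "?r x * ?r x = ?s x" for x using s[of x] by simp_all
  have cs: "continuous_on UNIV ?s" unfolding sq_def[abs_def] by (intro continuous_intros)
  have cr: "continuous_on UNIV (\<lambda>x. g (?r x))" if "continuous_on {0<..} g" for g :: "real \<Rightarrow> real"
    by (rule continuous_on_compose2[OF that]) (use r in \<open>auto intro!: continuous_intros cs\<close>)
  define g1 where "g1 b x = y (?r x) * inner x b / ?s x" for b x
  define g2 where "g2 b x = y (?r x) / ?s x + (inner x b)\<^sup>2 * (f (?r x) / ?s x - 2 * y (?r x) / (?s x)\<^sup>2)" for b x
  have ds: "((\<lambda>t. ?s (x + t *\<^sub>R b)) has_real_derivative 2 * inner x b) (at 0)" for x b
  proof -
    have "sq \<epsilon> (x + t *\<^sub>R b) = inner x x + 2 * t * inner x b + t\<^sup>2 * inner b b + \<epsilon>\<^sup>2" for t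
      by (simp add: sq_def inner_add_left inner_add_right inner_commute power2_eq_square)
    then show ?thesis by (simp only:) (auto intro!: derivative_eq_intros)
  qed
  have dr: "((\<lambda>t. ?r (x + t *\<^sub>R b)) has_real_derivative inner x b / ?r x) (at 0)" for x b
  proof -
    have "((\<lambda>t. sqrt (?s (x + t *\<^sub>R b))) has_real_derivative (inverse (sqrt (?s (x + 0 *\<^sub>R b))) / 2) * (2 * inner x b)) (at 0)"
      by (rule DERIV_chain2[OF DERIV_real_sqrt ds]) (use s in simp)
    moreover have "(inverse (sqrt (?s (x + 0 *\<^sub>R b))) / 2) * (2 * inner x b) = inner x b / ?r x"
      by (simp add: field_simps)
    ultimately show ?thesis by (simp only:)
  qed
  have dcomp: "((\<lambda>t. g (?r (x + t *\<^sub>R b))) has_real_derivative g' (?r x) * (inner x b / ?r x)) (at 0)"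
    if "\<And>r. r > 0 \<Longrightarrow> (g has_real_derivative g' r) (at r)" for g g' :: "real \<Rightarrow> real" and x b
  proof -
    have "(g has_real_derivative g' (?r x)) (at (?r (x + 0 *\<^sub>R b)))" using that[OF r(1)[of x]] by simp
    then show ?thesis by (rule DERIV_chain2[OF _ dr])
  qed
  have "(LINT x|lborel. u (?r x) * laplacian \<phi> x) = (LINT x|lborel. (\<Sum>b\<in>Basis. g2 b x) * \<phi> x)"
  proof (rule green_formula[OF \<phi>])
    show "continuous_on UNIV (\<lambda>x. u (?r x))" by (rule cr[OF cu])
    fix b :: "real^2" assume b: "b \<in> Basis"
    have bb: "inner b b = 1" using b by (simp add: inner_Basis)
    show "continuous_on UNIV (g1 b)" unfolding g1_def[abs_def] using s
      by (intro continuous_intros cs cr[OF cy]) auto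
    show "continuous_on UNIV (g2 b)" unfolding g2_def[abs_def] using s
      by (intro continuous_intros cs cr[OF cy] cr[OF cf]) auto
    show "has_dderiv (\<lambda>x. u (?r x)) b (g1 b)"
      unfolding has_dderiv_def
    proof
      fix x
      have "y (?r x) / ?r x * (inner x b / ?r x) = g1 b x"
        unfolding g1_def times_divide_times_eq r(2) ..
      then show "((\<lambda>t. u (?r (x + t *\<^sub>R b))) has_real_derivative g1 b x) (at 0)"
        using dcomp[OF du, of x b] by (simp only:)
    qed
    show "has_dderiv (g1 b) b (g2 b)"
      unfolding has_dderiv_def
    proof
      fix x
      have dyr: "((\<lambda>t. y (?r (x + t *\<^sub>R b))) has_real_derivative f (?r x) * inner x b) (at 0)"
        using dcomp[OF dy, of x b] r(1)[of x] by simp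
      have di: "((\<lambda>t. inner (x + t *\<^sub>R b) b) has_real_derivative 1) (at 0)"
        using bb by (auto intro!: derivative_eq_intros simp: inner_add_left)
      have nz: "?s (x + 0 *\<^sub>R b) \<noteq> 0" using s by simp
      from DERIV_divide[OF DERIV_mult[OF dyr di] ds nz]
      have "((\<lambda>t. g1 b (x + t *\<^sub>R b)) has_real_derivative
          ((f (?r x) * inner x b * inner x b + 1 * y (?r x)) * ?s x - y (?r x) * inner x b * (2 * inner x b)) / (?s x * ?s x)) (at 0)"
        unfolding g1_def by simp
      moreover have "((f (?r x) * inner x b * inner x b + 1 * y (?r x)) * ?s x - y (?r x) * inner x b * (2 * inner x b)) / (?s x * ?s x) = g2 b x"
        unfolding g2_def using s(2)[of x] by (simp add: field_simps power2_eq_square)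
      ultimately show "((\<lambda>t. g1 b (x + t *\<^sub>R b)) has_real_derivative g2 b x) (at 0)" by (simp only:)
    qed
  qed
  moreover have "(\<Sum>b\<in>Basis. g2 b x) = f (?r x) * (1 - \<epsilon>\<^sup>2 / ?s x) + 2 * y (?r x) * \<epsilon>\<^sup>2 / (?s x)\<^sup>2" for x
  proof -
    have "(\<Sum>b\<in>Basis. (inner x b)\<^sup>2) = inner x x"
      by (simp add: power2_eq_square euclidean_inner[of x x])
    then have "(\<Sum>b\<in>Basis. g2 b x) = 2 * (y (?r x) / ?s x) + (?s x - \<epsilon>\<^sup>2) * (f (?r x) / ?s x - 2 * y (?r x) / (?s x)\<^sup>2)"
      unfolding g2_def sum.distrib sum_distrib_right[symmetric] by (simp add: sq_def)
    also have "\<dots> = f (?r x) * (1 - \<epsilon>\<^sup>2 / ?s x) + 2 * y (?r x) * \<epsilon>\<^sup>2 / (?s x)\<^sup>2"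
      using s(2)[of x] by (simp add: field_simps power2_eq_square)
    finally show ?thesis .
  qed
  ultimately show ?thesis by simp
qed

lemma K0: "K \<ge> 0"
  using order_trans[OF abs_ge_zero f_le[of 1]] by simp

text \<open>The Laplacian of the regularised function splits into a part that tends to \<open>f\<close>, a part containing
  \<open>y - 2 * n\<close> that tends to zero, and \<open>4 * n\<close> times a rescaled \<open>bubble\<close>, which tends to \<open>4 * \<pi> * n\<close> times the
  Dirac mass.\<close>

theorem radial_laplace:
  "laplace_eq_dirac (\<lambda>x::real^2. u (norm x)) (\<lambda>x. f (norm x)) (4 * pi * n)"
  unfolding laplace_eq_dirac_def
proof (intro allI impI)
  fix \<phi> :: "real^2 \<Rightarrow> real" assume \<phi>: "test_function \<phi>"
  let ?L = "laplacian \<phi>"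
  note L = test_function_laplacian[OF \<phi>]
  define \<epsilon> where "\<epsilon> k = 1 / real (Suc k)" for k :: nat
  have e: "\<epsilon> k > 0" for k by (simp add: \<epsilon>_def)
  have elim: "\<epsilon> \<longlonglongrightarrow> 0" unfolding \<epsilon>_def[abs_def] using LIMSEQ_inverse_real_of_nat by (simp add: inverse_eq_divide)
  have s: "sq (\<epsilon> k) x > 0" for k x by (rule sq_pos(1)[OF e])
  have cs: "continuous_on UNIV (sq (\<epsilon> k))" for k unfolding sq_def[abs_def] by (intro continuous_intros)
  have cr: "continuous_on UNIV (\<lambda>x. g (sqrt (sq (\<epsilon> k) x)))" if "continuous_on {0<..} g" for g :: "real \<Rightarrow> real" and k
    by (rule continuous_on_compose2[OF that]) (use s in \<open>auto intro!: continuous_intros cs\<close>)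
  have slim: "(\<lambda>k. sq (\<epsilon> k) x) \<longlonglongrightarrow> (norm x)\<^sup>2" for x
  proof -
    have "(\<lambda>k. inner x x + (\<epsilon> k)\<^sup>2) \<longlonglongrightarrow> inner x x + 0\<^sup>2" by (intro tendsto_intros elim)
    then show ?thesis by (simp add: sq_def power2_norm_eq_inner)
  qed
  have rlim: "(\<lambda>k. g (sqrt (sq (\<epsilon> k) x))) \<longlonglongrightarrow> g (norm x)" if g: "continuous_on {0<..} g" and x: "x \<noteq> 0" for g :: "real \<Rightarrow> real" and x
  proof -
    have "(\<lambda>k. sqrt (sq (\<epsilon> k) x)) \<longlonglongrightarrow> sqrt ((norm x)\<^sup>2)" by (intro tendsto_intros slim)
    then have "(\<lambda>k. sqrt (sq (\<epsilon> k) x)) \<longlonglongrightarrow> norm x" by simp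
    moreover have "isCont g (norm x)" using g x by (simp add: continuous_on_eq_continuous_at)
    ultimately show ?thesis by (rule isCont_tendsto_compose[rotated])
  qed
  have q: "0 \<le> (\<epsilon> k)\<^sup>2 / sq (\<epsilon> k) x" "(\<epsilon> k)\<^sup>2 / sq (\<epsilon> k) x \<le> 1" for k x
    using s[of k x] sq_pos(2)[of "\<epsilon> k" x] by (simp_all add: divide_le_eq)
  have AE0: "AE x in lborel. x \<noteq> (0::real^2)" by (rule AE_lborel_singleton)
  have limL: "(\<lambda>k. LINT x|lborel. u (sqrt (sq (\<epsilon> k) x)) * ?L x) \<longlonglongrightarrow> (LINT x|lborel. u (norm x) * ?L x)"
  proof (rule integral_dominated_convergence[where w = "\<lambda>x. \<bar>bound x\<bar> * \<bar>?L x\<bar>"])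
    show "integrable lborel (\<lambda>x. \<bar>bound x\<bar> * \<bar>?L x\<bar>)"
      by (rule integrable_test_mult_abs[OF bound_locally_integrable L])
    show "(\<lambda>x. u (norm x) * ?L x) \<in> borel_measurable lborel"
      by (intro borel_measurable_integrable integrable_test_mult u_locally_integrable L)
    show "(\<lambda>x. u (sqrt (sq (\<epsilon> k) x)) * ?L x) \<in> borel_measurable lborel" for k
      by (intro borel_measurable_integrable integrable_test_mult locally_integrable_continuous cr cu L)
    show "AE x in lborel. (\<lambda>k. u (sqrt (sq (\<epsilon> k) x)) * ?L x) \<longlonglongrightarrow> u (norm x) * ?L x"
      using AE0 by eventually_elim (intro tendsto_mult_right rlim cu)
    fix k
    have "norm (u (sqrt (sq (\<epsilon> k) x)) * ?L x) \<le> \<bar>bound x\<bar> * \<bar>?L x\<bar>" if x: "x \<noteq> 0" for x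
    proof -
      let ?r = "sqrt (sq (\<epsilon> k) x)"
      have r: "?r > 0" using s by simp
      have "norm x \<le> ?r" by (rule sq_pos(3))
      moreover have "0 < norm x" using x by simp
      ultimately have "ln (norm x) \<le> ln ?r" using r by (intro ln_mono)
      then have "max 0 (- ln ?r) \<le> max 0 (- ln (norm x))" by simp
      then have "2 * n * max 0 (- ln ?r) \<le> 2 * n * max 0 (- ln (norm x))" using n0 by (intro mult_left_mono) auto
      then have "\<bar>u ?r\<bar> \<le> bound x" using u_le[OF r] unfolding bound_def by linarith
      then have "\<bar>u ?r\<bar> \<le> \<bar>bound x\<bar>" by linarith
      then show ?thesis unfolding real_norm_def abs_mult by (rule mult_right_mono) simp
    qed
    then show "AE x in lborel. norm (u (sqrt (sq (\<epsilon> k) x)) * ?L x) \<le> \<bar>bound x\<bar> * \<bar>?L x\<bar>"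
      using AE0 by (auto elim: AE_mp)
  qed
  let ?A = "\<lambda>k x. f (sqrt (sq (\<epsilon> k) x)) * (1 - (\<epsilon> k)\<^sup>2 / sq (\<epsilon> k) x)"
  let ?B = "\<lambda>k x. 2 * (y (sqrt (sq (\<epsilon> k) x)) - 2 * n) * (\<epsilon> k)\<^sup>2 / (sq (\<epsilon> k) x)\<^sup>2"
  let ?C = "\<lambda>k x. 4 * n * (\<epsilon> k)\<^sup>2 / (sq (\<epsilon> k) x)\<^sup>2"
  have snz: "sq (\<epsilon> k) x \<noteq> 0" for k x using s[of k x] by simp
  have cA: "continuous_on UNIV (?A k)" for k
    using snz by (intro continuous_intros cr cf cs) auto
  have cB: "continuous_on UNIV (?B k)" for k
    using snz by (intro continuous_intros cr cy cs) auto
  have cC: "continuous_on UNIV (?C k)" for k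
    using snz by (intro continuous_intros cs) auto
  have iABC: "integrable lborel (\<lambda>x. ?A k x * \<phi> x)" "integrable lborel (\<lambda>x. ?B k x * \<phi> x)" "integrable lborel (\<lambda>x. ?C k x * \<phi> x)" for k
    by (intro integrable_test_mult locally_integrable_continuous cA cB cC \<phi>)+
  have limA: "(\<lambda>k. LINT x|lborel. ?A k x * \<phi> x) \<longlonglongrightarrow> (LINT x|lborel. f (norm x) * \<phi> x)"
  proof (rule integral_dominated_convergence[where w = "\<lambda>x. K * \<bar>\<phi> x\<bar>"])
    show "integrable lborel (\<lambda>x. K * \<bar>\<phi> x\<bar>)"
      by (intro integrable_mult_right integrable_abs test_function_integrable[OF \<phi>])
    show "(\<lambda>x. f (norm x) * \<phi> x) \<in> borel_measurable lborel"
      by (intro borel_measurable_integrable integrable_test_mult f_locally_integrable \<phi>)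
    show "(\<lambda>x. ?A k x * \<phi> x) \<in> borel_measurable lborel" for k by (rule borel_measurable_integrable[OF iABC(1)])
    have "(\<lambda>k. ?A k x * \<phi> x) \<longlonglongrightarrow> f (norm x) * (1 - 0\<^sup>2 / (norm x)\<^sup>2) * \<phi> x" if "x \<noteq> 0" for x
      using that by (intro tendsto_intros rlim cf elim slim) auto
    then have "(\<lambda>k. ?A k x * \<phi> x) \<longlonglongrightarrow> f (norm x) * \<phi> x" if "x \<noteq> 0" for x using that by simp
    then show "AE x in lborel. (\<lambda>k. ?A k x * \<phi> x) \<longlonglongrightarrow> f (norm x) * \<phi> x"
      using AE0 by (auto elim: AE_mp)
    have "norm (?A k x * \<phi> x) \<le> K * \<bar>\<phi> x\<bar>" for k x
    proof -
      have "\<bar>f (sqrt (sq (\<epsilon> k) x))\<bar> * \<bar>1 - (\<epsilon> k)\<^sup>2 / sq (\<epsilon> k) x\<bar> \<le> K * 1"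
        using s[of k x] q[of k x] K0 by (intro mult_mono f_le) auto
      then have "\<bar>?A k x\<bar> \<le> K" by (simp add: abs_mult)
      then show ?thesis unfolding real_norm_def abs_mult[of _ "\<phi> x"] by (rule mult_right_mono) simp
    qed
    then show "AE x in lborel. norm (?A k x * \<phi> x) \<le> K * \<bar>\<phi> x\<bar>" for k by simp
  qed
  have limB: "(\<lambda>k. LINT x|lborel. ?B k x * \<phi> x) \<longlonglongrightarrow> (LINT x|(lborel :: (real^2) measure). 0)"
  proof (rule integral_dominated_convergence[where w = "\<lambda>x. (2 * K) * \<bar>\<phi> x\<bar>"])
    show "integrable lborel (\<lambda>x. (2 * K) * \<bar>\<phi> x\<bar>)"
      by (intro integrable_mult_right integrable_abs test_function_integrable[OF \<phi>])
    show "(\<lambda>x. ?B k x * \<phi> x) \<in> borel_measurable lborel" for k by (rule borel_measurable_integrable[OF iABC(2)])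
    have "(\<lambda>k. ?B k x * \<phi> x) \<longlonglongrightarrow> 2 * (y (norm x) - 2 * n) * 0\<^sup>2 / ((norm x)\<^sup>2)\<^sup>2 * \<phi> x" if "x \<noteq> 0" for x
      using that by (intro tendsto_intros rlim cy elim slim) auto
    then have "(\<lambda>k. ?B k x * \<phi> x) \<longlonglongrightarrow> 0" if "x \<noteq> 0" for x using that by simp
    then show "AE x in lborel. (\<lambda>k. ?B k x * \<phi> x) \<longlonglongrightarrow> 0"
      using AE0 by (auto elim: AE_mp)
    \<comment> \<open>The quadratic vanishing of \<open>y - 2 * n\<close> compensates one power of the singular denominator.\<close>
    have "norm (?B k x * \<phi> x) \<le> (2 * K) * \<bar>\<phi> x\<bar>" for k x
    proof -
      let ?s = "sq (\<epsilon> k) x"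
      have "\<bar>y (sqrt ?s) - 2 * n\<bar> \<le> K * ?s" using y_le[of "sqrt ?s"] s[of k x] by simp
      then have "\<bar>y (sqrt ?s) - 2 * n\<bar> * ((\<epsilon> k)\<^sup>2 / ?s\<^sup>2) \<le> (K * ?s) * ((\<epsilon> k)\<^sup>2 / ?s\<^sup>2)" by (rule mult_right_mono) simp
      also have "\<dots> = K * ((\<epsilon> k)\<^sup>2 / ?s)" using snz[of k x] by (simp add: power2_eq_square)
      also have "\<dots> \<le> K * 1" using q[of k x] K0 by (intro mult_left_mono) auto
      finally have le: "\<bar>y (sqrt ?s) - 2 * n\<bar> * ((\<epsilon> k)\<^sup>2 / ?s\<^sup>2) \<le> K" by simp
      define D where "D = y (sqrt ?s) - 2 * n"
      have "?B k x = 2 * (D * ((\<epsilon> k)\<^sup>2 / ?s\<^sup>2))"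
        unfolding D_def by (simp only: times_divide_eq_right mult.assoc)
      then have "\<bar>?B k x\<bar> = 2 * (\<bar>D\<bar> * ((\<epsilon> k)\<^sup>2 / ?s\<^sup>2))" by (simp only: abs_mult abs_divide abs_power2 abs_numeral)
      then have "\<bar>?B k x\<bar> \<le> 2 * K" using le unfolding D_def by linarith
      then show ?thesis unfolding real_norm_def abs_mult[of _ "\<phi> x"] by (rule mult_right_mono) simp
    qed
    then show "AE x in lborel. norm (?B k x * \<phi> x) \<le> (2 * K) * \<bar>\<phi> x\<bar>" for k by simp
  qed simp
  have mp: "bubble \<in> borel_measurable borel" using borel_measurable_integrable[OF bubble_integral(1)] by simp
  have m\<phi>: "\<phi> \<in> borel_measurable borel" by (rule borel_measurable_continuous_onI[OF test_function_cont[OF \<phi>]])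
  have C_eq: "(LINT x|lborel. ?C k x * \<phi> x) = 4 * n * (LINT z|lborel. bubble z * \<phi> (\<epsilon> k *\<^sub>R z))" for k
  proof -
    define c where "c = 1 / \<epsilon> k"
    have c: "c \<noteq> 0" "\<epsilon> k * c = 1" using e[of k] by (simp_all add: c_def)
    have [measurable]: "bubble \<in> borel_measurable borel" "\<phi> \<in> borel_measurable borel" by (rule mp, rule m\<phi>)
    have m: "(\<lambda>z. bubble z * \<phi> (\<epsilon> k *\<^sub>R z)) \<in> borel_measurable borel" by measurable
    have "(LINT z|lborel. bubble z * \<phi> (\<epsilon> k *\<^sub>R z)) = (LINT x|lborel. \<bar>c\<bar> ^ DIM(real^2) * (bubble (c *\<^sub>R (x - 0)) * \<phi> (\<epsilon> k *\<^sub>R (c *\<^sub>R (x - 0)))))"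
      by (rule lborel_integral_scale[OF m c(1), symmetric])
    also have "\<dots> = (LINT x|lborel. (\<epsilon> k)\<^sup>2 / (sq (\<epsilon> k) x)\<^sup>2 * \<phi> x)"
    proof (rule Bochner_Integration.integral_cong[OF refl])
      fix x :: "real^2"
      have "(\<epsilon> k)\<^sup>2 * (1 + (norm (c *\<^sub>R x))\<^sup>2) = sq (\<epsilon> k) x"
      proof -
        have "(\<epsilon> k)\<^sup>2 * (norm (c *\<^sub>R x))\<^sup>2 = (\<epsilon> k * c)\<^sup>2 * (norm x)\<^sup>2" by (simp add: power_mult_distrib)
        then show ?thesis using c by (simp add: distrib_left sq_def power2_norm_eq_inner)
      qed
      then have "(\<epsilon> k)\<^sup>2 / (sq (\<epsilon> k) x)\<^sup>2 = (\<epsilon> k)\<^sup>2 / ((\<epsilon> k)\<^sup>2 * (1 + (norm (c *\<^sub>R x))\<^sup>2))\<^sup>2" by simp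
      also have "\<dots> = c\<^sup>2 * bubble (c *\<^sub>R x)"
        using e[of k] by (simp add: c_def bubble_def power_mult_distrib power2_eq_square divide_simps)
      finally show "\<bar>c\<bar> ^ DIM(real^2) * (bubble (c *\<^sub>R (x - 0)) * \<phi> (\<epsilon> k *\<^sub>R (c *\<^sub>R (x - 0)))) = (\<epsilon> k)\<^sup>2 / (sq (\<epsilon> k) x)\<^sup>2 * \<phi> x"
        using c(2) by simp
    qed
    also have "4 * n * \<dots> = (LINT x|lborel. 4 * n * ((\<epsilon> k)\<^sup>2 / (sq (\<epsilon> k) x)\<^sup>2 * \<phi> x))"
      by (rule Bochner_Integration.integral_mult_right_zero[symmetric])
    finally show ?thesis by (simp add: mult.assoc)
  qed
  obtain Cb where Cb: "\<And>z. \<bar>\<phi> z\<bar> \<le> Cb" using test_function_bounded[OF \<phi>] by blast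
  have limP: "(\<lambda>k. LINT z|lborel. bubble z * \<phi> (\<epsilon> k *\<^sub>R z)) \<longlonglongrightarrow> (LINT z|lborel. bubble z * \<phi> 0)"
  proof (rule integral_dominated_convergence[where w = "\<lambda>z. bubble z * Cb"])
    have [measurable]: "bubble \<in> borel_measurable borel" "\<phi> \<in> borel_measurable borel" by (rule mp, rule m\<phi>)
    show "integrable lborel (\<lambda>z. bubble z * Cb)" using bubble_integral(1) by simp
    show "(\<lambda>z. bubble z * \<phi> 0) \<in> borel_measurable lborel" by measurable
    show "(\<lambda>z. bubble z * \<phi> (\<epsilon> k *\<^sub>R z)) \<in> borel_measurable lborel" for k by measurable
    have "(\<lambda>k. bubble z * \<phi> (\<epsilon> k *\<^sub>R z)) \<longlonglongrightarrow> bubble z * \<phi> 0" for z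
    proof -
      have "(\<lambda>k. \<epsilon> k *\<^sub>R z) \<longlonglongrightarrow> 0 *\<^sub>R z" by (intro tendsto_intros elim)
      then have "(\<lambda>k. \<epsilon> k *\<^sub>R z) \<longlonglongrightarrow> 0" by simp
      moreover have "isCont \<phi> 0" using test_function_cont[OF \<phi>] by (simp add: continuous_on_eq_continuous_at)
      ultimately have "(\<lambda>k. \<phi> (\<epsilon> k *\<^sub>R z)) \<longlonglongrightarrow> \<phi> 0" by (rule isCont_tendsto_compose[rotated])
      then show ?thesis by (rule tendsto_mult_left)
    qed
    then show "AE z in lborel. (\<lambda>k. bubble z * \<phi> (\<epsilon> k *\<^sub>R z)) \<longlonglongrightarrow> bubble z * \<phi> 0" by simp
    have "norm (bubble z * \<phi> (\<epsilon> k *\<^sub>R z)) \<le> bubble z * Cb" for k z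
    proof -
      have "bubble z \<ge> 0" by (simp add: bubble_def)
      then show ?thesis unfolding real_norm_def abs_mult by (simp add: mult_left_mono Cb)
    qed
    then show "AE z in lborel. norm (bubble z * \<phi> (\<epsilon> k *\<^sub>R z)) \<le> bubble z * Cb" for k by simp
  qed
  have "(\<lambda>k. 4 * n * (LINT z|lborel. bubble z * \<phi> (\<epsilon> k *\<^sub>R z))) \<longlonglongrightarrow> 4 * n * (LINT z|lborel. bubble z * \<phi> 0)"
    by (rule tendsto_mult_left[OF limP])
  moreover have "4 * n * (LINT z|lborel. bubble z * \<phi> 0) = 4 * pi * n * \<phi> 0" using bubble_integral(2) by simp
  ultimately have limC: "(\<lambda>k. LINT x|lborel. ?C k x * \<phi> x) \<longlonglongrightarrow> 4 * pi * n * \<phi> 0"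
    unfolding C_eq by (simp only:)
  have split: "(LINT x|lborel. u (sqrt (sq (\<epsilon> k) x)) * ?L x)
      = (LINT x|lborel. ?A k x * \<phi> x) + ((LINT x|lborel. ?B k x * \<phi> x) + (LINT x|lborel. ?C k x * \<phi> x))" for k
  proof -
    have "(f (sqrt (sq (\<epsilon> k) x)) * (1 - (\<epsilon> k)\<^sup>2 / sq (\<epsilon> k) x) + 2 * y (sqrt (sq (\<epsilon> k) x)) * (\<epsilon> k)\<^sup>2 / (sq (\<epsilon> k) x)\<^sup>2) * \<phi> x
      = ?A k x * \<phi> x + (?B k x * \<phi> x + ?C k x * \<phi> x)" for x
      by (simp add: algebra_simps diff_divide_distrib)
    then have "(LINT x|lborel. u (sqrt (sq (\<epsilon> k) x)) * ?L x) = (LINT x|lborel. ?A k x * \<phi> x + (?B k x * \<phi> x + ?C k x * \<phi> x))"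
      unfolding regularised_green[OF e \<phi>] by (simp only:)
    also have "\<dots> = (LINT x|lborel. ?A k x * \<phi> x) + (LINT x|lborel. ?B k x * \<phi> x + ?C k x * \<phi> x)"
      by (rule Bochner_Integration.integral_add[OF iABC(1) Bochner_Integration.integrable_add[OF iABC(2,3)]])
    also have "(LINT x|lborel. ?B k x * \<phi> x + ?C k x * \<phi> x) = (LINT x|lborel. ?B k x * \<phi> x) + (LINT x|lborel. ?C k x * \<phi> x)"
      by (rule Bochner_Integration.integral_add[OF iABC(2,3)])
    finally show ?thesis .
  qed
  have "(\<lambda>k. LINT x|lborel. u (sqrt (sq (\<epsilon> k) x)) * ?L x) \<longlonglongrightarrow> (LINT x|lborel. f (norm x) * \<phi> x) + (0 + 4 * pi * n * \<phi> 0)"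
    unfolding split using tendsto_add[OF limA tendsto_add[OF limB limC]] by simp
  from LIMSEQ_unique[OF limL this]
  show "(LINT x|lborel. u (norm x) * ?L x) = (LINT x|lborel. f (norm x) * \<phi> x) + 4 * pi * n * \<phi> 0" by simp
qed

end

section \<open>The solution in the plane\<close>

lemma radial_has_derivative:
  fixes x :: "'a::euclidean_space"
  assumes x: "x \<noteq> 0" and g: "(g has_real_derivative g') (at (norm x))"
  shows "((\<lambda>x. g (norm x)) has_derivative (\<lambda>h. g' * (1 / norm x * inner x h))) (at x)"
proof -
  have n: "(norm has_derivative (\<lambda>h. inner h (sgn x))) (at x)"
    by (rule has_derivative_norm[OF x])
  have "((\<lambda>x. g (norm x)) has_derivative (\<lambda>h. g' * inner h (sgn x))) (at x)"
    using has_derivative_compose[OF n g[unfolded has_field_derivative_def]] .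
  moreover have "inner h (sgn x) = 1 / norm x * inner x h" for h
    by (simp add: sgn_div_norm inner_commute divide_inverse)
  ultimately show ?thesis by simp
qed

text \<open>Exponential decay is compared with \<open>bubble\<close>, whose integrability is already known.\<close>

lemma integrable_exp_decay:
  fixes f :: "real \<Rightarrow> real"
  assumes m: "(\<lambda>x::real^2. f (norm x)) \<in> borel_measurable borel"
    and K: "\<And>r. r \<ge> 0 \<Longrightarrow> \<bar>f r\<bar> \<le> K" and d: "\<And>r. r \<ge> p \<Longrightarrow> \<bar>f r\<bar> \<le> C * exp (- r / 2)"
    and p: "p \<ge> 0" and C: "C \<ge> 0"
  shows "integrable lborel (\<lambda>x::real^2. f (norm x))"
proof -
  define M where "M = K * (1 + p\<^sup>2)\<^sup>2 + C * 8 ^ 4"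
  have K0: "K \<ge> 0" using order_trans[OF abs_ge_zero K[of 0]] by simp
  have M0: "M \<ge> 0" using K0 C by (simp add: M_def)
  have le: "\<bar>f r\<bar> \<le> M / (1 + r\<^sup>2)\<^sup>2" if r: "r \<ge> 0" for r
  proof -
    have "1 + r\<^sup>2 > 0" by (simp add: add_pos_nonneg)
    then have pos: "(1 + r\<^sup>2)\<^sup>2 > 0" by (rule zero_less_power)
    have "\<bar>f r\<bar> * (1 + r\<^sup>2)\<^sup>2 \<le> M"
    proof (cases "r \<le> p")
      case True
      have "(1 + r\<^sup>2)\<^sup>2 \<le> (1 + p\<^sup>2)\<^sup>2" using True r by (intro power_mono add_mono) auto
      then have "\<bar>f r\<bar> * (1 + r\<^sup>2)\<^sup>2 \<le> K * (1 + p\<^sup>2)\<^sup>2" using K[OF r] K0 by (intro mult_mono) auto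
      then show ?thesis using C by (simp add: M_def)
    next
      case False
      have "1 + r\<^sup>2 \<le> (1 + r)\<^sup>2" using r by (simp add: power2_eq_square algebra_simps)
      then have "(1 + r\<^sup>2)\<^sup>2 \<le> ((1 + r)\<^sup>2)\<^sup>2" by (intro power_mono) auto
      also have "\<dots> = (1 + r) ^ 4" by simp
      also have "\<dots> \<le> (8 * exp (r / 8)) ^ 4"
      proof (rule power_mono)
        show "1 + r \<le> 8 * exp (r / 8)" using exp_ge_add_one_self[of "r / 8"] by argo
        show "0 \<le> 1 + r" using r by simp
      qed
      also have "\<dots> = 8 ^ 4 * exp (r / 2)"
        by (simp add: power_mult_distrib exp_of_nat_mult[symmetric])
      finally have q: "(1 + r\<^sup>2)\<^sup>2 \<le> 8 ^ 4 * exp (r / 2)" .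
      have "\<bar>f r\<bar> * (1 + r\<^sup>2)\<^sup>2 \<le> (C * exp (- r / 2)) * (8 ^ 4 * exp (r / 2))"
        using False d[of r] C q by (intro mult_mono) auto
      also have "\<dots> = C * 8 ^ 4 * (exp (- r / 2) * exp (r / 2))" by (simp only: mult_ac)
      also have "exp (- r / 2) * exp (r / 2) = 1" by (simp add: exp_add[symmetric])
      finally show ?thesis using K0 by (simp add: M_def add_increasing)
    qed
    then show ?thesis using pos by (simp add: pos_le_divide_eq)
  qed
  have "integrable lborel (\<lambda>x. M * bubble x)" by (rule integrable_mult_right[OF bubble_integral(1)])
  then show ?thesis
  proof (rule Bochner_Integration.integrable_bound)
    show "(\<lambda>x::real^2. f (norm x)) \<in> borel_measurable lborel" using m by simp
    have "norm (f (norm x)) \<le> norm (M * bubble x)" for x :: "real^2"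
      using le[of "norm x"] M0 by (simp add: bubble_def)
    then show "AE x in lborel. norm (f (norm (x::real^2))) \<le> norm (M * bubble x)" by simp
  qed
qed

text \<open>Testing the equation with \<open>bump (x / R)\<close> and letting \<open>R\<close> tend to infinity shows that the right-hand side
  and the Dirac mass have total mass zero: the left-hand side tends to zero by \<open>scaled_laplacian_limit\<close>.\<close>

lemma quantized_integral:
  fixes u f :: "real^2 \<Rightarrow> real"
  assumes eq: "laplace_eq_dirac u f c" and u: "locally_integrable u" "(u \<longlongrightarrow> 0) at_infinity"
    and f: "integrable lborel f"
  shows "(LINT x|lborel. f x) = - c"
proof -
  define \<zeta> where "\<zeta> n y = bump ((1 / real (Suc n)) *\<^sub>R y)" for n :: nat and y :: "real^2"
  have t: "test_function (\<zeta> n)" for n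
    using test_function_scale[OF test_function_bump, of "1 / real (Suc n)" 1 0] unfolding \<zeta>_def[abs_def] by simp
  have lim0: "(\<lambda>n. LINT x|lborel. u x * laplacian (\<zeta> n) x) \<longlonglongrightarrow> 0"
    unfolding \<zeta>_def[abs_def] by (rule scaled_laplacian_limit[OF u test_function_bump])
  obtain C where C: "\<And>z::real^2. \<bar>bump z\<bar> \<le> C" using test_function_bounded[OF test_function_bump] by blast
  have lim1: "(\<lambda>n. LINT x|lborel. f x * \<zeta> n x) \<longlonglongrightarrow> (LINT x|lborel. f x * bump (0::real^2))"
  proof (rule integral_dominated_convergence[where w = "\<lambda>x. \<bar>f x\<bar> * C"])
    show "integrable lborel (\<lambda>x. \<bar>f x\<bar> * C)" by (intro integrable_mult_left integrable_abs f)
    show "(\<lambda>x. f x * bump (0::real^2)) \<in> borel_measurable lborel"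
      by (rule borel_measurable_times[OF borel_measurable_integrable[OF f] borel_measurable_const])
    show "(\<lambda>x. f x * \<zeta> n x) \<in> borel_measurable lborel" for n
      by (rule borel_measurable_times[OF borel_measurable_integrable[OF f] borel_measurable_integrable[OF test_function_integrable[OF t]]])
    have "(\<lambda>n. f x * \<zeta> n x) \<longlonglongrightarrow> f x * bump (0::real^2)" for x
    proof -
      have "isCont (bump :: real^2 \<Rightarrow> real) 0"
        using test_function_cont[OF test_function_bump[where 'a = "real^2"]] by (simp add: continuous_on_eq_continuous_at)
      moreover have "(\<lambda>n. (1 / real (Suc n)) *\<^sub>R x) \<longlonglongrightarrow> 0 *\<^sub>R x"
        by (intro tendsto_intros LIMSEQ_inverse_real_of_nat[unfolded inverse_eq_divide])
      then have "(\<lambda>n. (1 / real (Suc n)) *\<^sub>R x) \<longlonglongrightarrow> 0" by simp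
      ultimately have "(\<lambda>n. bump ((1 / real (Suc n)) *\<^sub>R x)) \<longlonglongrightarrow> bump (0::real^2)"
        by (rule isCont_tendsto_compose)
      then show ?thesis unfolding \<zeta>_def by (rule tendsto_mult_left)
    qed
    then show "AE x in lborel. (\<lambda>n. f x * \<zeta> n x) \<longlonglongrightarrow> f x * bump (0::real^2)" by simp
    have "norm (f x * \<zeta> n x) \<le> \<bar>f x\<bar> * C" for n x
      unfolding real_norm_def abs_mult \<zeta>_def by (rule mult_left_mono[OF C]) simp
    then show "AE x in lborel. norm (f x * \<zeta> n x) \<le> \<bar>f x\<bar> * C" for n by simp
  qed
  have "(LINT x|lborel. u x * laplacian (\<zeta> n) x) = (LINT x|lborel. f x * \<zeta> n x) + c * bump (0::real^2)" for n
    using eq t[of n] unfolding laplace_eq_dirac_def by (simp add: \<zeta>_def)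
  then have "(\<lambda>n. LINT x|lborel. u x * laplacian (\<zeta> n) x) \<longlonglongrightarrow> (LINT x|lborel. f x * bump (0::real^2)) + c * bump (0::real^2)"
    using tendsto_add[OF lim1 tendsto_const[of "c * bump (0::real^2)"]] by simp
  from LIMSEQ_unique[OF lim0 this]
  have "((LINT x|lborel. f x) + c) * bump (0::real^2) = 0" by (simp add: distrib_right)
  moreover have "bump (0::real^2) > 0" by (simp add: bump_props)
  ultimately show ?thesis by simp
qed

lemma abs_exp_minus_one_le_exp: "\<bar>exp x - 1\<bar> \<le> \<bar>x\<bar> * exp \<bar>x\<bar>" for x :: real
proof (cases "x \<ge> 0")
  case True
  have "(1 - x) * exp x \<le> exp (- x) * exp x"
    using exp_ge_add_one_self[of "- x"] by (intro mult_right_mono) auto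
  then have "exp x - 1 \<le> x * exp x" by (simp add: exp_minus algebra_simps)
  then show ?thesis using True by simp
next
  case False
  have "\<bar>x\<bar> * 1 \<le> \<bar>x\<bar> * exp \<bar>x\<bar>" by (intro mult_left_mono) auto
  moreover have "exp x \<le> 1" using False by simp
  ultimately show ?thesis using False exp_ge_add_one_self[of x] by linarith
qed

context vortex_system
begin

text \<open>The equations express the derivatives of \<open>u1\<close>, \<open>u2\<close>, \<open>y1\<close>, \<open>y2\<close> and of the two exponentials as polynomials in
  these functions, \<open>r\<close> and \<open>1 / r\<close>. Together with the coordinate functions they therefore generate an algebra
  that is closed under partial derivatives.\<close>

lemma radial_smooth:
  assumes d: "\<And>r. r > 0 \<Longrightarrow> (u1 has_real_derivative y1 r / r) (at r)"
    "\<And>r. r > 0 \<Longrightarrow> (u2 has_real_derivative y2 r / r) (at r)"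
    "\<And>r. r > 0 \<Longrightarrow> (y1 has_real_derivative r * rhs1 (exp (2 * u1 r) - 1) (exp (2 * u2 r) - 1)) (at r)"
    "\<And>r. r > 0 \<Longrightarrow> (y2 has_real_derivative r * rhs2 (exp (2 * u1 r) - 1) (exp (2 * u2 r) - 1)) (at r)"
  shows "smooth_on (\<lambda>x::'a::euclidean_space. u1 (norm x)) (- {0})"
    "smooth_on (\<lambda>x::'a. u2 (norm x)) (- {0})"
proof -
  define P where "P = {\<lambda>r. r, \<lambda>r. 1 / r, u1, u2, y1, y2, \<lambda>r. exp (2 * u1 r), \<lambda>r. exp (2 * u2 r)}"
  define G :: "('a \<Rightarrow> real) set" where "G = range (\<lambda>b x. inner x b) \<union> (\<lambda>g x. g (norm x)) ` P"
  have co: "(\<lambda>x. inner x b) \<in> alg G" for b by (rule alg.gen) (simp add: G_def)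
  have pr: "(\<lambda>x. g (norm x)) \<in> alg G" if "g \<in> P" for g
    by (rule alg.gen) (use that in \<open>auto simp: G_def\<close>)
  have mem: "(\<lambda>x. norm x) \<in> alg G" "(\<lambda>x. 1 / norm x) \<in> alg G" "(\<lambda>x. u1 (norm x)) \<in> alg G" "(\<lambda>x. u2 (norm x)) \<in> alg G"
    "(\<lambda>x. y1 (norm x)) \<in> alg G" "(\<lambda>x. y2 (norm x)) \<in> alg G"
    "(\<lambda>x. exp (2 * u1 (norm x))) \<in> alg G" "(\<lambda>x. exp (2 * u2 (norm x))) \<in> alg G"
    using pr[of "\<lambda>r. r"] pr[of "\<lambda>r. 1 / r"] pr[of u1] pr[of u2] pr[of y1] pr[of y2]
      pr[of "\<lambda>r. exp (2 * u1 r)"] pr[of "\<lambda>r. exp (2 * u2 r)"] by (simp_all add: P_def)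
  have dg: "\<exists>g'. (\<forall>r>0. (g has_real_derivative g' r) (at r)) \<and> (\<lambda>x. g' (norm x)) \<in> alg G" if "g \<in> P" for g
  proof -
    from that consider "g = (\<lambda>r. r)" | "g = (\<lambda>r. 1 / r)" | "g = u1" | "g = u2" | "g = y1" | "g = y2"
      | "g = (\<lambda>r. exp (2 * u1 r))" | "g = (\<lambda>r. exp (2 * u2 r))"
      unfolding P_def by blast
    then show ?thesis
    proof cases
      case 1
      then show ?thesis by (intro exI[of _ "\<lambda>r. 1"]) (auto intro: alg.const)
    next
      case 2
      have "(\<lambda>x. - 1 * (1 / norm x * (1 / norm x))) \<in> alg G" by (intro alg.mult alg.const mem)
      then show ?thesis unfolding 2
        by (intro exI[of _ "\<lambda>r. - 1 * (1 / r * (1 / r))"]) (auto intro!: derivative_eq_intros)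
    next
      case 3
      have "(\<lambda>x. y1 (norm x) * (1 / norm x)) \<in> alg G" by (intro alg.mult mem)
      then show ?thesis unfolding 3 by (intro exI[of _ "\<lambda>r. y1 r * (1 / r)"]) (simp add: d)
    next
      case 4
      have "(\<lambda>x. y2 (norm x) * (1 / norm x)) \<in> alg G" by (intro alg.mult mem)
      then show ?thesis unfolding 4 by (intro exI[of _ "\<lambda>r. y2 r * (1 / r)"]) (simp add: d)
    next
      case 5
      have "(\<lambda>x. norm x * (\<alpha> * (exp (2 * u1 (norm x)) + (- 1)) + \<beta> * (exp (2 * u2 (norm x)) + (- 1)))) \<in> alg G"
        by (intro alg.mult alg.add alg.const mem)
      then show ?thesis unfolding 5
        by (intro exI[of _ "\<lambda>r. r * (\<alpha> * (exp (2 * u1 r) + (- 1)) + \<beta> * (exp (2 * u2 r) + (- 1)))"])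
          (use d(3) in \<open>simp add: rhs1_def\<close>)
    next
      case 6
      have "(\<lambda>x. norm x * ((\<alpha> - 1 / 2) * (exp (2 * u1 (norm x)) + (- 1)) + (\<beta> + 1 / 2) * (exp (2 * u2 (norm x)) + (- 1)))) \<in> alg G"
        by (intro alg.mult alg.add alg.const mem)
      then show ?thesis unfolding 6
        by (intro exI[of _ "\<lambda>r. r * ((\<alpha> - 1 / 2) * (exp (2 * u1 r) + (- 1)) + (\<beta> + 1 / 2) * (exp (2 * u2 r) + (- 1)))"])
          (use d(4) in \<open>simp add: rhs2_def\<close>)
    next
      case 7
      have "(\<lambda>x. exp (2 * u1 (norm x)) * (2 * (y1 (norm x) * (1 / norm x)))) \<in> alg G"
        by (intro alg.mult alg.const mem)
      moreover have "((\<lambda>r. exp (2 * u1 r)) has_real_derivative exp (2 * u1 r) * (2 * (y1 r * (1 / r)))) (at r)" if "r > 0" for r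
        using d(1)[OF that] by (auto intro!: derivative_eq_intros)
      ultimately show ?thesis unfolding 7
        by (intro exI[of _ "\<lambda>r. exp (2 * u1 r) * (2 * (y1 r * (1 / r)))"]) blast
    next
      case 8
      have "(\<lambda>x. exp (2 * u2 (norm x)) * (2 * (y2 (norm x) * (1 / norm x)))) \<in> alg G"
        by (intro alg.mult alg.const mem)
      moreover have "((\<lambda>r. exp (2 * u2 r)) has_real_derivative exp (2 * u2 r) * (2 * (y2 r * (1 / r)))) (at r)" if "r > 0" for r
        using d(2)[OF that] by (auto intro!: derivative_eq_intros)
      ultimately show ?thesis unfolding 8
        by (intro exI[of _ "\<lambda>r. exp (2 * u2 r) * (2 * (y2 r * (1 / r)))"]) blast
    qed
  qed
  have G: "\<exists>D. (\<forall>x\<in>- {0}. (f has_derivative D x) (at x)) \<and> (\<forall>b\<in>Basis. \<exists>g\<in>alg G. \<forall>x\<in>- {0}. D x b = g x)"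
    if "f \<in> G" for f
  proof -
    from that consider b where "f = (\<lambda>x. inner x b)" | g where "g \<in> P" "f = (\<lambda>x. g (norm x))"
      unfolding G_def by blast
    then show ?thesis
    proof cases
      case 1
      have D: "(f has_derivative (\<lambda>h. inner h b)) (at x)" for x
        unfolding 1 by (auto intro!: derivative_eq_intros)
      show ?thesis
      proof (intro exI[of _ "\<lambda>x h. inner h b"] conjI ballI D)
        fix a :: 'a
        show "\<exists>g\<in>alg G. \<forall>x\<in>- {0}. inner a b = g x"
          by (rule bexI[OF _ alg.const[of "inner a b"]]) (rule ballI, rule refl)
      qed
    next
      case 2
      obtain g' where g': "\<forall>r>0. (g has_real_derivative g' r) (at r)" "(\<lambda>x. g' (norm x)) \<in> alg G"
        using dg[OF 2(1)] by blast
      show ?thesis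
      proof (intro exI[of _ "\<lambda>x h. g' (norm x) * (1 / norm x * inner x h)"] conjI ballI)
        show "(f has_derivative (\<lambda>h. g' (norm x) * (1 / norm x * inner x h))) (at x)" if "x \<in> - {0}" for x
          unfolding 2(2) by (rule radial_has_derivative) (use that g'(1) in auto)
        fix b :: 'a
        have "(\<lambda>x. g' (norm x) * (1 / norm x * inner x b)) \<in> alg G"
          by (intro alg.mult g'(2) mem co)
        then show "\<exists>h\<in>alg G. \<forall>x\<in>- {0}. g' (norm x) * (1 / norm x * inner x b) = h x"
          by (rule bexI[rotated]) (rule ballI, rule refl)
      qed
    qed
  qed
  have o: "open (- {0::'a})" by (rule open_Compl) simp
  show "smooth_on (\<lambda>x::'a. u1 (norm x)) (- {0})" "smooth_on (\<lambda>x::'a. u2 (norm x)) (- {0})"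
    by (rule alg_smooth[OF o G mem(3)], assumption) (rule alg_smooth[OF o G mem(4)], assumption)
qed

lemma grad_radial:
  assumes d: "(u1 has_real_derivative g1) (at (norm x))" "(u2 has_real_derivative g2) (at (norm x))" and x: "x \<noteq> 0"
  shows "norm (grad (\<lambda>z::'a::euclidean_space. a * u1 (norm z) + b * u2 (norm z)) x) = \<bar>a * g1 + b * g2\<bar>"
proof -
  let ?f = "\<lambda>z::'a. a * u1 (norm z) + b * u2 (norm z)"
  let ?D = "((a * g1 + b * g2) * (1 / norm x)) *\<^sub>R x"
  have "((\<lambda>r. a * u1 r + b * u2 r) has_real_derivative a * g1 + b * g2) (at (norm x))"
    by (intro DERIV_add DERIV_cmult d)
  from radial_has_derivative[OF x this]
  have D: "(?f has_derivative (\<lambda>h. inner h ?D)) (at x)"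
    by (simp add: inner_commute mult.assoc)
  have "grad ?f x = ?D"
    unfolding grad_def
  proof (rule the_equality)
    show "GDERIV ?f x :> ?D" using D by (simp only: gderiv_def)
    fix E assume "GDERIV ?f x :> E"
    then have "(?f has_derivative (\<lambda>h. inner h E)) (at x)" by (simp only: gderiv_def)
    from has_derivative_unique[OF this D] have "\<forall>h. inner h E = inner h ?D" by (auto dest: fun_cong)
    then show "E = ?D" by (rule vector_eq_ldot[THEN iffD1])
  qed
  then show ?thesis using x by (simp add: abs_mult)
qed

text \<open>The radial profiles as functions on the plane. The constant \<open>C\<close> is six times that of the radial solution,
  because the derivatives \<open>y r / r\<close> are bounded with the factor \<open>(2 * r + 4) / r \<le> 6\<close>.\<close>

theorem plane_solution:
  obtains u1 u2 g1 g2 :: "real \<Rightarrow> real" and p C :: real where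
    "weak_solution (4 * pi * real n1) (4 * pi * real n2) (\<lambda>x. u1 (norm x)) (\<lambda>x. u2 (norm x))"
    "smooth_on (\<lambda>x::real^2. u1 (norm x)) (- {0})" "smooth_on (\<lambda>x::real^2. u2 (norm x)) (- {0})"
    "p \<ge> 1" "C > 0"
    "\<And>r. r \<ge> p \<Longrightarrow> \<bar>u1 r\<bar> \<le> C * exp (- r / 2)" "\<And>r. r \<ge> p \<Longrightarrow> \<bar>u2 r\<bar> \<le> C * exp (- r / 2)"
    "\<And>r. r > 0 \<Longrightarrow> (u1 has_real_derivative g1 r) (at r)" "\<And>r. r > 0 \<Longrightarrow> (u2 has_real_derivative g2 r) (at r)"
    "\<And>r. r \<ge> p \<Longrightarrow> \<bar>g1 r\<bar> \<le> C * exp (- r / 2)" "\<And>r. r \<ge> p \<Longrightarrow> \<bar>g2 r\<bar> \<le> C * exp (- r / 2)"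
    "has_bochner_integral lborel (\<lambda>x::real^2. rhs1 (exp (2 * u1 (norm x)) - 1) (exp (2 * u2 (norm x)) - 1)) (- (4 * pi * real n1))"
    "has_bochner_integral lborel (\<lambda>x::real^2. rhs2 (exp (2 * u1 (norm x)) - 1) (exp (2 * u2 (norm x)) - 1)) (- (4 * pi * real n2))"
proof -
  obtain u1 u2 y1 y2 :: "real \<Rightarrow> real" and p C K :: real where
    p: "p \<ge> 1" and C: "C > 0" and K: "K \<ge> 0" and
    d: "\<And>r. r > 0 \<Longrightarrow> (u1 has_real_derivative y1 r / r) (at r)"
      "\<And>r. r > 0 \<Longrightarrow> (u2 has_real_derivative y2 r / r) (at r)"
      "\<And>r. r > 0 \<Longrightarrow> (y1 has_real_derivative r * rhs1 (exp (2 * u1 r) - 1) (exp (2 * u2 r) - 1)) (at r)"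
      "\<And>r. r > 0 \<Longrightarrow> (y2 has_real_derivative r * rhs2 (exp (2 * u1 r) - 1) (exp (2 * u2 r) - 1)) (at r)" and
    near: "\<And>r. 0 < r \<Longrightarrow> r \<le> 1 \<Longrightarrow> \<bar>u1 r - 2 * real n1 * ln r\<bar> \<le> K"
      "\<And>r. 0 < r \<Longrightarrow> r \<le> 1 \<Longrightarrow> \<bar>u2 r - 2 * real n2 * ln r\<bar> \<le> K" and
    away: "\<And>r. r \<ge> 1 \<Longrightarrow> \<bar>u1 r\<bar> \<le> K" "\<And>r. r \<ge> 1 \<Longrightarrow> \<bar>u2 r\<bar> \<le> K" and
    flux: "\<And>r. r > 0 \<Longrightarrow> \<bar>y1 r - 2 * real n1\<bar> \<le> K * r\<^sup>2"
      "\<And>r. r > 0 \<Longrightarrow> \<bar>y2 r - 2 * real n2\<bar> \<le> K * r\<^sup>2" and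
    dec: "\<And>r. r \<ge> p \<Longrightarrow> \<bar>u1 r\<bar> \<le> C * exp (- r / 2)"
      "\<And>r. r \<ge> p \<Longrightarrow> \<bar>u2 r\<bar> \<le> C * exp (- r / 2)"
      "\<And>r. r \<ge> p \<Longrightarrow> \<bar>y1 r\<bar> \<le> C * ((2 * r + 4) * exp (- r / 2))"
      "\<And>r. r \<ge> p \<Longrightarrow> \<bar>y2 r\<bar> \<le> C * ((2 * r + 4) * exp (- r / 2))"
    by (rule radial_solution) (rule that, assumption+)
  define f1 where "f1 r = rhs1 (exp (2 * u1 r) - 1) (exp (2 * u2 r) - 1)" for r
  define f2 where "f2 r = rhs2 (exp (2 * u1 r) - 1) (exp (2 * u2 r) - 1)" for r
  define s where "s = rhs_size"
  have s: "s > 0" using a0 b0 by (simp add: s_def rhs_size_def)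
  have f_le: "\<bar>f1 r\<bar> \<le> s * (\<bar>exp (2 * u1 r) - 1\<bar> + \<bar>exp (2 * u2 r) - 1\<bar>)"
    "\<bar>f2 r\<bar> \<le> s * (\<bar>exp (2 * u1 r) - 1\<bar> + \<bar>exp (2 * u2 r) - 1\<bar>)" for r
    using norm_rhs[of "exp (2 * u1 r) - 1" "exp (2 * u2 r) - 1"] norm_fst_le[of "f1 r" "f2 r"] norm_snd_le[of "f2 r" "f1 r"]
    unfolding f1_def[symmetric] f2_def[symmetric] s_def[symmetric] by simp_all
  have u_abs: "\<bar>u1 r\<bar> \<le> K + 2 * real n1 * max 0 (- ln r)" "\<bar>u2 r\<bar> \<le> K + 2 * real n2 * max 0 (- ln r)"
    and u_le: "u1 r \<le> K" "u2 r \<le> K" if r: "r > 0" for r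
  proof (atomize (full), cases "r \<le> 1")
    case True
    have l: "ln r \<le> 0" using r True by simp
    have n: "real n1 * ln r \<le> 0" "real n2 * ln r \<le> 0" using l by (simp_all add: mult_nonneg_nonpos)
    have m: "max 0 (- ln r) = - ln r" using l by simp
    show "(\<bar>u1 r\<bar> \<le> K + 2 * real n1 * max 0 (- ln r) \<and> \<bar>u2 r\<bar> \<le> K + 2 * real n2 * max 0 (- ln r)) \<and> u1 r \<le> K \<and> u2 r \<le> K"
      using near[OF r True] n unfolding m mult_minus_right mult.assoc by linarith
  next
    case False
    have "2 * real n1 * max 0 (- ln r) \<ge> 0" "2 * real n2 * max 0 (- ln r) \<ge> 0" by simp_all
    then show "(\<bar>u1 r\<bar> \<le> K + 2 * real n1 * max 0 (- ln r) \<and> \<bar>u2 r\<bar> \<le> K + 2 * real n2 * max 0 (- ln r)) \<and> u1 r \<le> K \<and> u2 r \<le> K"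
      using away[of r] False by linarith
  qed
  \<comment> \<open>The profiles are unspecified at \<open>0\<close>, but local integrability is proved with a bound that holds at the origin as well.\<close>
  define M where "M = exp (2 * K) + \<bar>exp (2 * u1 0)\<bar> + \<bar>exp (2 * u2 0)\<bar>"
  have e_le: "exp (2 * u1 r) \<le> M" "exp (2 * u2 r) \<le> M" if r: "r \<ge> 0" for r
  proof -
    have "exp (2 * u1 r) \<le> exp (2 * K)" "exp (2 * u2 r) \<le> exp (2 * K)" if "r \<noteq> 0" using u_le[of r] r that by auto
    then show "exp (2 * u1 r) \<le> M" "exp (2 * u2 r) \<le> M"
      unfolding M_def by (cases "r = 0"; simp add: add_increasing add_increasing2)+
  qed
  define L where "L = s * ((M + 1) + (M + 1))"
  have L: "\<bar>f1 r\<bar> \<le> L" "\<bar>f2 r\<bar> \<le> L" if r: "r \<ge> 0" for r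
  proof -
    have "\<bar>e - 1\<bar> \<le> M + 1" if "e \<le> M" "0 < e" for e :: real using that by linarith
    from this[OF e_le(1)[OF r] exp_gt_zero] this[OF e_le(2)[OF r] exp_gt_zero]
    have "\<bar>exp (2 * u1 r) - 1\<bar> + \<bar>exp (2 * u2 r) - 1\<bar> \<le> (M + 1) + (M + 1)" by (rule add_mono)
    then have "s * (\<bar>exp (2 * u1 r) - 1\<bar> + \<bar>exp (2 * u2 r) - 1\<bar>) \<le> L" unfolding L_def using s by (intro mult_left_mono) auto
    then show "\<bar>f1 r\<bar> \<le> L" "\<bar>f2 r\<bar> \<le> L" using f_le[of r] by linarith+
  qed
  define B where "B = max K L"
  have B: "K \<le> B" "L \<le> B" by (simp_all add: B_def)
  define F where "F = s * (4 * C * exp (2 * K))"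
  have F0: "F \<ge> 0" using s C by (simp add: F_def)
  have F: "\<bar>f1 r\<bar> \<le> F * exp (- r / 2)" "\<bar>f2 r\<bar> \<le> F * exp (- r / 2)" if r: "r \<ge> p" for r
  proof -
    have a: "\<bar>exp (2 * v) - 1\<bar> \<le> 2 * C * exp (2 * K) * exp (- r / 2)" if v: "\<bar>v\<bar> \<le> C * exp (- r / 2)" "\<bar>v\<bar> \<le> K" for v
    proof -
      have "\<bar>exp (2 * v) - 1\<bar> \<le> \<bar>2 * v\<bar> * exp \<bar>2 * v\<bar>" by (rule abs_exp_minus_one_le_exp)
      also have "\<dots> \<le> (2 * (C * exp (- r / 2))) * exp (2 * K)" using v by (intro mult_mono) auto
      finally show ?thesis by (simp add: mult_ac)
    qed
    have r1: "r \<ge> 1" using p r by simp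
    have "\<bar>exp (2 * u1 r) - 1\<bar> + \<bar>exp (2 * u2 r) - 1\<bar> \<le> 4 * C * exp (2 * K) * exp (- r / 2)"
      using a[OF dec(1)[OF r] away(1)[OF r1]] a[OF dec(2)[OF r] away(2)[OF r1]] by linarith
    then have "s * (\<bar>exp (2 * u1 r) - 1\<bar> + \<bar>exp (2 * u2 r) - 1\<bar>) \<le> s * (4 * C * exp (2 * K) * exp (- r / 2))"
      using s by (intro mult_left_mono) auto
    also have "\<dots> = F * exp (- r / 2)" by (simp only: F_def mult.assoc)
    finally show "\<bar>f1 r\<bar> \<le> F * exp (- r / 2)" "\<bar>f2 r\<bar> \<le> F * exp (- r / 2)" using f_le[of r] by linarith+
  qed
  have cu: "continuous_on {0<..} u1" "continuous_on {0<..} u2"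
    using d(1,2) by (auto intro!: continuous_at_imp_continuous_on DERIV_isCont)
  have cf: "continuous_on {0<..} f1" "continuous_on {0<..} f2"
    unfolding f1_def[abs_def] f2_def[abs_def] rhs1_def rhs2_def by (intro continuous_intros cu)+
  have ce: "continuous_on {0<..} (\<lambda>r. exp (2 * u1 r))" "continuous_on {0<..} (\<lambda>r. exp (2 * u2 r))"
    by (intro continuous_intros cu)+
  interpret S1: single_profile u1 y1 f1 "real n1" B
  proof
    fix r :: real assume r: "r > 0"
    have "K * r\<^sup>2 \<le> B * r\<^sup>2" using B by (intro mult_right_mono) auto
    then show "\<bar>y1 r - 2 * real n1\<bar> \<le> B * r\<^sup>2" using flux(1)[OF r] by linarith
    show "\<bar>u1 r\<bar> \<le> B + 2 * real n1 * max 0 (- ln r)" using u_abs(1)[OF r] B by linarith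
    show "\<bar>f1 r\<bar> \<le> B" using L(1)[of r] r B by simp
    show "(y1 has_real_derivative r * f1 r) (at r)" unfolding f1_def by (rule d(3)[OF r])
  qed (use d(1) cf(1) in auto)
  interpret S2: single_profile u2 y2 f2 "real n2" B
  proof
    fix r :: real assume r: "r > 0"
    have "K * r\<^sup>2 \<le> B * r\<^sup>2" using B by (intro mult_right_mono) auto
    then show "\<bar>y2 r - 2 * real n2\<bar> \<le> B * r\<^sup>2" using flux(2)[OF r] by linarith
    show "\<bar>u2 r\<bar> \<le> B + 2 * real n2 * max 0 (- ln r)" using u_abs(2)[OF r] B by linarith
    show "\<bar>f2 r\<bar> \<le> B" using L(2)[of r] r B by simp
    show "(y2 has_real_derivative r * f2 r) (at r)" unfolding f2_def by (rule d(4)[OF r])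
  qed (use d(2) cf(2) in auto)
  have sm: "smooth_on (\<lambda>x::real^2. u1 (norm x)) (- {0})" "smooth_on (\<lambda>x::real^2. u2 (norm x)) (- {0})"
    by (rule radial_smooth[OF d], assumption+)+
  have ex: "locally_integrable (\<lambda>x::real^2. exp (2 * u1 (norm x)))" "locally_integrable (\<lambda>x::real^2. exp (2 * u2 (norm x)))"
    using S1.radial_measurable[OF ce(1)] S1.radial_measurable[OF ce(2)] e_le
    by (auto intro!: locally_integrable_bound[OF locally_integrable_continuous[OF continuous_on_const[of UNIV M]]])
  have "((\<lambda>r::real. C * exp (- r / 2)) \<longlongrightarrow> 0) at_top" by real_asymp
  then have ez: "((\<lambda>x::real^2. C * exp (- norm x / 2)) \<longlongrightarrow> 0) at_infinity"
    by (rule filterlim_compose[OF _ filterlim_norm_at_top])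
  have ev: "\<forall>\<^sub>F x::real^2 in at_infinity. norm (u1 (norm x)) \<le> C * exp (- norm x / 2)"
    "\<forall>\<^sub>F x::real^2 in at_infinity. norm (u2 (norm x)) \<le> C * exp (- norm x / 2)"
    unfolding eventually_at_infinity real_norm_def
    by (intro exI[of _ p] allI impI dec(1), assumption) (intro exI[of _ p] allI impI dec(2), assumption)
  note lim = Lim_null_comparison[OF ev(1) ez] Lim_null_comparison[OF ev(2) ez]
  have weak: "weak_solution (4 * pi * real n1) (4 * pi * real n2) (\<lambda>x. u1 (norm x)) (\<lambda>x. u2 (norm x))"
    unfolding weak_solution_def f1_def[symmetric] f2_def[symmetric]
    by (intro conjI S1.radial_laplace S2.radial_laplace S1.u_locally_integrable S2.u_locally_integrable
        ex lim smooth_on_imp(1)[OF sm(1)] smooth_on_imp(1)[OF sm(2)])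
  have int: "integrable lborel (\<lambda>x::real^2. f1 (norm x))" "integrable lborel (\<lambda>x::real^2. f2 (norm x))"
    using p F0 by (auto intro!: integrable_exp_decay[OF S1.radial_measurable L(1) F(1)]
        integrable_exp_decay[OF S1.radial_measurable L(2) F(2)] cf)
  have hbi: "has_bochner_integral lborel (\<lambda>x::real^2. f1 (norm x)) (- (4 * pi * real n1))"
    "has_bochner_integral lborel (\<lambda>x::real^2. f2 (norm x)) (- (4 * pi * real n2))"
    unfolding has_bochner_integral_iff
    using int quantized_integral[OF S1.radial_laplace S1.u_locally_integrable lim(1) int(1)]
      quantized_integral[OF S2.radial_laplace S2.u_locally_integrable lim(2) int(2)] by blast+
  have g: "\<bar>y / r\<bar> \<le> (6 * C) * exp (- r / 2)" if "\<bar>y\<bar> \<le> C * ((2 * r + 4) * exp (- r / 2))" "r \<ge> p" for y r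
  proof -
    have "C * ((2 * r + 4) * exp (- r / 2)) \<le> C * ((6 * r) * exp (- r / 2))"
      using that(2) p C by (intro mult_left_mono mult_right_mono) auto
    also have "\<dots> = (6 * C) * exp (- r / 2) * r" by (simp add: mult_ac)
    finally have "\<bar>y\<bar> \<le> (6 * C) * exp (- r / 2) * r" using that(1) by linarith
    then show ?thesis using that(2) p by (simp add: pos_divide_le_eq)
  qed
  have C6: "C * exp (- r / 2) \<le> (6 * C) * exp (- r / 2)" for r using C by (intro mult_right_mono) auto
  show ?thesis
  proof (rule that[of u1 u2 p "6 * C" "\<lambda>r. y1 r / r" "\<lambda>r. y2 r / r"])
    show "\<bar>u1 r\<bar> \<le> 6 * C * exp (- r / 2)" "\<bar>u2 r\<bar> \<le> 6 * C * exp (- r / 2)" if "r \<ge> p" for r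
      using dec(1,2)[OF that] C6[of r] by linarith+
    show "\<bar>y1 r / r\<bar> \<le> 6 * C * exp (- r / 2)" "\<bar>y2 r / r\<bar> \<le> 6 * C * exp (- r / 2)" if "r \<ge> p" for r
      using g[OF dec(3)[OF that] that] g[OF dec(4)[OF that] that] .
    show "6 * C > 0" using C by simp
  qed (rule weak sm p d(1,2) hbi[unfolded f1_def f2_def] | assumption)+
qed

end

section \<open>The constants\<close>

text \<open>For \<open>N > 0\<close> the square root equals \<open>N - 1 / 2\<close>, so that \<open>lambda4 N = 1 / 2\<close>.\<close>

lemma lambda_min_le: "lambda_min N \<le> 1"
proof (cases "N = 0")
  case True
  have "1 / 2 \<le> sqrt (1 / 4 :: real)" by (rule real_le_rsqrt) (simp add: power2_eq_square)
  then show ?thesis using True by (simp add: lambda_min_def lambda3_def lambda4_def min_def)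
next
  case False
  have "(real N)\<^sup>2 - real N + 1 / 4 = (real N - 1 / 2)\<^sup>2" by (simp add: power2_eq_square algebra_simps)
  then have "sqrt ((real N)\<^sup>2 - real N + 1 / 4) = real N - 1 / 2" using False by (simp add: real_sqrt_abs)
  then have "lambda4 N = 1 / 2" by (simp add: lambda4_def)
  then show ?thesis by (simp add: lambda_min_def)
qed

text \<open>Here \<open>d = N - 1\<close>, and \<open>\<alpha> + \<beta> = N\<close>.\<close>

lemma vortex_system_constants:
  assumes "N > 1" "n1 > 0" "n2 > 0"
  shows "vortex_system (alpha N) (beta N) (real N - 1) n1 n2"
proof
  have N: "real N \<ge> 2" using assms(1) by simp
  have i: "1 / (2 * real N) \<le> 1 / 4" using N by (simp add: field_simps)
  have i0: "1 / (2 * real N) > 0" using N by simp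
  show "alpha N > 0" using i by (simp add: alpha_def)
  show "beta N > 0" using N i0 unfolding beta_def by linarith
  show "real N - 1 \<ge> 1" using N by simp
  show "(real N - 1) * alpha N = beta N + (real N - 1) / 2"
    using N by (simp add: alpha_def beta_def field_simps)
qed (use assms in auto)

text \<open>The smallest eigenvalue of the matrix is at most \<open>1\<close> because its characteristic polynomial is
  nonpositive at \<open>1\<close>.\<close>

lemma lambda0_le:
  assumes N1: "N > 1"
  shows "lambda0 N \<le> 1"
proof -
  define n where "n = real N"
  have n: "n \<ge> 2" using N1 by (simp add: n_def)
  define a where "a = (2 * (alpha N)\<^sup>2 - alpha N) / beta N"
  define b where "b = 2 * alpha N - 1"
  define c where "c = 2 * beta N + 1"
  have bn: "b = (2 * n - 1) / n" using n by (simp add: b_def alpha_def n_def[symmetric] field_simps)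
  have cn: "c = (2 * n\<^sup>2 - 2 * n + 1) / n" using n by (simp add: c_def beta_def n_def[symmetric] field_simps power2_eq_square)
  have al: "alpha N = (3 * n - 1) / (2 * n)" using n by (simp add: alpha_def n_def[symmetric] field_simps)
  have be: "beta N = (2 * n - 1) * (n - 1) / (2 * n)" using n by (simp add: beta_def n_def[symmetric] field_simps power2_eq_square)
  have an: "a = (3 * n - 1) / (n * (n - 1))"
  proof -
    have "2 * (alpha N)\<^sup>2 - alpha N = alpha N * b" by (simp add: b_def power2_eq_square algebra_simps)
    then have "a = ((3 * n - 1) / (2 * n) * ((2 * n - 1) / n)) / ((2 * n - 1) * (n - 1) / (2 * n))"
      unfolding a_def al[symmetric] bn[symmetric] be[symmetric] by simp
    also have "\<dots> = (3 * n - 1) / (n * (n - 1))" using n by (simp add: divide_simps)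
    finally show ?thesis .
  qed
  have det: "(1 - a) * (1 - c) \<le> b\<^sup>2"
  proof -
    have e1: "1 - a = (n\<^sup>2 - 4 * n + 1) / (n * (n - 1))" unfolding an using n by (simp add: field_simps power2_eq_square)
    have e2: "1 - c = - ((2 * n - 1) * (n - 1)) / n" unfolding cn using n by (simp add: field_simps power2_eq_square)
    have "(1 - a) * (1 - c) = - (n\<^sup>2 - 4 * n + 1) * (2 * n - 1) / n\<^sup>2"
      unfolding e1 e2 using n by (simp add: divide_simps power2_eq_square) (simp add: algebra_simps)
    also have "\<dots> \<le> (2 * n - 1) * (2 * n - 1) / n\<^sup>2"
    proof (intro divide_right_mono mult_right_mono)
      have "n * (n - 2) \<ge> 0" using n by simp
      then show "- (n\<^sup>2 - 4 * n + 1) \<le> 2 * n - 1" by (simp add: power2_eq_square algebra_simps)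
    qed (use n in auto)
    also have "\<dots> = b\<^sup>2" unfolding bn by (simp add: power2_eq_square)
    finally show ?thesis .
  qed
  \<comment> \<open>The smaller root \<open>l\<close> of the characteristic polynomial, an eigenvalue by exhibiting the eigenvector \<open>(b, l - a)\<close>.\<close>
  define D where "D = (a - c)\<^sup>2 + 4 * b\<^sup>2"
  define l where "l = (a + c - sqrt D) / 2"
  have D0: "D \<ge> 0" by (simp add: D_def)
  have root: "(l - a) * (l - c) = b\<^sup>2"
  proof -
    have "(l - a) * (l - c) = ((sqrt D)\<^sup>2 - (a - c)\<^sup>2) / 4"
      by (simp add: l_def power2_eq_square field_simps)
    then show ?thesis using D0 by (simp add: D_def)
  qed
  have l1: "l \<le> 1"
  proof -
    have "(a + c - 2)\<^sup>2 \<le> D" using det by (simp add: D_def power2_eq_square algebra_simps)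
    then have "a + c - 2 \<le> sqrt D" by (rule real_le_rsqrt)
    then show ?thesis by (simp add: l_def)
  qed
  let ?M = "M_mat N"
  have M: "?M \<in> carrier_mat 2 2" unfolding M_mat_def mat_of_rows_list_def carrier_mat_def by simp
  have Mrow: "?M = mat_of_rows_list 2 [[a, b], [b, c]]" unfolding M_mat_def a_def b_def c_def ..
  have b0: "b \<noteq> 0" using n by (simp add: bn)
  define v where "v = vec_of_list [b, l - a]"
  have "eigenvector ?M v l"
    unfolding eigenvector_def
  proof (intro conjI)
    show "v \<in> carrier_vec (dim_row ?M)" using M by (simp add: v_def carrier_vecI)
    show "v \<noteq> 0\<^sub>v (dim_row ?M)"
    proof
      assume "v = 0\<^sub>v (dim_row ?M)"
      then have "v $ 0 = 0\<^sub>v (dim_row ?M) $ 0" by simp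
      then show False using b0 M by (simp add: v_def)
    qed
    show "?M *\<^sub>v v = l \<cdot>\<^sub>v v"
    proof (rule eq_vecI)
      show "dim_vec (?M *\<^sub>v v) = dim_vec (l \<cdot>\<^sub>v v)" using M by (simp add: v_def)
      fix i assume "i < dim_vec (l \<cdot>\<^sub>v v)"
      then have i: "i = 0 \<or> i = 1" by (auto simp: v_def)
      have "b * b + c * (l - a) = l * (l - a)" using root by (simp add: power2_eq_square algebra_simps)
      then show "(?M *\<^sub>v v) $ i = (l \<cdot>\<^sub>v v) $ i"
        using i unfolding Mrow v_def
        by (auto simp: mat_of_rows_list_def scalar_prod_def numeral_2_eq_2 algebra_simps)
    qed
  qed
  then have ev: "eigenvalue ?M l" unfolding eigenvalue_def by blast
  have "finite {k. eigenvalue ?M k}"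
  proof -
    have "char_poly ?M \<noteq> 0" using degree_monic_char_poly[OF M] by auto
    then show ?thesis using eigenvalue_root_char_poly[OF M] poly_roots_finite by simp
  qed
  then have "lambda0 N \<le> l" unfolding lambda0_def using ev by (intro Min_le) auto
  then show ?thesis using l1 by simp
qed

section \<open>Existence, uniqueness, decay and quantised integrals\<close>

text \<open>The square decays like \<open>exp (- r)\<close>, which is faster than required because the rate \<open>(1 - \<epsilon>) * sqrt l\<close> is at
  most \<open>1\<close>.\<close>

lemma square_exp_decay:
  assumes a: "\<bar>a\<bar> \<le> D * exp (- r / 2)" and l: "l \<le> 1" and \<epsilon>: "0 < \<epsilon>" "\<epsilon> < 1" and r: "r \<ge> 0"
  shows "a\<^sup>2 \<le> D\<^sup>2 * exp (- (1 - \<epsilon>) * sqrt l * r)"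
proof -
  have "(1 - \<epsilon>) * sqrt l \<le> (1 - \<epsilon>) * 1" using l \<epsilon> by (intro mult_left_mono) auto
  also have "\<dots> \<le> 1" using \<epsilon> by simp
  finally have "(1 - \<epsilon>) * sqrt l \<le> 1" .
  from this have "(1 - \<epsilon>) * sqrt l * r \<le> 1 * r" using r by (rule mult_right_mono)
  then have e: "exp (- r) \<le> exp (- (1 - \<epsilon>) * sqrt l * r)"
    by (simp only: exp_le_cancel_iff mult_minus_left neg_le_iff_le mult_1)
  have "\<bar>a\<bar>\<^sup>2 \<le> (D * exp (- r / 2))\<^sup>2" by (rule power_mono[OF a]) simp
  also have "\<dots> = D\<^sup>2 * exp (- r)" by (simp add: power_mult_distrib exp_of_nat_mult[symmetric])
  also have "\<dots> \<le> D\<^sup>2 * exp (- (1 - \<epsilon>) * sqrt l * r)" by (rule mult_left_mono[OF e]) simp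
  finally show ?thesis by simp
qed

theorem theorem3p1:
  fixes N n1 n2 :: nat
  assumes "N > 1" and "n1 > 0" and "n2 > 0"
  shows "\<exists>u1 u2 :: real^2 \<Rightarrow> real.
    vortex_solution N n1 n2 u1 u2 \<and>
    (\<forall>v1 v2. vortex_solution N n1 n2 v1 v2 \<longrightarrow> (\<forall>x. x \<noteq> 0 \<longrightarrow> v1 x = u1 x \<and> v2 x = u2 x)) \<and>
    (\<forall>\<epsilon>::real. 0 < \<epsilon> \<and> \<epsilon> < 1 \<longrightarrow>
      (\<exists>C>0. eventually (\<lambda>x.
          \<bar>p_const N * u1 x\<bar>\<^sup>2 + \<bar>2 * u2 x\<bar>\<^sup>2
            \<le> C * exp (- (1 - \<epsilon>) * sqrt (lambda0 N) * norm x) \<and>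
          (norm (grad (\<lambda>y. m_const N * u1 y + 2 * u2 y) x))\<^sup>2 +
          (norm (grad (\<lambda>y. p_const N * u1 y + q_const N * u2 y) x))\<^sup>2
            \<le> C * exp (- (1 - \<epsilon>) * sqrt (lambda_min N) * norm x)) at_infinity)) \<and>
    has_bochner_integral lborel
      (\<lambda>x. ((m_const N + 2) * alpha N - 1) * (exp (2 * u1 x) - 1) +
            ((m_const N + 2) * beta N + 1) * (exp (2 * u2 x) - 1))
      (- 4 * pi * (m_const N * real n1 + 2 * real n2)) \<and>
    has_bochner_integral lborel
      (\<lambda>x. ((p_const N + q_const N) * alpha N - q_const N / 2) * (exp (2 * u1 x) - 1) +
            ((p_const N + q_const N) * beta N + q_const N / 2) * (exp (2 * u2 x) - 1))
      (- 4 * pi * (p_const N * real n1 + q_const N * real n2))"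
proof -
  interpret vortex_system "alpha N" "beta N" "real N - 1" n1 n2
    using assms by (rule vortex_system_constants)
  have sol: "vortex_solution N n1 n2 v1 v2 \<longleftrightarrow> smooth_on v1 (- {0}) \<and> smooth_on v2 (- {0}) \<and>
      weak_solution (4 * pi * real n1) (4 * pi * real n2) v1 v2" for v1 v2
    unfolding vortex_solution_def weak_solution_def rhs1_def rhs2_def using smooth_on_imp(1)[of v1] smooth_on_imp(1)[of v2] by blast
  obtain u1 u2 g1 g2 :: "real \<Rightarrow> real" and p C :: real where
    weak: "weak_solution (4 * pi * real n1) (4 * pi * real n2) (\<lambda>x. u1 (norm x)) (\<lambda>x. u2 (norm x))"
    and smooth: "smooth_on (\<lambda>x::real^2. u1 (norm x)) (- {0})" "smooth_on (\<lambda>x::real^2. u2 (norm x)) (- {0})"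
    and p: "p \<ge> 1" and C: "C > 0"
    and u: "\<And>r. r \<ge> p \<Longrightarrow> \<bar>u1 r\<bar> \<le> C * exp (- r / 2)" "\<And>r. r \<ge> p \<Longrightarrow> \<bar>u2 r\<bar> \<le> C * exp (- r / 2)"
    and d: "\<And>r. r > 0 \<Longrightarrow> (u1 has_real_derivative g1 r) (at r)" "\<And>r. r > 0 \<Longrightarrow> (u2 has_real_derivative g2 r) (at r)"
    and g: "\<And>r. r \<ge> p \<Longrightarrow> \<bar>g1 r\<bar> \<le> C * exp (- r / 2)" "\<And>r. r \<ge> p \<Longrightarrow> \<bar>g2 r\<bar> \<le> C * exp (- r / 2)"
    and int: "has_bochner_integral lborel (\<lambda>x::real^2. rhs1 (exp (2 * u1 (norm x)) - 1) (exp (2 * u2 (norm x)) - 1)) (- (4 * pi * real n1))"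
      "has_bochner_integral lborel (\<lambda>x::real^2. rhs2 (exp (2 * u1 (norm x)) - 1) (exp (2 * u2 (norm x)) - 1)) (- (4 * pi * real n2))"
    by (rule plane_solution) (rule that, assumption+)
  have lin: "\<bar>a * v + b * w\<bar> \<le> ((\<bar>a\<bar> + \<bar>b\<bar>) * C) * exp (- r / 2)"
    if "\<bar>v\<bar> \<le> C * exp (- r / 2)" "\<bar>w\<bar> \<le> C * exp (- r / 2)" for a b v w r :: real
  proof -
    have "\<bar>a * v + b * w\<bar> \<le> \<bar>a\<bar> * \<bar>v\<bar> + \<bar>b\<bar> * \<bar>w\<bar>" by (metis abs_mult abs_triangle_ineq)
    also have "\<dots> \<le> \<bar>a\<bar> * (C * exp (- r / 2)) + \<bar>b\<bar> * (C * exp (- r / 2))"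
      using that by (intro add_mono mult_left_mono) auto
    finally show ?thesis by (simp add: distrib_right mult.assoc)
  qed
  \<comment> \<open>The constants that the estimate for linear combinations yields for the four combinations occurring in the claim; a single component is a combination with coefficient \<open>0\<close>.\<close>
  define c1 where "c1 = (\<bar>p_const N\<bar> + \<bar>0\<bar>) * C"
  define c2 where "c2 = (\<bar>0\<bar> + \<bar>2\<bar>) * C"
  define c3 where "c3 = (\<bar>m_const N\<bar> + \<bar>2\<bar>) * C"
  define c4 where "c4 = (\<bar>p_const N\<bar> + \<bar>q_const N\<bar>) * C"
  define D where "D = (c1\<^sup>2 + c2\<^sup>2) + (c3\<^sup>2 + c4\<^sup>2)"
  have "c2\<^sup>2 > 0" using C by (simp add: c2_def)
  then have D0: "D > 0" unfolding D_def by (intro add_pos_nonneg add_nonneg_pos) auto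
  have DD: "c1\<^sup>2 + c2\<^sup>2 \<le> D" "c3\<^sup>2 + c4\<^sup>2 \<le> D" by (simp_all add: D_def)
  have decay: "\<bar>p_const N * u1 (norm x)\<bar>\<^sup>2 + \<bar>2 * u2 (norm x)\<bar>\<^sup>2
        \<le> D * exp (- (1 - \<epsilon>) * sqrt (lambda0 N) * norm x) \<and>
      (norm (grad (\<lambda>y::real^2. m_const N * u1 (norm y) + 2 * u2 (norm y)) x))\<^sup>2 +
      (norm (grad (\<lambda>y::real^2. p_const N * u1 (norm y) + q_const N * u2 (norm y)) x))\<^sup>2
        \<le> D * exp (- (1 - \<epsilon>) * sqrt (lambda_min N) * norm x)"
    if x: "p \<le> norm x" and \<epsilon>: "0 < \<epsilon>" "\<epsilon> < 1" for \<epsilon> and x :: "real^2"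
  proof -
    define r where "r = norm x"
    have r: "r \<ge> p" "r > 0" "r \<ge> 0" using x p by (auto simp: r_def)
    have x0: "x \<noteq> 0" using r by (auto simp: r_def)
    define E0 where "E0 = exp (- (1 - \<epsilon>) * sqrt (lambda0 N) * r)"
    define E1 where "E1 = exp (- (1 - \<epsilon>) * sqrt (lambda_min N) * r)"
    have E: "E0 \<ge> 0" "E1 \<ge> 0" by (simp_all add: E0_def E1_def)
    note sq0 = square_exp_decay[OF lin lambda0_le[OF assms(1)] \<epsilon> r(3), folded E0_def]
    note sq1 = square_exp_decay[OF lin lambda_min_le[of N] \<epsilon> r(3), folded E1_def]
    have "(p_const N * u1 r + 0 * u2 r)\<^sup>2 \<le> c1\<^sup>2 * E0" "(0 * u1 r + 2 * u2 r)\<^sup>2 \<le> c2\<^sup>2 * E0"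
      unfolding c1_def c2_def by (rule sq0[OF u(1)[OF r(1)] u(2)[OF r(1)]])+
    then have "(p_const N * u1 r)\<^sup>2 + (2 * u2 r)\<^sup>2 \<le> (c1\<^sup>2 + c2\<^sup>2) * E0"
      by (simp add: distrib_right)
    also have "\<dots> \<le> D * E0" by (rule mult_right_mono[OF DD(1) E(1)])
    finally have 1: "\<bar>p_const N * u1 r\<bar>\<^sup>2 + \<bar>2 * u2 r\<bar>\<^sup>2 \<le> D * E0" by simp
    have gr: "(norm (grad (\<lambda>y::real^2. a * u1 (norm y) + b * u2 (norm y)) x))\<^sup>2 = (a * g1 r + b * g2 r)\<^sup>2" for a b
      using grad_radial[OF d(1)[OF r(2), unfolded r_def] d(2)[OF r(2), unfolded r_def] x0] by (simp add: r_def)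
    have "(m_const N * g1 r + 2 * g2 r)\<^sup>2 \<le> c3\<^sup>2 * E1" "(p_const N * g1 r + q_const N * g2 r)\<^sup>2 \<le> c4\<^sup>2 * E1"
      unfolding c3_def c4_def by (rule sq1[OF g(1)[OF r(1)] g(2)[OF r(1)]])+
    then have "(m_const N * g1 r + 2 * g2 r)\<^sup>2 + (p_const N * g1 r + q_const N * g2 r)\<^sup>2 \<le> (c3\<^sup>2 + c4\<^sup>2) * E1"
      by (simp add: distrib_right)
    also have "\<dots> \<le> D * E1" by (rule mult_right_mono[OF DD(2) E(2)])
    finally have 2: "(m_const N * g1 r + 2 * g2 r)\<^sup>2 + (p_const N * g1 r + q_const N * g2 r)\<^sup>2 \<le> D * E1" .
    show ?thesis using 1 2 unfolding gr E0_def E1_def r_def[symmetric] by blast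
  qed
  have comb: "has_bochner_integral lborel
      (\<lambda>x::real^2. a * rhs1 (exp (2 * u1 (norm x)) - 1) (exp (2 * u2 (norm x)) - 1)
        + b * rhs2 (exp (2 * u1 (norm x)) - 1) (exp (2 * u2 (norm x)) - 1))
      (- 4 * pi * (a * real n1 + b * real n2))" for a b
  proof -
    have v: "a * (- (4 * pi * real n1)) + b * (- (4 * pi * real n2)) = - 4 * pi * (a * real n1 + b * real n2)"
      by (simp add: algebra_simps)
    show ?thesis unfolding v[symmetric] by (intro has_bochner_integral_add has_bochner_integral_mult_right int)
  qed
  have m_eq: "m_const N * rhs1 a b + 2 * rhs2 a b = ((m_const N + 2) * alpha N - 1) * a + ((m_const N + 2) * beta N + 1) * b"
    and pq_eq: "p_const N * rhs1 a b + q_const N * rhs2 a b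
      = ((p_const N + q_const N) * alpha N - q_const N / 2) * a + ((p_const N + q_const N) * beta N + q_const N / 2) * b" for a b
    by (simp_all add: rhs1_def rhs2_def algebra_simps)
  show ?thesis
  proof (rule exI[of _ "\<lambda>x::real^2. u1 (norm x)"], rule exI[of _ "\<lambda>x::real^2. u2 (norm x)"], intro conjI allI impI)
    show "vortex_solution N n1 n2 (\<lambda>x. u1 (norm x)) (\<lambda>x. u2 (norm x))"
      unfolding sol using weak smooth by blast
  next
    fix v1 v2 :: "real^2 \<Rightarrow> real" and x :: "real^2"
    assume "vortex_solution N n1 n2 v1 v2" "x \<noteq> 0"
    then have *: "v1 x = u1 (norm x) \<and> v2 x = u2 (norm x)"
      using weak_solution_unique[OF weak, of v1 v2 x] unfolding sol by blast
    show "v1 x = u1 (norm x)" using * by (rule conjunct1)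
    show "v2 x = u2 (norm x)" using * by (rule conjunct2)
  next
    fix \<epsilon> :: real assume "0 < \<epsilon> \<and> \<epsilon> < 1"
    then have \<epsilon>: "0 < \<epsilon>" "\<epsilon> < 1" by auto
    show "\<exists>C>0. eventually (\<lambda>x::real^2.
        \<bar>p_const N * u1 (norm x)\<bar>\<^sup>2 + \<bar>2 * u2 (norm x)\<bar>\<^sup>2
          \<le> C * exp (- (1 - \<epsilon>) * sqrt (lambda0 N) * norm x) \<and>
        (norm (grad (\<lambda>y. m_const N * u1 (norm y) + 2 * u2 (norm y)) x))\<^sup>2 +
        (norm (grad (\<lambda>y. p_const N * u1 (norm y) + q_const N * u2 (norm y)) x))\<^sup>2
          \<le> C * exp (- (1 - \<epsilon>) * sqrt (lambda_min N) * norm x)) at_infinity"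
      unfolding eventually_at_infinity
      by (rule exI[of _ D], rule conjI[OF D0], rule exI[of _ p]) (use decay[OF _ \<epsilon>] in blast)
  next
    show "has_bochner_integral lborel
        (\<lambda>x::real^2. ((m_const N + 2) * alpha N - 1) * (exp (2 * u1 (norm x)) - 1) +
            ((m_const N + 2) * beta N + 1) * (exp (2 * u2 (norm x)) - 1))
        (- 4 * pi * (m_const N * real n1 + 2 * real n2))"
      using comb[of "m_const N" 2] unfolding m_eq .
    show "has_bochner_integral lborel
        (\<lambda>x::real^2. ((p_const N + q_const N) * alpha N - q_const N / 2) * (exp (2 * u1 (norm x)) - 1) +
            ((p_const N + q_const N) * beta N + q_const N / 2) * (exp (2 * u2 (norm x)) - 1))
        (- 4 * pi * (p_const N * real n1 + q_const N * real n2))"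
      using comb[of "p_const N" "q_const N"] unfolding pq_eq .
  qed
qed

end
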